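(* Let $Y$ and $Y_k$, $k\in\mathbb N$, be Haar system Hardy spaces of the form $X_0(\mathbf r)$ (where $X$ and $\mathbf r$ may vary with $k$); let $(h_I)_{I\in\mathcal D}$ denote the Haar basis of $Y$ and $(h_{k,I})_{I\in\mathcal D}$ the Haar basis of $Y_k$. Suppose that the sequence of Rademacher functions $(r_n)_{n=0}^\infty$ is weakly null in $Y$ and in each $Y_k$, $k\in\mathbb N$, and let $E$ and $(e_m)_{m=1}^\infty$ denote one of the following pairs of Banach spaces and sequences: (i) $E=Y$ and $(e_m)_{m=1}^\infty=(h_I)_{I\in\mathcal D}$; (ii) $E=\ell^p((Y_k)_{k=1}^\infty)$ for some $1\le p<\infty$ and $(e_m)_{m=1}^\infty=(h_{k,I})_{k\in\mathbb N,I\in\mathcal D}$; (iii) $E=\ell^\infty((Y_k)_{k=1}^\infty)$ and $(e_m)_{m=1}^\infty=(h_{k,I})_{k\in\mathbb N,I\in\mathcal D}$, if $(Y_k)_{k=1}^\infty$ is uniformly asymptotically curved with respect to $(h_{k,I})_{k\in\mathbb N,I\in\mathcal D}$. Then $(e_m)_{m=1}^\infty$ has the $4/\delta$-factorization property in $E$; that is, for every $\delta>0$ and every bounded linear operator $T:E\to E$ with $\delta$-large diagonal with respect to $(e_m)_{m=1}^\infty$, the identity $I_E$ factors through $T$ with constant $(4/\delta)^+$.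
   Context: All Banach spaces are real. Haar system: $\mathcal D$ is the set of dyadic intervals $[\frac{i-1}{2^j},\frac{i}{2^j})$, $j\ge0$, $1\le i\le 2^j$; $\mathcal D_n=\{I\in\mathcal D:|I|=2^{-n}\}$. $I^+$, $I^-$ are the left and right halves of $I$. $h_I=\chi_{I^+}-\chi_{I^-}$ for $I\in\mathcal D$, $h_\varnothing=\chi_{[0,1)}$, $\mathcal D^+=\mathcal D\cup\{\varnothing\}$. The bijection $\iota:\mathcal D\to\mathbb N$, $[\frac{i}{2^j},\frac{i+1}{2^j})\mapsto 2^j+i$, together with $\iota(\varnothing)=0$, defines the linear order on $\mathcal D^+$ used for all sequences and series indexed by $\mathcal D$ or $\mathcal D^+$. $H=\operatorname{span}\{h_I:I\in\mathcal D^+\}$, $H_0=\operatorname{span}\{h_I:I\in\mathcal D\}$. Rademacher functions: $r_n=\sum_{I\in\mathcal D_n}h_I$, $n\ge0$. Haar system space: the completion $X$ of $H$ under a norm $\|\cdot\|_X$ such that $\|x\|_X=\|y\|_X$ whenever $x,y\in H$ and $|x|,|y|$ have the same distribution, and $\|\chi_{[0,1)}\|_X=1$. Haar system Hardy space: let $\mathcal R=\{(r_{\iota(I)})_{I\in\mathcal D^+},(r_0)_{I\in\mathcal D^+}\}$. For a Haar system space $X$ and $\mathbf r=(r_I)_{I\in\mathcal D^+}\in\mathcal R$, $X(\mathbf r)$ is the completion of $H$ under $\|\sum_{I\in\mathcal D^+}a_Ih_I\|_{X(\mathbf r)}=\big\|s\mapsto\int_0^1|\sum_{I\in\mathcal D^+}r_I(u)a_Ih_I(s)|\,du\big\|_X$,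 and $X_0(\mathbf r)$ is the closure of $H_0$ in $X(\mathbf r)$. $(h_I)_{I\in\mathcal D}$ is a monotone Schauder basis of $X_0(\mathbf r)$. Sums: $Y_k$ is identified with the subspace of $\ell^p((Y_k)_k)$ of sequences supported in the $k$th component. The family $(h_{k,I})_{k\in\mathbb N,I\in\mathcal D}$ is enumerated as a sequence $(e_m)_{m=1}^\infty$ in such a way that for each fixed $k$ the order of $(h_{k,I})_{I\in\mathcal D}$ is preserved; for $1\le p<\infty$ this is a monotone Schauder basis of $\ell^p((Y_k)_k)$. The functional $e_m^*$ associated with $e_m=h_{k,I}$ is the biorthogonal functional of $h_{k,I}$ in $Y_k$ applied to the $k$th component (also when $p=\infty$, where $(e_m)$ is not a Schauder basis). An operator $T\in\mathcal B(E)$ has $\delta$-large diagonal with respect to $(e_m)$ if $|\langle e_m^*,Te_m\rangle|\ge\delta$ for all $m$. $S$ factors through $T$ with constant $C$ if $S=ATB$ for some $A,B\in\mathcal B(E)$ with $\|A\|\|B\|\le C$; with constant $C^+$ if with constant $C+\gamma$ for every $\gamma>0$. Uniformly asymptotically curved: if $E_k$ is a Banach space with Schauder basis $(e_{k,j})_{j=1}^\infty$, $k\in\mathbb N$, then $(E_k)_k$ is uniformly asymptotically curved with respect to $(e_{k,j})_{k,j}$ if for every bounded array $(x_{k,j})_{k,j=1}^\infty$ such that $(x_{k,j})_{j=1}^\infty$ is a block basis of $(e_{k,j})_{j=1}^\infty$ for all $k$, one has $\lim_{n\to\infty}\sup_{k}\frac1n\|\sum_{j=1}^nx_{k,j}\|_{E_k}=0$.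 *)

theory Defs
  imports "HOL-Analysis.Analysis" "HOL-Library.Function_Algebras"
begin

instantiation "fun" :: (type, real_vector) real_vector
begin

definition scaleR_fun :: "real \<Rightarrow> ('a \<Rightarrow> 'b) \<Rightarrow> 'a \<Rightarrow> 'b"
  where "scaleR_fun c f = (\<lambda>x. c *\<^sub>R f x)"

instance
  by standard (simp_all add: scaleR_fun_def fun_eq_iff scaleR_add_right scaleR_add_left)

end

text \<open>Normed spaces are given by a carrier and a norm function:
  \<open>V\<close> is a linear subspace of a type of class \<open>real_vector\<close> and \<open>N\<close> is a norm on \<open>V\<close>.
  Values of maps and norms outside \<open>V\<close> are irrelevant.\<close>

definition linear_on :: "'v::real_vector set \<Rightarrow> ('v \<Rightarrow> 'w::real_vector) \<Rightarrow> bool" where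
  "linear_on V f \<longleftrightarrow>
     (\<forall>x\<in>V. \<forall>y\<in>V. f (x + y) = f x + f y) \<and> (\<forall>c. \<forall>x\<in>V. f (c *\<^sub>R x) = c *\<^sub>R f x)"

definition norm_on :: "'v::real_vector set \<Rightarrow> ('v \<Rightarrow> real) \<Rightarrow> bool" where
  "norm_on V N \<longleftrightarrow>
     (\<forall>x\<in>V. 0 \<le> N x) \<and> (\<forall>x\<in>V. N x = 0 \<longleftrightarrow> x = 0) \<and>
     (\<forall>x\<in>V. \<forall>y\<in>V. N (x + y) \<le> N x + N y) \<and> (\<forall>c. \<forall>x\<in>V. N (c *\<^sub>R x) = \<bar>c\<bar> * N x)"

definition bounded_functional :: "'v::real_vector set \<Rightarrow> ('v \<Rightarrow> real) \<Rightarrow> ('v \<Rightarrow> real) \<Rightarrow> bool" where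
  "bounded_functional V N f \<longleftrightarrow> linear_on V f \<and> (\<exists>K. \<forall>x\<in>V. \<bar>f x\<bar> \<le> K * N x)"

definition bounded_operator :: "'v::real_vector set \<Rightarrow> ('v \<Rightarrow> real) \<Rightarrow> ('v \<Rightarrow> 'v) \<Rightarrow> bool" where
  "bounded_operator V N T \<longleftrightarrow>
     linear_on V T \<and> (\<forall>x\<in>V. T x \<in> V) \<and> (\<exists>K. \<forall>x\<in>V. N (T x) \<le> K * N x)"

definition operator_norm :: "'v::real_vector set \<Rightarrow> ('v \<Rightarrow> real) \<Rightarrow> ('v \<Rightarrow> 'v) \<Rightarrow> real" where
  "operator_norm V N T = (SUP x \<in> {x \<in> V. N x \<le> 1}. N (T x))"

definition weakly_null :: "'v::real_vector set \<Rightarrow> ('v \<Rightarrow> real) \<Rightarrow> (nat \<Rightarrow> 'v) \<Rightarrow> bool" where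
  "weakly_null V N x \<longleftrightarrow>
     (\<forall>n. x n \<in> V) \<and> (\<forall>f. bounded_functional V N f \<longrightarrow> (\<lambda>n. f (x n)) \<longlonglongrightarrow> 0)"

definition factors_through ::
  "'v::real_vector set \<Rightarrow> ('v \<Rightarrow> real) \<Rightarrow> ('v \<Rightarrow> 'v) \<Rightarrow> ('v \<Rightarrow> 'v) \<Rightarrow> real \<Rightarrow> bool" where
  "factors_through V N S T C \<longleftrightarrow>
     (\<exists>A B. bounded_operator V N A \<and> bounded_operator V N B \<and>
            (\<forall>x\<in>V. S x = A (T (B x))) \<and>
            operator_norm V N A * operator_norm V N B \<le> C)"

definition factors_through_plus ::
  "'v::real_vector set \<Rightarrow> ('v \<Rightarrow> real) \<Rightarrow> ('v \<Rightarrow> 'v) \<Rightarrow> ('v \<Rightarrow> 'v) \<Rightarrow> real \<Rightarrow> bool" where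
  "factors_through_plus V N S T C \<longleftrightarrow> (\<forall>\<gamma>>0. factors_through V N S T (C + \<gamma>))"

definition large_diagonal ::
  "(nat \<Rightarrow> 'v) \<Rightarrow> (nat \<Rightarrow> 'v \<Rightarrow> real) \<Rightarrow> real \<Rightarrow> ('v \<Rightarrow> 'v) \<Rightarrow> bool" where
  "large_diagonal e e' \<delta> T \<longleftrightarrow> (\<forall>m. \<bar>e' m (T (e m))\<bar> \<ge> \<delta>)"

text \<open>The functionals \<open>e'\<close> associated with \<open>e\<close> are a parameter since they are not determined by
  \<open>e\<close> when \<open>e\<close> does not span a dense subspace.\<close>

definition factorization_property ::
  "'v::real_vector set \<Rightarrow> ('v \<Rightarrow> real) \<Rightarrow> (nat \<Rightarrow> 'v) \<Rightarrow> (nat \<Rightarrow> 'v \<Rightarrow> real) \<Rightarrow> (real \<Rightarrow> real) \<Rightarrow> bool"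
where
  "factorization_property V N e e' K \<longleftrightarrow>
     (\<forall>\<delta>>0. \<forall>T. bounded_operator V N T \<and> large_diagonal e e' \<delta> T \<longrightarrow>
        factors_through_plus V N (\<lambda>x. x) T (K \<delta>))"

text \<open>If the closed span of \<open>e\<close> is \<open>V\<close> and the functional below exists, it is unique on \<open>V\<close>.\<close>

definition biorthogonal_functional ::
  "'v::real_normed_vector set \<Rightarrow> 'i set \<Rightarrow> ('i \<Rightarrow> 'v) \<Rightarrow> 'i \<Rightarrow> 'v \<Rightarrow> real" where
  "biorthogonal_functional V S e i =
     (SOME f. bounded_functional V norm f \<and> (\<forall>j\<in>S. f (e j) = (if j = i then 1 else 0)))"

definition dyadic_interval :: "nat \<Rightarrow> nat \<Rightarrow> real set" where
  "dyadic_interval j i = {real i / 2 ^ j ..< real (i + 1) / 2 ^ j}"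

definition dyadic_level :: "nat \<Rightarrow> real set set" where
  "dyadic_level n = {dyadic_interval n i | i. i < 2 ^ n}"

definition dyadic :: "real set set" where
  "dyadic = (\<Union>n. dyadic_level n)"

text \<open>The extra index of the constant Haar function is literally the empty set.\<close>

definition dyadic_plus :: "real set set" where
  "dyadic_plus = insert {} dyadic"

definition left_half :: "real set \<Rightarrow> real set" where
  "left_half I = {Inf I ..< (Inf I + Sup I) / 2}"

definition right_half :: "real set \<Rightarrow> real set" where
  "right_half I = {(Inf I + Sup I) / 2 ..< Sup I}"

definition haar :: "real set \<Rightarrow> real \<Rightarrow> real" where
  "haar I = (if I = {} then indicator {0..<1}
             else (\<lambda>s. indicator (left_half I) s - indicator (right_half I) s))"

definition iota :: "real set \<Rightarrow> nat" where
  "iota I = (if I = {} then 0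
             else THE n. \<exists>j i. i < 2 ^ j \<and> I = dyadic_interval j i \<and> n = 2 ^ j + i)"

text \<open>\<open>dyadic\<close> listed in the order given by \<open>iota\<close>; the shift is due to \<open>iota\<close> being at least \<open>1\<close>
  on \<open>dyadic\<close>.\<close>

definition dyadic_seq :: "nat \<Rightarrow> real set" where
  "dyadic_seq m = the_inv_into dyadic iota (Suc m)"

definition rademacher :: "nat \<Rightarrow> real \<Rightarrow> real" where
  "rademacher n = (\<Sum>I\<in>dyadic_level n. haar I)"

definition haar_span :: "(real \<Rightarrow> real) set" where
  "haar_span = span (haar ` dyadic_plus)"

definition haar_span0 :: "(real \<Rightarrow> real) set" where
  "haar_span0 = span (haar ` dyadic)"

definition same_abs_distribution :: "(real \<Rightarrow> real) \<Rightarrow> (real \<Rightarrow> real) \<Rightarrow> bool" where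
  "same_abs_distribution x y \<longleftrightarrow>
     distr (restrict_space lborel {0..<1}) borel (\<lambda>s. \<bar>x s\<bar>) =
     distr (restrict_space lborel {0..<1}) borel (\<lambda>s. \<bar>y s\<bar>)"

text \<open>A Haar system space \<open>X\<close> is represented by its norm on the dense subspace \<open>haar_span\<close>.\<close>

definition haar_system_norm :: "((real \<Rightarrow> real) \<Rightarrow> real) \<Rightarrow> bool" where
  "haar_system_norm N \<longleftrightarrow>
     norm_on haar_span N \<and>
     (\<forall>x\<in>haar_span. \<forall>y\<in>haar_span. same_abs_distribution x y \<longrightarrow> N x = N y) \<and>
     N (indicator {0..<1}) = 1"

definition rademacher_choices :: "(real set \<Rightarrow> real \<Rightarrow> real) set" where
  "rademacher_choices = {\<lambda>I. rademacher (iota I), \<lambda>I. rademacher 0}"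

text \<open>\<open>J\<close> is a linear isometry from \<open>haar_span\<close>, with the norm of \<open>X(r)\<close>, into a Banach space.
  Hence the closure of the image of \<open>haar_span\<close> is a completion of \<open>haar_span\<close>, that is,
  a copy of \<open>X(r)\<close>.  All completions arise in this way.  Spaces realised in a common type may be
  different: each of them is separable and so embeds isometrically into a fixed Banach space such
  as the type of bounded real sequences.\<close>

definition hardy_completion ::
  "((real \<Rightarrow> real) \<Rightarrow> real) \<Rightarrow> (real set \<Rightarrow> real \<Rightarrow> real) \<Rightarrow> ((real \<Rightarrow> real) \<Rightarrow> 'a::banach) \<Rightarrow> bool" where
  "hardy_completion N r J \<longleftrightarrow>
     linear_on haar_span J \<and>
     (\<forall>F a. finite F \<and> F \<subseteq> dyadic_plus \<longrightarrow>
        norm (J (\<Sum>I\<in>F. a I *\<^sub>R haar I)) =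
        N (\<lambda>s. LBINT u:{0..1}. \<bar>\<Sum>I\<in>F. r I u * a I * haar I s\<bar>))"

text \<open>\<open>X\<^sub>0(r)\<close> as a subset of the Banach space in which \<open>J\<close> realises \<open>X(r)\<close>.\<close>

definition hardy0 :: "((real \<Rightarrow> real) \<Rightarrow> 'a::banach) \<Rightarrow> 'a set" where
  "hardy0 J = closure (J ` haar_span0)"

definition haar_functional :: "((real \<Rightarrow> real) \<Rightarrow> 'a::banach) \<Rightarrow> real set \<Rightarrow> 'a \<Rightarrow> real" where
  "haar_functional J = biorthogonal_functional (hardy0 J) dyadic (\<lambda>I. J (haar I))"

definition lp_sum :: "real \<Rightarrow> (nat \<Rightarrow> 'b::real_normed_vector set) \<Rightarrow> (nat \<Rightarrow> 'b) set" where
  "lp_sum p Y = {x. (\<forall>k. x k \<in> Y k) \<and> summable (\<lambda>k. norm (x k) powr p)}"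

definition lp_norm :: "real \<Rightarrow> (nat \<Rightarrow> 'b::real_normed_vector) \<Rightarrow> real" where
  "lp_norm p x = (\<Sum>k. norm (x k) powr p) powr (1 / p)"

definition linf_sum :: "(nat \<Rightarrow> 'b::real_normed_vector set) \<Rightarrow> (nat \<Rightarrow> 'b) set" where
  "linf_sum Y = {x. (\<forall>k. x k \<in> Y k) \<and> bounded (range x)}"

definition linf_norm :: "(nat \<Rightarrow> 'b::real_normed_vector) \<Rightarrow> real" where
  "linf_norm x = (SUP k. norm (x k))"

definition component_vector :: "nat \<Rightarrow> 'b::zero \<Rightarrow> nat \<Rightarrow> 'b" where
  "component_vector k y = (\<lambda>l. if l = k then y else 0)"

definition array_enumeration :: "(nat \<Rightarrow> nat \<times> real set) \<Rightarrow> bool" where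
  "array_enumeration \<phi> \<longleftrightarrow>
     bij_betw \<phi> UNIV (UNIV \<times> dyadic) \<and>
     (\<forall>m n. m < n \<and> fst (\<phi> m) = fst (\<phi> n) \<longrightarrow> iota (snd (\<phi> m)) < iota (snd (\<phi> n)))"

definition array_basis ::
  "(nat \<Rightarrow> (real \<Rightarrow> real) \<Rightarrow> 'b::banach) \<Rightarrow> (nat \<Rightarrow> nat \<times> real set) \<Rightarrow> nat \<Rightarrow> nat \<Rightarrow> 'b" where
  "array_basis J \<phi> m = (case \<phi> m of (k, I) \<Rightarrow> component_vector k (J k (haar I)))"

definition array_functional ::
  "(nat \<Rightarrow> (real \<Rightarrow> real) \<Rightarrow> 'b::banach) \<Rightarrow> (nat \<Rightarrow> nat \<times> real set) \<Rightarrow> nat \<Rightarrow> (nat \<Rightarrow> 'b) \<Rightarrow> real" where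
  "array_functional J \<phi> m x = (case \<phi> m of (k, I) \<Rightarrow> haar_functional (J k) I (x k))"

definition block_basis :: "(nat \<Rightarrow> 'v::real_vector) \<Rightarrow> (nat \<Rightarrow> 'v) \<Rightarrow> bool" where
  "block_basis e x \<longleftrightarrow>
     (\<exists>q a. strict_mono q \<and> (\<forall>j. x j = (\<Sum>i\<in>{q j..<q (Suc j)}. a i *\<^sub>R e i) \<and> x j \<noteq> 0))"

text \<open>The \<open>k\<close>-th space is the closed span of \<open>e k\<close>, with the norm of the ambient type.\<close>

definition uniformly_asymptotically_curved :: "(nat \<Rightarrow> nat \<Rightarrow> 'b::real_normed_vector) \<Rightarrow> bool" where
  "uniformly_asymptotically_curved e \<longleftrightarrow>
     (\<forall>x. (\<exists>M. \<forall>k j. norm (x k j) \<le> M) \<and> (\<forall>k. block_basis (e k) (x k)) \<longrightarrow>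
        (\<lambda>n. SUP k. 1 / real n * norm (\<Sum>j<n. x k j)) \<longlonglongrightarrow> 0)"

end

theory Submission
  imports Defs "HOL-Library.Discrete_Functions"
begin

section \<open>Factorization of the identity on sums of Haar system Hardy spaces\<close>

text \<open>
  Levels \<open>lam i\<close> and components \<open>\<kappa> i\<close> are chosen one after the other so that the matrix of \<open>T\<close> between
  distinct chosen levels is negligible: the Rademacher functions being weakly null, every functional
  is small on a late level even with arbitrary signs, and the Haar coefficients of a fixed vector
  are small there as well.  In a component, on the union \<open>S\<close> of some intervals and up to a common
  sign, the diagonal is positive with average at least about \<open>\<delta> / 2\<close>.  For an interval \<open>K\<close> consider
  the limiting supremum of the averages of this diagonal over partitions of \<open>K\<close> into intervals
  from late chosen levels.  It is additive in \<open>K\<close>, so a system \<open>b I\<close> distributed like the Haar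
  system can be built from nearly optimal partitions with random signs such that the diagonal of \<open>T\<close>
  along \<open>b\<close> is almost constant, equal to some \<open>c\<close> close to \<open>\<delta> / 2\<close> or larger.  Here the second moment
  over the signs shows that the off-diagonal entries within a level and the imbalance between the
  halves of \<open>I\<close> are small.  The embedding along \<open>b\<close> has norm \<open>1\<close>, its adjoint has norm \<open>1\<close>, and
  restriction to \<open>S\<close> has norm at most \<open>2\<close>; with \<open>1 / c\<close> this is the constant \<open>4 / \<delta>\<close>.  The remaining error
  is removed by a Neumann series.\<close>

subsection \<open>Dyadic trees\<close>

text \<open>The diagonal cannot simply be divided out: for the constant choice of \<open>r\<close>
  the Haar basis may be conditional, and a Haar multiplier is controlled only through the total
  variation of its entries along the tree. This is why the diagonal has to be made almost constant.
  The 4 has two sources. The sign of the diagonal can be fixed only on part of the unit interval,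
  and the better of the two signs keeps at least half of the weight; discarding the rest means
  multiplying \<open>f\<close> minus a conditional expectation of \<open>f\<close> by an indicator,
  which costs a factor 2. Suprema over partitions are used because their limit is additive: the
  value of an interval is the sum of the values over any of its partitions, so stability can fail
  only through an unequal distribution between the two children, and this is what the random signs
  even out. In an l^infinity sum a functional is not determined by its values on the array. Uniform
  asymptotic curvature is the substitute: it makes every functional small on vectors all of whose
  components start late.\<close>

text \<open>A dyadic interval is represented by its value \<open>K \<ge> 1\<close> under \<open>iota\<close>: its halves are
  \<open>2 * K\<close> and \<open>2 * K + 1\<close>, and \<open>under x K\<close> means that the interval of \<open>x\<close> is contained in that of \<open>K\<close>.\<close>

abbreviation (input) lev :: "nat \<Rightarrow> nat" where "lev \<equiv> floor_log"

definition wt :: "nat \<Rightarrow> real" where "wt K = 1 / 2 ^ lev K"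

definition level :: "nat \<Rightarrow> nat set" where "level n = {2 ^ n ..< 2 ^ Suc n}"

definition under :: "nat \<Rightarrow> nat \<Rightarrow> bool" where "under x K \<longleftrightarrow> (\<exists>j. x div 2 ^ j = K)"

text \<open>The value of the Haar function of \<open>K\<close> on the interval \<open>x\<close>.
  This reading is valid when \<open>x\<close> is strictly below \<open>K\<close> or disjoint from
  it; for \<open>x\<close> equal to \<open>K\<close> or above \<open>K\<close> the value is set to
  0.\<close>

definition hsgn :: "nat \<Rightarrow> nat \<Rightarrow> real" where
  "hsgn K x = (if under x (2 * K) then 1 else if under x (2 * K + 1) then -1 else 0)"

definition leaves :: "nat \<Rightarrow> nat \<Rightarrow> nat set" where
  "leaves M K = {x \<in> level M. under x K}"

lemma wt_pos [simp]: "wt K > 0" by (simp add: wt_def)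
lemma wt_nonneg [simp]: "wt K \<ge> 0" by (simp add: wt_def)
lemma wt_neq_0 [simp]: "wt K \<noteq> 0" by (simp add: wt_def)
lemma wt_le_1: "wt K \<le> 1" by (simp add: wt_def)
lemma wt_one [simp]: "wt (Suc 0) = 1" "wt 1 = 1" by (simp_all add: wt_def)

lemma lev_double [simp]: "K \<ge> 1 \<Longrightarrow> lev (2 * K) = Suc (lev K)" "K \<ge> 1 \<Longrightarrow> lev (Suc (2 * K)) = Suc (lev K)"
  using floor_log_rec[of "Suc (2 * K)"] by auto

lemma wt_double [simp]: "K \<ge> 1 \<Longrightarrow> wt (2 * K) = wt K / 2" "K \<ge> 1 \<Longrightarrow> wt (Suc (2 * K)) = wt K / 2"
  by (simp_all add: wt_def)

lemma level_iff: "x \<in> level n \<longleftrightarrow> x \<ge> 1 \<and> lev x = n"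
proof
  assume "x \<in> level n"
  hence "2 ^ n \<le> x" "x < 2 * 2 ^ n" by (auto simp: level_def)
  moreover have "(1::nat) \<le> 2 ^ n" by simp
  ultimately show "x \<ge> 1 \<and> lev x = n" using floor_log_eqI[of x n] by (simp add: order.trans)
next
  assume "x \<ge> 1 \<and> lev x = n"
  thus "x \<in> level n" using floor_log_exp2_le[of x] floor_log_exp2_gt[of x] by (auto simp: level_def)
qed

lemma level_pos: "x \<in> level n \<Longrightarrow> x \<ge> 1" by (simp add: level_iff)

lemma finite_level [simp]: "finite (level n)" by (simp add: level_def)
lemma card_level [simp]: "card (level n) = 2 ^ n" by (simp add: level_def)
lemma level_0 [simp]: "level 0 = {1}" by (auto simp: level_def)

lemma level_Suc: "level (Suc n) = (\<lambda>x. 2 * x) ` level n \<union> (\<lambda>x. 2 * x + 1) ` level n"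
proof (intro equalityI subsetI)
  fix x assume "x \<in> level (Suc n)"
  hence "x div 2 \<in> level n" by (auto simp: level_def)
  moreover have "x = 2 * (x div 2) \<or> x = 2 * (x div 2) + 1" by linarith
  ultimately show "x \<in> (\<lambda>x. 2 * x) ` level n \<union> (\<lambda>x. 2 * x + 1) ` level n" by blast
qed (auto simp: level_def)

lemma sum_level_Suc: "(\<Sum>x\<in>level (Suc n). f x) = (\<Sum>x\<in>level n. f (2 * x) + f (2 * x + 1 :: nat) :: 'a::comm_monoid_add)"
proof -
  have "(\<Sum>x\<in>level (Suc n). f x) = (\<Sum>x\<in>(\<lambda>x. 2 * x) ` level n. f x) + (\<Sum>x\<in>(\<lambda>x. 2 * x + 1) ` level n. f x)"
    unfolding level_Suc by (rule sum.union_disjoint) (auto, presburger)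
  also have "\<dots> = (\<Sum>x\<in>level n. f (2 * x)) + (\<Sum>x\<in>level n. f (2 * x + 1))"
    by (subst (1 2) sum.reindex) (auto simp: inj_on_def)
  finally show ?thesis by (simp add: sum.distrib)
qed

lemma level_disjoint: "m \<noteq> n \<Longrightarrow> level m \<inter> level n = {}" by (auto simp: level_iff)

lemma div2_level: "x \<in> level (Suc n) \<Longrightarrow> x div 2 \<in> level n" by (auto simp: level_def)

lemma div_level: "x \<in> level (n + q) \<Longrightarrow> x div 2 ^ q \<in> level n"
proof (induction q arbitrary: x)
  case (Suc q)
  have "x div 2 ^ Suc q = (x div 2) div 2 ^ q" by (simp add: div_mult2_eq)
  thus ?case using Suc div2_level[of x "n + q"] by simp
qed simp

lemma lt_pow_level: "K \<ge> 1 \<Longrightarrow> K < 2 ^ n \<longleftrightarrow> lev K < n"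
proof -
  assume K: "K \<ge> 1"
  have a: "2 ^ lev K \<le> K" "K < 2 ^ Suc (lev K)" using K floor_log_exp2_le[of K] floor_log_exp2_gt[of K] by auto
  show ?thesis
  proof
    assume "K < 2 ^ n" hence "(2::nat) ^ lev K < 2 ^ n" using a by linarith
    thus "lev K < n" by simp
  next
    assume "lev K < n" hence "(2::nat) ^ Suc (lev K) \<le> 2 ^ n" by (intro power_increasing) auto
    thus "K < 2 ^ n" using a by linarith
  qed
qed

lemma nodes_Suc: "{1..<2 ^ Suc n} = {1..<2 ^ n} \<union> level n"
  by (auto simp: level_def)

lemma nodes_level_disj: "{1..<2 ^ n} \<inter> level n = {}" by (auto simp: level_def)

lemma sum_nodes_Suc: "sum f {1..<2 ^ Suc n} = sum f {1..<2 ^ n} + sum f (level n)"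
  unfolding nodes_Suc by (rule sum.union_disjoint) (use nodes_level_disj in \<open>auto simp del: power_Suc\<close>)

lemma under_refl [simp]: "under x x" unfolding under_def by (rule exI[of _ 0]) simp

lemma under_trans: "under x y \<Longrightarrow> under y z \<Longrightarrow> under x z"
  unfolding under_def by (metis div_mult2_eq power_add)

lemma under_child [simp]: "under (2 * K) K" "under (Suc (2 * K)) K"
  unfolding under_def by (auto intro!: exI[of _ 1])

text \<open>For \<open>K \<ge> 1\<close> the exponent in \<open>under\<close> is forced to be the
  difference of the levels, since each halving of a number at least 2 lowers the level by one. Every
  number lies under 0, hence the recurring positivity hypotheses.\<close>

lemma under_lev:
  assumes "under x K" "K \<ge> 1"
  shows "x \<ge> 1 \<and> lev K \<le> lev x \<and> x div 2 ^ (lev x - lev K) = K"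
proof -
  obtain j where j: "x div 2 ^ j = K" using assms(1) by (auto simp: under_def)
  have x1: "x \<ge> 1" using j assms(2) by (cases "x = 0") auto
  have main: "x div 2 ^ j = K \<Longrightarrow> lev K \<le> lev x \<and> j = lev x - lev K" for j
  proof (induction j arbitrary: x)
    case (Suc j)
    have e: "(x div 2) div 2 ^ j = K" using Suc.prems by (simp add: div_mult2_eq)
    have "x \<ge> 2" using e assms(2) by (cases "x div 2 = 0") auto
    hence "lev x = Suc (lev (x div 2))" using floor_log_rec by blast
    thus ?case using Suc.IH[OF e] by (simp add: Suc_diff_le del: floor_log_half)
  qed auto
  show ?thesis using main[OF j] j x1 by simp
qed

lemma under_iff: "K \<ge> 1 \<Longrightarrow> x \<ge> 1 \<Longrightarrow> under x K \<longleftrightarrow> lev K \<le> lev x \<and> x div 2 ^ (lev x - lev K) = K"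
  using under_lev under_def by blast

lemma under_pos: "under x K \<Longrightarrow> K \<ge> 1 \<Longrightarrow> x \<ge> 1" using under_lev by blast

lemma under_same_lev: "under x K \<Longrightarrow> under x L \<Longrightarrow> lev K = lev L \<Longrightarrow> K \<ge> 1 \<Longrightarrow> L \<ge> 1 \<Longrightarrow> K = L"
  using under_lev by metis

lemma under_linear: "under x K \<Longrightarrow> under x L \<Longrightarrow> lev K \<le> lev L \<Longrightarrow> K \<ge> 1 \<Longrightarrow> L \<ge> 1 \<Longrightarrow> under L K"
proof -
  assume a: "under x K" "under x L" "lev K \<le> lev L" "K \<ge> 1" "L \<ge> 1"
  have "x div 2 ^ (lev x - lev K) = K" "x div 2 ^ (lev x - lev L) = L" "lev L \<le> lev x"
    using a under_lev by auto
  moreover have "lev x - lev K = (lev x - lev L) + (lev L - lev K)" using a(3) \<open>lev L \<le> lev x\<close> by simp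
  ultimately have "L div 2 ^ (lev L - lev K) = K" by (metis div_mult2_eq power_add)
  thus ?thesis by (auto simp: under_def)
qed

lemma under_1: "x \<ge> 1 \<Longrightarrow> under x 1"
  using under_iff[of 1 x] floor_log_exp2_le[of x] floor_log_exp2_gt[of x]
  by (auto simp: div_nat_eqI)

lemma not_under_sib: "K \<ge> 1 \<Longrightarrow> under x (2 * K) \<Longrightarrow> \<not> under x (Suc (2 * K))"
  using under_same_lev[of x "2*K" "Suc (2*K)"] by auto

lemma under_cases:
  assumes "under x K" "K \<ge> 1" "lev K < lev x"
  shows "under x (2 * K) \<or> under x (Suc (2 * K))"
proof -
  let ?j = "lev x - lev K"
  have e: "x div 2 ^ ?j = K" using under_lev assms by blast
  obtain j where j: "?j = Suc j" using assms(3) by (metis Suc_diff_Suc)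
  have "(x div 2 ^ j) div 2 = K" using e j by (metis div_mult2_eq mult.commute power_Suc)
  hence "x div 2 ^ j = 2 * K \<or> x div 2 ^ j = Suc (2 * K)" by auto
  thus ?thesis by (auto simp: under_def)
qed

lemma under_lev_eq: "under x K \<Longrightarrow> K \<ge> 1 \<Longrightarrow> lev x = lev K \<Longrightarrow> x = K"
  using under_lev[of x K] by simp

lemma under_le: "under x K \<Longrightarrow> K \<le> x" by (auto simp: under_def)

lemma under_childD:
  assumes "K \<ge> 1" "under x (2 * K) \<or> under x (Suc (2 * K))"
  shows "under x K" "lev K < lev x" "x \<ge> 1"
  using assms under_lev[of x "2 * K"] under_lev[of x "Suc (2 * K)"]
    under_trans[OF _ under_child(1), of x K] under_trans[OF _ under_child(2), of x K] by auto

lemma hsgn_alt: "K \<ge> 1 \<Longrightarrow> hsgn K x \<noteq> 0 \<longleftrightarrow> under x K \<and> lev K < lev x"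
  using under_cases[of x K] under_childD[of K x] by (auto simp: hsgn_def)

lemma hsgn_abs: "K \<ge> 1 \<Longrightarrow> \<bar>hsgn K x\<bar> = (if under x K \<and> lev K < lev x then 1 else 0)"
  using hsgn_alt[of K x] by (auto simp: hsgn_def split: if_splits)

lemma hsgn_under: "K \<ge> 1 \<Longrightarrow> under x y \<Longrightarrow> lev K < lev y \<Longrightarrow> y \<ge> 1 \<Longrightarrow> hsgn K x = hsgn K y"
proof -
  assume a: "K \<ge> 1" "under x y" "lev K < lev y" "y \<ge> 1"
  have "under x L \<longleftrightarrow> under y L" if "L \<ge> 1" "lev L \<le> lev y" for L
    using under_linear[of x L y] a that under_trans by blast
  thus ?thesis using a by (simp add: hsgn_def)
qed

lemma leaves_level: "leaves M K \<subseteq> level M" by (auto simp: leaves_def)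
lemma finite_leaves [simp]: "finite (leaves M K)" by (simp add: leaves_def)

lemma leaves_split:
  assumes "K \<ge> 1" "lev K < M"
  shows "leaves M K = leaves M (2 * K) \<union> leaves M (2 * K + 1)" "leaves M (2 * K) \<inter> leaves M (2 * K + 1) = {}"
  using assms under_cases[of _ K] not_under_sib[of K] under_childD(1)[of K]
  by (auto simp: leaves_def level_iff)

lemma leaves_self: "K \<in> level M \<Longrightarrow> leaves M K = {K}"
  by (auto simp: leaves_def level_iff intro: under_lev_eq)

lemma card_leaves: "K \<ge> 1 \<Longrightarrow> lev K \<le> M \<Longrightarrow> card (leaves M K) = 2 ^ (M - lev K)"
proof (induction "M - lev K" arbitrary: K)
  case 0
  thus ?case using leaves_self[of K M] by (simp add: level_iff)
next
  case (Suc d)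
  have "card (leaves M K) = card (leaves M (2 * K)) + card (leaves M (2 * K + 1))"
    using leaves_split[of K M] Suc by (metis card_Un_disjoint finite_leaves zero_less_Suc zero_less_diff)
  also have "\<dots> = 2 ^ d + 2 ^ d"
  proof -
    have "d = M - Suc (lev K)" using Suc.hyps(2) by simp
    moreover have "Suc (lev K) \<le> M" using Suc.hyps(2) by simp
    ultimately show ?thesis using Suc.hyps(1)[of "2 * K"] Suc.hyps(1)[of "2 * K + 1"] Suc.prems by simp
  qed
  finally show ?case using Suc by (metis mult_2 power_Suc)
qed

lemma card_leaves_wt: "K \<ge> 1 \<Longrightarrow> lev K \<le> M \<Longrightarrow> real (card (leaves M K)) = 2 ^ M * wt K"
  by (simp add: card_leaves wt_def power_diff_conv_inverse flip: power_inverse) (simp add: field_simps power_diff)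

section \<open>Dyadic partitions, antichains and signs\<close>

inductive Part :: "nat \<Rightarrow> nat set \<Rightarrow> bool" where
  Part_self: "Part K {K}"
| Part_split: "Part (2 * K) P \<Longrightarrow> Part (2 * K + 1) Q \<Longrightarrow> Part K (P \<union> Q)"

text \<open>The covering clause is restricted to \<open>x\<close> at least as deep as every member,
  because a coarser \<open>x\<close> may be cut by the partition. All clauses pass through a
  bisection since nothing lies under both halves of \<open>K\<close>.\<close>

lemma Part_props:
  assumes "Part K P" "K \<ge> 1"
  shows "finite P \<and> P \<noteq> {} \<and> (\<forall>L\<in>P. under L K \<and> L \<ge> 1) \<and> (\<forall>L\<in>P. \<forall>L'\<in>P. under L L' \<longrightarrow> L = L') \<and>
     (\<Sum>L\<in>P. wt L) = wt K \<and> (\<forall>x. under x K \<longrightarrow> (\<forall>L\<in>P. lev L \<le> lev x) \<longrightarrow> (\<exists>L\<in>P. under x L))"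
  using assms
proof (induction rule: Part.induct)
  case (Part_self K)
  thus ?case by auto
next
  case (Part_split K P Q)
  have IP: "finite P" "P \<noteq> {}" "\<And>L. L \<in> P \<Longrightarrow> under L (2*K) \<and> L \<ge> 1" "\<And>L L'. L \<in> P \<Longrightarrow> L' \<in> P \<Longrightarrow> under L L' \<Longrightarrow> L = L'"
     "sum wt P = wt K / 2" "\<And>x. under x (2*K) \<Longrightarrow> (\<forall>L\<in>P. lev L \<le> lev x) \<Longrightarrow> (\<exists>L\<in>P. under x L)"
    using Part_split.IH(1) Part_split.prems by (auto)
  have IQ: "finite Q" "Q \<noteq> {}" "\<And>L. L \<in> Q \<Longrightarrow> under L (Suc(2*K)) \<and> L \<ge> 1" "\<And>L L'. L \<in> Q \<Longrightarrow> L' \<in> Q \<Longrightarrow> under L L' \<Longrightarrow> L = L'"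
     "sum wt Q = wt K / 2" "\<And>x. under x (Suc(2*K)) \<Longrightarrow> (\<forall>L\<in>Q. lev L \<le> lev x) \<Longrightarrow> (\<exists>L\<in>Q. under x L)"
    using Part_split.IH(2) Part_split.prems by (auto)
  have disj: "\<not> under L L' \<and> \<not> under L' L" if "L \<in> P" "L' \<in> Q" for L L'
    using IP(3)[OF that(1)] IQ(3)[OF that(2)] not_under_sib[OF Part_split.prems] under_trans by blast
  have PQ: "P \<inter> Q = {}" using disj under_refl by blast
  have "(\<Sum>L\<in>P \<union> Q. wt L) = wt K" using sum.union_disjoint[of P Q wt] IP IQ PQ by simp
  moreover have "\<exists>L\<in>P\<union>Q. under x L" if "under x K" "\<forall>L\<in>P\<union>Q. lev L \<le> lev x" for x
  proof -
    obtain L where L: "L \<in> P" using IP by blast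
    have "lev K < lev L" using under_lev[of L "2*K"] IP(3)[OF L] Part_split.prems by simp
    moreover have "lev L \<le> lev x" using that(2) L by blast
    ultimately have "lev K < lev x" by (rule less_le_trans)
    thus ?thesis using under_cases[OF that(1)] Part_split.prems IP(6) IQ(6) that(2) by blast
  qed
  moreover have "\<forall>L\<in>P\<union>Q. under L K \<and> L \<ge> 1" using IP(3) IQ(3) under_trans under_child by (metis UnE)
  moreover have "\<forall>L\<in>P\<union>Q. \<forall>L'\<in>P\<union>Q. under L L' \<longrightarrow> L = L'" using IP(4) IQ(4) disj by blast
  ultimately show ?case using IP(1,2) IQ(1) by blast
qed

definition antichain :: "nat set \<Rightarrow> bool" where
  "antichain P \<longleftrightarrow> finite P \<and> (\<forall>L\<in>P. L \<ge> 1) \<and> (\<forall>L\<in>P. \<forall>L'\<in>P. under L L' \<longrightarrow> L = L')"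

definition refine :: "nat set \<Rightarrow> nat set \<Rightarrow> bool" where
  "refine P Q \<longleftrightarrow> (\<exists>p. (\<forall>K\<in>P. Part K (p K)) \<and> Q = \<Union> (p ` P))"

lemma antichain_leaf_unique:
  "antichain P \<Longrightarrow> K \<in> P \<Longrightarrow> L \<in> P \<Longrightarrow> under x K \<Longrightarrow> under x L \<Longrightarrow> K = L"
  unfolding antichain_def by (metis nat_le_linear under_linear)

lemma antichain_refine:
  assumes "antichain P" "refine P Q"
  shows "antichain Q" "sum wt Q = sum wt P" "\<And>L. L \<in> Q \<Longrightarrow> \<exists>K\<in>P. under L K"
    "\<And>K x. K \<in> P \<Longrightarrow> under x K \<Longrightarrow> (\<forall>L\<in>Q. lev L \<le> lev x) \<Longrightarrow> \<exists>L\<in>Q. under x L"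
proof -
  obtain p where p: "\<And>K. K \<in> P \<Longrightarrow> Part K (p K)" and Q: "Q = \<Union> (p ` P)" using assms(2) by (auto simp: refine_def)
  have K1: "K \<in> P \<Longrightarrow> K \<ge> 1" for K using assms(1) by (auto simp: antichain_def)
  note pp = Part_props[OF p K1]
  have disj: "K = K'" if "K \<in> P" "K' \<in> P" "L \<in> p K" "L' \<in> p K'" "under L L'" for K K' L L'
  proof -
    have "under L K" "under L' K'" using pp[of K] pp[of K'] that by blast+
    thus ?thesis using antichain_leaf_unique[OF assms(1) that(1,2)] that(5) under_trans by blast
  qed
  show "\<exists>K\<in>P. under L K" if "L \<in> Q" for L
  proof -
    have "\<exists>K\<in>P. L \<in> p K" using that Q by blast
    thus ?thesis using pp by blast
  qed
  show "\<exists>L\<in>Q. under x L" if "K \<in> P" "under x K" "\<forall>L\<in>Q. lev L \<le> lev x" for K x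
  proof -
    have "\<forall>L\<in>p K. lev L \<le> lev x" using that(1,3) Q by blast
    hence "\<exists>L\<in>p K. under x L" using pp[OF that(1) that(1)] that(2) by simp
    thus ?thesis using Q that(1) by blast
  qed
  show "antichain Q" unfolding antichain_def
  proof (intro conjI ballI impI)
    show "finite Q" using assms(1) pp by (auto simp: Q antichain_def)
    fix L assume LQ: "L \<in> Q"
    then obtain K where "K \<in> P" "L \<in> p K" using Q by blast
    thus "L \<ge> 1" using pp[of K] by blast
    fix L' assume "L' \<in> Q" "under L L'"
    then obtain K K' where K: "K \<in> P" "L \<in> p K" "K' \<in> P" "L' \<in> p K'" using \<open>L \<in> Q\<close> Q by blast
    hence "K = K'" using disj \<open>under L L'\<close> by blast
    thus "L = L'" using pp[OF K(1) K(1)] K \<open>under L L'\<close> by blast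
  qed
  have "sum wt Q = (\<Sum>K\<in>P. sum wt (p K))" unfolding Q
  proof (rule sum.UNION_disjoint)
    show "finite P" using assms(1) by (simp add: antichain_def)
    show "\<forall>i\<in>P. finite (p i)" using pp by blast
    show "\<forall>i\<in>P. \<forall>j\<in>P. i \<noteq> j \<longrightarrow> p i \<inter> p j = {}" using disj under_refl by blast
  qed
  also have "\<dots> = sum wt P" using pp by (intro sum.cong) auto
  finally show "sum wt Q = sum wt P" .
qed

text \<open>Sign patterns are encoded by the set of indices with sign 1, so that averaging over
  random signs becomes a sum over \<open>Pow\<close>.\<close>

definition sg :: "nat set \<Rightarrow> nat \<Rightarrow> real" where "sg A K = (if K \<in> A then 1 else -1)"

lemma sg_abs [simp]: "\<bar>sg A K\<bar> = 1" by (simp add: sg_def)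
lemma sg_sq [simp]: "sg A K * sg A K = 1" by (simp add: sg_def)

subsection \<open>Faithful Haar systems\<close>

text \<open>\<open>source B \<Theta> I\<close> is the set where the \<open>I\<close>-th function of the system lives: the part of the
  support of its parent on which the parent is \<open>1\<close> (left child, \<open>I\<close> even) or \<open>-1\<close>.\<close>

definition pick :: "bool \<Rightarrow> nat set \<Rightarrow> nat \<Rightarrow> nat" where
  "pick b A K = (if (K \<in> A) = b then 2 * K else 2 * K + 1)"

definition source :: "(nat \<Rightarrow> nat set) \<Rightarrow> (nat \<Rightarrow> nat set) \<Rightarrow> nat \<Rightarrow> nat set" where
  "source B \<Theta> I = (if I \<le> 1 then {1} else pick (even I) (\<Theta> (I div 2)) ` B (I div 2))"

definition faithful :: "(nat \<Rightarrow> nat set) \<Rightarrow> (nat \<Rightarrow> nat set) \<Rightarrow> bool" where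
  "faithful B \<Theta> \<longleftrightarrow> (\<forall>I\<ge>1. refine (source B \<Theta> I) (B I))"

lemma pick_under [simp]: "under (pick b A K) K" by (simp add: pick_def)
lemma pick_pos: "K \<ge> 1 \<Longrightarrow> pick b A K \<ge> 1" by (simp add: pick_def)
lemma pick_lev [simp]: "K \<ge> 1 \<Longrightarrow> lev (pick b A K) = Suc (lev K)" by (simp add: pick_def)
lemma pick_wt [simp]: "K \<ge> 1 \<Longrightarrow> wt (pick b A K) = wt K / 2" by (simp add: pick_def)

lemma pick_hsgn: "K \<ge> 1 \<Longrightarrow> under x (pick b A K) \<Longrightarrow> sg A K * hsgn K x = (if b then 1 else -1)"
  using not_under_sib[of K x] by (auto simp: pick_def sg_def hsgn_def split: if_splits)

lemma antichain_pick:
  assumes "antichain P" shows "antichain (pick b A ` P)" "inj_on (pick b A) P" "sum wt (pick b A ` P) = sum wt P / 2"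
proof -
  have P1: "K \<ge> 1" if "K \<in> P" for K using that assms by (auto simp: antichain_def)
  have key: "K = L" if "K \<in> P" "L \<in> P" "under (pick b A K) (pick b A L)" for K L
    using antichain_leaf_unique[OF assms that(1,2)] that(3) pick_under under_trans by blast
  show "inj_on (pick b A) P" using key under_refl by (intro inj_onI) metis
  thus "sum wt (pick b A ` P) = sum wt P / 2" using P1 by (simp add: sum.reindex sum_divide_distrib)
  show "antichain (pick b A ` P)" unfolding antichain_def
    using key assms P1 pick_pos by (auto simp: antichain_def)
qed

context
  fixes B \<Theta> assumes faith: "faithful B \<Theta>"
begin

lemma source_1 [simp]: "source B \<Theta> 1 = {1}" "source B \<Theta> (Suc 0) = {1}" by (simp_all add: source_def)

lemma source_child: "I \<ge> 1 \<Longrightarrow> source B \<Theta> (2 * I) = pick True (\<Theta> I) ` B I"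
  "I \<ge> 1 \<Longrightarrow> source B \<Theta> (Suc (2 * I)) = pick False (\<Theta> I) ` B I"
  by (simp_all add: source_def)

lemma source_props: "I \<ge> 1 \<Longrightarrow> antichain (source B \<Theta> I) \<and> sum wt (source B \<Theta> I) = wt I \<and> antichain (B I) \<and> sum wt (B I) = wt I"
proof (induction I rule: less_induct)
  case (less I)
  have "antichain (source B \<Theta> I) \<and> sum wt (source B \<Theta> I) = wt I"
  proof (cases "I = 1")
    case True thus ?thesis by (simp add: antichain_def)
  next
    case False
    hence I: "I \<ge> 2" using less by simp
    have IH: "antichain (B (I div 2))" "sum wt (B (I div 2)) = wt (I div 2)" using less.IH[of "I div 2"] I by auto
    have "lev I = Suc (lev (I div 2))" using I floor_log_rec by blast
    hence "wt I = wt (I div 2) / 2" by (simp add: wt_def del: floor_log_half)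
    thus ?thesis using antichain_pick(1)[OF IH(1), of "even I" "\<Theta> (I div 2)"]
      antichain_pick(3)[OF IH(1), of "even I" "\<Theta> (I div 2)"] IH(2) I by (simp add: source_def)
  qed
  moreover have "refine (source B \<Theta> I) (B I)" using faith less by (auto simp: faithful_def)
  ultimately show ?case using antichain_refine by metis
qed

lemma B_antichain: "I \<ge> 1 \<Longrightarrow> antichain (B I)" and source_antichain: "I \<ge> 1 \<Longrightarrow> antichain (source B \<Theta> I)"
  and B_wt: "I \<ge> 1 \<Longrightarrow> sum wt (B I) = wt I"
  using source_props by auto

lemma B_finite: "I \<ge> 1 \<Longrightarrow> finite (B I)" and B_pos: "I \<ge> 1 \<Longrightarrow> K \<in> B I \<Longrightarrow> K \<ge> 1"
  using B_antichain by (auto simp: antichain_def)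

lemma B_refine: "I \<ge> 1 \<Longrightarrow> refine (source B \<Theta> I) (B I)" using faith by (auto simp: faithful_def)

text \<open>On the support of a descendant \<open>z\<close> of \<open>I\<close>, the function built
  for \<open>I\<close> has the constant value of the Haar function of \<open>I\<close> at
  \<open>z\<close>. For a child this is how \<open>pick\<close> chooses halves; further down,
  \<open>z\<close> inherits the value from its parent because its pieces lie inside pieces of the
  parent.\<close>

lemma source_under_B:
  assumes "under z (2 * I) \<or> under z (Suc (2 * I))" "I \<ge> 1" "L \<in> source B \<Theta> z"
  shows "\<exists>K\<in>B I. under L K \<and> lev K < lev L \<and> sg (\<Theta> I) K * hsgn K L = hsgn I z"
  using assms(1,3)
proof (induction z arbitrary: L rule: less_induct)
  case (less z)
  have z1: "z \<ge> 1" using less.prems(1) under_pos[of z "2 * I"] under_pos[of z "Suc (2 * I)"] assms(2) by auto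
  show ?case
  proof (cases "z = 2 * I \<or> z = Suc (2 * I)")
    case True
    define b where "b \<longleftrightarrow> z = 2 * I"
    have b: "source B \<Theta> z = pick b (\<Theta> I) ` B I" "b \<longleftrightarrow> z = 2 * I" using source_child[OF assms(2)] True by (auto simp: b_def)
    obtain K where K: "K \<in> B I" "L = pick b (\<Theta> I) K" using less b(1) by auto
    have K1: "K \<ge> 1" using B_pos assms(2) K by blast
    have "hsgn I z = (if b then 1 else -1)" using True b(2) not_under_sib[of I] assms(2)
        not_under_sib[OF assms(2), of "Suc (2 * I)"] by (auto simp: hsgn_def)
    thus ?thesis using pick_hsgn[OF K1, of L b "\<Theta> I"] K K1 by (intro bexI[of _ K]) auto
  next
    case False
    have ln: "lev z > Suc (lev I)"
    proof -
      have "lev z \<ge> Suc (lev I)" using less.prems(1) under_lev[of z "2*I"] under_lev[of z "Suc (2*I)"] assms(2) by auto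
      moreover have "lev z \<noteq> Suc (lev I)" using less.prems(1) under_lev_eq[of z "2*I"] under_lev_eq[of z "Suc (2*I)"] assms(2) False by auto
      ultimately show ?thesis by simp
    qed
    have z2: "z \<ge> 2"
    proof (rule ccontr)
      assume "\<not> z \<ge> 2" hence "z = 1" using z1 by simp
      thus False using ln by simp
    qed
    have lz: "lev (z div 2) = lev z - 1" by simp
    have uz: "under z (z div 2)" unfolding under_def by (rule exI[of _ 1]) simp
    have zd: "z div 2 \<ge> 1" using z2 by simp
    have "Suc (lev I) \<le> lev (z div 2)" using ln lz by linarith
    hence par: "under (z div 2) (2 * I) \<or> under (z div 2) (Suc (2 * I))"
      using less.prems(1) under_linear[of z "2 * I" "z div 2"] under_linear[of z "Suc (2 * I)" "z div 2"] uz assms(2) zd by (auto simp del: floor_log_half)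
    obtain b where b: "source B \<Theta> z = pick b (\<Theta> (z div 2)) ` B (z div 2)" using z2 by (simp add: source_def)
    then obtain K' where K': "K' \<in> B (z div 2)" "L = pick b (\<Theta> (z div 2)) K'" using less.prems by auto
    obtain L' where L': "L' \<in> source B \<Theta> (z div 2)" "under K' L'"
      using antichain_refine(3)[OF source_antichain B_refine] zd K' by blast
    obtain K where K: "K \<in> B I" "under L' K" "lev K < lev L'" "sg (\<Theta> I) K * hsgn K L' = hsgn I (z div 2)"
      using less.IH[of "z div 2" L'] par L' z2 by auto
    have K1: "K \<ge> 1" using B_pos assms(2) K by blast
    have L'1: "L' \<ge> 1" using source_antichain[OF zd] L' by (auto simp: antichain_def)
    have LL': "under L L'" using K'(2) L'(2) under_trans pick_under by blast
    have "hsgn K L = hsgn K L'" using hsgn_under[OF K1 LL' K(3) L'1] .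
    moreover have "hsgn I z = hsgn I (z div 2)" using hsgn_under[OF assms(2) uz _ zd] ln lz by simp
    moreover have "lev L' \<le> lev L" using under_lev[OF LL' L'1] by blast
    ultimately show ?thesis using K under_trans[OF LL' K(2)] by (intro bexI[of _ K]) auto
  qed
qed

section \<open>Leaves of a fine level under a faithful system\<close>

definition region :: "nat \<Rightarrow> nat \<Rightarrow> nat set" where
  "region M z = {x \<in> level M. \<exists>K\<in>source B \<Theta> z. under x K}"

text \<open>At such a level \<open>M\<close> every function of the system whose index has level
  below \<open>n\<close> is constant on the leaves.\<close>

definition deep :: "nat \<Rightarrow> nat \<Rightarrow> bool" where
  "deep n M \<longleftrightarrow> (\<forall>I\<ge>1. lev I < n \<longrightarrow> (\<forall>K\<in>B I. lev K < M))"

lemma region_level: "region M z \<subseteq> level M" by (auto simp: region_def)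

lemma deep_mono: "deep n M \<Longrightarrow> k \<le> n \<Longrightarrow> deep k M" by (auto simp: deep_def)

lemma region_UN: "region M z = (\<Union>K\<in>source B \<Theta> z. leaves M K)" by (auto simp: region_def leaves_def)

lemma region_B:
  assumes "I \<ge> 1" "lev I < n" "deep n M"
  shows "region M I = (\<Union>K\<in>B I. leaves M K)"
proof -
  have d: "lev K < M" if "K \<in> B I" for K using assms that by (auto simp: deep_def)
  show ?thesis
  proof (intro equalityI subsetI)
    fix x assume "x \<in> region M I"
    then obtain K where K: "K \<in> source B \<Theta> I" "under x K" "x \<in> level M" by (auto simp: region_def)
    have "\<forall>L\<in>B I. lev L \<le> lev x" using d K(3) by (fastforce simp: level_iff)
    then obtain L where "L \<in> B I" "under x L"
      using antichain_refine(4)[OF source_antichain[OF assms(1)] B_refine[OF assms(1)] K(1,2)] by blast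
    thus "x \<in> (\<Union>K\<in>B I. leaves M K)" using K by (auto simp: leaves_def)
  next
    fix x assume "x \<in> (\<Union>K\<in>B I. leaves M K)"
    then obtain L where L: "L \<in> B I" "under x L" "x \<in> level M" by (auto simp: leaves_def)
    obtain K where "K \<in> source B \<Theta> I" "under L K"
      using antichain_refine(3)[OF source_antichain[OF assms(1)] B_refine[OF assms(1)] L(1)] by blast
    thus "x \<in> region M I" using L under_trans unfolding region_def by blast
  qed
qed

lemma region_child:
  assumes "I \<ge> 1"
  shows "region M (2 * I) = (\<Union>K\<in>B I. leaves M (pick True (\<Theta> I) K))"
    "region M (Suc (2 * I)) = (\<Union>K\<in>B I. leaves M (pick False (\<Theta> I) K))"
  using source_child[OF assms] by (auto simp: region_UN)

lemma leaves_pick: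
  assumes "K \<ge> 1" "lev K < M"
  shows "leaves M K = leaves M (pick True A K) \<union> leaves M (pick False A K)"
    "leaves M (pick True A K) \<inter> leaves M (pick False A K) = {}"
  using leaves_split[OF assms] by (auto simp: pick_def)

lemma leaves_B_disjoint: "I \<ge> 1 \<Longrightarrow> K \<in> B I \<Longrightarrow> L \<in> B I \<Longrightarrow> x \<in> leaves M K \<Longrightarrow> x \<in> leaves M L \<Longrightarrow> K = L"
  using antichain_leaf_unique[OF B_antichain] by (auto simp: leaves_def)

lemma leaves_mono: "under K L \<Longrightarrow> leaves M K \<subseteq> leaves M L" using under_trans by (auto simp: leaves_def)

lemma region_split:
  assumes "I \<ge> 1" "lev I < n" "deep n M"
  shows "region M I = region M (2 * I) \<union> region M (Suc (2 * I))" "region M (2 * I) \<inter> region M (Suc (2 * I)) = {}"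
proof -
  have d: "K \<ge> 1" "lev K < M" if "K \<in> B I" for K using assms that B_pos by (auto simp: deep_def)
  show "region M I = region M (2 * I) \<union> region M (Suc (2 * I))"
    unfolding region_B[OF assms] region_child[OF assms(1)] using leaves_pick(1)[OF d] by blast
  show "region M (2 * I) \<inter> region M (Suc (2 * I)) = {}"
  proof (rule equals0I)
    fix x assume "x \<in> region M (2 * I) \<inter> region M (Suc (2 * I))"
    then obtain K L where KL: "K \<in> B I" "L \<in> B I" "x \<in> leaves M (pick True (\<Theta> I) K)" "x \<in> leaves M (pick False (\<Theta> I) L)"
      unfolding region_child[OF assms(1)] by blast
    hence "x \<in> leaves M K" "x \<in> leaves M L" using leaves_mono[OF pick_under] by blast+
    hence "K = L" using leaves_B_disjoint[OF assms(1) KL(1,2)] by blast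
    thus False using leaves_pick(2)[OF d[OF KL(1)]] KL by blast
  qed
qed

lemma card_region:
  assumes "z \<ge> 1" "\<forall>K\<in>source B \<Theta> z. lev K \<le> M"
  shows "real (card (region M z)) = 2 ^ M * wt z"
proof -
  have ac: "antichain (source B \<Theta> z)" using source_antichain assms by blast
  have "card (region M z) = (\<Sum>K\<in>source B \<Theta> z. card (leaves M K))" unfolding region_UN
    using ac antichain_leaf_unique[OF ac] by (intro card_UN_disjoint) (auto simp: antichain_def leaves_def)
  hence "real (card (region M z)) = (\<Sum>K\<in>source B \<Theta> z. 2 ^ M * wt K)"
    using ac assms(2) card_leaves_wt by (auto simp: antichain_def)
  thus ?thesis using source_props[OF assms(1)] by (simp flip: sum_distrib_left)
qed

lemma deep_source: "deep n M \<Longrightarrow> z \<in> level n \<Longrightarrow> K \<in> source B \<Theta> z \<Longrightarrow> lev K \<le> M"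
proof (cases "z \<le> 1")
  case False
  assume a: "deep n M" "z \<in> level n" "K \<in> source B \<Theta> z"
  have z: "z div 2 \<ge> 1" "lev (z div 2) < n" using a(2) False floor_log_rec[of z] by (auto simp: level_iff simp del: floor_log_half)
  obtain L b where L: "L \<in> B (z div 2)" "K = pick b (\<Theta> (z div 2)) L" using a(3) False by (auto simp: source_def)
  have "lev L < M" using a(1) z L by (auto simp: deep_def)
  thus ?thesis using L B_pos[OF z(1) L(1)] by simp
qed (simp add: source_def)

lemma region_ex1: "deep n M \<Longrightarrow> x \<in> level M \<Longrightarrow> \<exists>!z. z \<in> level n \<and> x \<in> region M z"
proof (induction n)
  case 0
  thus ?case using under_1 by (auto simp: region_def level_iff)
next
  case (Suc n)
  obtain z where z: "z \<in> level n" "x \<in> region M z" and u: "\<And>z'. z' \<in> level n \<Longrightarrow> x \<in> region M z' \<Longrightarrow> z' = z"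
    using Suc deep_mono[of "Suc n" M n] by auto
  have sp: "region M w = region M (2 * w) \<union> region M (Suc (2 * w))" "region M (2 * w) \<inter> region M (Suc (2 * w)) = {}" if "w \<in> level n" for w
    using region_split[of w "Suc n" M] that Suc.prems by (auto simp: level_iff)
  obtain b where b: "x \<in> region M (2 * z + b)" "b = 0 \<or> b = 1" using sp(1)[OF z(1)] z(2)
    by (metis Un_iff add_0_right add.commute plus_1_eq_Suc)
  show ?case
  proof (rule ex1I[of _ "2 * z + b"])
    show "2 * z + b \<in> level (Suc n) \<and> x \<in> region M (2 * z + b)" using b z by (auto simp: level_Suc)
    fix y assume y: "y \<in> level (Suc n) \<and> x \<in> region M y"
    then obtain w c where w: "w \<in> level n" "y = 2 * w + c" "c = 0 \<or> c = (1::nat)" by (auto simp: level_Suc)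
    have xy: "x \<in> region M y" using y by blast
    have "region M y \<subseteq> region M w"
    proof (cases "c = 0")
      case True
      hence "y = 2 * w" using w by simp
      thus ?thesis unfolding sp(1)[OF w(1)] by blast
    next
      case False
      hence "y = Suc (2 * w)" using w by simp
      thus ?thesis unfolding sp(1)[OF w(1)] by blast
    qed
    hence wz: "w = z" using u w xy by blast
    show "y = 2 * z + b"
    proof (rule ccontr)
      assume "y \<noteq> 2 * z + b"
      hence "(y = 2 * z \<and> 2 * z + b = Suc (2 * z)) \<or> (y = Suc (2 * z) \<and> 2 * z + b = 2 * z)" using w(2,3) b(2) wz by auto
      hence "x \<in> region M (2 * z)" "x \<in> region M (Suc (2 * z))" using xy b(1) by metis+
      thus False using sp(2)[OF z(1)] by blast
    qed
  qed
qed

text \<open>The measure preserving map that transports the Haar system to the faithful one: on the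
  leaves of a deep level the function built for \<open>I\<close> is the Haar function of
  \<open>I\<close> composed with \<open>rho\<close>.\<close>

definition rho :: "nat \<Rightarrow> nat \<Rightarrow> nat \<Rightarrow> nat" where
  "rho n M x = (THE z. z \<in> level n \<and> x \<in> region M z)"

lemma rho: "deep n M \<Longrightarrow> x \<in> level M \<Longrightarrow> rho n M x \<in> level n \<and> x \<in> region M (rho n M x)"
  unfolding rho_def by (rule theI') (rule region_ex1)

lemma rho_eq: "deep n M \<Longrightarrow> z \<in> level n \<Longrightarrow> x \<in> region M z \<Longrightarrow> rho n M x = z"
  using rho[of n M x] region_ex1[of n M x] region_level by blast

lemma rho_fibre: "deep n M \<Longrightarrow> z \<in> level n \<Longrightarrow> {x \<in> level M. rho n M x = z} = region M z"
  using rho rho_eq region_level by blast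

lemma card_rho_fibre: "deep n M \<Longrightarrow> z \<in> level n \<Longrightarrow> card {x \<in> level M. rho n M x = z} * 2 ^ n = 2 ^ M"
proof -
  assume a: "deep n M" "z \<in> level n"
  have "real (card (region M z)) = 2 ^ M * wt z" using card_region[of z M] deep_source[OF a] a by (auto simp: level_iff)
  hence "real (card (region M z)) * 2 ^ n = 2 ^ M" using a by (simp add: wt_def level_iff)
  hence "real (card (region M z) * 2 ^ n) = real (2 ^ M)" by simp
  hence "card (region M z) * 2 ^ n = 2 ^ M" using of_nat_eq_iff by blast
  thus ?thesis using rho_fibre[OF a] by simp
qed

lemma rho_anc:
  assumes "deep n M" "x \<in> level M" "I \<ge> 1" "lev I < n"
  shows "x \<in> region M I \<longleftrightarrow> under (rho n M x) I" and "x \<in> region M (2 * I) \<longleftrightarrow> under (rho n M x) (2 * I)"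
   and "x \<in> region M (Suc (2 * I)) \<longleftrightarrow> under (rho n M x) (Suc (2 * I))"
proof -
  have *: "x \<in> region M J \<longleftrightarrow> under (rho n M x) J" if J: "J \<ge> 1" "lev J \<le> n" for J
  proof -
    have up: "x \<in> region M z \<Longrightarrow> z \<in> level k \<Longrightarrow> k \<le> n \<Longrightarrow> j \<le> k \<Longrightarrow> x \<in> region M (z div 2 ^ j) \<and> z div 2 ^ j \<in> level (k - j)" for z k j
    proof (induction j)
      case (Suc j)
      let ?w = "z div 2 ^ j"
      have w: "x \<in> region M ?w" "?w \<in> level (Suc (k - Suc j))" using Suc by (auto simp: Suc_diff_Suc)
      hence w2: "?w div 2 \<in> level (k - Suc j)" by (intro div2_level)
      have "x \<in> region M (?w div 2)"
        using region_split(1)[of "?w div 2" n M] w w2 assms(1) Suc.prems div_mult_mod_eq[of ?w 2]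
        by (cases "even ?w") (auto simp: level_iff elim!: oddE evenE)
      moreover have "?w div 2 = z div 2 ^ Suc j" by (metis div_mult2_eq mult.commute power_Suc)
      ultimately show ?case using w2 by simp
    qed simp
    let ?z = "rho n M x"
    have z: "?z \<in> level n" "x \<in> region M ?z" using rho assms by auto
    let ?a = "?z div 2 ^ (n - lev J)"
    have a: "x \<in> region M ?a" "?a \<in> level (lev J)" using up[OF z(2,1), of "n - lev J"] J by auto
    have "J \<in> level (lev J)" using J by (simp add: level_iff)
    hence "x \<in> region M J \<longleftrightarrow> J = ?a" using region_ex1[OF deep_mono[OF assms(1) J(2)] assms(2)] a by metis
    also have "\<dots> \<longleftrightarrow> under ?z J" using under_iff[of J ?z] J z by (auto simp: level_iff)
    finally show ?thesis .
  qed
  show "x \<in> region M I \<longleftrightarrow> under (rho n M x) I" "x \<in> region M (2 * I) \<longleftrightarrow> under (rho n M x) (2 * I)"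
    "x \<in> region M (Suc (2 * I)) \<longleftrightarrow> under (rho n M x) (Suc (2 * I))"
    using *[OF assms(3)] *[of "2 * I"] *[of "Suc (2 * I)"] assms(3,4) by simp_all
qed

lemma hsgn_rho:
  assumes "deep n M" "x \<in> level M" "I \<ge> 1" "lev I < n" "K \<in> B I" "under x K"
  shows "under (rho n M x) I" "lev K < lev x" "sg (\<Theta> I) K * hsgn K x = hsgn I (rho n M x)"
proof -
  have K: "K \<ge> 1" "lev K < M" using assms B_pos by (auto simp: deep_def)
  show lx: "lev K < lev x" using K assms by (simp add: level_iff)
  have "x \<in> region M I" using region_B[OF assms(3,4,1)] assms by (auto simp: leaves_def)
  thus "under (rho n M x) I" using rho_anc(1)[OF assms(1-4)] by blast
  have "x \<in> leaves M K" using assms by (simp add: leaves_def)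
  then consider "x \<in> leaves M (pick True (\<Theta> I) K)" | "x \<in> leaves M (pick False (\<Theta> I) K)" using leaves_pick(1)[OF K] by blast
  thus "sg (\<Theta> I) K * hsgn K x = hsgn I (rho n M x)"
  proof cases
    case 1
    hence "x \<in> region M (2 * I)" using region_child[OF assms(3)] assms by blast
    hence "under (rho n M x) (2 * I)" using rho_anc(2)[OF assms(1-4)] by blast
    thus ?thesis using pick_hsgn[OF K(1), of x True "\<Theta> I"] 1 by (auto simp: leaves_def hsgn_def)
  next
    case 2
    hence "x \<in> region M (Suc (2 * I))" using region_child[OF assms(3)] assms by blast
    hence "under (rho n M x) (Suc (2 * I))" using rho_anc(3)[OF assms(1-4)] by blast
    thus ?thesis using pick_hsgn[OF K(1), of x False "\<Theta> I"] 2 not_under_sib[OF assms(3)] by (auto simp: leaves_def hsgn_def)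
  qed
qed

lemma hsgn_rho_ex:
  assumes "deep n M" "x \<in> level M" "I \<ge> 1" "lev I < n" "under (rho n M x) I"
  shows "\<exists>K\<in>B I. under x K"
  using rho_anc(1)[OF assms(1-4)] assms(5) region_B[OF assms(3,4,1)] by (auto simp: leaves_def)

text \<open>Since \<open>B I\<close> is an antichain, at most one block contributes at a leaf
  \<open>x\<close>; its signed Haar function has the required value there by the choice of
  halves.\<close>

lemma sum_hsgn_rho:
  assumes "deep n M" "x \<in> level M" "I \<ge> 1" "lev I < n"
  shows "(\<Sum>K\<in>B I. sg (\<Theta> I) K * hsgn K x) = hsgn I (rho n M x)"
proof (cases "under (rho n M x) I")
  case True
  then obtain K where K: "K \<in> B I" "under x K" using hsgn_rho_ex[OF assms] by blast
  have "sg (\<Theta> I) L * hsgn L x = 0" if "L \<in> B I - {K}" for L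
    using that antichain_leaf_unique[OF B_antichain[OF assms(3)] K(1) _ K(2), of L] hsgn_alt[of L x] B_pos[OF assms(3), of L] by auto
  hence "(\<Sum>L\<in>B I - {K}. sg (\<Theta> I) L * hsgn L x) = 0" by (intro sum.neutral) blast
  hence "(\<Sum>K\<in>B I. sg (\<Theta> I) K * hsgn K x) = sg (\<Theta> I) K * hsgn K x"
    using sum.remove[OF B_finite[OF assms(3)] K(1), of "\<lambda>K. sg (\<Theta> I) K * hsgn K x"] by simp
  thus ?thesis using hsgn_rho(3)[OF assms K] by simp
next
  case False
  have "hsgn L x = 0" if "L \<in> B I" for L
    using hsgn_rho(1)[OF assms that] False hsgn_alt[of L x] B_pos[OF assms(3) that] by auto
  moreover have "hsgn I (rho n M x) = 0" using False hsgn_alt[OF assms(3)] by blast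
  ultimately show ?thesis by simp
qed

text \<open>Every block of \<open>B I\<close> gives exactly one of its halves to each child of
  \<open>I\<close>, so any union of whole blocks is divided evenly between the two children.\<close>

lemma card_half:
  assumes "deep n M" "I \<ge> 1" "lev I < n" "\<And>L. L \<in> B I \<Longrightarrow> leaves M L \<subseteq> U \<or> leaves M L \<inter> U = {}"
  shows "2 * card (U \<inter> region M (2 * I)) = card (U \<inter> region M I)"
    "2 * card (U \<inter> region M (Suc (2 * I))) = card (U \<inter> region M I)"
proof -
  have d: "K \<ge> 1" "lev K < M" if "K \<in> B I" for K using assms that B_pos by (auto simp: deep_def)
  have cp: "card (leaves M L) = 2 * card (leaves M (pick b A L))" if "L \<in> B I" for L b A
    using card_leaves[of L M] card_leaves[of "pick b A L" M] d[OF that] pick_pos[of L b A]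
    by (simp add: Suc_diff_Suc flip: power_Suc)
  define V where "V = {L \<in> B I. leaves M L \<subseteq> U}"
  have fV: "finite V" using B_finite assms by (simp add: V_def)
  have *: "2 * card (U \<inter> (\<Union>K\<in>B I. leaves M (pick b (\<Theta> I) K))) = card (U \<inter> region M I)" for b
  proof -
    have sub: "leaves M (pick b (\<Theta> I) L) \<subseteq> leaves M L" for L by (rule leaves_mono) simp
    have e1: "U \<inter> (\<Union>K\<in>B I. leaves M (pick b (\<Theta> I) K)) = (\<Union>K\<in>V. leaves M (pick b (\<Theta> I) K))"
      unfolding V_def using assms(4) sub by blast
    have e2: "U \<inter> region M I = (\<Union>K\<in>V. leaves M K)"
      using assms(4) unfolding region_B[OF assms(2,3,1)] V_def by blast
    have "card (\<Union>K\<in>V. leaves M K) = (\<Sum>K\<in>V. card (leaves M K))"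
      using fV leaves_B_disjoint[OF assms(2)] by (intro card_UN_disjoint) (auto simp: V_def)
    moreover have "card (\<Union>K\<in>V. leaves M (pick b (\<Theta> I) K)) = (\<Sum>K\<in>V. card (leaves M (pick b (\<Theta> I) K)))"
    proof (intro card_UN_disjoint ballI impI)
      fix K L assume "K \<in> V" "L \<in> V" "K \<noteq> L"
      thus "leaves M (pick b (\<Theta> I) K) \<inter> leaves M (pick b (\<Theta> I) L) = {}"
        using leaves_B_disjoint[OF assms(2), of K L] sub[of K] sub[of L] by (auto simp: V_def)
    qed (use fV in auto)
    ultimately show ?thesis unfolding e1 e2 using cp by (simp add: V_def sum_distrib_left)
  qed
  show "2 * card (U \<inter> region M (2 * I)) = card (U \<inter> region M I)"
    "2 * card (U \<inter> region M (Suc (2 * I))) = card (U \<inter> region M I)"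
    using *[of True] *[of False] region_child[OF assms(2)] by auto
qed

text \<open>A form of independence: inside each block of \<open>B I\<close> the region of a
  descendant \<open>z\<close> occupies the proportion \<open>wt z / wt I\<close>, as it does in all
  of \<open>B I\<close>. Each step down the tree halves the count by \<open>card_half\<close>, since
  the finer blocks lie entirely inside or outside \<open>K\<close>.\<close>

lemma card_leaves_region:
  assumes "deep n M" "I \<ge> 1" "K \<in> B I" "under z (2 * I) \<or> under z (Suc (2 * I))" "lev z \<le> n"
  shows "real (card (leaves M K \<inter> region M z)) = 2 ^ M * wt K * wt z / wt I"
  using assms(4,5)
proof (induction z rule: less_induct)
  case (less z)
  have z1: "z \<ge> 1" and lI: "lev I < lev z" using less.prems(1) under_childD[OF assms(2)] by blast+
  have K1: "K \<ge> 1" "lev K < M" using B_pos assms lI less.prems(2) by (auto simp: deep_def)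
  have z2: "z \<ge> 2" using lI by (cases "z = 1") (use z1 in auto)
  define J where "J = z div 2"
  have J: "J \<ge> 1" "z = 2 * J \<or> z = Suc (2 * J)" using z2 by (auto simp: J_def)
  have lJ: "lev z = Suc (lev J)" "lev J < n" "wt z = wt J / 2" using J less.prems(2) by auto
  have zJ: "under z J" using J by auto
  have half: "2 * card (leaves M K \<inter> region M z) = card (leaves M K \<inter> region M J)"
    if "\<And>L. L \<in> B J \<Longrightarrow> leaves M L \<subseteq> leaves M K \<or> leaves M L \<inter> leaves M K = {}"
    using card_half[OF assms(1) J(1) lJ(2), of "leaves M K"] that J(2) by blast
  show ?case
  proof (cases "J = I")
    case True
    have "2 * card (leaves M K \<inter> region M z) = card (leaves M K \<inter> region M I)"
      using half leaves_B_disjoint[OF assms(2) assms(3)] True by blast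
    also have "leaves M K \<inter> region M I = leaves M K" using region_B[OF assms(2) _ assms(1)] assms(3) lJ True by blast
    finally have "2 * real (card (leaves M K \<inter> region M z)) = 2 ^ M * wt K" using card_leaves_wt[of K M] K1 by simp
    moreover have "wt z / wt I = 1 / 2" using lJ(3) True by simp
    ultimately show ?thesis by (metis (no_types, lifting) mult.commute mult_cancel_left2 nonzero_mult_div_cancel_left times_divide_eq_right zero_neq_numeral)
  next
    case False
    have lIJ: "lev I < lev J"
    proof -
      have "lev I \<le> lev J" using lI lJ by simp
      moreover have "lev I \<noteq> lev J"
      proof
        assume "lev I = lev J"
        moreover have "under z I" using less.prems(1) under_childD(1)[OF assms(2)] by blast
        ultimately show False using under_same_lev[OF _ zJ] False assms(2) J by blast
      qed
      ultimately show ?thesis by simp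
    qed
    have uJ: "under J (2 * I) \<or> under J (Suc (2 * I))"
      using less.prems(1) under_linear[of z "2 * I" J] under_linear[of z "Suc (2 * I)" J] zJ lIJ assms(2) J by auto
    have "leaves M L \<subseteq> leaves M K \<or> leaves M L \<inter> leaves M K = {}" if L: "L \<in> B J" for L
    proof -
      obtain L' where L': "L' \<in> source B \<Theta> J" "under L L'" using antichain_refine(3)[OF source_antichain[OF J(1)] B_refine[OF J(1)] L] by blast
      obtain K' where K': "K' \<in> B I" "under L' K'" using source_under_B[OF uJ assms(2) L'(1)] by blast
      have "leaves M L \<subseteq> leaves M K'" using leaves_mono under_trans L' K' by blast
      thus ?thesis using leaves_B_disjoint[OF assms(2) assms(3) K'(1)] by blast
    qed
    from half[OF this] have "2 * real (card (leaves M K \<inter> region M z)) = real (card (leaves M K \<inter> region M J))" by linarith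
    moreover have "J < z" using J by auto
    hence "real (card (leaves M K \<inter> region M J)) = 2 ^ M * wt K * wt J / wt I" using less.IH[of J] uJ lJ(2) by simp
    ultimately have "2 * real (card (leaves M K \<inter> region M z)) = 2 * (2 ^ M * wt K * wt z / wt I)" unfolding lJ(3) by simp
    thus ?thesis by simp
  qed
qed

text \<open>Blocks above one leaf become strictly smaller as the index descends; this is what later
  keeps the blocks of different indices over a leaf distinct.\<close>

lemma B_strict:
  assumes "I \<ge> 1" "J \<ge> 1" "under J I" "I \<noteq> J" "K \<in> B I" "L \<in> B J" "under x K" "under x L"
  shows "lev K < lev L"
proof -
  have "lev I < lev J" using under_lev[OF assms(3,1)] under_lev_eq[OF assms(3,1)] assms(4) by fastforce
  hence u: "under J (2 * I) \<or> under J (Suc (2 * I))" using under_cases assms by blast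
  obtain L' where L': "L' \<in> source B \<Theta> J" "under L L'" using antichain_refine(3)[OF source_antichain[OF assms(2)] B_refine[OF assms(2)] assms(6)] by blast
  obtain K' where K': "K' \<in> B I" "under L' K'" "lev K' < lev L'" using source_under_B[OF u assms(1) L'(1)] by blast
  have "under x K'" using assms(8) L' K' under_trans by blast
  hence "K' = K" using antichain_leaf_unique[OF B_antichain[OF assms(1)] K'(1) assms(5)] assms(7) by blast
  moreover have "L' \<ge> 1" using source_antichain[OF assms(2)] L' by (auto simp: antichain_def)
  ultimately show ?thesis using K' under_lev[OF L'(2)] by simp
qed

end

section \<open>Orthogonality and expansion of Haar functions\<close>

lemma hsgn_double:
  assumes "K \<ge> 1" "lev K < lev z"
  shows "hsgn K (2 * z) = hsgn K z" "hsgn K (Suc (2 * z)) = hsgn K z"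
proof -
  have "z \<ge> 1" using assms by (cases "z = 0") auto
  thus "hsgn K (2 * z) = hsgn K z" "hsgn K (Suc (2 * z)) = hsgn K z"
    using hsgn_under[OF assms(1) under_child(1), of z] hsgn_under[OF assms(1) under_child(2), of z] assms(2) by auto
qed

lemma hsgn_same_level:
  assumes "K \<in> level n" "z \<in> level n"
  shows "hsgn K (2 * z) = (if z = K then 1 else 0)" "hsgn K (Suc (2 * z)) = (if z = K then -1 else 0)"
proof -
  have K: "K \<ge> 1" "lev K = n" "z \<ge> 1" "lev z = n" using assms by (auto simp: level_iff)
  have "under (2 * z) K \<Longrightarrow> z = K" using under_linear[of "2 * z" K z] under_lev_eq[of z K] K by simp
  moreover have "under (Suc (2 * z)) K \<Longrightarrow> z = K" using under_linear[of "Suc (2 * z)" K z] under_lev_eq[of z K] K by simp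
  ultimately have "hsgn K (2 * z) = (if z = K then 1 else 0) \<and> hsgn K (Suc (2 * z)) = (if z = K then -1 else 0)"
  proof (cases "z = K")
    case False
    hence "\<not> under (2 * z) K" "\<not> under (Suc (2 * z)) K" using \<open>under (2 * z) K \<Longrightarrow> z = K\<close> \<open>under (Suc (2 * z)) K \<Longrightarrow> z = K\<close> by blast+
    hence "hsgn K (2 * z) = 0" "hsgn K (Suc (2 * z)) = 0" using hsgn_alt[OF K(1)] by blast+
    thus ?thesis using False by auto
  next
    case True
    have "\<not> under (Suc (2 * K)) (2 * K)" using not_under_sib[OF K(1), of "Suc (2 * K)"] by auto
    thus ?thesis using True by (auto simp: hsgn_def)
  qed
  thus "hsgn K (2 * z) = (if z = K then 1 else 0)" "hsgn K (Suc (2 * z)) = (if z = K then -1 else 0)" by auto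
qed

lemma sum_hsgn_mult:
  assumes "K \<ge> 1" "L \<ge> 1" "lev K < M" "lev L < M"
  shows "(\<Sum>x\<in>level M. hsgn K x * hsgn L x) = (if K = L then 2 ^ M * wt K else 0)"
  using assms(3,4)
proof (induction M)
  case (Suc M)
  have KL: "K \<in> level (lev K)" "L \<in> level (lev L)" using assms by (auto simp: level_iff)
  consider "lev K < M" "lev L < M" | "lev K = M" "lev L < M" | "lev K < M" "lev L = M" | "lev K = M" "lev L = M"
    using Suc by linarith
  thus ?case
  proof cases
    case 1
    have "(\<Sum>x\<in>level (Suc M). hsgn K x * hsgn L x) = (\<Sum>z\<in>level M. 2 * (hsgn K z * hsgn L z))"
      unfolding sum_level_Suc using 1 hsgn_double assms by (intro sum.cong) (auto simp: level_iff)
    thus ?thesis using Suc.IH[OF 1] by (simp flip: sum_distrib_left)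
  next
    case 2
    have "(\<Sum>x\<in>level (Suc M). hsgn K x * hsgn L x) = (\<Sum>z\<in>level M. 0)"
      unfolding sum_level_Suc using 2 KL hsgn_same_level[of K M] hsgn_double[OF assms(2)]
      by (intro sum.cong) (auto simp: level_iff)
    thus ?thesis using 2 by auto
  next
    case 3
    have "(\<Sum>x\<in>level (Suc M). hsgn K x * hsgn L x) = (\<Sum>z\<in>level M. 0)"
      unfolding sum_level_Suc using 3 KL hsgn_same_level[of L M] hsgn_double[OF assms(1)]
      by (intro sum.cong) (auto simp: level_iff)
    thus ?thesis using 3 by auto
  next
    case 4
    have "(\<Sum>x\<in>level (Suc M). hsgn K x * hsgn L x) = (\<Sum>z\<in>level M. if z = K then (if K = L then 2 else 0) else 0)"
      unfolding sum_level_Suc using 4 KL hsgn_same_level[of L M] hsgn_same_level[of K M]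
      by (intro sum.cong) auto
    also have "\<dots> = (if K = L then 2 else 0)" using KL 4 by (subst sum.delta) auto
    finally show ?thesis using 4 by (auto simp: wt_def)
  qed
qed simp

lemma sum_hsgn:
  assumes "K \<ge> 1" "lev K < M"
  shows "(\<Sum>x\<in>level M. hsgn K x) = 0"
  using assms(2)
proof (induction M)
  case (Suc M)
  show ?case
  proof (cases "lev K < M")
    case True
    have "(\<Sum>x\<in>level (Suc M). hsgn K x) = (\<Sum>z\<in>level M. 2 * hsgn K z)"
      unfolding sum_level_Suc using True hsgn_double[OF assms(1)] by (intro sum.cong) (auto simp: level_iff)
    thus ?thesis using Suc.IH[OF True] by (simp flip: sum_distrib_left)
  next
    case False
    hence "K \<in> level M" using Suc assms by (simp add: level_iff)
    thus ?thesis unfolding sum_level_Suc using hsgn_same_level[of K M] by (intro sum.neutral) auto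
  qed
qed simp

lemma sum_hsgn_leaves:
  assumes "K \<ge> 1" "lev K < M" "z \<ge> 1" "lev z \<le> lev K"
  shows "(\<Sum>x\<in>leaves M z. hsgn K x) = 0"
proof (cases "under K z")
  case True
  have "(\<Sum>x\<in>leaves M z. hsgn K x) = (\<Sum>x\<in>level M. hsgn K x)"
    using True hsgn_alt[OF assms(1)] under_trans[OF _ True] by (intro sum.mono_neutral_left) (auto simp: leaves_def)
  thus ?thesis using sum_hsgn assms by simp
next
  case False
  have "hsgn K x = 0" if "x \<in> leaves M z" for x
    using that hsgn_alt[OF assms(1), of x] under_linear[of x z K] assms False by (auto simp: leaves_def)
  thus ?thesis by simp
qed

text \<open>In the induction the pair averages \<open>h\<close> form a function on the previous
  level with the same coarse coefficients up to scaling, while the last level adds the half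
  differences of siblings.\<close>

lemma haar_expansion:
  fixes g :: "nat \<Rightarrow> real"
  assumes "z \<in> level n"
  shows "g z = sum g (level n) / 2 ^ n + (\<Sum>I\<in>{1..<2^n}. (2 ^ lev I / 2 ^ n * (\<Sum>w\<in>level n. hsgn I w * g w)) * hsgn I z)"
  using assms
proof (induction n arbitrary: g z)
  case (Suc n)
  define h where "h w = (g (2 * w) + g (2 * w + 1)) / 2" for w
  define y where "y = z div 2"
  have y: "y \<in> level n" using Suc.prems div2_level by (simp add: y_def)
  have z: "z = 2 * y \<or> z = Suc (2 * y)" by (auto simp: y_def)
  have s1: "sum g (level (Suc n)) = 2 * sum h (level n)"
    unfolding sum_level_Suc sum_distrib_left by (intro sum.cong) (auto simp: h_def)
  have s2: "(\<Sum>w\<in>level (Suc n). hsgn I w * g w) = 2 * (\<Sum>w\<in>level n. hsgn I w * h w)" if "I \<in> {1..<2^n}" for I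
  proof -
    have I: "I \<ge> 1" "lev I < n" using that lt_pow_level[of I n] by auto
    have "(\<Sum>w\<in>level (Suc n). hsgn I w * g w) = (\<Sum>w\<in>level n. 2 * (hsgn I w * h w))"
      unfolding sum_level_Suc using I hsgn_double[OF I(1)] by (intro sum.cong) (auto simp: h_def level_iff field_simps)
    thus ?thesis by (simp add: sum_distrib_left)
  qed
  have h3: "hsgn I z = hsgn I y" if "I \<in> {1..<2^n}" for I
    using z hsgn_double[of I y] that lt_pow_level[of I n] y by (auto simp: level_iff)
  have s4: "(\<Sum>w\<in>level (Suc n). hsgn I w * g w) = g (2 * I) - g (2 * I + 1)" if "I \<in> level n" for I
  proof -
    have "(\<Sum>w\<in>level (Suc n). hsgn I w * g w) = (\<Sum>w\<in>level n. if w = I then g (2 * I) - g (2 * I + 1) else 0)"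
      unfolding sum_level_Suc using hsgn_same_level[OF that] by (intro sum.cong) auto
    thus ?thesis using that by simp
  qed
  have "(\<Sum>I\<in>level n. (2 ^ lev I / 2 ^ Suc n * (\<Sum>w\<in>level (Suc n). hsgn I w * g w)) * hsgn I z)
      = (\<Sum>I\<in>level n. if I = y then (g (2 * y) - g (2 * y + 1)) / 2 * hsgn y z else 0)"
  proof (intro sum.cong refl)
    fix I assume I: "I \<in> level n"
    show "(2 ^ lev I / 2 ^ Suc n * (\<Sum>w\<in>level (Suc n). hsgn I w * g w)) * hsgn I z = (if I = y then (g (2 * y) - g (2 * y + 1)) / 2 * hsgn y z else 0)"
      using s4[OF I] hsgn_same_level[OF I y] z I by (auto simp: level_iff)
  qed
  also have "\<dots> = (g (2 * y) - g (2 * y + 1)) / 2 * hsgn y z" using y by simp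
  also have "\<dots> = g z - h y" using z hsgn_same_level[OF y y] by (auto simp: h_def field_simps)
  finally have top: "(\<Sum>I\<in>level n. (2 ^ lev I / 2 ^ Suc n * (\<Sum>w\<in>level (Suc n). hsgn I w * g w)) * hsgn I z) = g z - h y" .
  have "(\<Sum>I\<in>{1..<2^n}. (2 ^ lev I / 2 ^ Suc n * (\<Sum>w\<in>level (Suc n). hsgn I w * g w)) * hsgn I z)
     = (\<Sum>I\<in>{1..<2^n}. (2 ^ lev I / 2 ^ n * (\<Sum>w\<in>level n. hsgn I w * h w)) * hsgn I y)"
    using s2 h3 by (intro sum.cong) auto
  hence "(\<Sum>I\<in>{1..<2^Suc n}. (2 ^ lev I / 2 ^ Suc n * (\<Sum>w\<in>level (Suc n). hsgn I w * g w)) * hsgn I z)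
     = (\<Sum>I\<in>{1..<2^n}. (2 ^ lev I / 2 ^ n * (\<Sum>w\<in>level n. hsgn I w * h w)) * hsgn I y) + (g z - h y)"
    unfolding sum_nodes_Suc top by simp
  thus ?case using Suc.IH[OF y, of h] s1 by simp
qed simp

subsection \<open>Norms of Haar expansions\<close>

text \<open>Expectation of \<open>\<bar>c + \<Sum>k\<in>F. \<epsilon>\<^sub>k y\<^sub>k\<bar>\<close> over independent signs.\<close>

definition Eo :: "nat set \<Rightarrow> real \<Rightarrow> (nat \<Rightarrow> real) \<Rightarrow> real" where
  "Eo F c y = (\<Sum>A\<in>Pow F. \<bar>c + (\<Sum>k\<in>F. sg A k * y k)\<bar>) / 2 ^ card F"

lemma Eo_empty [simp]: "Eo {} c y = \<bar>c\<bar>" by (simp add: Eo_def)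

lemma sum_Pow_insert:
  fixes f :: "'b set \<Rightarrow> 'a::comm_monoid_add"
  assumes "finite F" "k \<notin> F"
  shows "(\<Sum>A\<in>Pow (insert k F). f A) = (\<Sum>A\<in>Pow F. f (insert k A) + f A)"
proof -
  have "(\<Sum>A\<in>Pow (insert k F). f A) = (\<Sum>A\<in>Pow F. f A) + (\<Sum>A\<in>insert k ` Pow F. f A)"
    unfolding Pow_insert using assms by (intro sum.union_disjoint) auto
  also have "(\<Sum>A\<in>insert k ` Pow F. f A) = (\<Sum>A\<in>Pow F. f (insert k A))"
    using assms by (subst sum.reindex) (auto simp: inj_on_def insert_ident)
  finally show ?thesis by (simp add: sum.distrib add.commute)
qed

lemma sg_insert: "k \<notin> F \<Longrightarrow> (\<Sum>j\<in>F. sg (insert k A) j * y j) = (\<Sum>j\<in>F. sg A j * y j)"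
  by (intro sum.cong) (auto simp: sg_def)

lemma Eo_insert:
  assumes "finite F" "k \<notin> F"
  shows "Eo (insert k F) c y = (Eo F (c + y k) y + Eo F (c - y k) y) / 2"
proof -
  have "(\<Sum>A\<in>Pow (insert k F). \<bar>c + (\<Sum>j\<in>insert k F. sg A j * y j)\<bar>)
     = (\<Sum>A\<in>Pow F. \<bar>(c + y k) + (\<Sum>j\<in>F. sg A j * y j)\<bar> + \<bar>(c - y k) + (\<Sum>j\<in>F. sg A j * y j)\<bar>)"
    unfolding sum_Pow_insert[OF assms]
  proof (intro sum.cong refl)
    fix A assume "A \<in> Pow F"
    hence "sg (insert k A) k = 1" "sg A k = -1" using assms by (auto simp: sg_def)
    thus "\<bar>c + (\<Sum>j\<in>insert k F. sg (insert k A) j * y j)\<bar> + \<bar>c + (\<Sum>j\<in>insert k F. sg A j * y j)\<bar>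
        = \<bar>(c + y k) + (\<Sum>j\<in>F. sg A j * y j)\<bar> + \<bar>(c - y k) + (\<Sum>j\<in>F. sg A j * y j)\<bar>"
      using assms sg_insert[OF assms(2)] by (simp add: add.assoc)
  qed
  thus ?thesis unfolding Eo_def using assms by (simp add: sum.distrib field_simps)
qed

text \<open>Only the triangle inequality and positive homogeneity enter, so the weights are not
  normalised.\<close>

lemma Eo_convex: "Eo F (\<Sum>x\<in>X. w x * c x) (\<lambda>k. \<Sum>x\<in>X. w x * y x k) \<le> (\<Sum>x\<in>X. w x * Eo F (c x) (y x))"
  if w: "\<And>x. x \<in> X \<Longrightarrow> w x \<ge> 0" for w :: "'a \<Rightarrow> real"
proof -
  have "\<bar>(\<Sum>x\<in>X. w x * c x) + (\<Sum>k\<in>F. sg A k * (\<Sum>x\<in>X. w x * y x k))\<bar>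
     \<le> (\<Sum>x\<in>X. w x * \<bar>c x + (\<Sum>k\<in>F. sg A k * y x k)\<bar>)" for A
  proof -
    have "(\<Sum>k\<in>F. sg A k * (\<Sum>x\<in>X. w x * y x k)) = (\<Sum>x\<in>X. w x * (\<Sum>k\<in>F. sg A k * y x k))"
      by (simp add: sum_distrib_left mult.left_commute) (rule sum.swap)
    hence "(\<Sum>x\<in>X. w x * c x) + (\<Sum>k\<in>F. sg A k * (\<Sum>x\<in>X. w x * y x k)) = (\<Sum>x\<in>X. w x * (c x + (\<Sum>k\<in>F. sg A k * y x k)))"
      by (simp add: sum.distrib distrib_left)
    also have "\<bar>\<dots>\<bar> \<le> (\<Sum>x\<in>X. \<bar>w x * (c x + (\<Sum>k\<in>F. sg A k * y x k))\<bar>)" by (rule sum_abs)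
    also have "\<dots> = (\<Sum>x\<in>X. w x * \<bar>c x + (\<Sum>k\<in>F. sg A k * y x k)\<bar>)" using w by (intro sum.cong) (auto simp: abs_mult)
    finally show ?thesis .
  qed
  hence "(\<Sum>A\<in>Pow F. \<bar>(\<Sum>x\<in>X. w x * c x) + (\<Sum>k\<in>F. sg A k * (\<Sum>x\<in>X. w x * y x k))\<bar>)
     \<le> (\<Sum>A\<in>Pow F. \<Sum>x\<in>X. w x * \<bar>c x + (\<Sum>k\<in>F. sg A k * y x k)\<bar>)" by (rule sum_mono)
  also have "\<dots> = (\<Sum>x\<in>X. w x * (\<Sum>A\<in>Pow F. \<bar>c x + (\<Sum>k\<in>F. sg A k * y x k)\<bar>))"
    by (subst sum.swap) (simp add: sum_distrib_left)
  finally show ?thesis unfolding Eo_def by (simp add: sum_divide_distrib[symmetric] divide_right_mono)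
qed

text \<open>Dropping a sign averages over the shifts by \<open>y k\<close> and \<open>- y k\<close>,
  and \<open>c\<close> is the mean of \<open>c + y k\<close> and \<open>c - y k\<close>; convexity
  does the rest.\<close>

lemma Eo_le_insert: "finite F \<Longrightarrow> k \<notin> F \<Longrightarrow> Eo F c y \<le> Eo (insert k F) c y"
proof -
  assume a: "finite F" "k \<notin> F"
  have "Eo F (\<Sum>x\<in>{True,False}. 1/2 * (if x then c + y k else c - y k)) (\<lambda>k. \<Sum>x\<in>{True,False}. 1/2 * y k)
     \<le> (\<Sum>x\<in>{True,False}. 1/2 * Eo F (if x then c + y k else c - y k) y)" by (rule Eo_convex) auto
  moreover have "(c + y k) / 2 + (c - y k) / 2 = c" by (simp add: field_simps)
  ultimately show ?thesis using Eo_insert[OF a, of c y] by simp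
qed

lemma Eo_mono: "finite F \<Longrightarrow> G \<subseteq> F \<Longrightarrow> Eo G c y \<le> Eo F c y"
proof -
  assume a: "finite F" "G \<subseteq> F"
  have "Eo G c y \<le> Eo (G \<union> H) c y" if "finite H" "H \<inter> G = {}" for H
    using that
  proof (induction H rule: finite_induct)
    case (insert x H)
    have fin: "finite (G \<union> H)" using a insert finite_subset by auto
    show ?case using insert Eo_le_insert[OF fin, of x c y] by (simp add: disjoint_iff)
  qed simp
  moreover have "(F - G) \<inter> G = {}" by blast
  ultimately have "Eo G c y \<le> Eo (G \<union> (F - G)) c y" using a by blast
  thus ?thesis using a by (simp add: Un_absorb1)
qed

lemma Eo_cong: "(\<And>k. k \<in> F \<Longrightarrow> y k = y' k) \<Longrightarrow> Eo F c y = Eo F c y'"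
  by (simp add: Eo_def)

lemma Eo_zero: "finite F \<Longrightarrow> G \<subseteq> F \<Longrightarrow> (\<And>k. k \<in> F - G \<Longrightarrow> y k = 0) \<Longrightarrow> Eo F c y = Eo G c y"
proof -
  assume a: "finite F" "G \<subseteq> F" "\<And>k. k \<in> F - G \<Longrightarrow> y k = 0"
  have "Eo (G \<union> H) c y = Eo G c y" if "finite H" "H \<subseteq> F - G" for H
    using that
  proof (induction H rule: finite_induct)
    case (insert x H)
    have fin: "finite (G \<union> H)" "x \<notin> G \<union> H" "y x = 0" using a insert finite_subset by auto
    show ?case using insert Eo_insert[OF fin(1,2), of c y] fin by simp
  qed simp
  from this[of "F - G"] show ?thesis using a by (simp add: Un_absorb1)
qed

lemma Eo_reindex:
  assumes "finite G" "inj_on f G" "\<And>k. k \<in> G \<Longrightarrow> \<bar>y (f k)\<bar> = \<bar>y' k\<bar>"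
  shows "Eo (f ` G) c y = Eo G c y'"
  using assms
proof (induction G arbitrary: c rule: finite_induct)
  case (insert x G)
  have a: "f x \<notin> f ` G" "finite (f ` G)" using insert by (auto simp: inj_on_def)
  have IH: "Eo (f ` G) c y = Eo G c y'" for c using insert by (simp add: inj_on_def)
  have "y (f x) = y' x \<or> y (f x) = - y' x" using insert.prems(2)[of x] by (auto simp: abs_eq_iff)
  thus ?case using Eo_insert[OF a(2,1), of c y] Eo_insert[OF insert(1,2), of c y'] IH by auto
qed simp

lemma Eo_nonneg: "Eo F c y \<ge> 0" by (simp add: Eo_def sum_nonneg)

lemma Eo_single: "Eo {k} 0 y = \<bar>y k\<bar>" using Eo_insert[of "{}" k 0 y] by simp

section \<open>Rearrangement invariant norms on step functions\<close>

text \<open>\<open>\<mu> M\<close> is the norm of a Haar system space on functions that are constant on intervals of level \<open>M\<close>.\<close>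

locale leaf_norm =
  fixes \<mu> :: "nat \<Rightarrow> (nat \<Rightarrow> real) \<Rightarrow> real"
  assumes mu_ext: "(\<And>x. x \<in> level M \<Longrightarrow> v x = w x) \<Longrightarrow> \<mu> M v = \<mu> M w"
    and mu_add: "\<mu> M (\<lambda>x. v x + w x) \<le> \<mu> M v + \<mu> M w"
    and mu_scale: "\<mu> M (\<lambda>x. c * v x) = \<bar>c\<bar> * \<mu> M v"
    and mu_perm: "bij_betw \<pi> (level M) (level M) \<Longrightarrow> (\<And>x. x \<in> level M \<Longrightarrow> \<bar>v (\<pi> x)\<bar> = \<bar>w x\<bar>) \<Longrightarrow> \<mu> M v = \<mu> M w"
    and mu_Suc: "\<mu> (Suc M) (\<lambda>x. v (x div 2)) = \<mu> M v"
    and mu_one: "\<mu> 0 (\<lambda>_. 1) = 1"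
begin

lemma mu_abs: "(\<And>x. x \<in> level M \<Longrightarrow> \<bar>v x\<bar> = \<bar>w x\<bar>) \<Longrightarrow> \<mu> M v = \<mu> M w"
  using mu_perm[of id M v w] by simp

lemma mu_zero: "\<mu> M (\<lambda>_. 0) = 0" using mu_scale[of M 0 "\<lambda>_. 0"] by simp

lemma mu_nonneg: "\<mu> M v \<ge> 0"
proof -
  have "0 \<le> \<mu> M v + \<mu> M (\<lambda>x. -1 * v x)" using mu_add[of M v "\<lambda>x. -1 * v x"] mu_zero by simp
  thus ?thesis unfolding mu_scale by simp
qed

lemma mu_const: "\<mu> M (\<lambda>_. c) = \<bar>c\<bar>"
proof (induction M)
  case 0 show ?case using mu_scale[of 0 c "\<lambda>_. 1"] mu_one by simp
next
  case (Suc M) thus ?case using mu_Suc[of M "\<lambda>_. c"] by simp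
qed

text \<open>The changed function is a convex combination of \<open>w\<close> and of \<open>w\<close>
  with its sign flipped at \<open>a\<close>, and these two have equal norm because only absolute
  values count. Repeating this over all leaves gives monotonicity of the norm.\<close>

lemma mu_upd:
  assumes "\<bar>t\<bar> \<le> \<bar>w a\<bar>"
  shows "\<mu> M (w(a := t)) \<le> \<mu> M w"
proof (cases "w a = 0")
  case True
  hence "w(a := t) = w" using assms by auto
  thus ?thesis by simp
next
  case False
  define l where "l = t / w a"
  have l: "\<bar>l\<bar> \<le> 1" "t = l * w a" using False assms by (auto simp: l_def divide_le_eq_1)
  define u where "u = w(a := - w a)"
  have "w(a := t) = (\<lambda>x. (1 + l) / 2 * w x + (1 - l) / 2 * u x)"
    by (auto simp: fun_eq_iff l(2) u_def field_simps)
  hence "\<mu> M (w(a := t)) \<le> \<mu> M (\<lambda>x. (1 + l) / 2 * w x) + \<mu> M (\<lambda>x. (1 - l) / 2 * u x)"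
    using mu_add[of M "\<lambda>x. (1 + l) / 2 * w x" "\<lambda>x. (1 - l) / 2 * u x"] by (simp only:)
  also have "\<dots> = (1 + l) / 2 * \<mu> M w + (1 - l) / 2 * \<mu> M u"
    unfolding mu_scale using l(1) by simp
  also have "\<mu> M u = \<mu> M w" by (rule mu_abs) (auto simp: u_def)
  also have "(1 + l) / 2 * \<mu> M w + (1 - l) / 2 * \<mu> M w = \<mu> M w" by (simp add: field_simps)
  finally show ?thesis .
qed

lemma mu_mono:
  assumes "\<And>x. x \<in> level M \<Longrightarrow> \<bar>v x\<bar> \<le> \<bar>w x\<bar>"
  shows "\<mu> M v \<le> \<mu> M w"
proof -
  have "\<mu> M (\<lambda>x. if x \<in> F then v x else w x) \<le> \<mu> M w" if "finite F" "F \<subseteq> level M" for F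
    using that
  proof (induction F rule: finite_induct)
    case (insert a F)
    let ?u = "\<lambda>x. if x \<in> F then v x else w x"
    have "(\<lambda>x. if x \<in> insert a F then v x else w x) = ?u(a := v a)" by auto
    moreover have "\<mu> M (?u(a := v a)) \<le> \<mu> M ?u" using insert assms by (intro mu_upd) auto
    ultimately show ?case using insert by simp
  qed simp
  from this[of "level M"] have "\<mu> M (\<lambda>x. if x \<in> level M then v x else w x) \<le> \<mu> M w" by simp
  moreover have "\<mu> M (\<lambda>x. if x \<in> level M then v x else w x) = \<mu> M v" by (rule mu_ext) simp
  ultimately show ?thesis by simp
qed

definition sib :: "nat \<Rightarrow> nat" where "sib x = (if even x then x + 1 else x - 1)"

text \<open>Averaging over sibling pairs is the mean of \<open>v\<close> and of \<open>v\<close>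
  composed with the permutation \<open>sib\<close>, so conditional expectation to the previous level
  is a contraction.\<close>

lemma mu_pair: "\<mu> n (\<lambda>z. (v (2 * z) + v (2 * z + 1)) / 2) \<le> \<mu> (Suc n) v"
proof -
  have sib2: "sib (sib x) = x" for x by (auto simp: sib_def)
  have sibl: "sib x \<in> level (Suc n)" if "x \<in> level (Suc n)" for x
    using that by (auto simp: sib_def level_Suc)
  have bij: "bij_betw sib (level (Suc n)) (level (Suc n))"
    by (rule bij_betw_byWitness[where f' = sib]) (use sib2 sibl in auto)
  have "\<mu> n (\<lambda>z. (v (2 * z) + v (2 * z + 1)) / 2) = \<mu> (Suc n) (\<lambda>x. (v (2 * (x div 2)) + v (2 * (x div 2) + 1)) / 2)"
    using mu_Suc[of n "\<lambda>z. (v (2 * z) + v (2 * z + 1)) / 2"] by simp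
  also have "\<dots> = \<mu> (Suc n) (\<lambda>x. 1/2 * v x + 1/2 * v (sib x))"
  proof (rule mu_ext)
    fix x show "(v (2 * (x div 2)) + v (2 * (x div 2) + 1)) / 2 = 1/2 * v x + 1/2 * v (sib x)"
      by (cases "even x") (auto simp: sib_def elim!: evenE oddE)
  qed
  also have "\<dots> \<le> \<mu> (Suc n) (\<lambda>x. 1/2 * v x) + \<mu> (Suc n) (\<lambda>x. 1/2 * v (sib x))" by (rule mu_add)
  also have "\<dots> = 1/2 * \<mu> (Suc n) v + 1/2 * \<mu> (Suc n) (\<lambda>x. v (sib x))" unfolding mu_scale by simp
  also have "\<mu> (Suc n) (\<lambda>x. v (sib x)) = \<mu> (Suc n) v" using mu_perm[OF bij, of v "\<lambda>x. v (sib x)"] by simp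
  finally show ?thesis by simp
qed

lemma sum_leaves_Suc:
  assumes "z \<in> level n"
  shows "(\<Sum>x\<in>leaves (Suc (n + q)) z. f x) = (\<Sum>x\<in>leaves (n + q) z. f (2 * x) + f (2 * x + 1 :: nat) :: real)"
proof -
  have z: "z \<ge> 1" "lev z = n" using assms by (auto simp: level_iff)
  have *: "under (2 * x) z \<longleftrightarrow> under x z" "under (Suc (2 * x)) z \<longleftrightarrow> under x z" if "x \<in> level (n + q)" for x
  proof -
    have x: "x \<ge> 1" "lev z \<le> lev x" using that z by (auto simp: level_iff)
    show "under (2 * x) z \<longleftrightarrow> under x z"
      using under_linear[OF _ under_child(1) x(2) z(1) x(1)] under_trans[OF under_child(1)] by blast
    show "under (Suc (2 * x)) z \<longleftrightarrow> under x z"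
      using under_linear[OF _ under_child(2) x(2) z(1) x(1)] under_trans[OF under_child(2)] by blast
  qed
  have "(\<Sum>x\<in>leaves (Suc (n + q)) z. f x) = (\<Sum>x\<in>level (Suc (n + q)). if under x z then f x else 0)"
    unfolding leaves_def by (rule sum.inter_filter) simp
  also have "\<dots> = (\<Sum>x\<in>level (n + q). if under x z then f (2 * x) + f (2 * x + 1) else 0)"
    unfolding sum_level_Suc using * by (intro sum.cong) auto
  also have "\<dots> = (\<Sum>x\<in>leaves (n + q) z. f (2 * x) + f (2 * x + 1))"
    unfolding leaves_def by (rule sum.inter_filter[symmetric]) simp
  finally show ?thesis .
qed

lemma mu_block: "\<mu> n (\<lambda>z. (\<Sum>x\<in>leaves (n + q) z. v x) / 2 ^ q) \<le> \<mu> (n + q) v"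
proof (induction q arbitrary: v)
  case 0
  have "\<mu> n (\<lambda>z. (\<Sum>x\<in>leaves n z. v x) / 2 ^ 0) = \<mu> n v" by (rule mu_ext) (simp add: leaves_self)
  thus ?case by simp
next
  case (Suc q)
  have "\<mu> n (\<lambda>z. (\<Sum>x\<in>leaves (n + Suc q) z. v x) / 2 ^ Suc q) = \<mu> n (\<lambda>z. (\<Sum>x\<in>leaves (n + q) z. (v (2 * x) + v (2 * x + 1)) / 2) / 2 ^ q)"
    by (rule mu_ext) (simp add: sum_leaves_Suc flip: sum_divide_distrib)
  also have "\<dots> \<le> \<mu> (n + q) (\<lambda>x. (v (2 * x) + v (2 * x + 1)) / 2)" by (rule Suc.IH)
  also have "\<dots> \<le> \<mu> (Suc (n + q)) v" by (rule mu_pair)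
  finally show ?case by simp
qed

lemma mu_div: "\<mu> (n + q) (\<lambda>x. f (x div 2 ^ q)) = \<mu> n f"
proof (induction q)
  case (Suc q)
  have "\<mu> (n + Suc q) (\<lambda>x. f (x div 2 ^ Suc q)) = \<mu> (Suc (n + q)) (\<lambda>x. f ((x div 2) div 2 ^ q))"
    by (simp add: div_mult2_eq)
  also have "\<dots> = \<mu> (n + q) (\<lambda>x. f (x div 2 ^ q))" by (rule mu_Suc)
  finally show ?case using Suc by simp
qed simp

definition equifibred :: "nat \<Rightarrow> nat \<Rightarrow> (nat \<Rightarrow> nat) \<Rightarrow> bool" where
  "equifibred n M \<rho> \<longleftrightarrow> n \<le> M \<and> \<rho> ` level M \<subseteq> level n \<and> (\<forall>z\<in>level n. card {x \<in> level M. \<rho> x = z} = 2 ^ (M - n))"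

text \<open>A map with fibres of equal size differs from the truncation
  \<open>x div 2 ^ (M - n)\<close> only by a permutation of the leaves, obtained by matching fibres
  with blocks. Statements about such maps thus reduce to permutation invariance.\<close>

lemma equifibred_bij:
  assumes "equifibred n M \<rho>"
  shows "\<exists>\<pi>. bij_betw \<pi> (level M) (level M) \<and> (\<forall>x\<in>level M. \<pi> x div 2 ^ (M - n) = \<rho> x)"
proof -
  have nM: "n \<le> M" and img: "\<And>x. x \<in> level M \<Longrightarrow> \<rho> x \<in> level n" using assms by (auto simp: equifibred_def)
  have "\<exists>b. bij_betw b {x \<in> level M. \<rho> x = z} (leaves M z)" if "z \<in> level n" for z

  proof (intro finite_same_card_bij)
    show "finite {x \<in> level M. \<rho> x = z}" by simp
    have "card (leaves M z) = 2 ^ (M - n)" using card_leaves[of z M] that nM by (simp add: level_iff)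
    thus "card {x \<in> level M. \<rho> x = z} = card (leaves M z)" using assms that by (simp add: equifibred_def)
  qed simp
  then obtain b where b: "\<And>z. z \<in> level n \<Longrightarrow> bij_betw (b z) {x \<in> level M. \<rho> x = z} (leaves M z)" by metis
  define \<pi> where "\<pi> x = b (\<rho> x) x" for x
  have mem: "\<pi> x \<in> leaves M (\<rho> x)" if "x \<in> level M" for x
    using b[OF img[OF that]] that by (auto simp: \<pi>_def bij_betw_def)
  have d: "\<pi> x div 2 ^ (M - n) = \<rho> x" if "x \<in> level M" for x
    using mem[OF that] img[OF that] under_lev[of "\<pi> x" "\<rho> x"] by (auto simp: leaves_def level_iff)
  have "inj_on \<pi> (level M)"
  proof (rule inj_onI)
    fix x y assume xy: "x \<in> level M" "y \<in> level M" "\<pi> x = \<pi> y"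
    hence "\<rho> x = \<rho> y" using d by metis
    thus "x = y" using b[OF img[OF xy(1)]] xy by (auto simp: \<pi>_def bij_betw_def inj_on_def)
  qed
  moreover have "\<pi> ` level M \<subseteq> level M" using mem leaves_level by blast
  ultimately have "bij_betw \<pi> (level M) (level M)" by (simp add: bij_betw_def endo_inj_surj)
  thus ?thesis using d by blast
qed

lemma mu_pull: "equifibred n M \<rho> \<Longrightarrow> \<mu> M (\<lambda>x. f (\<rho> x)) = \<mu> n f"
proof -
  assume a: "equifibred n M \<rho>"
  then obtain \<pi> where p: "bij_betw \<pi> (level M) (level M)" "\<And>x. x \<in> level M \<Longrightarrow> \<pi> x div 2 ^ (M - n) = \<rho> x"
    using equifibred_bij by blast
  have "\<mu> n f = \<mu> M (\<lambda>x. f (x div 2 ^ (M - n)))" using mu_div[of n "M - n" f] a by (simp add: equifibred_def)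
  also have "\<dots> = \<mu> M (\<lambda>x. f (\<rho> x))" by (rule mu_perm[OF p(1)]) (simp add: p(2))
  finally show ?thesis by simp
qed

text \<open>After rearranging the leaves the averages over the fibres become averages over dyadic
  blocks, where \<open>mu_block\<close> applies.\<close>

lemma mu_fibre: "equifibred n M \<rho> \<Longrightarrow> \<mu> n (\<lambda>z. (\<Sum>x | x \<in> level M \<and> \<rho> x = z. v x) * 2 ^ n / 2 ^ M) \<le> \<mu> M v"
proof -
  assume a: "equifibred n M \<rho>"
  then obtain \<pi> where p: "bij_betw \<pi> (level M) (level M)" "\<And>x. x \<in> level M \<Longrightarrow> \<pi> x div 2 ^ (M - n) = \<rho> x"
    using equifibred_bij by blast
  have nM: "n \<le> M" using a by (simp add: equifibred_def)
  define v' where "v' y = v (inv_into (level M) \<pi> y)" for y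
  have v': "v' (\<pi> x) = v x" if "x \<in> level M" for x using p(1) that by (simp add: v'_def bij_betw_def)
  have *: "(\<Sum>x\<in>leaves M z. v' x) = (\<Sum>x | x \<in> level M \<and> \<rho> x = z. v x)" if z: "z \<in> level n" for z
  proof -
    have "bij_betw \<pi> {x \<in> level M. \<rho> x = z} (leaves M z)"
    proof -
      have 1: "\<pi> x \<in> leaves M z \<longleftrightarrow> \<rho> x = z" if "x \<in> level M" for x
      proof -
        have "\<pi> x \<in> level M" using p(1) that by (auto simp: bij_betw_def)
        thus ?thesis using p(2)[OF that] under_iff[of z "\<pi> x"] z nM by (auto simp: leaves_def level_iff)
      qed
      have "\<pi> ` {x \<in> level M. \<rho> x = z} = leaves M z"
      proof (intro equalityI subsetI)
        fix y assume y: "y \<in> leaves M z"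
        hence "y \<in> level M" using leaves_level by blast
        then obtain x where "x \<in> level M" "y = \<pi> x" using p(1) by (auto simp: bij_betw_def)
        thus "y \<in> \<pi> ` {x \<in> level M. \<rho> x = z}" using 1 y by blast
      qed (use 1 in auto)
      moreover have "inj_on \<pi> {x \<in> level M. \<rho> x = z}" using p(1) by (auto simp: bij_betw_def inj_on_def)
      ultimately show ?thesis by (simp add: bij_betw_def)
    qed
    hence "(\<Sum>x\<in>leaves M z. v' x) = (\<Sum>x\<in>{x \<in> level M. \<rho> x = z}. v' (\<pi> x))" by (rule sum.reindex_bij_betw[symmetric])
    also have "\<dots> = (\<Sum>x | x \<in> level M \<and> \<rho> x = z. v x)" using v' by (intro sum.cong) auto
    finally show ?thesis .
  qed
  have "\<mu> n (\<lambda>z. (\<Sum>x | x \<in> level M \<and> \<rho> x = z. v x) * 2 ^ n / 2 ^ M) = \<mu> n (\<lambda>z. (\<Sum>x\<in>leaves M z. v' x) / 2 ^ (M - n))"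
    using * nM by (intro mu_ext) (simp add: power_diff)
  also have "\<dots> \<le> \<mu> M v'" using mu_block[of n v' "M - n"] nM by simp
  also have "\<mu> M v' = \<mu> M v" by (rule mu_perm[OF p(1)]) (simp add: v')
  finally show ?thesis .
qed

text \<open>The case of level 0 of block averaging, applied to the absolute value of
  \<open>v\<close>: there the norm of a constant is its modulus. So every such norm dominates the L1
  norm.\<close>

lemma mu_mean: "(\<Sum>x\<in>level M. \<bar>v x\<bar>) / 2 ^ M \<le> \<mu> M v"
proof -
  have "(\<Sum>x\<in>level M. \<bar>v x\<bar>) / 2 ^ M = \<mu> 0 (\<lambda>z. (\<Sum>x\<in>level M. \<bar>v x\<bar>) / 2 ^ M)" by (simp add: mu_const sum_nonneg)
  also have "\<dots> = \<mu> 0 (\<lambda>z. (\<Sum>x\<in>leaves (0 + M) z. \<bar>v x\<bar>) / 2 ^ M)"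
    using under_1 by (intro mu_ext) (auto simp: leaves_def level_iff intro!: arg_cong[where f="\<lambda>t. t / 2 ^ M"] sum.cong)
  also have "\<dots> \<le> \<mu> (0 + M) (\<lambda>x. \<bar>v x\<bar>)" by (rule mu_block)
  also have "\<dots> = \<mu> M v" using mu_abs[of M "\<lambda>x. \<bar>v x\<bar>" v] by simp
  finally show ?thesis .
qed

lemma mu_leaves:
  assumes "K \<in> level l" "L \<in> level l" "l \<le> M"
  shows "\<mu> M (indicator (leaves M K)) = \<mu> M (indicator (leaves M L))"
proof -
  have c: "card (leaves M K) = card (leaves M L)" using assms card_leaves by (simp add: level_iff)
  have c2: "card (level M - leaves M K) = card (level M - leaves M L)"
    using c leaves_level by (simp add: card_Diff_subset)
  obtain f where f: "bij_betw f (leaves M L) (leaves M K)" using c finite_same_card_bij finite_leaves by metis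
  obtain g where g: "bij_betw g (level M - leaves M L) (level M - leaves M K)" using c2 finite_same_card_bij finite_level finite_Diff by metis
  define \<pi> where "\<pi> x = (if x \<in> leaves M L then f x else g x)" for x
  have "bij_betw \<pi> (leaves M L) (leaves M K)" using f by (rule bij_betw_cong[THEN iffD1, rotated]) (simp add: \<pi>_def)
  moreover have "bij_betw \<pi> (level M - leaves M L) (level M - leaves M K)" using g by (rule bij_betw_cong[THEN iffD1, rotated]) (simp add: \<pi>_def)
  ultimately have "bij_betw \<pi> (leaves M L \<union> (level M - leaves M L)) (leaves M K \<union> (level M - leaves M K))"
    by (rule bij_betw_combine) auto
  hence pi: "bij_betw \<pi> (level M) (level M)" using leaves_level by (simp add: Un_absorb1)
  show ?thesis
  proof (rule mu_perm[OF pi])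
    fix x assume x: "x \<in> level M"
    show "\<bar>indicator (leaves M K) (\<pi> x) :: real\<bar> = \<bar>indicator (leaves M L) x\<bar>"
    proof (cases "x \<in> leaves M L")
      case True
      hence "\<pi> x \<in> leaves M K" using f by (auto simp: \<pi>_def bij_betw_def)
      thus ?thesis using True by simp
    next
      case False
      hence "\<pi> x \<notin> leaves M K" using g x by (auto simp: \<pi>_def bij_betw_def)
      thus ?thesis using False by simp
    qed
  qed
qed

end

section \<open>The interface between norms and Haar coefficients\<close>

abbreviation nodes :: "nat \<Rightarrow> nat set" where "nodes n \<equiv> {1..<2^n}"

text \<open>All that is needed about the norm of a Haar system Hardy space as a function of the Haar coefficients.\<close>

locale haar_gauge =
  fixes nrm :: "nat \<Rightarrow> (nat \<Rightarrow> real) \<Rightarrow> real"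
  assumes gauge_faithful: "faithful B \<Theta> \<Longrightarrow> deep B n M \<Longrightarrow>
      nrm M (\<lambda>K. \<Sum>I\<in>nodes n. if K \<in> B I then sg (\<Theta> I) K * a I else 0) = nrm n a"
    and gauge_adjoint: "faithful B \<Theta> \<Longrightarrow> deep B n M \<Longrightarrow>
      nrm n (\<lambda>I. \<Sum>K\<in>B I. sg (\<Theta> I) K * wt K / wt I * a K) \<le> nrm M a"
    and gauge_restrict: "S \<subseteq> level m \<Longrightarrow> nrm n (\<lambda>K. if \<exists>L\<in>S. under K L then a K else 0) \<le> 2 * nrm n a"
    and gauge_level: "l < n \<Longrightarrow> (\<Sum>K\<in>level l. wt K * \<bar>a K\<bar>) \<le> nrm n a"
    and gauge_bounded: "l < n \<Longrightarrow> (\<And>K. \<bar>c K\<bar> \<le> 1) \<Longrightarrow> nrm n (\<lambda>K. if K \<in> level l then c K else 0) \<le> 1"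
    and gauge_unit: "l < n \<Longrightarrow> K \<in> level l \<Longrightarrow> L \<in> level l \<Longrightarrow>
      nrm n (\<lambda>J. if J = K then 1 else 0) = nrm n (\<lambda>J. if J = L then 1 else 0)"

lemma anc_iff: "x \<in> level n \<Longrightarrow> K \<in> level l \<Longrightarrow> l \<le> n \<Longrightarrow> under x K \<longleftrightarrow> K = x div 2 ^ (n - l)"
  using under_iff[of K x] by (auto simp: level_iff)

lemma anc_level: "x \<in> level n \<Longrightarrow> l \<le> n \<Longrightarrow> x div 2 ^ (n - l) \<in> level l"
  using div_level[of x l "n - l"] by simp

lemma sum_anc:
  fixes c :: "nat \<Rightarrow> real"
  assumes "x \<in> level n" "l \<le> n"
  shows "(\<Sum>K\<in>level l. if under x K then c K else 0) = c (x div 2 ^ (n - l))"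
proof -
  have "(\<Sum>K\<in>level l. if under x K then c K else 0) = (\<Sum>K\<in>level l. if K = x div 2 ^ (n - l) then c (x div 2 ^ (n - l)) else 0)"
    using anc_iff[OF assms(1) _ assms(2)] by (intro sum.cong) auto
  thus ?thesis using anc_level[OF assms] by simp
qed

lemma node_iff: "K \<in> nodes n \<longleftrightarrow> K \<ge> 1 \<and> lev K < n"
  using lt_pow_level[of K n] by (cases "K \<ge> 1") auto

lemma B_nodes:
  assumes "faithful B \<Theta>" "deep B n M" "I \<in> nodes n"
  shows "B I \<subseteq> nodes M"
proof
  fix K assume K: "K \<in> B I"
  have I: "I \<ge> 1" "lev I < n" using assms(3) node_iff by auto
  have "K \<ge> 1" using B_pos[OF assms(1) I(1) K] .
  moreover have "lev K < M" using assms(2) I K by (auto simp: deep_def[OF assms(1)])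
  ultimately show "K \<in> nodes M" using node_iff by blast
qed

lemma (in leaf_norm) equifibred_rho:
  assumes "faithful B \<Theta>" "deep B n M"
  shows "equifibred n M (rho B \<Theta> n M)"
proof -
  have c: "card {x \<in> level M. rho B \<Theta> n M x = z} * 2 ^ n = 2 ^ M" if "z \<in> level n" for z
    using card_rho_fibre[OF assms that] .
  \<comment> \<open>Some element of \<open>level n\<close> is needed to apply the fibre count and so
    conclude \<open>n \<le> M\<close> from divisibility.\<close>
  have "(2::nat) ^ n \<in> level n" by (simp add: level_def)
  hence "(2::nat) ^ n dvd 2 ^ M" using c by (metis dvd_triv_right)
  hence nM: "n \<le> M" using power_dvd_imp_le[of "2::nat" n M] by simp
  have "card {x \<in> level M. rho B \<Theta> n M x = z} = 2 ^ (M - n)" if "z \<in> level n" for z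
  proof -
    have "card {x \<in> level M. rho B \<Theta> n M x = z} * 2 ^ n = 2 ^ (M - n) * 2 ^ n"
      using c[OF that] nM by (simp flip: power_add)
    thus ?thesis by simp
  qed
  moreover have "rho B \<Theta> n M ` level M \<subseteq> level n" using rho[OF assms] by blast
  ultimately show ?thesis using nM by (simp add: equifibred_def)
qed

text \<open>\<open>cnrm\<close> and \<open>inrm\<close> are the Hardy norms for the constant and the independent choice of \<open>r\<close>.\<close>

context leaf_norm
begin

definition csum :: "nat \<Rightarrow> (nat \<Rightarrow> real) \<Rightarrow> nat \<Rightarrow> real" where
  "csum n a x = (\<Sum>K\<in>nodes n. a K * hsgn K x)"

definition cnrm :: "nat \<Rightarrow> (nat \<Rightarrow> real) \<Rightarrow> real" where
  "cnrm n a = \<mu> n (csum n a)"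

definition isum :: "nat \<Rightarrow> (nat \<Rightarrow> real) \<Rightarrow> nat \<Rightarrow> real" where
  "isum n a x = Eo (nodes n) 0 (\<lambda>K. a K * hsgn K x)"

definition inrm :: "nat \<Rightarrow> (nat \<Rightarrow> real) \<Rightarrow> real" where
  "inrm n a = \<mu> n (isum n a)"

lemma sum_hsgn_csum:
  assumes "K \<in> nodes M"
  shows "(\<Sum>x\<in>level M. hsgn K x * csum M a x) = 2 ^ M * wt K * a K"
proof -
  have K: "K \<ge> 1" "lev K < M" using assms node_iff by auto
  have "(\<Sum>x\<in>level M. hsgn K x * csum M a x) = (\<Sum>L\<in>nodes M. a L * (\<Sum>x\<in>level M. hsgn K x * hsgn L x))"
    unfolding csum_def sum_distrib_left by (subst sum.swap) (simp add: mult.left_commute)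
  also have "\<dots> = (\<Sum>L\<in>nodes M. if L = K then 2 ^ M * wt K * a K else 0)"
    using sum_hsgn_mult[OF K(1) _ K(2)] node_iff by (intro sum.cong) auto
  finally show ?thesis using assms by simp
qed

lemma csum_faithful:
  assumes "faithful B \<Theta>" "deep B n M" "x \<in> level M"
  shows "csum M (\<lambda>K. \<Sum>I\<in>nodes n. if K \<in> B I then sg (\<Theta> I) K * a I else 0) x = csum n a (rho B \<Theta> n M x)"
proof -
  have "csum M (\<lambda>K. \<Sum>I\<in>nodes n. if K \<in> B I then sg (\<Theta> I) K * a I else 0) x
     = (\<Sum>I\<in>nodes n. \<Sum>K\<in>nodes M. if K \<in> B I then a I * (sg (\<Theta> I) K * hsgn K x) else 0)"
    unfolding csum_def sum_distrib_right by (subst sum.swap) (intro sum.cong refl, auto)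
  also have "\<dots> = (\<Sum>I\<in>nodes n. a I * hsgn I (rho B \<Theta> n M x))"
  proof (intro sum.cong refl)
    fix I assume I: "I \<in> nodes n"
    hence I': "I \<ge> 1" "lev I < n" using node_iff by auto
    have "(\<Sum>K\<in>nodes M. if K \<in> B I then a I * (sg (\<Theta> I) K * hsgn K x) else 0) = (\<Sum>K\<in>nodes M \<inter> B I. a I * (sg (\<Theta> I) K * hsgn K x))"
      by (subst sum.inter_restrict) auto
    also have "nodes M \<inter> B I = B I" using B_nodes[OF assms(1,2) I] by blast
    finally show "(\<Sum>K\<in>nodes M. if K \<in> B I then a I * (sg (\<Theta> I) K * hsgn K x) else 0) = a I * hsgn I (rho B \<Theta> n M x)"
      using sum_hsgn_rho[OF assms I'] by (simp flip: sum_distrib_left)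
  qed
  finally show ?thesis by (simp add: csum_def)
qed

text \<open>Averaging over the fibres of \<open>rho\<close> is the adjoint of composing with
  \<open>rho\<close>. Both sides have mean 0, so comparing Haar coefficients through
  \<open>haar_expansion\<close> identifies them.\<close>

lemma csum_adjoint:
  assumes "faithful B \<Theta>" "deep B n M" "z \<in> level n"
  shows "csum n (\<lambda>I. \<Sum>K\<in>B I. sg (\<Theta> I) K * wt K / wt I * a K) z
      = (\<Sum>x | x \<in> level M \<and> rho B \<Theta> n M x = z. csum M a x) * 2 ^ n / 2 ^ M"
proof -
  let ?R = "rho B \<Theta> n M"
  define g where "g w = (\<Sum>x | x \<in> level M \<and> ?R x = w. csum M a x) * 2 ^ n / 2 ^ M" for w
  have img: "?R ` level M \<subseteq> level n" using rho[OF assms(1,2)] by blast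
  have corr: "(\<Sum>w\<in>level n. f w * g w) = (\<Sum>x\<in>level M. f (?R x) * csum M a x) * 2 ^ n / 2 ^ M" for f :: "nat \<Rightarrow> real"
  proof -
    have "(\<Sum>x\<in>level M. f (?R x) * csum M a x) = (\<Sum>w\<in>level n. \<Sum>x\<in>{x \<in> level M. ?R x = w}. f (?R x) * csum M a x)"
      by (rule sum.group[symmetric, OF _ _ img]) auto
    also have "\<dots> = (\<Sum>w\<in>level n. f w * (\<Sum>x\<in>{x \<in> level M. ?R x = w}. csum M a x))"
      unfolding sum_distrib_left by (intro sum.cong) auto
    finally have e: "(\<Sum>x\<in>level M. f (?R x) * csum M a x) = (\<Sum>w\<in>level n. f w * (\<Sum>x\<in>{x \<in> level M. ?R x = w}. csum M a x))" .
    show ?thesis unfolding g_def e sum_distrib_right[of _ _ "2 ^ n"] sum_divide_distrib[of _ _ "2 ^ M"] by (intro sum.cong) (auto simp: mult.assoc simp flip: sum_distrib_right sum_divide_distrib)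
  qed
  have "(\<Sum>x\<in>level M. csum M a x) = (\<Sum>L\<in>nodes M. a L * (\<Sum>x\<in>level M. hsgn L x))"
    unfolding csum_def sum_distrib_left by (rule sum.swap)
  also have "\<dots> = 0" using sum_hsgn node_iff by (intro sum.neutral) (metis mult_zero_right)
  finally have s0: "(\<Sum>x\<in>level M. csum M a x) = 0" .
  have g0: "sum g (level n) = 0" using corr[of "\<lambda>_. 1"] s0 by simp
  have cf: "2 ^ lev I / 2 ^ n * (\<Sum>w\<in>level n. hsgn I w * g w) = (\<Sum>K\<in>B I. sg (\<Theta> I) K * wt K / wt I * a K)"
    if I: "I \<in> nodes n" for I
  proof -
    have I': "I \<ge> 1" "lev I < n" using I node_iff by auto
    have "(\<Sum>x\<in>level M. hsgn I (?R x) * csum M a x) = (\<Sum>x\<in>level M. \<Sum>K\<in>B I. sg (\<Theta> I) K * (hsgn K x * csum M a x))"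
      using sum_hsgn_rho[OF assms(1,2) _ I'] by (intro sum.cong) (auto simp: sum_distrib_right mult.assoc simp flip: sum_hsgn_rho[OF assms(1,2) _ I'])
    also have "\<dots> = (\<Sum>K\<in>B I. sg (\<Theta> I) K * (\<Sum>x\<in>level M. hsgn K x * csum M a x))"
      by (subst sum.swap) (simp add: sum_distrib_left)
    also have "\<dots> = (\<Sum>K\<in>B I. sg (\<Theta> I) K * (2 ^ M * wt K * a K))"
      using sum_hsgn_csum[of _ M a] B_nodes[OF assms(1,2) I] by (intro sum.cong) auto
    finally have "(\<Sum>w\<in>level n. hsgn I w * g w) = (\<Sum>K\<in>B I. sg (\<Theta> I) K * (2 ^ M * wt K * a K)) * 2 ^ n / 2 ^ M"
      using corr[of "hsgn I"] by simp
    hence "2 ^ lev I / 2 ^ n * (\<Sum>w\<in>level n. hsgn I w * g w) = 2 ^ lev I / 2 ^ M * (\<Sum>K\<in>B I. sg (\<Theta> I) K * (2 ^ M * wt K * a K))"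
      by simp
    also have "\<dots> = (\<Sum>K\<in>B I. 2 ^ lev I / 2 ^ M * (sg (\<Theta> I) K * (2 ^ M * wt K * a K)))" by (rule sum_distrib_left)
    also have "\<dots> = (\<Sum>K\<in>B I. sg (\<Theta> I) K * wt K / wt I * a K)" by (intro sum.cong refl) (simp add: wt_def[of I])
    finally show ?thesis .
  qed
  have "csum n (\<lambda>I. \<Sum>K\<in>B I. sg (\<Theta> I) K * wt K / wt I * a K) z
     = (\<Sum>I\<in>nodes n. (2 ^ lev I / 2 ^ n * (\<Sum>w\<in>level n. hsgn I w * g w)) * hsgn I z)"
    unfolding csum_def
  proof (intro sum.cong refl)
    fix I assume I: "I \<in> nodes n"
    show "(\<Sum>K\<in>B I. sg (\<Theta> I) K * wt K / wt I * a K) * hsgn I z = 2 ^ lev I / 2 ^ n * (\<Sum>w\<in>level n. hsgn I w * g w) * hsgn I z"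
      unfolding cf[OF I] ..
  qed
  also have "\<dots> = g z" using haar_expansion[OF assms(3), of g] g0 by simp
  finally show ?thesis by (simp add: g_def)
qed

text \<open>The terms of level below \<open>m\<close> form the conditional expectation on level
  \<open>m\<close>, and each later term lives inside a single interval of level \<open>m\<close>.
  Keeping only indices under \<open>S\<close> is therefore \<open>f\<close> minus its conditional
  expectation, multiplied by the indicator of \<open>S\<close>; this is where the factor 2 in
  \<open>gauge_restrict\<close> comes from.\<close>

lemma csum_restrict:
  assumes "S \<subseteq> level m" "m < n" "x \<in> level n"
  shows "csum n (\<lambda>K. if \<exists>L\<in>S. under K L then a K else 0) x =
    (if x div 2 ^ (n - m) \<in> S then csum n a x - (\<Sum>y\<in>leaves n (x div 2 ^ (n - m)). csum n a y) / 2 ^ (n - m) else 0)"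
proof -
  define z where "z = x div 2 ^ (n - m)"
  have z: "z \<in> level m" using anc_level[OF assms(3)] assms(2) by (simp add: z_def)
  have z': "z \<ge> 1" "lev z = m" using z by (auto simp: level_iff)
  have xz: "under x z" using anc_iff[OF assms(3) z] assms(2) by (simp add: z_def)
  have below: "hsgn K y = hsgn K z" if "K \<ge> 1" "lev K < m" "y \<in> leaves n z" for K y
    using hsgn_under[of K y z] that z' by (auto simp: leaves_def)
  have "(\<Sum>y\<in>leaves n z. csum n a y) = (\<Sum>K\<in>nodes n. a K * (\<Sum>y\<in>leaves n z. hsgn K y))"
    unfolding csum_def sum_distrib_left by (rule sum.swap)
  also have "\<dots> = (\<Sum>K\<in>nodes n. if lev K < m then 2 ^ (n - m) * (a K * hsgn K x) else 0)"
  proof (intro sum.cong refl)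
    fix K assume K: "K \<in> nodes n"
    hence K': "K \<ge> 1" "lev K < n" using node_iff by auto
    show "a K * (\<Sum>y\<in>leaves n z. hsgn K y) = (if lev K < m then 2 ^ (n - m) * (a K * hsgn K x) else 0)"
    proof (cases "lev K < m")
      case True
      have "(\<Sum>y\<in>leaves n z. hsgn K y) = real (card (leaves n z)) * hsgn K z" using below[OF K'(1) True] by simp
      also have "card (leaves n z) = 2 ^ (n - m)" using card_leaves[of z n] z' assms(2) by simp
      also have "hsgn K z = hsgn K x" using below[OF K'(1) True] xz assms(3) by (simp add: leaves_def)
      finally show ?thesis using True by simp
    next
      case False
      thus ?thesis using sum_hsgn_leaves[OF K' z'(1)] z'(2) by simp
    qed
  qed
  finally have tot: "(\<Sum>y\<in>leaves n z. csum n a y) = (\<Sum>K\<in>nodes n. if lev K < m then 2 ^ (n - m) * (a K * hsgn K x) else 0)" .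
  have avg: "(\<Sum>y\<in>leaves n z. csum n a y) / 2 ^ (n - m) = (\<Sum>K\<in>nodes n. if lev K < m then a K * hsgn K x else 0)"
    unfolding tot sum_divide_distrib by (intro sum.cong) auto
  have d: "csum n a x - (\<Sum>y\<in>leaves n z. csum n a y) / 2 ^ (n - m) = (\<Sum>K\<in>nodes n. if lev K < m then 0 else a K * hsgn K x)"
    unfolding avg unfolding csum_def sum_subtractf[symmetric] by (intro sum.cong) auto
  have tm: "(if \<exists>L\<in>S. under K L then a K else 0) * hsgn K x = (if z \<in> S then (if lev K < m then 0 else a K * hsgn K x) else 0)"
    if K: "K \<in> nodes n" for K
  proof (cases "hsgn K x = 0")
    case False
    have K1: "K \<ge> 1" using K by simp
    have xK: "under x K" using False hsgn_alt[OF K1] by blast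
    have "(\<exists>L\<in>S. under K L) \<longleftrightarrow> m \<le> lev K \<and> z \<in> S"
    proof
      assume "\<exists>L\<in>S. under K L"
      then obtain L where L: "L \<in> S" "under K L" by blast
      have L': "L \<in> level m" using L assms(1) by blast
      have "under x L" using xK L(2) under_trans by blast
      hence "L = z" using anc_iff[OF assms(3) L'] assms(2) by (simp add: z_def)
      moreover have "m \<le> lev K" using under_lev[OF L(2)] L' by (simp add: level_iff)
      ultimately show "m \<le> lev K \<and> z \<in> S" using L by simp
    next
      assume a: "m \<le> lev K \<and> z \<in> S"
      hence "under K z" using under_linear[OF xz xK] z' K1 by simp
      thus "\<exists>L\<in>S. under K L" using a by blast
    qed
    thus ?thesis by auto
  qed auto
  have "csum n (\<lambda>K. if \<exists>L\<in>S. under K L then a K else 0) x = (\<Sum>K\<in>nodes n. if z \<in> S then (if lev K < m then 0 else a K * hsgn K x) else 0)"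
    unfolding csum_def using tm by (intro sum.cong) auto
  also have "\<dots> = (if z \<in> S then csum n a x - (\<Sum>y\<in>leaves n z. csum n a y) / 2 ^ (n - m) else 0)"
    unfolding d by simp
  finally show ?thesis unfolding z_def .
qed

lemma csum_level:
  assumes "x \<in> level n" "l < n"
  shows "\<bar>csum n (\<lambda>K. if K \<in> level l then c K else 0) x\<bar> = \<bar>c (x div 2 ^ (n - l))\<bar>"
proof -
  let ?z = "x div 2 ^ (n - l)"
  have sub: "level l \<subseteq> nodes n"
  proof
    fix K assume "K \<in> level l" thus "K \<in> nodes n" unfolding node_iff using assms(2) by (simp add: level_iff)
  qed
  have "csum n (\<lambda>K. if K \<in> level l then c K else 0) x = (\<Sum>K\<in>nodes n. if K \<in> level l then c K * hsgn K x else 0)"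
    unfolding csum_def by (intro sum.cong) auto
  also have "\<dots> = (\<Sum>K\<in>level l. c K * hsgn K x)" using sub by (simp add: sum.inter_restrict[symmetric] Int_absorb1)
  also have "\<dots> = (\<Sum>K\<in>level l. if under x K then c K * hsgn K x else 0)"
    using hsgn_alt[OF level_pos] by (intro sum.cong) auto
  also have "\<dots> = c ?z * hsgn ?z x" using sum_anc assms by simp
  finally have e: "csum n (\<lambda>K. if K \<in> level l then c K else 0) x = c ?z * hsgn ?z x" .
  have z: "?z \<in> level l" using anc_level assms by simp
  hence "under x ?z" using anc_iff[OF assms(1) z] assms(2) by simp
  hence "\<bar>hsgn ?z x\<bar> = 1" using hsgn_abs[of ?z x] z assms by (simp add: level_iff)
  thus ?thesis using e by (simp add: abs_mult)
qed

lemma isum_level: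
  assumes "x \<in> level n" "l < n"
  shows "isum n (\<lambda>K. if K \<in> level l then c K else 0) x = \<bar>c (x div 2 ^ (n - l))\<bar>"
proof -
  let ?z = "x div 2 ^ (n - l)"
  have z: "?z \<in> level l" using anc_level assms by simp
  have zn: "?z \<in> nodes n" unfolding node_iff using z assms by (simp add: level_iff)
  have "under x ?z" using anc_iff[OF assms(1) z] assms(2) by simp
  hence h: "\<bar>hsgn ?z x\<bar> = 1" using hsgn_abs[of ?z x] z assms by (simp add: level_iff)
  have "isum n (\<lambda>K. if K \<in> level l then c K else 0) x = Eo {?z} 0 (\<lambda>K. (if K \<in> level l then c K else 0) * hsgn K x)"
    unfolding isum_def
  proof (rule Eo_zero)
    fix K assume K: "K \<in> nodes n - {?z}"
    show "(if K \<in> level l then c K else 0) * hsgn K x = 0"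
    proof (cases "K \<in> level l")
      case True
      hence "\<not> under x K" using anc_iff[OF assms(1) True] assms(2) K by simp
      thus ?thesis using hsgn_alt[of K x] K by auto
    qed simp
  qed (use zn in auto)
  thus ?thesis using Eo_single[of ?z] z h by (simp add: abs_mult)
qed

lemma sum_level_mean:
  assumes "l < n" "\<And>K x. K \<in> level l \<Longrightarrow> x \<in> level n \<Longrightarrow> under x K \<Longrightarrow> \<bar>a K\<bar> \<le> v x"
  shows "(\<Sum>K\<in>level l. wt K * \<bar>a K\<bar>) \<le> (\<Sum>x\<in>level n. v x) / 2 ^ n"
proof -
  have "2 ^ n * (\<Sum>K\<in>level l. wt K * \<bar>a K\<bar>) = (\<Sum>K\<in>level l. \<Sum>x\<in>level n. if under x K then \<bar>a K\<bar> else 0)"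
    unfolding sum_distrib_left
  proof (intro sum.cong refl)
    fix K assume K: "K \<in> level l"
    have "(\<Sum>x\<in>level n. if under x K then \<bar>a K\<bar> else 0) = (\<Sum>x\<in>leaves n K. \<bar>a K\<bar>)"
      unfolding leaves_def by (rule sum.inter_filter[symmetric]) simp
    also have "\<dots> = 2 ^ n * wt K * \<bar>a K\<bar>" using card_leaves_wt[of K n] K assms by (simp add: level_iff)
    finally show "2 ^ n * (wt K * \<bar>a K\<bar>) = (\<Sum>x\<in>level n. if under x K then \<bar>a K\<bar> else 0)" by simp
  qed
  also have "\<dots> = (\<Sum>x\<in>level n. \<Sum>K\<in>level l. if under x K then \<bar>a K\<bar> else 0)" by (rule sum.swap)
  also have "\<dots> = (\<Sum>x\<in>level n. \<bar>a (x div 2 ^ (n - l))\<bar>)" using assms by (intro sum.cong) (auto simp: sum_anc)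
  also have "\<dots> \<le> (\<Sum>x\<in>level n. v x)"
  proof (rule sum_mono)
    fix x assume x: "x \<in> level n"
    have z: "x div 2 ^ (n - l) \<in> level l" using anc_level x assms by simp
    thus "\<bar>a (x div 2 ^ (n - l))\<bar> \<le> v x" using assms(2)[OF z x] anc_iff[OF x z] assms(1) by simp
  qed
  finally show ?thesis by (simp add: pos_le_divide_eq mult.commute)
qed

lemma cnrm_gauge: "haar_gauge cnrm"
proof
  fix B \<Theta> n M a assume f: "faithful B \<Theta>" "deep B n M"
  note eq = equifibred_rho[OF f]
  have "cnrm M (\<lambda>K. \<Sum>I\<in>nodes n. if K \<in> B I then sg (\<Theta> I) K * a I else 0) = \<mu> M (\<lambda>x. csum n a (rho B \<Theta> n M x))"
    unfolding cnrm_def using csum_faithful[OF f] by (intro mu_ext) auto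
  also have "\<dots> = cnrm n a" unfolding cnrm_def by (rule mu_pull[OF eq])
  finally show "cnrm M (\<lambda>K. \<Sum>I\<in>nodes n. if K \<in> B I then sg (\<Theta> I) K * a I else 0) = cnrm n a" .
  have "cnrm n (\<lambda>I. \<Sum>K\<in>B I. sg (\<Theta> I) K * wt K / wt I * a K) = \<mu> n (\<lambda>z. (\<Sum>x | x \<in> level M \<and> rho B \<Theta> n M x = z. csum M a x) * 2 ^ n / 2 ^ M)"
    unfolding cnrm_def using csum_adjoint[OF f] by (intro mu_ext) auto
  also have "\<dots> \<le> cnrm M a" unfolding cnrm_def by (rule mu_fibre[OF eq])
  finally show "cnrm n (\<lambda>I. \<Sum>K\<in>B I. sg (\<Theta> I) K * wt K / wt I * a K) \<le> cnrm M a" .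
next
  fix S m n a assume S: "S \<subseteq> level m"
  show "cnrm n (\<lambda>K. if \<exists>L\<in>S. under K L then a K else 0) \<le> 2 * cnrm n a"
  proof (cases "m < n")
    case True
    define h where "h z = (\<Sum>y\<in>leaves n z. csum n a y) / 2 ^ (n - m)" for z
    have "cnrm n (\<lambda>K. if \<exists>L\<in>S. under K L then a K else 0) \<le> \<mu> n (\<lambda>x. \<bar>csum n a x\<bar> + \<bar>h (x div 2 ^ (n - m))\<bar>)"
      unfolding cnrm_def
    proof (rule mu_mono)
      fix x assume x: "x \<in> level n"
      show "\<bar>csum n (\<lambda>K. if \<exists>L\<in>S. under K L then a K else 0) x\<bar> \<le> \<bar>\<bar>csum n a x\<bar> + \<bar>h (x div 2 ^ (n - m))\<bar>\<bar>"
        unfolding csum_restrict[OF S True x] h_def by (auto split: if_splits simp del: abs_divide)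
    qed
    also have "\<dots> \<le> \<mu> n (\<lambda>x. \<bar>csum n a x\<bar>) + \<mu> n (\<lambda>x. \<bar>h (x div 2 ^ (n - m))\<bar>)" by (rule mu_add)
    also have "\<mu> n (\<lambda>x. \<bar>csum n a x\<bar>) = cnrm n a" unfolding cnrm_def by (rule mu_abs) simp
    also have "\<mu> n (\<lambda>x. \<bar>h (x div 2 ^ (n - m))\<bar>) = \<mu> n (\<lambda>x. h (x div 2 ^ (n - m)))" by (rule mu_abs) simp
    also have "\<dots> = \<mu> m h" using mu_div[of m "n - m" h] True by simp
    also have "\<dots> \<le> cnrm n a" unfolding cnrm_def h_def using mu_block[of m "csum n a" "n - m"] True by simp
    finally show ?thesis by simp
  next
    case False
    have "\<not> (\<exists>L\<in>S. under K L)" if "K \<in> nodes n" for K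
      using that under_lev[of K] S False unfolding node_iff by (fastforce simp: level_iff)
    hence "cnrm n (\<lambda>K. if \<exists>L\<in>S. under K L then a K else 0) = \<mu> n (\<lambda>_. 0)"
      unfolding cnrm_def csum_def by (intro mu_ext sum.neutral) auto
    thus ?thesis using mu_zero mu_nonneg by (simp add: cnrm_def)
  qed
next
  fix l n a assume l: "l < (n::nat)"
  have "2 ^ n * (\<Sum>K\<in>level l. wt K * \<bar>a K\<bar>) \<le> (\<Sum>x\<in>level n. \<bar>csum n a x\<bar>)"
  proof -
    have "2 ^ n * (\<Sum>K\<in>level l. wt K * \<bar>a K\<bar>) \<le> (\<Sum>K\<in>level l. \<Sum>x\<in>level n. if under x K then \<bar>csum n a x\<bar> else 0)"
      unfolding sum_distrib_left
    proof (rule sum_mono)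
      fix K assume "K \<in> level l"
      hence K: "K \<ge> 1" "lev K < n" "K \<in> nodes n" using l node_iff[of K n] by (auto simp: level_iff)
      have "2 ^ n * (wt K * \<bar>a K\<bar>) = \<bar>\<Sum>x\<in>level n. hsgn K x * csum n a x\<bar>"
        unfolding sum_hsgn_csum[OF K(3)] by (simp add: abs_mult)
      also have "\<dots> \<le> (\<Sum>x\<in>level n. \<bar>hsgn K x * csum n a x\<bar>)" by (rule sum_abs)
      also have "\<dots> \<le> (\<Sum>x\<in>level n. if under x K then \<bar>csum n a x\<bar> else 0)"
        using hsgn_abs[OF K(1)] by (intro sum_mono) (auto simp: abs_mult)
      finally show "2 ^ n * (wt K * \<bar>a K\<bar>) \<le> (\<Sum>x\<in>level n. if under x K then \<bar>csum n a x\<bar> else 0)" .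
    qed
    also have "\<dots> = (\<Sum>x\<in>level n. \<Sum>K\<in>level l. if under x K then \<bar>csum n a x\<bar> else 0)" by (rule sum.swap)
    also have "\<dots> = (\<Sum>x\<in>level n. \<bar>csum n a x\<bar>)" using l by (intro sum.cong) (auto simp: sum_anc)
    finally show ?thesis .
  qed
  hence "(\<Sum>K\<in>level l. wt K * \<bar>a K\<bar>) \<le> (\<Sum>x\<in>level n. \<bar>csum n a x\<bar>) / 2 ^ n" by (simp add: pos_le_divide_eq mult.commute)
  also have "\<dots> \<le> cnrm n a" unfolding cnrm_def by (rule mu_mean)
  finally show "(\<Sum>K\<in>level l. wt K * \<bar>a K\<bar>) \<le> cnrm n a" .
next
  fix l n and c :: "nat \<Rightarrow> real" assume l: "l < (n::nat)" "\<And>K. \<bar>c K\<bar> \<le> 1"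
  have "cnrm n (\<lambda>K. if K \<in> level l then c K else 0) \<le> \<mu> n (\<lambda>_. 1)"
    unfolding cnrm_def using csum_level[OF _ l(1)] l(2) by (intro mu_mono) simp
  thus "cnrm n (\<lambda>K. if K \<in> level l then c K else 0) \<le> 1" using mu_const by simp
next
  fix l n K L assume l: "l < (n::nat)" "K \<in> level l" "L \<in> level l"
  have *: "cnrm n (\<lambda>J. if J = K then 1 else 0) = \<mu> n (indicator (leaves n K))" if "K \<in> level l" for K
    unfolding cnrm_def
  proof (rule mu_abs)
    fix x assume x: "x \<in> level n"
    have K: "K \<in> nodes n" using l that node_iff[of K n] by (simp add: level_iff)
    have "csum n (\<lambda>J. if J = K then 1 else 0) x = hsgn K x"
      unfolding csum_def using K by (simp add: if_distrib[of "\<lambda>t. t * _"] cong: if_cong)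
    thus "\<bar>csum n (\<lambda>J. if J = K then 1 else 0) x\<bar> = \<bar>indicator (leaves n K) x :: real\<bar>"
      using hsgn_abs[of K x] that x l by (auto simp: level_iff leaves_def indicator_def)
  qed
  show "cnrm n (\<lambda>J. if J = K then 1 else 0) = cnrm n (\<lambda>J. if J = L then 1 else 0)"
    unfolding *[OF l(2)] *[OF l(3)] using l by (intro mu_leaves[of _ l]) auto
qed

section \<open>The Hardy norm for independent signs\<close>

lemma isum_eq: "isum n a x = Eo (nodes n) 0 (\<lambda>K. if under x K \<and> lev K < lev x then a K else 0)"
proof -
  have "isum n a x = Eo (id ` nodes n) 0 (\<lambda>K. a K * hsgn K x)" by (simp add: isum_def)
  also have "\<dots> = Eo (nodes n) 0 (\<lambda>K. if under x K \<and> lev K < lev x then a K else 0)"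
    by (rule Eo_reindex) (auto simp: abs_mult hsgn_abs)
  finally show ?thesis .
qed

lemma isum_nonneg: "isum n a x \<ge> 0" by (simp add: isum_def Eo_nonneg)

definition anc :: "nat \<Rightarrow> nat \<Rightarrow> nat set" where "anc n x = {K \<in> nodes n. under x K \<and> lev K < lev x}"

lemma finite_anc [simp]: "finite (anc n x)" by (simp add: anc_def)

text \<open>At a leaf a Haar function is 0 or a sign, and \<open>Eo\<close> does not see signs; only
  the moduli of the coefficients of the intervals strictly above the leaf remain.\<close>

lemma isum_anc: "isum n a x = Eo (anc n x) 0 a"
proof -
  have "isum n a x = Eo (anc n x) 0 (\<lambda>K. if under x K \<and> lev K < lev x then a K else 0)"
    unfolding isum_eq by (rule Eo_zero) (auto simp: anc_def)
  also have "\<dots> = Eo (anc n x) 0 a" by (rule Eo_cong) (simp add: anc_def)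
  finally show ?thesis .
qed

context
  fixes B \<Theta> n M assumes faith: "faithful B \<Theta>" and dp: "deep B n M"
begin

definition host :: "nat \<Rightarrow> nat \<Rightarrow> nat" where "host x I = (THE K. K \<in> B I \<and> under x K)"

lemma host:
  assumes "x \<in> level M" "I \<in> anc n (rho B \<Theta> n M x)"
  shows "host x I \<in> B I" "under x (host x I)" "host x I \<in> anc M x" "K \<in> B I \<Longrightarrow> under x K \<Longrightarrow> K = host x I"
proof -
  have I: "I \<ge> 1" "lev I < n" "under (rho B \<Theta> n M x) I" using assms(2) node_iff by (auto simp: anc_def)
  have uniq: "K = L" if "K \<in> B I" "L \<in> B I" "under x K" "under x L" for K L
    using antichain_leaf_unique[OF B_antichain[OF faith I(1)]] that by blast
  have "\<exists>K\<in>B I. under x K" using hsgn_rho_ex[OF faith dp assms(1) I] .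
  hence "\<exists>!K. K \<in> B I \<and> under x K" using uniq by blast
  from theI'[OF this] show h: "host x I \<in> B I" "under x (host x I)" by (auto simp: host_def)
  show "K \<in> B I \<Longrightarrow> under x K \<Longrightarrow> K = host x I" using uniq h by blast
  have "I \<in> nodes n" using I node_iff by blast
  hence "host x I \<in> nodes M" using B_nodes[OF faith dp] h(1) by blast
  thus "host x I \<in> anc M x" using h(2) hsgn_rho(2)[OF faith dp assms(1) I(1,2) h] by (simp add: anc_def)
qed

text \<open>Two indices above the same point of level \<open>n\<close> are comparable, so by
  \<open>B_strict\<close> their blocks over \<open>x\<close> have different levels.\<close>

lemma inj_host:
  assumes "x \<in> level M"
  shows "inj_on (host x) (anc n (rho B \<Theta> n M x))"
proof (rule inj_onI)
  fix I J assume IJ: "I \<in> anc n (rho B \<Theta> n M x)" "J \<in> anc n (rho B \<Theta> n M x)" "host x I = host x J"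
  have a: "I \<ge> 1" "J \<ge> 1" "under (rho B \<Theta> n M x) I" "under (rho B \<Theta> n M x) J" using IJ by (auto simp: anc_def)
  note h = host[OF assms IJ(1)] host[OF assms IJ(2)]
  show "I = J"
  proof (rule ccontr)
    assume ne: "I \<noteq> J"
    have "under I J \<or> under J I" using under_linear[OF a(3,4) _ a(1,2)] under_linear[OF a(4,3) _ a(2,1)] by linarith
    thus False
    proof
      assume "under J I"
      thus False using B_strict[OF faith a(1,2) _ ne h(1,5,2,6)] IJ(3) by simp
    next
      assume "under I J"
      thus False using B_strict[OF faith a(2,1) _ ne[symmetric] h(5,1,6,2)] IJ(3) by simp
    qed
  qed
qed

text \<open>Seen from \<open>x\<close>, only the hosts carry possibly non-zero coefficients, and
  they are distinct. Both sides thus average random signs over the same family of moduli.\<close>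

lemma isum_faithful:
  assumes "x \<in> level M"
  shows "isum M (\<lambda>K. \<Sum>I\<in>nodes n. if K \<in> B I then sg (\<Theta> I) K * a I else 0) x = isum n a (rho B \<Theta> n M x)"
proof -
  let ?b = "\<lambda>K. \<Sum>I\<in>nodes n. if K \<in> B I then sg (\<Theta> I) K * a I else 0"
  let ?A = "anc n (rho B \<Theta> n M x)"
  have rl: "rho B \<Theta> n M x \<in> level n" using rho[OF faith dp assms] by blast
  have inA: "I \<in> ?A" "K = host x I" if "I \<in> nodes n" "K \<in> B I" "under x K" for I K
  proof -
    have I: "I \<ge> 1" "lev I < n" using that node_iff by auto
    have "under (rho B \<Theta> n M x) I" using hsgn_rho(1)[OF faith dp assms I that(2,3)] .
    thus "I \<in> ?A" using that(1) I rl by (simp add: anc_def level_iff)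
    thus "K = host x I" using host(4)[OF assms] that by blast
  qed
  have "isum M ?b x = Eo (host x ` ?A) 0 ?b" unfolding isum_anc
  proof (rule Eo_zero)
    show "host x ` ?A \<subseteq> anc M x" using host(3)[OF assms] by blast
    fix K assume K: "K \<in> anc M x - host x ` ?A"
    have "K \<notin> B I" if "I \<in> nodes n" for I
    proof
      assume KI: "K \<in> B I"
      have "under x K" using K by (simp add: anc_def)
      from inA[OF that KI this] K show False by blast
    qed
    thus "?b K = 0" by (intro sum.neutral) auto
  qed simp
  also have "\<dots> = Eo ?A 0 a"
  proof (rule Eo_reindex[OF finite_anc inj_host[OF assms]])
    fix J assume J: "J \<in> ?A"
    note h = host[OF assms J]
    have Jn: "J \<in> nodes n" using J by (simp add: anc_def)
    have "?b (host x J) = (\<Sum>I\<in>nodes n. if I = J then sg (\<Theta> J) (host x J) * a J else 0)"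
    proof (intro sum.cong refl)
      fix I assume I: "I \<in> nodes n"
      show "(if host x J \<in> B I then sg (\<Theta> I) (host x J) * a I else 0) = (if I = J then sg (\<Theta> J) (host x J) * a J else 0)"
      proof (cases "host x J \<in> B I")
        case True
        have "I \<in> ?A" "host x J = host x I" using inA[OF I True h(2)] by auto
        hence "I = J" using inj_host[OF assms] J by (auto simp: inj_on_def)
        thus ?thesis using True by simp
      next
        case False
        thus ?thesis using h(1) by auto
      qed
    qed
    also have "\<dots> = sg (\<Theta> J) (host x J) * a J" using Jn by simp
    finally show "\<bar>?b (host x J)\<bar> = \<bar>a J\<bar>" by (simp add: abs_mult)
  qed
  finally show ?thesis by (simp add: isum_anc)
qed

text \<open>By \<open>card_leaves_region\<close> the coefficient of \<open>I\<close> is the mean,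
  over the fibre of \<open>z\<close>, of the signed coefficients of the hosts. Convexity moves the
  mean outside \<open>Eo\<close>, and adding the remaining intervals above \<open>x\<close> only
  increases it.\<close>

lemma isum_adjoint:
  assumes "z \<in> level n"
  shows "isum n (\<lambda>I. \<Sum>K\<in>B I. sg (\<Theta> I) K * wt K / wt I * a K) z
      \<le> (\<Sum>x | x \<in> level M \<and> rho B \<Theta> n M x = z. isum M a x) * 2 ^ n / 2 ^ M"
proof -
  let ?A = "anc n z"
  have reg: "{x \<in> level M. rho B \<Theta> n M x = z} = region B \<Theta> M z" by (rule rho_fibre[OF faith dp assms])
  let ?X = "region B \<Theta> M z"
  have X: "x \<in> level M \<and> rho B \<Theta> n M x = z" if "x \<in> ?X" for x using that reg by blast
  have z: "z \<ge> 1" "lev z = n" using assms by (auto simp: level_iff)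
  have coef: "(\<Sum>K\<in>B I. sg (\<Theta> I) K * wt K / wt I * a K) = (\<Sum>x\<in>?X. (2 ^ n / 2 ^ M) * (sg (\<Theta> I) (host x I) * a (host x I)))"
    if I: "I \<in> ?A" for I
  proof -
    have I': "I \<ge> 1" "lev I < n" "under z I" "lev I < lev z" using I node_iff by (auto simp: anc_def)
    have ch: "under z (2 * I) \<or> under z (Suc (2 * I))" using under_cases[OF I'(3,1,4)] .
    have "(\<Sum>x\<in>?X. sg (\<Theta> I) (host x I) * a (host x I)) = (\<Sum>x\<in>?X. \<Sum>K\<in>B I. if under x K then sg (\<Theta> I) K * a K else 0)"
    proof (intro sum.cong refl)
      fix x assume x: "x \<in> ?X"
      have IA: "I \<in> anc n (rho B \<Theta> n M x)" using I X[OF x] by simp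
      note h = host[OF conjunct1[OF X[OF x]] IA]
      have "(\<Sum>K\<in>B I. if under x K then sg (\<Theta> I) K * a K else 0) = (\<Sum>K\<in>B I. if K = host x I then sg (\<Theta> I) (host x I) * a (host x I) else 0)"
      proof (intro sum.cong refl)
        fix K assume K: "K \<in> B I"
        show "(if under x K then sg (\<Theta> I) K * a K else 0) = (if K = host x I then sg (\<Theta> I) (host x I) * a (host x I) else 0)"
          using h(2) h(4)[OF K] by (cases "K = host x I") auto
      qed
      thus "sg (\<Theta> I) (host x I) * a (host x I) = (\<Sum>K\<in>B I. if under x K then sg (\<Theta> I) K * a K else 0)"
        using h(1) B_finite[OF faith I'(1)] by simp
    qed
    also have "\<dots> = (\<Sum>K\<in>B I. \<Sum>x\<in>?X. if under x K then sg (\<Theta> I) K * a K else 0)" by (rule sum.swap)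
    also have "\<dots> = (\<Sum>K\<in>B I. 2 ^ M * wt K * wt z / wt I * (sg (\<Theta> I) K * a K))"
    proof (intro sum.cong refl)
      fix K assume K: "K \<in> B I"
      have "(\<Sum>x\<in>?X. if under x K then sg (\<Theta> I) K * a K else 0) = (\<Sum>x\<in>{x \<in> ?X. under x K}. sg (\<Theta> I) K * a K)"
        by (rule sum.inter_filter[symmetric]) (simp add: region_def[OF faith])
      also have "{x \<in> ?X. under x K} = leaves M K \<inter> ?X" using X by (auto simp: leaves_def)
      finally show "(\<Sum>x\<in>?X. if under x K then sg (\<Theta> I) K * a K else 0) = 2 ^ M * wt K * wt z / wt I * (sg (\<Theta> I) K * a K)"
        using card_leaves_region[OF faith dp I'(1) K ch] z by simp
    qed
    finally have e: "(\<Sum>x\<in>?X. sg (\<Theta> I) (host x I) * a (host x I)) = (\<Sum>K\<in>B I. 2 ^ M * wt K * wt z / wt I * (sg (\<Theta> I) K * a K))" .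
    have "(\<Sum>x\<in>?X. (2 ^ n / 2 ^ M) * (sg (\<Theta> I) (host x I) * a (host x I))) = (2 ^ n / 2 ^ M) * (\<Sum>K\<in>B I. 2 ^ M * wt K * wt z / wt I * (sg (\<Theta> I) K * a K))"
      unfolding e[symmetric] by (rule sum_distrib_left[symmetric])
    also have "\<dots> = (\<Sum>K\<in>B I. sg (\<Theta> I) K * wt K / wt I * a K)"
      unfolding sum_distrib_left using z by (intro sum.cong refl) (simp add: wt_def[of z] field_simps)
    finally show ?thesis by simp
  qed
  have "isum n (\<lambda>I. \<Sum>K\<in>B I. sg (\<Theta> I) K * wt K / wt I * a K) z
     = Eo ?A (\<Sum>x\<in>?X. (2 ^ n / 2 ^ M) * 0) (\<lambda>I. \<Sum>x\<in>?X. (2 ^ n / 2 ^ M) * (sg (\<Theta> I) (host x I) * a (host x I)))"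
    unfolding isum_anc mult_zero_right sum.neutral_const by (rule Eo_cong) (rule coef)
  also have "\<dots> \<le> (\<Sum>x\<in>?X. (2 ^ n / 2 ^ M) * Eo ?A 0 (\<lambda>I. sg (\<Theta> I) (host x I) * a (host x I)))"
    by (rule Eo_convex) simp
  also have "\<dots> \<le> (\<Sum>x\<in>?X. (2 ^ n / 2 ^ M) * isum M a x)"
  proof (intro sum_mono mult_left_mono)
    fix x assume x: "x \<in> ?X"
    have xx: "x \<in> level M" "rho B \<Theta> n M x = z" using X[OF x] by auto
    have "Eo ?A 0 (\<lambda>I. sg (\<Theta> I) (host x I) * a (host x I)) = Eo (host x ` ?A) 0 a"
      using inj_host[OF xx(1)] xx(2) by (intro Eo_reindex[symmetric]) (auto simp: abs_mult)
    also have "\<dots> \<le> Eo (anc M x) 0 a" using host(3)[OF xx(1)] xx(2) by (intro Eo_mono) auto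
    finally show "Eo ?A 0 (\<lambda>I. sg (\<Theta> I) (host x I) * a (host x I)) \<le> isum M a x" by (simp add: isum_anc)
  qed simp
  also have "\<dots> = (2 ^ n / 2 ^ M) * (\<Sum>x\<in>?X. isum M a x)" by (rule sum_distrib_left[symmetric])
  also have "\<dots> = (\<Sum>x\<in>?X. isum M a x) * 2 ^ n / 2 ^ M" by simp
  finally show ?thesis unfolding reg .
qed

end

lemma inrm_gauge: "haar_gauge inrm"
proof
  fix B \<Theta> n M a assume f: "faithful B \<Theta>" "deep B n M"
  note eq = equifibred_rho[OF f]
  have "inrm M (\<lambda>K. \<Sum>I\<in>nodes n. if K \<in> B I then sg (\<Theta> I) K * a I else 0) = \<mu> M (\<lambda>x. isum n a (rho B \<Theta> n M x))"
    unfolding inrm_def using isum_faithful[OF f] by (intro mu_ext) auto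
  also have "\<dots> = inrm n a" unfolding inrm_def by (rule mu_pull[OF eq])
  finally show "inrm M (\<lambda>K. \<Sum>I\<in>nodes n. if K \<in> B I then sg (\<Theta> I) K * a I else 0) = inrm n a" .
  have "inrm n (\<lambda>I. \<Sum>K\<in>B I. sg (\<Theta> I) K * wt K / wt I * a K) \<le> \<mu> n (\<lambda>z. (\<Sum>x | x \<in> level M \<and> rho B \<Theta> n M x = z. isum M a x) * 2 ^ n / 2 ^ M)"
    unfolding inrm_def
  proof (rule mu_mono)
    fix z assume z: "z \<in> level n"
    show "\<bar>isum n (\<lambda>I. \<Sum>K\<in>B I. sg (\<Theta> I) K * wt K / wt I * a K) z\<bar> \<le> \<bar>(\<Sum>x | x \<in> level M \<and> rho B \<Theta> n M x = z. isum M a x) * 2 ^ n / 2 ^ M\<bar>"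
      unfolding abs_of_nonneg[OF isum_nonneg] by (rule order_trans[OF isum_adjoint[OF f z] abs_ge_self])
  qed
  also have "\<dots> \<le> inrm M a" unfolding inrm_def by (rule mu_fibre[OF eq])
  finally show "inrm n (\<lambda>I. \<Sum>K\<in>B I. sg (\<Theta> I) K * wt K / wt I * a K) \<le> inrm M a" .
next
  fix S m n a assume S: "S \<subseteq> level m"
  \<comment> \<open>For independent signs omitting terms is a contraction, so here restriction has
    norm at most 1; the 2 is due to the constant choice alone.\<close>
  have "inrm n (\<lambda>K. if \<exists>L\<in>S. under K L then a K else 0) \<le> inrm n a" unfolding inrm_def
  proof (rule mu_mono)
    fix x
    let ?G = "{K \<in> anc n x. \<exists>L\<in>S. under K L}"
    have "isum n (\<lambda>K. if \<exists>L\<in>S. under K L then a K else 0) x = Eo ?G 0 (\<lambda>K. if \<exists>L\<in>S. under K L then a K else 0)"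
      unfolding isum_anc by (rule Eo_zero) auto
    also have "\<dots> = Eo ?G 0 a" by (rule Eo_cong) simp
    also have "\<dots> \<le> isum n a x" unfolding isum_anc by (rule Eo_mono) auto
    finally show "\<bar>isum n (\<lambda>K. if \<exists>L\<in>S. under K L then a K else 0) x\<bar> \<le> \<bar>isum n a x\<bar>"
      by (simp add: isum_def Eo_nonneg)
  qed
  thus "inrm n (\<lambda>K. if \<exists>L\<in>S. under K L then a K else 0) \<le> 2 * inrm n a" using mu_nonneg[of n "isum n a"] by (simp add: inrm_def)
next
  fix l n a assume l: "l < (n::nat)"
  have "(\<Sum>K\<in>level l. wt K * \<bar>a K\<bar>) \<le> (\<Sum>x\<in>level n. isum n a x) / 2 ^ n"
  proof (rule sum_level_mean[OF l])
    fix K x assume a: "K \<in> level l" "x \<in> level n" "under x K"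
    have "K \<in> nodes n" unfolding node_iff using a l by (simp add: level_iff)
    hence "{K} \<subseteq> anc n x" using a l by (simp add: anc_def level_iff)
    from Eo_mono[OF finite_anc this, of 0 a] show "\<bar>a K\<bar> \<le> isum n a x" by (simp add: isum_anc Eo_single)
  qed
  also have "\<dots> = (\<Sum>x\<in>level n. \<bar>isum n a x\<bar>) / 2 ^ n" by (simp add: isum_def Eo_nonneg)
  also have "\<dots> \<le> inrm n a" unfolding inrm_def by (rule mu_mean)
  finally show "(\<Sum>K\<in>level l. wt K * \<bar>a K\<bar>) \<le> inrm n a" .
next
  fix l n and c :: "nat \<Rightarrow> real" assume l: "l < (n::nat)" "\<And>K. \<bar>c K\<bar> \<le> 1"
  have "inrm n (\<lambda>K. if K \<in> level l then c K else 0) \<le> \<mu> n (\<lambda>_. 1)"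
    unfolding inrm_def using isum_level[OF _ l(1)] l(2) by (intro mu_mono) simp
  thus "inrm n (\<lambda>K. if K \<in> level l then c K else 0) \<le> 1" using mu_const by simp
next
  fix l n K L assume l: "l < (n::nat)" "K \<in> level l" "L \<in> level l"
  have *: "inrm n (\<lambda>J. if J = K then 1 else 0) = \<mu> n (indicator (leaves n K))" if K: "K \<in> level l" for K
    unfolding inrm_def
  proof (rule mu_ext)
    fix x assume x: "x \<in> level n"
    have "(\<lambda>J. if J = K then 1 else 0) = (\<lambda>J. if J \<in> level l then (if J = K then 1 else (0::real)) else 0)" using K by auto
    hence "isum n (\<lambda>J. if J = K then 1 else 0) x = \<bar>if x div 2 ^ (n - l) = K then 1 else 0\<bar>"
      using isum_level[OF x l(1), of "\<lambda>J. if J = K then 1 else 0"] by simp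
    thus "isum n (\<lambda>J. if J = K then 1 else 0) x = (indicator (leaves n K) x :: real)"
      using anc_iff[OF x K] x l by (auto simp: leaves_def indicator_def)
  qed
  show "inrm n (\<lambda>J. if J = K then 1 else 0) = inrm n (\<lambda>J. if J = L then 1 else 0)"
    unfolding *[OF l(2)] *[OF l(3)] using l by (intro mu_leaves[of _ l]) auto
qed

end

subsection \<open>Haar system Hardy spaces\<close>

definition ivl :: "nat \<Rightarrow> real set" where "ivl K = dyadic_interval (lev K) (K - 2 ^ lev K)"

definition leaf :: "nat \<Rightarrow> real \<Rightarrow> nat" where "leaf M s = 2 ^ M + nat \<lfloor>s * 2 ^ M\<rfloor>"

definition stepf :: "nat \<Rightarrow> (nat \<Rightarrow> real) \<Rightarrow> real \<Rightarrow> real" where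
  "stepf M v s = (if s \<in> {0..<1} then v (leaf M s) else 0)"

lemma stepf_in: "s \<in> {0..<1} \<Longrightarrow> stepf M v s = v (leaf M s)"
  and stepf_out: "s \<notin> {0..<1} \<Longrightarrow> stepf M v s = 0"
  by (simp_all only: stepf_def if_True if_False)

lemma pow_lev_le: "K \<ge> 1 \<Longrightarrow> 2 ^ lev K \<le> K" and lt_pow_lev: "K < 2 * 2 ^ lev K"
  using floor_log_exp2_le[of K] floor_log_exp2_gt[of K] by auto

lemma leaf_level: "s \<in> {0..<1} \<Longrightarrow> leaf M s \<in> level M"
proof -
  assume s: "s \<in> {0..<1}"
  hence "s * 2 ^ M < 2 ^ M" "s * 2 ^ M \<ge> 0" by auto
  hence "nat \<lfloor>s * 2 ^ M\<rfloor> < 2 ^ M" by (simp add: nat_less_iff floor_less_iff)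
  thus ?thesis by (simp add: leaf_def level_def)
qed

lemma leaf_div: "s \<in> {0..<1} \<Longrightarrow> leaf (M + q) s div 2 ^ q = leaf M s"
proof (induction q)
  case (Suc q)
  have "\<lfloor>s * 2 ^ Suc (M + q)\<rfloor> div 2 = \<lfloor>s * 2 ^ (M + q)\<rfloor>"
    using floor_divide_real_eq_div[of 2 "s * 2 ^ Suc (M + q)"] by simp
  moreover have "\<lfloor>s * 2 ^ Suc (M + q)\<rfloor> \<ge> 0" using Suc by simp
  ultimately have "nat \<lfloor>s * 2 ^ Suc (M + q)\<rfloor> div 2 = nat \<lfloor>s * 2 ^ (M + q)\<rfloor>"
    by (metis nat_div_distrib nat_numeral zero_le_numeral)
  hence "leaf (Suc (M + q)) s div 2 = leaf (M + q) s" by (simp add: leaf_def)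
  hence "leaf (M + Suc q) s div 2 ^ Suc q = leaf (M + q) s div 2 ^ q" by (simp add: div_mult2_eq)
  thus ?case using Suc by simp
qed simp

lemma mem_ivl: "K \<ge> 1 \<Longrightarrow> s \<in> ivl K \<longleftrightarrow> s \<in> {0..<1} \<and> leaf (lev K) s = K"
proof -
  assume K: "K \<ge> 1"
  define j i where "j = lev K" and "i = K - 2 ^ j"
  have i: "K = 2 ^ j + i" "i < 2 ^ j" using pow_lev_le[OF K] lt_pow_lev[of K] by (auto simp: i_def j_def)
  have "s \<in> ivl K \<longleftrightarrow> real i \<le> s * 2 ^ j \<and> s * 2 ^ j < real (i + 1)"
    unfolding ivl_def dyadic_interval_def by (simp add: j_def[symmetric] i_def[symmetric] field_simps)
  also have "\<dots> \<longleftrightarrow> \<lfloor>s * 2 ^ j\<rfloor> = int i" by (auto simp: floor_eq_iff)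
  also have "\<dots> \<longleftrightarrow> s \<in> {0..<1} \<and> leaf j s = K"
  proof
    assume a: "\<lfloor>s * 2 ^ j\<rfloor> = int i"
    hence "0 \<le> s * 2 ^ j" "s * 2 ^ j < real (i + 1)" by linarith+
    moreover have "real (i + 1) \<le> 2 ^ j" using i(2) by (metis Suc_eq_plus1 Suc_leI numeral_power_eq_of_nat_cancel_iff of_nat_le_iff of_nat_numeral of_nat_power)
    ultimately have "0 \<le> s * 2 ^ j" "s * 2 ^ j < 1 * 2 ^ j" by linarith+
    moreover have "(0::real) < 2 ^ j" by simp
    ultimately have "s \<in> {0..<1}" by (auto simp: zero_le_mult_iff)
    thus "s \<in> {0..<1} \<and> leaf j s = K" using a i by (simp add: leaf_def)
  next
    assume a: "s \<in> {0..<1} \<and> leaf j s = K"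
    hence "nat \<lfloor>s * 2 ^ j\<rfloor> = i" using i by (simp add: leaf_def)
    thus "\<lfloor>s * 2 ^ j\<rfloor> = int i" using a by auto
  qed
  finally show ?thesis by (simp add: j_def)
qed

lemma mem_ivl_under: "K \<ge> 1 \<Longrightarrow> lev K \<le> M \<Longrightarrow> s \<in> ivl K \<longleftrightarrow> s \<in> {0..<1} \<and> under (leaf M s) K"
proof -
  assume K: "K \<ge> 1" "lev K \<le> M"
  have "s \<in> {0..<1} \<Longrightarrow> leaf (lev K) s = K \<longleftrightarrow> under (leaf M s) K"
    using anc_iff[of "leaf M s" M K "lev K"] leaf_level[of s M] leaf_div[of s "lev K" "M - lev K"] K by (auto simp: level_iff)
  thus ?thesis using mem_ivl[OF K(1)] by blast
qed

lemma ivl_atLeastLessThan: "ivl K = {real (K - 2 ^ lev K) / 2 ^ lev K ..< real (K - 2 ^ lev K + 1) / 2 ^ lev K}"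
  by (simp add: ivl_def dyadic_interval_def)

lemma ivl_measure: "emeasure lborel (ivl K) = ennreal (1 / 2 ^ lev K)"
  unfolding ivl_atLeastLessThan by (subst emeasure_lborel_Ico) (auto simp: divide_right_mono simp flip: diff_divide_distrib)

lemma ivl_sets [measurable]: "ivl K \<in> sets borel" unfolding ivl_atLeastLessThan by simp

lemma ivl_nonempty: "ivl K \<noteq> {}" unfolding ivl_atLeastLessThan by (simp add: divide_strict_right_mono)

lemma ivl_halves:
  assumes "K \<ge> 1" shows "left_half (ivl K) = ivl (2 * K)" "right_half (ivl K) = ivl (2 * K + 1)"
proof -
  define j i where "j = lev K" and "i = K - 2 ^ j"
  have i: "K = 2 ^ j + i" using pow_lev_le[OF assms] by (simp add: i_def j_def)
  have I: "ivl K = {real i / 2 ^ j ..< real (i + 1) / 2 ^ j}" unfolding ivl_atLeastLessThan by (simp add: j_def i_def)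
  have lt: "real i / 2 ^ j < real (i + 1) / 2 ^ j" by (simp add: divide_strict_right_mono)
  have IS: "Inf (ivl K) = real i / 2 ^ j" "Sup (ivl K) = real (i + 1) / 2 ^ j" using lt unfolding I by simp_all
  have mid: "(real i / 2 ^ j + real (i + 1) / 2 ^ j) / 2 = real (2 * i + 1) / 2 ^ Suc j" by (simp add: field_simps)
  have e: "real (i + 1) / 2 ^ j = real (2 * i + 1 + 1) / 2 ^ Suc j" by (simp add: field_simps)
  have l: "lev (2 * K) = Suc j" "lev (2 * K + 1) = Suc j" using assms by (auto simp: j_def)
  have d: "2 * K - 2 ^ Suc j = 2 * i" "2 * K + 1 - 2 ^ Suc j = 2 * i + 1" using i by auto
  show "left_half (ivl K) = ivl (2 * K)" unfolding left_half_def IS mid unfolding ivl_atLeastLessThan l d by simp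
  show "right_half (ivl K) = ivl (2 * K + 1)" unfolding right_half_def IS mid unfolding ivl_atLeastLessThan l d unfolding e ..
qed

lemma haar_ivl:
  assumes "K \<ge> 1" "lev K < M"
  shows "haar (ivl K) = stepf M (hsgn K)"
proof
  fix s
  have m: "s \<in> ivl (2 * K) \<longleftrightarrow> s \<in> {0..<1} \<and> under (leaf M s) (2 * K)"
    "s \<in> ivl (2 * K + 1) \<longleftrightarrow> s \<in> {0..<1} \<and> under (leaf M s) (2 * K + 1)"
    using mem_ivl_under[of "2 * K" M s] mem_ivl_under[of "2 * K + 1" M s] assms by auto
  have ns: "\<not> (under (leaf M s) (2 * K) \<and> under (leaf M s) (2 * K + 1))" using not_under_sib[OF assms(1)] by auto
  show "haar (ivl K) s = stepf M (hsgn K) s"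
    unfolding haar_def ivl_halves[OF assms(1)] using ivl_nonempty m ns
    by (auto simp: indicator_def stepf_def hsgn_def)
qed

lemma dyadic_level_eq: "dyadic_level n = ivl ` level n"
proof
  show "dyadic_level n \<subseteq> ivl ` level n"
  proof
    fix I assume "I \<in> dyadic_level n"
    then obtain i where i: "i < 2 ^ n" "I = dyadic_interval n i" by (auto simp: dyadic_level_def)
    have l: "2 ^ n + i \<in> level n" using i by (auto simp: level_def)
    hence "ivl (2 ^ n + i) = I" using i by (simp add: ivl_def level_iff)
    thus "I \<in> ivl ` level n" using l by blast
  qed
  show "ivl ` level n \<subseteq> dyadic_level n"
  proof
    fix I assume "I \<in> ivl ` level n"
    then obtain K where K: "K \<in> level n" "I = ivl K" by blast
    hence "K - 2 ^ n < 2 ^ n" by (auto simp: level_def)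
    thus "I \<in> dyadic_level n" using K unfolding dyadic_level_def ivl_def by (auto simp: level_iff)
  qed
qed

lemma dyadic_eq: "dyadic = ivl ` {1..}"
proof -
  have "(\<Union>n. level n) = {1..}" by (auto simp: level_iff)
  thus ?thesis unfolding dyadic_def dyadic_level_eq by (simp flip: image_UN)
qed

lemma ivl_inj: "K \<ge> 1 \<Longrightarrow> L \<ge> 1 \<Longrightarrow> ivl K = ivl L \<Longrightarrow> K = L"
proof -
  assume a: "K \<ge> 1" "L \<ge> 1" "ivl K = ivl L"
  have "ennreal (1 / 2 ^ lev K) = ennreal (1 / 2 ^ lev L)" using ivl_measure a(3) by metis
  hence "(2::real) ^ lev K = 2 ^ lev L" by simp
  hence l: "lev K = lev L" by simp
  obtain s where "s \<in> ivl K" using ivl_nonempty by blast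
  thus ?thesis using mem_ivl a l by metis
qed

lemma iota_ivl: "K \<ge> 1 \<Longrightarrow> iota (ivl K) = K"
proof -
  assume K: "K \<ge> 1"
  have "(THE n. \<exists>j i. i < 2 ^ j \<and> ivl K = dyadic_interval j i \<and> n = 2 ^ j + i) = K"
  proof (rule the_equality)
    have "K - 2 ^ lev K < 2 ^ lev K" "K = 2 ^ lev K + (K - 2 ^ lev K)" using pow_lev_le[OF K] lt_pow_lev[of K] by auto
    thus "\<exists>j i. i < 2 ^ j \<and> ivl K = dyadic_interval j i \<and> K = 2 ^ j + i" unfolding ivl_def by blast
    fix n assume "\<exists>j i. i < 2 ^ j \<and> ivl K = dyadic_interval j i \<and> n = 2 ^ j + i"
    then obtain j i where n: "i < 2 ^ j" "ivl K = dyadic_interval j i" "n = 2 ^ j + i" by blast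
    have "n \<in> level j" using n by (auto simp: level_def)
    hence "ivl n = dyadic_interval j i" "n \<ge> 1" using n by (auto simp: ivl_def level_iff)
    thus "n = K" using ivl_inj[OF _ K] n by simp
  qed
  thus ?thesis using ivl_nonempty by (simp add: iota_def)
qed

lemma dyadic_seq_ivl: "dyadic_seq m = ivl (Suc m)"
proof -
  have "inj_on iota dyadic" unfolding dyadic_eq by (auto simp: inj_on_def iota_ivl)
  moreover have "ivl (Suc m) \<in> dyadic" unfolding dyadic_eq by auto
  ultimately have "the_inv_into dyadic iota (iota (ivl (Suc m))) = ivl (Suc m)" by (rule the_inv_into_f_f)
  thus ?thesis by (simp add: dyadic_seq_def iota_ivl)
qed

lemma sum_fun_app: "(\<Sum>a\<in>A. f a) x = (\<Sum>a\<in>A. f a x :: real)"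
  by (induction A rule: infinite_finite_induct) (auto simp: zero_fun_def)

lemma haar_in_span: "K \<ge> 1 \<Longrightarrow> haar (ivl K) \<in> haar_span"
  unfolding haar_span_def dyadic_plus_def dyadic_eq by (intro span_base) auto

text \<open>A function on one level is the function of its pair averages on the previous level plus
  the half differences times Haar functions.\<close>

lemma stepf_span: "stepf M v \<in> haar_span"
proof (induction M arbitrary: v)
  case 0
  have "leaf 0 s = 1" if "s \<in> {0..<1}" for s using leaf_level[OF that, of 0] by simp
  hence "stepf 0 v = v 1 *\<^sub>R haar {}" by (auto simp: fun_eq_iff scaleR_fun_def haar_def stepf_def indicator_def)
  moreover have "haar {} \<in> haar_span" unfolding haar_span_def dyadic_plus_def by (intro span_base) auto
  ultimately show ?case by (simp add: haar_span_def span_scale)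
next
  case (Suc M)
  let ?w = "\<lambda>z. (v (2 * z) + v (2 * z + 1)) / 2" and ?d = "\<lambda>z. (v (2 * z) - v (2 * z + 1)) / 2"
  have eq: "stepf (Suc M) v = stepf M ?w + (\<Sum>K\<in>level M. ?d K *\<^sub>R haar (ivl K))"
  proof
    fix s
    show "stepf (Suc M) v s = (stepf M ?w + (\<Sum>K\<in>level M. ?d K *\<^sub>R haar (ivl K))) s"
    proof (cases "s \<in> {0..<1}")
      case True
      define x z where "x = leaf (Suc M) s" and "z = leaf M s"
      have z: "x div 2 = z" using leaf_div[OF True, of M 1] by (simp add: x_def z_def)
      have zl: "z \<in> level M" using leaf_level[OF True] by (simp add: z_def)
      have xz: "x = 2 * z \<or> x = Suc (2 * z)" using z by auto
      have "(\<Sum>K\<in>level M. ?d K *\<^sub>R haar (ivl K)) s = (\<Sum>K\<in>level M. ?d K * hsgn K x)"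
        unfolding sum_fun_app
      proof (intro sum.cong refl)
        fix K assume "K \<in> level M"
        hence "haar (ivl K) = stepf (Suc M) (hsgn K)" using haar_ivl[of K "Suc M"] by (simp add: level_iff)
        thus "(?d K *\<^sub>R haar (ivl K)) s = ?d K * hsgn K x" using True by (simp add: scaleR_fun_def stepf_def x_def)
      qed
      also have "\<dots> = (\<Sum>K\<in>level M. if K = z then ?d z * hsgn z x else 0)"
      proof (intro sum.cong refl)
        fix K assume "K \<in> level M"
        from hsgn_same_level[OF this zl] show "?d K * hsgn K x = (if K = z then ?d z * hsgn z x else 0)" using xz by auto
      qed
      also have "\<dots> = ?d z * hsgn z x" using zl by simp
      also have "\<dots> = v x - ?w z" using xz hsgn_same_level[OF zl zl] by (auto simp: field_simps)
      finally show ?thesis using True by (simp add: stepf_def x_def[symmetric] z_def[symmetric])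
    next
      case False
      have "(?d K *\<^sub>R haar (ivl K)) s = 0" if "K \<in> level M" for K
        using stepf_out[OF False] haar_ivl[of K "Suc M"] that by (auto simp: scaleR_fun_def level_iff)
      hence "(\<Sum>K\<in>level M. ?d K *\<^sub>R haar (ivl K)) s = 0" unfolding sum_fun_app by (intro sum.neutral) auto
      thus ?thesis using stepf_out[OF False] by simp
    qed
  qed
  moreover have "(\<Sum>K\<in>level M. ?d K *\<^sub>R haar (ivl K)) \<in> haar_span"
    unfolding haar_span_def using haar_in_span level_pos unfolding haar_span_def by (intro span_sum span_scale) blast
  ultimately show ?case unfolding eq haar_span_def using Suc.IH[of ?w] span_add unfolding haar_span_def by blast
qed

section \<open>Integrals and distributions of step functions\<close>

lemma stepf_alt: "stepf M v = (\<lambda>s. \<Sum>x\<in>level M. v x * indicator (ivl x) s)"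
proof
  fix s
  show "stepf M v s = (\<Sum>x\<in>level M. v x * indicator (ivl x) s)"
  proof (cases "s \<in> {0..<1}")
    case True
    have "(\<Sum>x\<in>level M. v x * indicator (ivl x) s) = (\<Sum>x\<in>level M. if x = leaf M s then v (leaf M s) else 0)"
      using mem_ivl True by (intro sum.cong) (auto simp: level_iff indicator_def)
    thus ?thesis using True leaf_level[OF True] by (simp add: stepf_def)
  next
    case False
    have "s \<notin> ivl x" if "x \<in> level M" for x using mem_ivl[of x s] that False by (auto simp: level_iff)
    thus ?thesis using stepf_out[OF False] by simp
  qed
qed

lemma stepf_integral: "(LBINT u:{0..1}. stepf M v u) = (\<Sum>x\<in>level M. v x) / 2 ^ M"
proof -
  have ind: "indicator {0..1} u *\<^sub>R stepf M v u = stepf M v u" for u by (auto simp: stepf_def indicator_def)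
  have ms: "measure lborel (ivl x) = 1 / 2 ^ M" if "x \<in> level M" for x
    using ivl_measure[of x] that by (simp add: measure_def level_iff)
  have fin: "emeasure lborel (ivl x) < \<infinity>" for x by (simp add: ivl_measure)
  have "(LBINT u:{0..1}. stepf M v u) = (LBINT u. \<Sum>x\<in>level M. v x * indicator (ivl x) u)"
    unfolding set_lebesgue_integral_def ind unfolding stepf_alt ..
  also have "\<dots> = (\<Sum>x\<in>level M. LBINT u. v x * indicator (ivl x) u)"
    using fin by (intro Bochner_Integration.integral_sum integrable_mult_right integrable_real_indicator) auto
  also have "\<dots> = (\<Sum>x\<in>level M. v x * (1 / 2 ^ M))" using ms by (intro sum.cong) auto
  finally show ?thesis by (simp add: sum_divide_distrib)
qed

text \<open>All leaves have the same measure, so the distribution of the modulus only counts how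
  many leaves take a value in a given set; a permutation of the leaves keeps these counts.\<close>

lemma stepf_same_distribution:
  assumes "bij_betw \<pi> (level M) (level M)" "\<And>x. x \<in> level M \<Longrightarrow> \<bar>v (\<pi> x)\<bar> = \<bar>w x\<bar>"
  shows "same_abs_distribution (stepf M v) (stepf M w)"
  unfolding same_abs_distribution_def
proof (rule measure_eqI)
  let ?R = "restrict_space lborel {0..<1::real}"
  have meas: "(\<lambda>s. \<bar>stepf M v s\<bar>) \<in> borel_measurable ?R" for v
    unfolding stepf_alt by (intro measurable_restrict_space1) measurable
  have em: "emeasure (distr ?R borel (\<lambda>s. \<bar>stepf M v s\<bar>)) A = of_nat (card {x \<in> level M. \<bar>v x\<bar> \<in> A}) * ennreal (1 / 2 ^ M)"
    if A: "A \<in> sets borel" for A v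
  proof -
    let ?V = "{x \<in> level M. \<bar>v x\<bar> \<in> A}"
    have fin: "finite ?V" by simp
    have "(\<lambda>s. \<bar>stepf M v s\<bar>) -` A \<inter> space ?R = (\<Union>x\<in>?V. ivl x)"
      using mem_ivl leaf_level by (auto simp: stepf_def space_restrict_space level_iff)
    hence "emeasure (distr ?R borel (\<lambda>s. \<bar>stepf M v s\<bar>)) A = emeasure ?R (\<Union>x\<in>?V. ivl x)"
      using emeasure_distr[OF meas A] by simp
    also have "\<dots> = emeasure lborel (\<Union>x\<in>?V. ivl x)"
      using mem_ivl by (intro emeasure_restrict_space) (auto simp: level_iff)
    also have "\<dots> = (\<Sum>x\<in>?V. emeasure lborel (ivl x))"
      using mem_ivl fin by (intro sum_emeasure[symmetric]) (auto simp: disjoint_family_on_def level_iff)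
    also have "\<dots> = (\<Sum>x\<in>?V. ennreal (1 / 2 ^ M))" using ivl_measure by (intro sum.cong) (auto simp: level_iff)
    finally show ?thesis by simp
  qed
  show "sets (distr ?R borel (\<lambda>s. \<bar>stepf M v s\<bar>)) = sets (distr ?R borel (\<lambda>s. \<bar>stepf M w s\<bar>))" by simp
  fix A assume "A \<in> sets (distr ?R borel (\<lambda>s. \<bar>stepf M v s\<bar>))"
  hence A: "A \<in> sets borel" by simp
  have "bij_betw \<pi> {x \<in> level M. \<bar>w x\<bar> \<in> A} {x \<in> level M. \<bar>v x\<bar> \<in> A}"
  proof -
    have "\<pi> ` {x \<in> level M. \<bar>w x\<bar> \<in> A} = {x \<in> level M. \<bar>v x\<bar> \<in> A}"
    proof (intro equalityI subsetI)
      fix y assume y: "y \<in> {x \<in> level M. \<bar>v x\<bar> \<in> A}"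
      then obtain x where x: "x \<in> level M" "y = \<pi> x" using assms(1) by (auto simp: bij_betw_def)
      hence "\<bar>w x\<bar> \<in> A" using y assms(2)[OF x(1)] by simp
      thus "y \<in> \<pi> ` {x \<in> level M. \<bar>w x\<bar> \<in> A}" using x by blast
    next
      fix y assume "y \<in> \<pi> ` {x \<in> level M. \<bar>w x\<bar> \<in> A}"
      then obtain x where x: "x \<in> level M" "\<bar>w x\<bar> \<in> A" "y = \<pi> x" by blast
      thus "y \<in> {x \<in> level M. \<bar>v x\<bar> \<in> A}" using assms(1) assms(2)[OF x(1)] by (auto simp: bij_betw_def)
    qed
    thus ?thesis using assms(1) by (auto simp: bij_betw_def inj_on_def)
  qed
  hence "card {x \<in> level M. \<bar>w x\<bar> \<in> A} = card {x \<in> level M. \<bar>v x\<bar> \<in> A}" by (rule bij_betw_same_card)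
  thus "emeasure (distr ?R borel (\<lambda>s. \<bar>stepf M v s\<bar>)) A = emeasure (distr ?R borel (\<lambda>s. \<bar>stepf M w s\<bar>)) A"
    using em[OF A] by simp
qed

lemma haar_system_leaf_norm:
  assumes "haar_system_norm N"
  shows "leaf_norm (\<lambda>M v. N (stepf M v))"
proof
  have N: "\<And>x y. x \<in> haar_span \<Longrightarrow> y \<in> haar_span \<Longrightarrow> N (x + y) \<le> N x + N y"
    "\<And>c x. x \<in> haar_span \<Longrightarrow> N (c *\<^sub>R x) = \<bar>c\<bar> * N x"
    "\<And>x y. x \<in> haar_span \<Longrightarrow> y \<in> haar_span \<Longrightarrow> same_abs_distribution x y \<Longrightarrow> N x = N y"
    "N (indicator {0..<1}) = 1"
    using assms by (auto simp: haar_system_norm_def norm_on_def)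
  fix M v w
  show "N (stepf M v) = N (stepf M w)" if "\<And>x. x \<in> level M \<Longrightarrow> v x = w x"
  proof -
    have "stepf M v = stepf M w" using that leaf_level by (auto simp: stepf_def fun_eq_iff)
    thus ?thesis by simp
  qed
  have "stepf M (\<lambda>x. v x + w x) = stepf M v + stepf M w" by (auto simp: stepf_def fun_eq_iff)
  thus "N (stepf M (\<lambda>x. v x + w x)) \<le> N (stepf M v) + N (stepf M w)" using N(1) stepf_span by simp
  fix c
  have "stepf M (\<lambda>x. c * v x) = c *\<^sub>R stepf M v" by (auto simp: stepf_def fun_eq_iff scaleR_fun_def)
  thus "N (stepf M (\<lambda>x. c * v x)) = \<bar>c\<bar> * N (stepf M v)" using N(2) stepf_span by simp
  show "N (stepf M v) = N (stepf M w)" if "bij_betw \<pi> (level M) (level M)" "\<And>x. x \<in> level M \<Longrightarrow> \<bar>v (\<pi> x)\<bar> = \<bar>w x\<bar>" for \<pi>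
    using N(3) stepf_span stepf_same_distribution that by blast
  have "stepf (Suc M) (\<lambda>x. v (x div 2)) = stepf M v" using leaf_div[of _ M 1] by (auto simp: stepf_def fun_eq_iff)
  thus "N (stepf (Suc M) (\<lambda>x. v (x div 2))) = N (stepf M v)" by simp
  have "stepf 0 (\<lambda>_. 1) = indicator {0..<1}" by (auto simp: stepf_def fun_eq_iff indicator_def)
  thus "N (stepf 0 (\<lambda>_. 1)) = 1" using N(4) by simp
qed

section \<open>Rademacher functions as independent signs\<close>

lemma rademacher_stepf:
  assumes "K < M"
  shows "rademacher K = stepf M (\<lambda>x. if even (x div 2 ^ (M - Suc K)) then 1 else -1)"
proof
  fix u
  have inj: "inj_on ivl (level K)" using ivl_inj level_pos by (auto simp: inj_on_def)
  have r: "rademacher K u = (\<Sum>I\<in>level K. stepf (Suc K) (hsgn I) u)"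
    unfolding rademacher_def dyadic_level_eq sum.reindex[OF inj] o_def sum_fun_app
    using haar_ivl[of _ "Suc K"] by (intro sum.cong) (auto simp: level_iff)
  show "rademacher K u = stepf M (\<lambda>x. if even (x div 2 ^ (M - Suc K)) then 1 else -1) u"
  proof (cases "u \<in> {0..<1}")
    case True
    define x z where "x = leaf (Suc K) u" and "z = leaf K u"
    have z: "x div 2 = z" using leaf_div[OF True, of K 1] by (simp add: x_def z_def)
    have zl: "z \<in> level K" using leaf_level[OF True] by (simp add: z_def)
    have xz: "x = 2 * z \<or> x = Suc (2 * z)" using z by auto
    have "rademacher K u = (\<Sum>I\<in>level K. hsgn I x)" using r True by (simp add: stepf_def x_def)
    also have "\<dots> = (\<Sum>I\<in>level K. if I = z then hsgn z x else 0)"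
    proof (intro sum.cong refl)
      fix I assume "I \<in> level K"
      from hsgn_same_level[OF this zl] show "hsgn I x = (if I = z then hsgn z x else 0)" using xz by auto
    qed
    also have "\<dots> = hsgn z x" using zl by simp
    also have "\<dots> = (if even x then 1 else -1)" using xz hsgn_same_level[OF zl zl] by auto
    also have "x = leaf M u div 2 ^ (M - Suc K)" using leaf_div[OF True, of "Suc K" "M - Suc K"] assms by (simp add: x_def)
    finally show ?thesis using True by (simp add: stepf_def)
  next
    case False
    thus ?thesis using r stepf_out[OF False] by simp
  qed
qed

text \<open>The binary digits of a uniformly chosen leaf are independent fair signs. The induction
  splits off the last digit, which separates \<open>2 * z\<close> from
  \<open>2 * z + 1\<close>.\<close>

lemma Eo_rademacher:
  assumes "F \<subseteq> {..<M}"
  shows "(\<Sum>x\<in>level M. \<bar>c + (\<Sum>K\<in>F. (if even (x div 2 ^ (M - Suc K)) then 1 else -1) * y K)\<bar>) / 2 ^ M = Eo F c y"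
  using assms
proof (induction M arbitrary: F c)
  case (Suc M)
  let ?s = "\<lambda>M (x::nat) K. (if even (x div 2 ^ (M - Suc K)) then 1 else -1) :: real"
  define G where "G = F - {M}"
  have G: "G \<subseteq> {..<M}" using Suc.prems by (auto simp: G_def)
  have finG: "finite G" using G finite_subset by blast
  have dv: "?s (Suc M) (2 * z) K = ?s M z K" "?s (Suc M) (2 * z + 1) K = ?s M z K" if "K \<in> G" for z K
  proof -
    have "Suc M - Suc K = Suc (M - Suc K)" using G that by auto
    thus "?s (Suc M) (2 * z) K = ?s M z K" "?s (Suc M) (2 * z + 1) K = ?s M z K" by (simp_all add: div_mult2_eq)
  qed
  have sG: "(\<Sum>K\<in>G. ?s (Suc M) (2 * z) K * y K) = (\<Sum>K\<in>G. ?s M z K * y K)"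
    "(\<Sum>K\<in>G. ?s (Suc M) (2 * z + 1) K * y K) = (\<Sum>K\<in>G. ?s M z K * y K)" for z
    using dv by (auto intro!: sum.cong)
  show ?case
  proof (cases "M \<in> F")
    case True
    hence F: "F = insert M G" "M \<notin> G" by (auto simp: G_def)
    have "(\<Sum>x\<in>level (Suc M). \<bar>c + (\<Sum>K\<in>F. ?s (Suc M) x K * y K)\<bar>)
       = (\<Sum>z\<in>level M. \<bar>(c + y M) + (\<Sum>K\<in>G. ?s M z K * y K)\<bar> + \<bar>(c - y M) + (\<Sum>K\<in>G. ?s M z K * y K)\<bar>)"
      unfolding sum_level_Suc F(1) sum.insert[OF finG F(2)] sG by (intro sum.cong refl) (simp add: add.assoc)
    also have "\<dots> / 2 ^ Suc M = (Eo G (c + y M) y + Eo G (c - y M) y) / 2"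
      using Suc.IH[OF G, of "c + y M"] Suc.IH[OF G, of "c - y M"] by (simp add: sum.distrib field_simps)
    finally show ?thesis using Eo_insert[OF finG F(2), of c y] F(1) by simp
  next
    case False
    hence F: "F = G" by (auto simp: G_def)
    have "(\<Sum>x\<in>level (Suc M). \<bar>c + (\<Sum>K\<in>F. ?s (Suc M) x K * y K)\<bar>) = (\<Sum>z\<in>level M. 2 * \<bar>c + (\<Sum>K\<in>G. ?s M z K * y K)\<bar>)"
      unfolding sum_level_Suc F sG by simp
    thus ?thesis using Suc.IH[OF G, of c] F by (simp flip: sum_distrib_left)
  qed
qed simp

lemma rademacher_integral:
  assumes "finite F"
  shows "(LBINT u:{0..1}. \<bar>\<Sum>K\<in>F. rademacher K u * y K\<bar>) = Eo F 0 y"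
proof -
  obtain M where M: "F \<subseteq> {..<M}" using assms finite_nat_iff_bounded by blast
  let ?s = "\<lambda>(x::nat) K. (if even (x div 2 ^ (M - Suc K)) then 1 else -1) :: real"
  have "(\<lambda>u. \<bar>\<Sum>K\<in>F. rademacher K u * y K\<bar>) = stepf M (\<lambda>x. \<bar>0 + (\<Sum>K\<in>F. ?s x K * y K)\<bar>)"
  proof
    fix u
    have eq: "(\<Sum>K\<in>F. rademacher K u * y K) = (\<Sum>K\<in>F. stepf M (\<lambda>x. ?s x K) u * y K)"
      using rademacher_stepf[of _ M] M by (intro sum.cong) auto
    show "\<bar>\<Sum>K\<in>F. rademacher K u * y K\<bar> = stepf M (\<lambda>x. \<bar>0 + (\<Sum>K\<in>F. ?s x K * y K)\<bar>) u"
    proof (cases "u \<in> {0..<1}")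
      case True thus ?thesis using eq by (simp only: stepf_in[OF True] add_0)
    next
      case False thus ?thesis using eq by (simp add: stepf_out[OF False])
    qed
  qed
  thus ?thesis using stepf_integral[of M "\<lambda>x. \<bar>0 + (\<Sum>K\<in>F. ?s x K * y K)\<bar>"] Eo_rademacher[OF M, of 0 y] by simp
qed

text \<open>From here on a Hardy space enters only through the vectors \<open>e K\<close> realising
  the Haar functions and through a gauge. The index is the value under \<open>iota\<close>, so it
  starts at 1 and \<open>e 0\<close> is arbitrary.\<close>

locale haar_basis =
  fixes e :: "nat \<Rightarrow> 'b::banach" and nrm :: "nat \<Rightarrow> (nat \<Rightarrow> real) \<Rightarrow> real"
  assumes gauge: "haar_gauge nrm"
    and norm_e: "norm (\<Sum>K\<in>nodes n. a K *\<^sub>R e K) = nrm n a"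
begin

definition Y :: "'b set" where "Y = closure (span (e ` {1..}))"

end

locale haar_null = haar_basis e nrm for e :: "nat \<Rightarrow> 'b::banach" and nrm +
  assumes null: "weakly_null Y norm (\<lambda>n. \<Sum>K\<in>level n. e K)"

lemma linear_on_span_image:
  assumes "linear_on (span S) f" "T \<subseteq> S"
  shows "f ` span T = span (f ` T)"
proof -
  have TS: "span T \<subseteq> span S" using assms(2) by (rule span_mono)
  have f: "\<And>x y. x \<in> span S \<Longrightarrow> y \<in> span S \<Longrightarrow> f (x + y) = f x + f y" "\<And>c x. x \<in> span S \<Longrightarrow> f (c *\<^sub>R x) = c *\<^sub>R f x"
    using assms(1) by (auto simp: linear_on_def)
  have f0: "f 0 = 0" using f(2)[of 0 0] span_zero[of S] by simp
  show ?thesis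
  proof (intro equalityI subsetI)
    fix y assume "y \<in> f ` span T"
    then obtain x where x: "x \<in> span T" "y = f x" by blast
    have "x \<in> span T \<and> f x \<in> span (f ` T)" using x(1)
    proof (induction rule: span_induct_alt)
      case base show ?case by (simp add: f0 span_zero)
    next
      case (step c x y)
      have "x \<in> span S" "y \<in> span S" "c *\<^sub>R x \<in> span S" using step TS assms(2) span_base span_scale by blast+
      hence "f (c *\<^sub>R x + y) = c *\<^sub>R f x + f y" using f by simp
      thus ?case using step by (auto intro: span_add span_scale span_base)
    qed
    thus "y \<in> span (f ` T)" using x by simp
  next
    fix y assume "y \<in> span (f ` T)"
    thus "y \<in> f ` span T"
    proof (induction rule: span_induct_alt)
      case base thus ?case using f0 span_zero by (metis imageI)
    next
      case (step c y z)
      then obtain t w where t: "t \<in> T" "y = f t" "w \<in> span T" "z = f w" by blast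
      have m: "t \<in> span T" "c *\<^sub>R t + w \<in> span T" using t by (auto intro: span_add span_scale span_base)
      have "f (c *\<^sub>R t + w) = c *\<^sub>R f t + f w" using f t m TS span_scale[of t S c] by (metis subsetD)
      thus ?case using t m by (metis imageI)
    qed
  qed
qed

lemma linear_on_sum:
  assumes "linear_on V f" "subspace V" "finite A" "\<And>a. a \<in> A \<Longrightarrow> g a \<in> V"
  shows "f (\<Sum>a\<in>A. c a *\<^sub>R g a) = (\<Sum>a\<in>A. c a *\<^sub>R f (g a))"
  using assms(3,4)
proof (induction A rule: finite_induct)
  case empty
  have "f (0 *\<^sub>R 0) = 0 *\<^sub>R f 0" using assms(1,2) subspace_0 unfolding linear_on_def by blast
  thus ?case by simp
next
  case (insert a A)
  have m: "c a *\<^sub>R g a \<in> V" "(\<Sum>a\<in>A. c a *\<^sub>R g a) \<in> V"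
    using insert assms(2) by (auto intro: subspace_scale subspace_sum)
  have "f (c a *\<^sub>R g a + (\<Sum>a\<in>A. c a *\<^sub>R g a)) = c a *\<^sub>R f (g a) + f (\<Sum>a\<in>A. c a *\<^sub>R g a)"
    using assms(1) m insert unfolding linear_on_def by simp
  thus ?case using insert by simp
qed

lemma hardy_haar_basis:
  assumes "haar_system_norm N" "r \<in> rademacher_choices" "hardy_completion N r J"
  shows "\<exists>nrm. haar_basis (\<lambda>K. J (haar (ivl K))) nrm"
proof -
  interpret leaf_norm "\<lambda>M v. N (stepf M v)" by (rule haar_system_leaf_norm[OF assms(1)])
  have lin: "linear_on haar_span J" using assms(3) by (simp add: hardy_completion_def)
  have sub: "subspace haar_span" by (simp add: haar_span_def)
  have nrm: "norm (\<Sum>K\<in>nodes n. a K *\<^sub>R J (haar (ivl K))) = N (\<lambda>s. LBINT u:{0..1}. \<bar>\<Sum>K\<in>nodes n. r (ivl K) u * a K * haar (ivl K) s\<bar>)" for n a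
  proof -
    have inj: "inj_on ivl (nodes n)" using ivl_inj by (auto simp: inj_on_def)
    let ?a = "\<lambda>I. a (iota I)"
    have "norm (J (\<Sum>I\<in>ivl ` nodes n. ?a I *\<^sub>R haar I)) = N (\<lambda>s. LBINT u:{0..1}. \<bar>\<Sum>I\<in>ivl ` nodes n. r I u * ?a I * haar I s\<bar>)"
    proof -
      have "finite (ivl ` nodes n) \<and> ivl ` nodes n \<subseteq> dyadic_plus" by (auto simp: dyadic_plus_def dyadic_eq)
      from conjunct2[OF assms(3)[unfolded hardy_completion_def], rule_format, OF this] show ?thesis .
    qed
    moreover have "(\<Sum>I\<in>ivl ` nodes n. ?a I *\<^sub>R haar I) = (\<Sum>K\<in>nodes n. a K *\<^sub>R haar (ivl K))"
      unfolding sum.reindex[OF inj] by (intro sum.cong) (auto simp: iota_ivl)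
    moreover have "(\<Sum>I\<in>ivl ` nodes n. r I u * ?a I * haar I s) = (\<Sum>K\<in>nodes n. r (ivl K) u * a K * haar (ivl K) s)" for u s
      unfolding sum.reindex[OF inj] by (intro sum.cong) (auto simp: iota_ivl)
    moreover have "J (\<Sum>K\<in>nodes n. a K *\<^sub>R haar (ivl K)) = (\<Sum>K\<in>nodes n. a K *\<^sub>R J (haar (ivl K)))"
      by (rule linear_on_sum[OF lin sub]) (auto intro: haar_in_span)
    ultimately show ?thesis by simp
  qed
  have hv: "haar (ivl K) s = stepf n (hsgn K) s" if "K \<in> nodes n" for K n s
    using haar_ivl[of K n] that node_iff by auto
  consider "r = (\<lambda>I. rademacher 0)" | "r = (\<lambda>I. rademacher (iota I))" using assms(2) by (auto simp: rademacher_choices_def)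
  thus ?thesis
  proof cases
    case 1
    have "norm (\<Sum>K\<in>nodes n. a K *\<^sub>R J (haar (ivl K))) = cnrm n a" for n a
    proof -
      have "(\<lambda>s. LBINT u:{0..1}. \<bar>\<Sum>K\<in>nodes n. r (ivl K) u * a K * haar (ivl K) s\<bar>) = stepf n (\<lambda>x. \<bar>csum n a x\<bar>)"
      proof
        fix s
        \<comment> \<open>As all signs agree, one Rademacher function factors out; written as a sum
          over \<open>{0}\<close>, the formula for independent signs returns the plain absolute
          value.\<close>
        have "(\<Sum>K\<in>nodes n. r (ivl K) u * a K * haar (ivl K) s) = (\<Sum>k\<in>{0}. rademacher k u * (\<Sum>K\<in>nodes n. a K * stepf n (hsgn K) s))" for u
        proof -
          have cs: "(\<Sum>K\<in>nodes n. a K * haar (ivl K) s) = (\<Sum>K\<in>nodes n. a K * stepf n (hsgn K) s)"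
            by (intro sum.cong refl) (simp only: hv)
          show ?thesis unfolding 1 cs[symmetric] by (simp add: sum_distrib_left mult.assoc)
        qed
        hence "(LBINT u:{0..1}. \<bar>\<Sum>K\<in>nodes n. r (ivl K) u * a K * haar (ivl K) s\<bar>) = \<bar>\<Sum>K\<in>nodes n. a K * stepf n (hsgn K) s\<bar>"
          using rademacher_integral[of "{0}" "\<lambda>_. \<Sum>K\<in>nodes n. a K * stepf n (hsgn K) s"] Eo_single[of 0] by simp
        also have "\<dots> = stepf n (\<lambda>x. \<bar>csum n a x\<bar>) s"
        proof (cases "s \<in> {0..<1}")
          case True show ?thesis by (simp only: stepf_in[OF True] csum_def)
        next
          case False show ?thesis by (simp add: stepf_out[OF False])
        qed
        finally show "(LBINT u:{0..1}. \<bar>\<Sum>K\<in>nodes n. r (ivl K) u * a K * haar (ivl K) s\<bar>) = stepf n (\<lambda>x. \<bar>csum n a x\<bar>) s" .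
      qed
      hence "norm (\<Sum>K\<in>nodes n. a K *\<^sub>R J (haar (ivl K))) = N (stepf n (\<lambda>x. \<bar>csum n a x\<bar>))" using nrm by simp
      also have "\<dots> = cnrm n a" unfolding cnrm_def by (rule mu_abs) simp
      finally show ?thesis .
    qed
    thus ?thesis using cnrm_gauge by (intro exI[of _ cnrm]) (simp add: haar_basis_def)
  next
    case 2
    have "norm (\<Sum>K\<in>nodes n. a K *\<^sub>R J (haar (ivl K))) = inrm n a" for n a
    proof -
      have "(\<lambda>s. LBINT u:{0..1}. \<bar>\<Sum>K\<in>nodes n. r (ivl K) u * a K * haar (ivl K) s\<bar>) = stepf n (isum n a)"
      proof
        fix s
        have "(\<Sum>K\<in>nodes n. r (ivl K) u * a K * haar (ivl K) s) = (\<Sum>K\<in>nodes n. rademacher K u * (a K * stepf n (hsgn K) s))" for u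
          unfolding 2
        proof (intro sum.cong refl)
          fix K assume K: "K \<in> nodes n"
          hence "iota (ivl K) = K" by (simp add: iota_ivl)
          thus "rademacher (iota (ivl K)) u * a K * haar (ivl K) s = rademacher K u * (a K * stepf n (hsgn K) s)"
            using hv[OF K] by simp
        qed
        hence "(LBINT u:{0..1}. \<bar>\<Sum>K\<in>nodes n. r (ivl K) u * a K * haar (ivl K) s\<bar>) = Eo (nodes n) 0 (\<lambda>K. a K * stepf n (hsgn K) s)"
          using rademacher_integral[of "nodes n"] by simp
        also have "\<dots> = stepf n (isum n a) s"
        proof (cases "s \<in> {0..<1}")
          case True show ?thesis by (simp only: stepf_in[OF True] isum_def)
        next
          case False show ?thesis by (simp add: stepf_out[OF False] Eo_def)
        qed
        finally show "(LBINT u:{0..1}. \<bar>\<Sum>K\<in>nodes n. r (ivl K) u * a K * haar (ivl K) s\<bar>) = stepf n (isum n a) s" .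
      qed
      thus ?thesis using nrm by (simp add: inrm_def)
    qed
    thus ?thesis using inrm_gauge by (intro exI[of _ inrm]) (simp add: haar_basis_def)
  qed
qed

lemma hardy_haar_null:
  assumes "haar_system_norm N" "r \<in> rademacher_choices" "hardy_completion N r J"
    "weakly_null (hardy0 J) norm (\<lambda>n. J (rademacher n))"
  shows "\<exists>nrm. haar_null (\<lambda>K. J (haar (ivl K))) nrm"
    "hardy0 J = haar_basis.Y (\<lambda>K. J (haar (ivl K)))"
proof -
  obtain nrm where nrm: "haar_basis (\<lambda>K. J (haar (ivl K))) nrm" using hardy_haar_basis[OF assms(1-3)] by blast
  have lin: "linear_on haar_span J" using assms(3) by (simp add: hardy_completion_def)
  have "J ` haar_span0 = span (J ` haar ` dyadic)"
    unfolding haar_span0_def using lin unfolding haar_span_def by (rule linear_on_span_image) (auto simp: dyadic_plus_def)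
  also have "J ` haar ` dyadic = (\<lambda>K. J (haar (ivl K))) ` {1..}" unfolding dyadic_eq by (simp add: image_image)
  finally show Y: "hardy0 J = haar_basis.Y (\<lambda>K. J (haar (ivl K)))"
    unfolding hardy0_def haar_basis.Y_def[OF nrm] by simp
  have "J (rademacher n) = (\<Sum>K\<in>level n. J (haar (ivl K)))" for n
  proof -
    have inj: "inj_on ivl (level n)" using ivl_inj level_pos by (auto simp: inj_on_def)
    have e1: "rademacher n = (\<Sum>K\<in>level n. 1 *\<^sub>R haar (ivl K))" unfolding rademacher_def dyadic_level_eq sum.reindex[OF inj] by simp
    have "J (\<Sum>K\<in>level n. 1 *\<^sub>R haar (ivl K)) = (\<Sum>K\<in>level n. 1 *\<^sub>R J (haar (ivl K)))"
      using lin by (rule linear_on_sum) (use haar_in_span level_pos in \<open>auto simp: haar_span_def\<close>)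
    thus ?thesis unfolding e1 by simp
  qed
  thus "\<exists>nrm. haar_null (\<lambda>K. J (haar (ivl K))) nrm" using nrm assms(4) Y
    by (intro exI[of _ nrm]) (simp add: haar_null_def haar_null_axioms_def)
qed

subsection \<open>Operators on a Haar system Hardy space\<close>

text \<open>The target may be another normed space, so operators and functionals are treated
  together, with an explicit bound; that values stay in a given subspace is stated separately where
  needed.\<close>

definition bdl :: "'a::real_normed_vector set \<Rightarrow> real \<Rightarrow> ('a \<Rightarrow> 'c::real_normed_vector) \<Rightarrow> bool" where
  "bdl V C f \<longleftrightarrow> linear_on V f \<and> 0 \<le> C \<and> (\<forall>x\<in>V. norm (f x) \<le> C * norm x)"

lemma bdl_add: "bdl V C f \<Longrightarrow> x \<in> V \<Longrightarrow> y \<in> V \<Longrightarrow> f (x + y) = f x + f y"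
  and bdl_scale: "bdl V C f \<Longrightarrow> x \<in> V \<Longrightarrow> f (c *\<^sub>R x) = c *\<^sub>R f x"
  and bdl_norm: "bdl V C f \<Longrightarrow> x \<in> V \<Longrightarrow> norm (f x) \<le> C * norm x"
  and bdl_nonneg: "bdl V C f \<Longrightarrow> 0 \<le> C"
  and bdl_linear: "bdl V C f \<Longrightarrow> linear_on V f"
  by (auto simp: bdl_def linear_on_def)

lemma bdl_diff: "bdl V C f \<Longrightarrow> subspace V \<Longrightarrow> x \<in> V \<Longrightarrow> y \<in> V \<Longrightarrow> f (x - y) = f x - f y"
proof -
  assume a: "bdl V C f" "subspace V" "x \<in> V" "y \<in> V"
  have "f ((x - y) + y) = f (x - y) + f y" by (rule bdl_add[OF a(1)]) (use a subspace_diff in auto)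
  thus ?thesis by (simp add: algebra_simps)
qed

lemma bdlI: "(\<And>x y. x \<in> V \<Longrightarrow> y \<in> V \<Longrightarrow> f (x + y) = f x + f y) \<Longrightarrow> (\<And>c x. x \<in> V \<Longrightarrow> f (c *\<^sub>R x) = c *\<^sub>R f x)
   \<Longrightarrow> 0 \<le> C \<Longrightarrow> (\<And>x. x \<in> V \<Longrightarrow> norm (f x) \<le> C * norm x) \<Longrightarrow> bdl V C f"
  by (auto simp: bdl_def linear_on_def)

lemma bdl_mono: "bdl Y C f \<Longrightarrow> C \<le> D \<Longrightarrow> bdl Y D f"
  unfolding bdl_def by (meson mult_right_mono norm_ge_zero order_trans)

lemma bdl_compose:
  assumes "bdl V C f" "bdl W D g" "\<And>x. x \<in> V \<Longrightarrow> f x \<in> W"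
  shows "bdl V (D * C) (\<lambda>x. g (f x))"
proof (rule bdlI)
  fix x assume x: "x \<in> V"
  have "norm (g (f x)) \<le> D * norm (f x)" by (rule bdl_norm[OF assms(2) assms(3)[OF x]])
  also have "\<dots> \<le> D * (C * norm x)" using bdl_norm[OF assms(1) x] bdl_nonneg[OF assms(2)] by (rule mult_left_mono)
  finally show "norm (g (f x)) \<le> D * C * norm x" by simp
qed (use assms(3) bdl_add[OF assms(1)] bdl_add[OF assms(2)] bdl_scale[OF assms(1)] bdl_scale[OF assms(2)]
  bdl_nonneg[OF assms(1)] bdl_nonneg[OF assms(2)] in auto)

lemma bdl_minus:
  assumes "bdl V C f" "bdl V D g" shows "bdl V (C + D) (\<lambda>x. f x - g x)"
proof (rule bdlI)
  fix x assume x: "x \<in> V"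
  show "norm (f x - g x) \<le> (C + D) * norm x"
    using norm_triangle_ineq4[of "f x" "g x"] bdl_norm[OF assms(1) x] bdl_norm[OF assms(2) x] by (simp add: distrib_right)
qed (use bdl_add[OF assms(1)] bdl_add[OF assms(2)] bdl_scale[OF assms(1)] bdl_scale[OF assms(2)]
  bdl_nonneg[OF assms(1)] bdl_nonneg[OF assms(2)] in \<open>auto simp: scaleR_diff_right\<close>)

lemma bdl_cmult: "bdl V C f \<Longrightarrow> bdl V (\<bar>c\<bar> * C) (\<lambda>x. c *\<^sub>R f x)"
  by (auto simp: bdl_def linear_on_def scaleR_add_right mult.assoc intro: mult_left_mono)

lemma bdl_id: "bdl V 1 (\<lambda>x. x)" by (simp add: bdl_def linear_on_def)

lemma bdl_extend:
  fixes f :: "'a::real_normed_vector \<Rightarrow> 'c::banach"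
  assumes "subspace V" "bdl V C f"
  shows "\<exists>g. bdl (closure V) C g \<and> (\<forall>x\<in>V. g x = f x) \<and> (\<forall>x\<in>closure V. g x \<in> closure (f ` V))"
proof -
  have dist: "norm (f x - f y) \<le> C * norm (x - y)" if "x \<in> V" "y \<in> V" for x y
    using bdl_norm[OF assms(2), of "x - y"] bdl_diff[OF assms(2,1) that] subspace_diff[OF assms(1) that] by simp
  have lip: "C-lipschitz_on V f"
    by (rule lipschitz_onI) (use dist bdl_nonneg[OF assms(2)] in \<open>auto simp: dist_norm\<close>)
  obtain g where g: "uniformly_continuous_on (closure V) g" "\<And>x. x \<in> V \<Longrightarrow> f x = g x"
    using uniformly_continuous_on_extension_on_closure[OF lipschitz_on_uniformly_continuous[OF lip]] by metis
  have cont: "continuous_on (closure V) g" using g(1) by (rule uniformly_continuous_imp_continuous)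
  have lim: "(\<lambda>n. f (s n)) \<longlonglongrightarrow> g x" if "\<And>n. s n \<in> V" "s \<longlonglongrightarrow> x" for s x
  proof -
    have x: "x \<in> closure V" using that by (auto simp: closure_sequential)
    have "(\<lambda>n. g (s n)) \<longlonglongrightarrow> g x"
    proof (rule continuous_on_tendsto_compose[OF cont that(2) x])
      show "\<forall>\<^sub>F n in sequentially. s n \<in> closure V" using that(1) closure_subset by (intro always_eventually) blast
    qed
    thus ?thesis using g(2) that(1) by simp
  qed
  have "bdl (closure V) C g"
  proof (rule bdlI)
    fix x y assume "x \<in> closure V" "y \<in> closure V"
    then obtain s t where st: "\<And>n. s n \<in> V" "s \<longlonglongrightarrow> x" "\<And>n. t n \<in> V" "t \<longlonglongrightarrow> y" by (auto simp: closure_sequential)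
    have "(\<lambda>n. f (s n + t n)) \<longlonglongrightarrow> g (x + y)" using st assms(1) by (intro lim tendsto_add) (auto intro: subspace_add)
    moreover have "(\<lambda>n. f (s n + t n)) \<longlonglongrightarrow> g x + g y"
      using tendsto_add[OF lim[OF st(1,2)] lim[OF st(3,4)]] bdl_add[OF assms(2) st(1) st(3)] by simp
    ultimately show "g (x + y) = g x + g y" by (rule LIMSEQ_unique)
  next
    fix c x assume "x \<in> closure V"
    then obtain s where st: "\<And>n. s n \<in> V" "s \<longlonglongrightarrow> x" by (auto simp: closure_sequential)
    have "(\<lambda>n. f (c *\<^sub>R s n)) \<longlonglongrightarrow> g (c *\<^sub>R x)" using st assms(1) by (intro lim tendsto_scaleR) (auto intro: subspace_scale)
    moreover have "(\<lambda>n. f (c *\<^sub>R s n)) \<longlonglongrightarrow> c *\<^sub>R g x"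
      using tendsto_scaleR[OF tendsto_const lim[OF st]] bdl_scale[OF assms(2) st(1)] by simp
    ultimately show "g (c *\<^sub>R x) = c *\<^sub>R g x" by (rule LIMSEQ_unique)
  next
    fix x assume "x \<in> closure V"
    then obtain s where st: "\<And>n. s n \<in> V" "s \<longlonglongrightarrow> x" by (auto simp: closure_sequential)
    show "norm (g x) \<le> C * norm x"
      using tendsto_le[OF _ tendsto_mult[OF tendsto_const tendsto_norm[OF st(2)]] tendsto_norm[OF lim[OF st]]] bdl_norm[OF assms(2) st(1)] by simp
  qed (use bdl_nonneg[OF assms(2)] in simp)
  moreover have "g x \<in> closure (f ` V)" if "x \<in> closure V" for x
  proof -
    obtain s where st: "\<And>n. s n \<in> V" "s \<longlonglongrightarrow> x" using \<open>x \<in> closure V\<close> by (auto simp: closure_sequential)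
    have "(\<forall>n. f (s n) \<in> f ` V) \<and> (\<lambda>n. f (s n)) \<longlonglongrightarrow> g x" using lim[OF st] st(1) by blast
    thus ?thesis unfolding closure_sequential by (intro exI[of _ "\<lambda>n. f (s n)"])
  qed
  ultimately show ?thesis using g(2) by auto
qed

text \<open>A single block weighs at most as much as the whole of \<open>B I\<close>, whose total
  weight is \<open>wt I\<close>.\<close>

lemma lev_le_of_mem:
  assumes "faithful B \<Theta>" "I \<ge> 1" "K \<in> B I" shows "lev I \<le> lev K"
proof -
  have "wt K \<le> sum wt (B I)" by (rule member_le_sum) (use assms B_finite in auto)
  hence "wt K \<le> wt I" using B_wt[OF assms(1,2)] by simp
  hence "(2::real) ^ lev I \<le> 2 ^ lev K" by (simp add: wt_def field_simps)
  thus ?thesis by simp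
qed

lemma deep_ex:
  assumes "faithful B \<Theta>" shows "\<exists>M\<ge>m. deep B n M"
proof -
  have "finite (\<Union>I\<in>nodes n. B I)" using B_finite[OF assms] by auto
  then obtain M where M: "\<And>K. K \<in> (\<Union>I\<in>nodes n. B I) \<Longrightarrow> lev K \<le> M"
    by (metis (no_types) finite_imageI finite_nat_set_iff_bounded_le image_eqI)
  have "deep B n (max m (Suc M))" unfolding deep_def[OF assms]
  proof (intro allI impI ballI)
    fix I K assume a: "1 \<le> I" "lev I < n" "K \<in> B I"
    hence "I \<in> nodes n" using node_iff by blast
    hence "lev K \<le> M" using M a by blast
    thus "lev K < max m (Suc M)" by simp
  qed
  thus ?thesis by (intro exI[of _ "max m (Suc M)"]) simp
qed

section \<open>Coefficients, restrictions, embeddings and multipliers\<close>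

context haar_basis
begin

sublocale haar_gauge nrm by (rule gauge)

definition lc :: "nat \<Rightarrow> (nat \<Rightarrow> real) \<Rightarrow> 'b" where "lc n a = (\<Sum>K\<in>nodes n. a K *\<^sub>R e K)"

lemma norm_lc: "norm (lc n a) = nrm n a" unfolding lc_def by (rule norm_e)

lemma nodes_mono: "n \<le> m \<Longrightarrow> nodes n \<subseteq> nodes m"
  by (auto intro: order.strict_trans2 power_increasing)

lemma sum_nodes_extend:
  fixes u :: "nat \<Rightarrow> 'c::real_vector"
  assumes "n \<le> m" shows "(\<Sum>K\<in>nodes n. a K *\<^sub>R u K) = (\<Sum>K\<in>nodes m. (if K \<in> nodes n then a K else 0) *\<^sub>R u K)"
  using nodes_mono[OF assms] by (intro sum.mono_neutral_cong_left) auto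

lemma lc_extend: "n \<le> m \<Longrightarrow> lc n a = lc m (\<lambda>K. if K \<in> nodes n then a K else 0)"
  unfolding lc_def by (rule sum_nodes_extend)

lemma subspace_span_e: "subspace (span (e ` {1..}))" by simp

lemma lc_span: "lc n a \<in> span (e ` {1..})"
  unfolding lc_def by (intro span_sum span_scale span_base) auto

lemma span_lc: "y \<in> span (e ` {1..}) \<Longrightarrow> \<exists>n a. y = lc n a"
proof (induction rule: span_induct_alt)
  case base
  show ?case by (intro exI[of _ 0]) (simp add: lc_def)
next
  case (step c x y)
  then obtain K n a where K: "K \<ge> 1" "x = e K" "y = lc n a" by auto
  define m where "m = max n (Suc (lev K))"
  have Km: "K \<in> nodes m" unfolding node_iff using K by (simp add: m_def)
  have "c *\<^sub>R x + y = (\<Sum>L\<in>nodes m. (if L = K then c else 0) *\<^sub>R e L) + lc m (\<lambda>K. if K \<in> nodes n then a K else 0)"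
    using K Km lc_extend[of n m a] by (simp add: m_def if_distrib[of "\<lambda>t. t *\<^sub>R _"] cong: if_cong)
  also have "\<dots> = lc m (\<lambda>L. (if L = K then c else 0) + (if L \<in> nodes n then a L else 0))"
    by (simp add: lc_def scaleR_add_left sum.distrib)
  finally show ?case by blast
qed

lemma subspace_Y: "subspace Y"
  unfolding subspace_def
proof (intro conjI ballI allI)
  let ?S = "span (e ` {1..})"
  show "0 \<in> Y" unfolding Y_def by (rule subsetD[OF closure_subset span_zero])
  fix x assume "x \<in> Y"
  then obtain s where s: "\<And>n. s n \<in> ?S" "s \<longlonglongrightarrow> x" by (auto simp: Y_def closure_sequential)
  have "(\<forall>n. c *\<^sub>R s n \<in> ?S) \<and> (\<lambda>n. c *\<^sub>R s n) \<longlonglongrightarrow> c *\<^sub>R x" for c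
    by (intro conjI allI span_scale tendsto_scaleR tendsto_const s)
  thus "c *\<^sub>R x \<in> Y" for c unfolding Y_def closure_sequential by (intro exI[of _ "\<lambda>n. c *\<^sub>R s n"]) simp
  fix y assume "y \<in> Y"
  then obtain t where t: "\<And>n. t n \<in> ?S" "t \<longlonglongrightarrow> y" by (auto simp: Y_def closure_sequential)
  have "(\<forall>n. s n + t n \<in> ?S) \<and> (\<lambda>n. s n + t n) \<longlonglongrightarrow> x + y"
    by (intro conjI allI span_add tendsto_add s t)
  thus "x + y \<in> Y" unfolding Y_def closure_sequential by (intro exI[of _ "\<lambda>n. s n + t n"]) simp
qed

lemma lc_Y: "lc n a \<in> Y" unfolding Y_def by (rule subsetD[OF closure_subset lc_span])

lemma e_Y: "K \<ge> 1 \<Longrightarrow> e K \<in> Y" unfolding Y_def by (intro subsetD[OF closure_subset] span_base) simp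

lemma closed_Y: "closed Y" by (simp add: Y_def)

lemma Y_approx: "y \<in> Y \<Longrightarrow> \<epsilon> > 0 \<Longrightarrow> \<exists>n a. norm (y - lc n a) < \<epsilon>"
  unfolding Y_def closure_approachable by (metis span_lc dist_commute dist_norm)

lemma Y_add: "x \<in> Y \<Longrightarrow> y \<in> Y \<Longrightarrow> x + y \<in> Y" and Y_scale: "x \<in> Y \<Longrightarrow> c *\<^sub>R x \<in> Y" and Y_0: "0 \<in> Y"
  and Y_diff: "x \<in> Y \<Longrightarrow> y \<in> Y \<Longrightarrow> x - y \<in> Y"
  by (rule subspace_add[OF subspace_Y] subspace_scale[OF subspace_Y] subspace_0[OF subspace_Y] subspace_diff[OF subspace_Y]; assumption)+

lemma bdl_lc:
  assumes "linear_on Y f"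
  shows "f (lc n a) = (\<Sum>K\<in>nodes n. a K *\<^sub>R f (e K))"
  unfolding lc_def using assms subspace_Y by (rule linear_on_sum) (use e_Y in auto)

text \<open>By density: the a priori bound \<open>D\<close>, however large, only multiplies the
  distance to a finite combination, so the constant \<open>C\<close> survives in the limit.\<close>

lemma bdl_le:
  assumes "bdl Y D f" "C \<ge> 0" "\<And>n a. norm (f (lc n a)) \<le> C * norm (lc n a)"
  shows "bdl Y C f"
proof (rule bdlI)
  fix y assume y: "y \<in> Y"
  show "norm (f y) \<le> C * norm y"
  proof (rule field_le_epsilon)
    fix \<epsilon> :: real assume \<epsilon>: "\<epsilon> > 0"
    have D: "D \<ge> 0" using bdl_nonneg[OF assms(1)] .
    define \<eta> where "\<eta> = \<epsilon> / (C + D + 1)"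
    have \<eta>: "\<eta> > 0" "(C + D) * \<eta> \<le> \<epsilon>" using \<epsilon> D assms(2) by (auto simp: \<eta>_def field_simps)
    obtain n a where x: "norm (y - lc n a) < \<eta>" using Y_approx[OF y \<eta>(1)] by blast
    have "norm (f y) \<le> norm (f (y - lc n a)) + norm (f (lc n a))"
      using bdl_diff[OF assms(1) subspace_Y y lc_Y] norm_triangle_sub[of "f y" "f (lc n a)"] by (simp add: add.commute)
    also have "\<dots> \<le> D * norm (y - lc n a) + C * norm (lc n a)"
      using bdl_norm[OF assms(1) Y_diff[OF y lc_Y]] assms(3) by (intro add_mono) auto
    also have "norm (lc n a) \<le> norm y + norm (y - lc n a)" using norm_triangle_ineq4[of y "y - lc n a"] by simp
    hence "D * norm (y - lc n a) + C * norm (lc n a) \<le> D * norm (y - lc n a) + C * (norm y + norm (y - lc n a))"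
      using assms(2) by (intro add_left_mono mult_left_mono) auto
    also have "\<dots> = C * norm y + (C + D) * norm (y - lc n a)" by (simp add: algebra_simps)
    also have "\<dots> \<le> C * norm y + (C + D) * \<eta>" using x D assms(2) by (intro add_left_mono mult_left_mono) auto
    finally show "norm (f y) \<le> C * norm y + \<epsilon>" using \<eta>(2) by simp
  qed
qed (use bdl_add[OF assms(1)] bdl_scale[OF assms(1)] assms(2) in auto)

lemma bdl_eq:
  assumes "bdl Y C f" "bdl Y D g" "\<And>K. K \<ge> 1 \<Longrightarrow> f (e K) = g (e K)" "y \<in> Y"
  shows "f y = g y"
proof -
  note 1 = bdl_minus[OF assms(1,2)]
  have "f (lc n a) = g (lc n a)" for n a
    unfolding bdl_lc[OF bdl_linear[OF assms(1)]] bdl_lc[OF bdl_linear[OF assms(2)]] using assms(3) by (intro sum.cong) auto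
  hence "bdl Y 0 (\<lambda>y. f y - g y)" by (intro bdl_le[OF 1]) auto
  from bdl_norm[OF this assms(4)] show ?thesis by simp
qed

text \<open>All operators below are defined by prescribing images of the Haar vectors. The estimate
  on finite combinations also gives well-definedness: two representations of one vector differ by a
  combination of norm 0.\<close>

lemma ext_exists:
  fixes u :: "nat \<Rightarrow> 'c::banach"
  assumes "C \<ge> 0" "\<And>n a. norm (\<Sum>K\<in>nodes n. a K *\<^sub>R u K) \<le> C * norm (lc n a)"
  shows "\<exists>U. bdl Y C U \<and> (\<forall>K\<ge>1. U (e K) = u K) \<and> (\<forall>y\<in>Y. U y \<in> closure (span (u ` {1..})))"
proof -
  let ?S = "span (e ` {1..})"
  define uc where "uc n a = (\<Sum>K\<in>nodes n. a K *\<^sub>R u K)" for n a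
  have wd: "uc n a = uc m b" if "lc n a = lc m b" for n m a b
  proof -
    define M where "M = max n m"
    define a' b' where "a' K = (if K \<in> nodes n then a K else 0)" and "b' K = (if K \<in> nodes m then b K else 0)" for K
    have l: "lc n a = lc M a'" "lc m b = lc M b'" unfolding a'_def b'_def by (rule lc_extend, simp add: M_def)+
    have v: "uc n a = uc M a'" "uc m b = uc M b'" unfolding a'_def b'_def uc_def by (rule sum_nodes_extend, simp add: M_def)+
    have "uc M a' - uc M b' = uc M (\<lambda>K. a' K - b' K)" by (simp add: uc_def scaleR_diff_left sum_subtractf)
    moreover have "lc M (\<lambda>K. a' K - b' K) = lc M a' - lc M b'" by (simp add: lc_def scaleR_diff_left sum_subtractf)
    ultimately have "norm (uc M a' - uc M b') \<le> 0" using assms(2)[of "\<lambda>K. a' K - b' K" M] that l by (simp add: uc_def)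
    thus ?thesis using v by simp
  qed
  define U0 where "U0 y = (SOME z. \<exists>n a. y = lc n a \<and> z = uc n a)" for y
  have U0: "U0 (lc n a) = uc n a" for n a
    unfolding U0_def
  proof (rule someI2_ex)
    fix z assume "\<exists>m b. lc n a = lc m b \<and> z = uc m b"
    then obtain m b where "lc n a = lc m b" "z = uc m b" by blast
    thus "z = uc n a" using wd[of n a m b] by simp
  qed blast
  have b: "bdl ?S C U0"
  proof (rule bdlI)
    fix x y assume "x \<in> ?S" "y \<in> ?S"
    then obtain n a m b where xy: "x = lc n a" "y = lc m b" using span_lc by metis
    define M where "M = max n m"
    define a' b' where "a' K = (if K \<in> nodes n then a K else 0)" and "b' K = (if K \<in> nodes m then b K else 0)" for K
    have l: "lc n a = lc M a'" "lc m b = lc M b'" unfolding a'_def b'_def by (rule lc_extend, simp add: M_def)+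
    have "x + y = lc M (\<lambda>K. a' K + b' K)" unfolding xy l by (simp add: lc_def scaleR_add_left sum.distrib)
    thus "U0 (x + y) = U0 x + U0 y" unfolding xy l by (simp add: U0) (simp add: uc_def scaleR_add_left sum.distrib)
  next
    fix c x assume "x \<in> ?S"
    then obtain n a where x: "x = lc n a" using span_lc by metis
    have "c *\<^sub>R x = lc n (\<lambda>K. c * a K)" by (simp add: x lc_def scaleR_sum_right)
    thus "U0 (c *\<^sub>R x) = c *\<^sub>R U0 x" by (simp add: U0 x) (simp add: uc_def scaleR_sum_right)
  next
    fix x assume "x \<in> ?S"
    then obtain n a where x: "x = lc n a" using span_lc by metis
    thus "norm (U0 x) \<le> C * norm x" using assms(2) by (simp add: U0 uc_def)
  qed (use assms in auto)
  obtain U where U: "bdl Y C U" "\<And>x. x \<in> ?S \<Longrightarrow> U x = U0 x" "\<And>x. x \<in> Y \<Longrightarrow> U x \<in> closure (U0 ` ?S)"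
    using bdl_extend[OF subspace_span_e b] unfolding Y_def by blast
  have e1: "U (e K) = u K" if K: "K \<ge> 1" for K
  proof -
    have Kn: "K \<in> nodes (Suc (lev K))" unfolding node_iff using K by simp
    have "e K = lc (Suc (lev K)) (\<lambda>L. if L = K then 1 else 0)"
      using Kn by (simp add: lc_def if_distrib[of "\<lambda>t. t *\<^sub>R _"] cong: if_cong)
    hence "U (e K) = uc (Suc (lev K)) (\<lambda>L. if L = K then 1 else 0)" using U(2) U0 lc_span by metis
    thus ?thesis using Kn by (simp add: uc_def if_distrib[of "\<lambda>t. t *\<^sub>R _"] cong: if_cong)
  qed
  have "U0 ` ?S \<subseteq> span (u ` {1..})"
  proof
    fix z assume "z \<in> U0 ` ?S"
    then obtain y where y: "y \<in> ?S" "z = U0 y" by blast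
    then obtain n a where "y = lc n a" using span_lc by blast
    hence "z = uc n a" using y U0 by simp
    moreover have "uc n a \<in> span (u ` {1..})" unfolding uc_def by (intro span_sum span_scale span_base) auto
    ultimately show "z \<in> span (u ` {1..})" by simp
  qed
  hence "closure (U0 ` ?S) \<subseteq> closure (span (u ` {1..}))" by (rule closure_mono)
  thus ?thesis using U e1 by blast
qed

lemma ext_Y:
  assumes "C \<ge> 0" "\<And>n a. norm (\<Sum>K\<in>nodes n. a K *\<^sub>R u K) \<le> C * norm (lc n a)" "\<And>K. K \<ge> 1 \<Longrightarrow> u K \<in> Y"
  shows "\<exists>U. bdl Y C U \<and> (\<forall>K\<ge>1. U (e K) = u K) \<and> (\<forall>y\<in>Y. U y \<in> Y)"
proof -
  have "span (u ` {1..}) \<subseteq> Y" using assms(3) by (intro span_minimal subspace_Y) auto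
  hence "closure (span (u ` {1..})) \<subseteq> Y" by (rule closure_minimal[OF _ closed_Y])
  thus ?thesis using ext_exists[of C u, OF assms(1,2)] by blast
qed

lemma coeff_le: "K \<in> nodes n \<Longrightarrow> wt K * \<bar>a K\<bar> \<le> norm (lc n a)"
proof -
  assume K: "K \<in> nodes n"
  have l: "K \<in> level (lev K)" "lev K < n" using K node_iff by (auto simp: level_iff)
  have "wt K * \<bar>a K\<bar> \<le> (\<Sum>L\<in>level (lev K). wt L * \<bar>a L\<bar>)"
    by (rule member_le_sum[OF l(1)]) auto
  also have "\<dots> \<le> norm (lc n a)" unfolding norm_lc by (rule gauge_level[OF l(2)])
  finally show ?thesis .
qed

text \<open>The biorthogonal functional with a bound read off from the gauge. On the completed space
  it agrees with the functional \<open>haar_functional\<close> of the theorem, by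
  uniqueness.\<close>

definition cf :: "nat \<Rightarrow> 'b \<Rightarrow> real" where
  "cf K = (SOME f. bdl Y (1 / wt K) f \<and> (\<forall>L\<ge>1. f (e L) = (if L = K then 1 else 0)))"

lemma cf: "bdl Y (1 / wt K) (cf K)" and cf_e: "L \<ge> 1 \<Longrightarrow> cf K (e L) = (if L = K then 1 else 0)"
proof -
  have "\<exists>U. bdl Y (1 / wt K) U \<and> (\<forall>L\<ge>1. U (e L) = (if L = K then 1 else (0::real))) \<and> (\<forall>y\<in>Y. U y \<in> closure (span ((\<lambda>L. if L = K then 1 else (0::real)) ` {1..})))"
  proof (rule ext_exists)
    fix n and a :: "nat \<Rightarrow> real"
    have "norm (\<Sum>L\<in>nodes n. a L *\<^sub>R (if L = K then 1 else (0::real))) = (if K \<in> nodes n then \<bar>a K\<bar> else 0)"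
      by (simp add: if_distrib[of "\<lambda>t. _ * t"] cong: if_cong)
    also have "\<dots> \<le> 1 / wt K * norm (lc n a)"
      using coeff_le[of K n a] by (simp add: pos_le_divide_eq mult.commute)
    finally show "norm (\<Sum>L\<in>nodes n. a L *\<^sub>R (if L = K then 1 else (0::real))) \<le> 1 / wt K * norm (lc n a)" .
  qed simp
  hence "\<exists>f. bdl Y (1 / wt K) f \<and> (\<forall>L\<ge>1. f (e L) = (if L = K then 1 else (0::real)))" by blast
  from someI_ex[OF this, folded cf_def]
  show "bdl Y (1 / wt K) (cf K)" "L \<ge> 1 \<Longrightarrow> cf K (e L) = (if L = K then 1 else 0)" by auto
qed

lemma cf_lc: "cf K (lc n a) = (if K \<in> nodes n then a K else 0)"
proof -
  have "cf K (lc n a) = (\<Sum>L\<in>nodes n. if L = K then a K else 0)"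
    unfolding bdl_lc[OF bdl_linear[OF cf]] using cf_e by (intro sum.cong) auto
  thus ?thesis by simp
qed

lemma cf_le: "y \<in> Y \<Longrightarrow> \<bar>cf K y\<bar> \<le> norm y / wt K"
  using bdl_norm[OF cf, of y K] by simp

lemma cf_level: "y \<in> Y \<Longrightarrow> (\<Sum>K\<in>level l. wt K * \<bar>cf K y\<bar>) \<le> norm y"
proof (rule field_le_epsilon)
  fix \<epsilon> :: real assume y: "y \<in> Y" and \<epsilon>: "\<epsilon> > 0"
  \<comment> \<open>The approximation error enters once for each of the \<open>2 ^ l\<close>
    intervals of the level and once for the norm of the approximating combination.\<close>
  define \<eta> where "\<eta> = \<epsilon> / (1 + 2 ^ l)"
  have p: "0 < 1 + (2::real) ^ l" by (rule add_pos_pos) auto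
  hence \<eta>: "\<eta> > 0" "(1 + 2 ^ l) * \<eta> = \<epsilon>" using \<epsilon> by (auto simp: \<eta>_def)
  obtain n a where x: "norm (y - lc n a) < \<eta>" using Y_approx[OF y \<eta>(1)] by blast
  define m where "m = max n (Suc l)"
  define b where "b K = (if K \<in> nodes n then a K else 0)" for K
  have lx: "lc n a = lc m b" unfolding b_def by (rule lc_extend) (simp add: m_def)
  have "wt K * \<bar>cf K y\<bar> \<le> norm (y - lc m b) + wt K * \<bar>b K\<bar>" if K: "K \<in> level l" for K
  proof -
    have "K \<in> nodes m" unfolding node_iff using K by (simp add: level_iff m_def)
    hence "cf K y = cf K (y - lc m b) + b K" using bdl_diff[OF cf subspace_Y y lc_Y, of K m b] cf_lc[of K m b] by simp
    hence "wt K * \<bar>cf K y\<bar> \<le> wt K * \<bar>cf K (y - lc m b)\<bar> + wt K * \<bar>b K\<bar>"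
      by (metis abs_triangle_ineq distrib_left mult_left_mono wt_nonneg)
    moreover have "wt K * \<bar>cf K (y - lc m b)\<bar> \<le> norm (y - lc m b)"
      using cf_le[OF Y_diff[OF y lc_Y], of K m b] by (simp add: pos_le_divide_eq mult.commute)
    ultimately show ?thesis by linarith
  qed
  hence "(\<Sum>K\<in>level l. wt K * \<bar>cf K y\<bar>) \<le> (\<Sum>K\<in>level l. norm (y - lc m b) + wt K * \<bar>b K\<bar>)" by (rule sum_mono)
  also have "\<dots> = 2 ^ l * norm (y - lc m b) + (\<Sum>K\<in>level l. wt K * \<bar>b K\<bar>)" by (simp add: sum.distrib)
  also have "(\<Sum>K\<in>level l. wt K * \<bar>b K\<bar>) \<le> norm (lc m b)" unfolding norm_lc by (rule gauge_level) (simp add: m_def)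
  also have "norm (lc m b) \<le> norm y + norm (y - lc m b)" using norm_triangle_ineq4[of y "y - lc m b"] by simp
  finally have "(\<Sum>K\<in>level l. wt K * \<bar>cf K y\<bar>) \<le> norm y + (1 + 2 ^ l) * norm (y - lc m b)" by (simp add: algebra_simps)
  also have "(1 + 2 ^ l) * norm (y - lc m b) \<le> (1 + 2 ^ l) * \<eta>" using x lx p by (intro mult_left_mono) auto
  finally show "(\<Sum>K\<in>level l. wt K * \<bar>cf K y\<bar>) \<le> norm y + \<epsilon>" using \<eta>(2) by simp
qed

lemma norm_sum_level:
  assumes "\<And>K. \<bar>c K\<bar> \<le> 1" shows "norm (\<Sum>K\<in>level l. c K *\<^sub>R e K) \<le> 1"
proof -
  have sub: "level l \<subseteq> nodes (Suc l)" using node_iff by (auto simp: level_def)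
  have "(\<Sum>K\<in>level l. c K *\<^sub>R e K) = lc (Suc l) (\<lambda>K. if K \<in> level l then c K else 0)"
    unfolding lc_def using sub by (intro sum.mono_neutral_cong_left) auto
  thus ?thesis unfolding norm_lc using gauge_bounded[of l "Suc l" c] assms by (simp add: norm_lc)
qed

lemma e_eq_lc: "K \<ge> 1 \<Longrightarrow> lev K < n \<Longrightarrow> e K = lc n (\<lambda>L. if L = K then 1 else 0)"
proof -
  assume "K \<ge> 1" "lev K < n"
  hence "K \<in> nodes n" using node_iff by blast
  thus ?thesis by (simp add: lc_def if_distrib[of "\<lambda>t. t *\<^sub>R _"] cong: if_cong)
qed

lemma norm_e_le: "K \<ge> 1 \<Longrightarrow> norm (e K) \<le> 1"
proof -
  assume K: "K \<ge> 1"
  have l: "K \<in> level (lev K)" using K by (simp add: level_iff)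
  have "(\<Sum>L\<in>level (lev K). (if L = K then 1 else 0) *\<^sub>R e L) = e K" using l by (simp add: if_distrib[of "\<lambda>t. t *\<^sub>R _"] cong: if_cong)
  thus ?thesis using norm_sum_level[of "\<lambda>L. if L = K then 1 else 0" "lev K"] by simp
qed

lemma norm_e_level: "K \<ge> 1 \<Longrightarrow> L \<ge> 1 \<Longrightarrow> lev K = lev L \<Longrightarrow> norm (e K) = norm (e L)"
  using e_eq_lc[of K "Suc (lev K)"] e_eq_lc[of L "Suc (lev K)"] gauge_unit[of "lev K" "Suc (lev K)" K L]
  by (simp add: norm_lc level_iff)

lemma norm_e_ge: "K \<ge> 1 \<Longrightarrow> wt K \<le> norm (e K)"
  using coeff_le[of K "Suc (lev K)" "\<lambda>L. if L = K then 1 else 0"] e_eq_lc[of K "Suc (lev K)"] node_iff[of K "Suc (lev K)"] by simp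

lemma norm_e_pos: "K \<ge> 1 \<Longrightarrow> norm (e K) > 0"
  using norm_e_ge[of K] wt_pos[of K] by linarith

definition res :: "nat set \<Rightarrow> 'b \<Rightarrow> 'b" where
  "res S = (SOME U. bdl Y 2 U \<and> (\<forall>K\<ge>1. U (e K) = (if \<exists>L\<in>S. under K L then e K else 0)) \<and> (\<forall>y\<in>Y. U y \<in> Y))"

lemma res:
  assumes "S \<subseteq> level m"
  shows "bdl Y 2 (res S)" "K \<ge> 1 \<Longrightarrow> res S (e K) = (if \<exists>L\<in>S. under K L then e K else 0)" "y \<in> Y \<Longrightarrow> res S y \<in> Y"
proof -
  have "\<exists>U. bdl Y 2 U \<and> (\<forall>K\<ge>1. U (e K) = (if \<exists>L\<in>S. under K L then e K else 0)) \<and> (\<forall>y\<in>Y. U y \<in> Y)"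
  proof (rule ext_Y)
    fix n and a :: "nat \<Rightarrow> real"
    have "(\<Sum>K\<in>nodes n. a K *\<^sub>R (if \<exists>L\<in>S. under K L then e K else 0)) = lc n (\<lambda>K. if \<exists>L\<in>S. under K L then a K else 0)"
      unfolding lc_def by (intro sum.cong) auto
    thus "norm (\<Sum>K\<in>nodes n. a K *\<^sub>R (if \<exists>L\<in>S. under K L then e K else 0)) \<le> 2 * norm (lc n a)"
      using gauge_restrict[OF assms, of n a] by (simp add: norm_lc)
  qed (use e_Y Y_0 in auto)
  from someI_ex[OF this, folded res_def]
  show "bdl Y 2 (res S)" "K \<ge> 1 \<Longrightarrow> res S (e K) = (if \<exists>L\<in>S. under K L then e K else 0)" "y \<in> Y \<Longrightarrow> res S y \<in> Y" by auto
qed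

lemma res_lc: "S \<subseteq> level m \<Longrightarrow> res S (lc n a) = lc n (\<lambda>K. if \<exists>L\<in>S. under K L then a K else 0)"
  unfolding bdl_lc[OF bdl_linear[OF res(1)]] unfolding lc_def using res(2) by (intro sum.cong) auto

lemma level_res: "K \<ge> 1 \<Longrightarrow> (\<exists>L\<in>level m. under K L) \<longleftrightarrow> m \<le> lev K"
proof
  assume K: "K \<ge> 1" "\<exists>L\<in>level m. under K L"
  thus "m \<le> lev K" using under_lev by (auto simp: level_iff)
next
  assume K: "K \<ge> 1" "m \<le> lev K"
  have Kl: "K \<in> level (lev K)" using K by (simp add: level_iff)
  show "\<exists>L\<in>level m. under K L" using anc_level[OF Kl K(2)] anc_iff[OF Kl _ K(2)] by blast
qed

text \<open>Restriction to the indices under \<open>level m\<close> is the tail projection. Its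
  bound 2 does not depend on \<open>m\<close>, and it kills each fixed finite combination for late
  \<open>m\<close>.\<close>

lemma tail_res:
  assumes "y \<in> Y" shows "(\<lambda>m. res (level m) y) \<longlonglongrightarrow> 0" and "y - res (level m) y = lc m (\<lambda>K. cf K y)"
proof -
  show "(\<lambda>m. res (level m) y) \<longlonglongrightarrow> 0"
  proof (rule LIMSEQ_I)
    fix r :: real assume r: "r > 0"
    obtain n a where x: "norm (y - lc n a) < r / 2" using Y_approx[OF assms, of "r / 2"] r by auto
    show "\<exists>no. \<forall>m\<ge>no. norm (res (level m) y - 0) < r"
    proof (intro exI[of _ n] allI impI)
      fix m assume m: "m \<ge> n"
      have "res (level m) (lc n a) = (\<Sum>K\<in>nodes n. 0)"
        unfolding res_lc[OF subset_refl] unfolding lc_def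
      proof (intro sum.cong refl)
        fix K assume K: "K \<in> nodes n"
        hence "K \<ge> 1" "lev K < n" using node_iff by auto
        hence "\<not> (\<exists>L\<in>level m. under K L)" using level_res[of K m] m by simp
        thus "(if \<exists>L\<in>level m. under K L then a K else 0) *\<^sub>R e K = 0" by simp
      qed
      hence "res (level m) y = res (level m) (y - lc n a)"
        using bdl_diff[OF res(1)[OF subset_refl] subspace_Y assms lc_Y, of m n a] by simp
      hence "norm (res (level m) y) \<le> 2 * norm (y - lc n a)"
        using bdl_norm[OF res(1)[OF subset_refl] Y_diff[OF assms lc_Y]] by simp
      thus "norm (res (level m) y - 0) < r" using x by simp
    qed
  qed
  note 1 = bdl_minus[OF bdl_id res(1)[OF subset_refl]]
  have 2: "bdl Y (\<Sum>K\<in>nodes m. 1 / wt K) (\<lambda>y. lc m (\<lambda>K. cf K y))"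
  proof (rule bdlI)
    fix x assume x: "x \<in> Y"
    have "norm (lc m (\<lambda>K. cf K x)) \<le> (\<Sum>K\<in>nodes m. norm (cf K x *\<^sub>R e K))" unfolding lc_def by (rule norm_sum)
    also have "\<dots> \<le> (\<Sum>K\<in>nodes m. norm x / wt K)"
    proof (rule sum_mono)
      fix K assume "K \<in> nodes m"
      hence "norm (e K) \<le> 1" using norm_e_le by simp
      hence "\<bar>cf K x\<bar> * norm (e K) \<le> \<bar>cf K x\<bar> * 1" by (intro mult_left_mono) auto
      thus "norm (cf K x *\<^sub>R e K) \<le> norm x / wt K" using cf_le[OF x, of K] by simp
    qed
    finally show "norm (lc m (\<lambda>K. cf K x)) \<le> (\<Sum>K\<in>nodes m. 1 / wt K) * norm x" by (simp add: sum_distrib_right)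
  qed (use bdl_add[OF cf] bdl_scale[OF cf] in \<open>auto simp: lc_def scaleR_add_left sum.distrib scaleR_sum_right intro!: sum_nonneg\<close>)
  show "y - res (level m) y = lc m (\<lambda>K. cf K y)"
  proof (rule bdl_eq[OF 1 2 _ assms])
    fix L :: nat assume L: "L \<ge> 1"
    have "lc m (\<lambda>K. cf K (e L)) = (\<Sum>K\<in>nodes m. if K = L then e L else 0)"
      unfolding lc_def using cf_e[OF L] by (intro sum.cong) auto
    thus "e L - res (level m) (e L) = lc m (\<lambda>K. cf K (e L))"
      using res(2)[OF subset_refl L] level_res[OF L, of m] node_iff[of L m] L by auto
  qed
qed

lemma norm_le_coeffs:
  assumes "y \<in> Y" "\<And>m. (\<Sum>K\<in>nodes m. \<bar>cf K y\<bar>) \<le> s"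
  shows "norm y \<le> s"
proof -
  have b: "norm (lc m (\<lambda>K. cf K y)) \<le> s" for m
  proof -
    have "norm (lc m (\<lambda>K. cf K y)) \<le> (\<Sum>K\<in>nodes m. norm (cf K y *\<^sub>R e K))" unfolding lc_def by (rule norm_sum)
    also have "\<dots> \<le> (\<Sum>K\<in>nodes m. \<bar>cf K y\<bar>)"
    proof (rule sum_mono)
      fix K assume "K \<in> nodes m"
      hence "norm (e K) \<le> 1" using norm_e_le by simp
      hence "\<bar>cf K y\<bar> * norm (e K) \<le> \<bar>cf K y\<bar> * 1" by (intro mult_left_mono) auto
      thus "norm (cf K y *\<^sub>R e K) \<le> \<bar>cf K y\<bar>" by simp
    qed
    finally show ?thesis using assms(2)[of m] by simp
  qed
  have "(\<lambda>m. y - res (level m) y) \<longlonglongrightarrow> y - 0" by (intro tendsto_diff tendsto_const tail_res(1)[OF assms(1)])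
  hence "(\<lambda>m. lc m (\<lambda>K. cf K y)) \<longlonglongrightarrow> y" using tail_res(2)[OF assms(1)] by simp
  thus ?thesis by (rule LIMSEQ_le_const2[OF tendsto_norm]) (use b in auto)
qed

text \<open>The projection onto the line of \<open>e K\<close> is the restriction to
  \<open>{K}\<close> minus the restriction to the two halves of \<open>K\<close>. Each has norm at
  most 2, which gives 4.\<close>

lemma cf_norm_e: "K \<ge> 1 \<Longrightarrow> y \<in> Y \<Longrightarrow> \<bar>cf K y\<bar> * norm (e K) \<le> 4 * norm y"
proof -
  assume K: "K \<ge> 1" and y: "y \<in> Y"
  have S: "{K} \<subseteq> level (lev K)" "{2 * K, Suc (2 * K)} \<subseteq> level (Suc (lev K))" using K by (auto simp: level_iff)
  note 1 = bdl_minus[OF res(1)[OF S(1)] res(1)[OF S(2)]]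
  have 2: "bdl Y (1 / wt K) (\<lambda>y. cf K y *\<^sub>R e K)"
  proof (rule bdlI)
    fix x assume x: "x \<in> Y"
    have "\<bar>cf K x\<bar> * norm (e K) \<le> \<bar>cf K x\<bar> * 1" using norm_e_le[OF K] by (intro mult_left_mono) auto
    thus "norm (cf K x *\<^sub>R e K) \<le> 1 / wt K * norm x" using cf_le[OF x, of K] by simp
  qed (use bdl_add[OF cf] bdl_scale[OF cf] in \<open>auto simp: scaleR_add_left\<close>)
  have "res {K} y - res {2 * K, Suc (2 * K)} y = cf K y *\<^sub>R e K"
  proof (rule bdl_eq[OF 1 2 _ y])
    fix L :: nat assume L: "L \<ge> 1"
    have "under L K \<longleftrightarrow> L = K \<or> under L (2 * K) \<or> under L (Suc (2 * K))"
      using under_lev_eq[of L K] under_cases[of L K] under_childD(1)[OF K, of L] under_lev[of L K] K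
      by (metis le_neq_implies_less under_refl)
    moreover have "\<not> under K (2 * K)" "\<not> under K (Suc (2 * K))" using under_le[of K "2 * K"] under_le[of K "Suc (2 * K)"] K by auto
    ultimately show "res {K} (e L) - res {2 * K, Suc (2 * K)} (e L) = cf K (e L) *\<^sub>R e K"
      using res(2)[OF S(1) L] res(2)[OF S(2) L] cf_e[OF L, of K] by auto
  qed
  thus ?thesis using bdl_norm[OF 1 y] by simp
qed

lemma emb_bound:
  assumes "faithful B \<Theta>"
  shows "norm (\<Sum>I\<in>nodes n. a I *\<^sub>R (\<Sum>K\<in>B I. sg (\<Theta> I) K *\<^sub>R e K)) \<le> 1 * norm (lc n a)"
proof -
  obtain M where M: "deep B n M" using deep_ex[OF assms] by blast
  have "(\<Sum>I\<in>nodes n. a I *\<^sub>R (\<Sum>K\<in>B I. sg (\<Theta> I) K *\<^sub>R e K)) = (\<Sum>I\<in>nodes n. \<Sum>K\<in>nodes M. (if K \<in> B I then sg (\<Theta> I) K * a I else 0) *\<^sub>R e K)"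
  proof (intro sum.cong refl)
    fix I assume I: "I \<in> nodes n"
    have "a I *\<^sub>R (\<Sum>K\<in>B I. sg (\<Theta> I) K *\<^sub>R e K) = (\<Sum>K\<in>B I. (sg (\<Theta> I) K * a I) *\<^sub>R e K)"
      by (simp add: scaleR_sum_right mult.commute)
    also have "\<dots> = (\<Sum>K\<in>nodes M. (if K \<in> B I then sg (\<Theta> I) K * a I else 0) *\<^sub>R e K)"
      using B_nodes[OF assms M I] by (intro sum.mono_neutral_cong_left) auto
    finally show "a I *\<^sub>R (\<Sum>K\<in>B I. sg (\<Theta> I) K *\<^sub>R e K) = (\<Sum>K\<in>nodes M. (if K \<in> B I then sg (\<Theta> I) K * a I else 0) *\<^sub>R e K)" .
  qed
  also have "\<dots> = lc M (\<lambda>K. \<Sum>I\<in>nodes n. if K \<in> B I then sg (\<Theta> I) K * a I else 0)"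
    unfolding lc_def scaleR_sum_left by (rule sum.swap)
  finally show ?thesis using gauge_faithful[OF assms M, of a] by (simp add: norm_lc)
qed

lemma emb_exists:
  assumes "faithful B \<Theta>"
  shows "\<exists>U. bdl Y 1 U \<and> (\<forall>I\<ge>1. U (e I) = (\<Sum>K\<in>B I. sg (\<Theta> I) K *\<^sub>R e K)) \<and> (\<forall>y\<in>Y. U y \<in> Y) \<and>
    (\<forall>y\<in>Y. U y \<in> closure (span ((\<lambda>I. \<Sum>K\<in>B I. sg (\<Theta> I) K *\<^sub>R e K) ` {1..})))"
proof -
  let ?b = "\<lambda>I. \<Sum>K\<in>B I. sg (\<Theta> I) K *\<^sub>R e K"
  have "?b I \<in> Y" if "I \<ge> 1" for I
    using that B_pos[OF assms] e_Y subspace_Y by (intro subspace_sum subspace_scale) auto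
  hence "span (?b ` {1..}) \<subseteq> Y" by (intro span_minimal subspace_Y) auto
  hence "closure (span (?b ` {1..})) \<subseteq> Y" by (rule closure_minimal[OF _ closed_Y])
  thus ?thesis using ext_exists[of 1 ?b, OF zero_le_one emb_bound[OF assms]] by blast
qed

lemma adj_exists:
  assumes "faithful B \<Theta>"
  shows "\<exists>U. bdl Y 1 U \<and> (\<forall>I y. I \<ge> 1 \<longrightarrow> y \<in> Y \<longrightarrow> cf I (U y) = (\<Sum>K\<in>B I. sg (\<Theta> I) K * wt K / wt I * cf K y)) \<and> (\<forall>y\<in>Y. U y \<in> Y)"
proof -
  define c where "c I K = (if K \<in> B I then sg (\<Theta> I) K * wt K / wt I else 0)" for I K
  \<comment> \<open>Only indices \<open>I\<close> with \<open>lev I \<le> lev K\<close> can have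
    \<open>K\<close> in \<open>B I\<close>, so cutting off at \<open>Suc (lev K)\<close> loses
    nothing.\<close>
  define u where "u K = lc (Suc (lev K)) (\<lambda>I. c I K)" for K
  have u: "u K = (\<Sum>I\<in>nodes n. c I K *\<^sub>R e I)" if "K \<in> nodes n" for n K
  proof -
    have K: "lev K < n" using that node_iff by blast
    show ?thesis unfolding u_def lc_def
    proof (rule sum.mono_neutral_left)
      show "nodes (Suc (lev K)) \<subseteq> nodes n" using K by (intro nodes_mono) simp
      show "\<forall>i\<in>nodes n - nodes (Suc (lev K)). c i K *\<^sub>R e i = 0"
      proof
        fix I assume I: "I \<in> nodes n - nodes (Suc (lev K))"
        hence I1: "I \<ge> 1" using node_iff[of I n] by blast
        hence "\<not> lev I < Suc (lev K)" using I node_iff[of I "Suc (lev K)"] by blast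
        hence "K \<notin> B I" using lev_le_of_mem[OF assms I1, of K] by auto
        thus "c I K *\<^sub>R e I = 0" by (simp add: c_def)
      qed
    qed simp
  qed
  have "\<exists>U. bdl Y 1 U \<and> (\<forall>K\<ge>1. U (e K) = u K) \<and> (\<forall>y\<in>Y. U y \<in> Y)"
  proof (rule ext_Y)
    fix n and a :: "nat \<Rightarrow> real"
    define a' where "a' K = (if K \<in> nodes n then a K else 0)" for K
    obtain M where M: "deep B n M" "n \<le> M" using deep_ex[OF assms] by blast
    have cI: "(\<Sum>K\<in>nodes n. a K * c I K) = (\<Sum>K\<in>B I. sg (\<Theta> I) K * wt K / wt I * a' K)" if I: "I \<in> nodes n" for I
    proof -
      have fin: "finite (B I)" using B_finite[OF assms] I by simp
      have "(\<Sum>K\<in>nodes n. a K * c I K) = (\<Sum>K\<in>nodes n \<inter> B I. sg (\<Theta> I) K * wt K / wt I * a' K)"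
        by (rule sum.mono_neutral_cong_right) (auto simp: c_def a'_def)
      also have "\<dots> = (\<Sum>K\<in>B I. sg (\<Theta> I) K * wt K / wt I * a' K)"
        using fin by (intro sum.mono_neutral_left) (auto simp: a'_def)
      finally show ?thesis .
    qed
    have "(\<Sum>K\<in>nodes n. a K *\<^sub>R u K) = (\<Sum>K\<in>nodes n. \<Sum>I\<in>nodes n. (a K * c I K) *\<^sub>R e I)"
      using u by (intro sum.cong) (auto simp: scaleR_sum_right)
    also have "\<dots> = (\<Sum>I\<in>nodes n. (\<Sum>K\<in>nodes n. a K * c I K) *\<^sub>R e I)"
      unfolding scaleR_sum_left by (rule sum.swap)
    also have "\<dots> = lc n (\<lambda>I. \<Sum>K\<in>B I. sg (\<Theta> I) K * wt K / wt I * a' K)"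
      unfolding lc_def by (intro sum.cong refl) (simp only: cI)
    finally have "norm (\<Sum>K\<in>nodes n. a K *\<^sub>R u K) \<le> nrm M a'"
      using gauge_adjoint[OF assms M(1), of a'] by (simp add: norm_lc)
    also have "\<dots> = norm (lc n a)" unfolding norm_lc[symmetric] a'_def using lc_extend[OF M(2), of a] by simp
    finally show "norm (\<Sum>K\<in>nodes n. a K *\<^sub>R u K) \<le> 1 * norm (lc n a)" by simp
  qed (auto simp: u_def lc_Y)
  then obtain U where U: "bdl Y 1 U" "\<And>K. K \<ge> 1 \<Longrightarrow> U (e K) = u K" "\<And>y. y \<in> Y \<Longrightarrow> U y \<in> Y" by blast
  have "cf I (U y) = (\<Sum>K\<in>B I. sg (\<Theta> I) K * wt K / wt I * cf K y)" if I: "I \<ge> 1" and y: "y \<in> Y" for I y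
  proof (rule bdl_eq[OF _ _ _ y])
    show "bdl Y (1 / wt I * 1) (\<lambda>y. cf I (U y))" by (rule bdl_compose[OF U(1) cf U(3)])
    show "bdl Y (\<Sum>K\<in>B I. 1 / wt I) (\<lambda>y. \<Sum>K\<in>B I. sg (\<Theta> I) K * wt K / wt I * cf K y)"
    proof (rule bdlI)
      fix x assume x: "x \<in> Y"
      have "norm (\<Sum>K\<in>B I. sg (\<Theta> I) K * wt K / wt I * cf K x) \<le> (\<Sum>K\<in>B I. norm (sg (\<Theta> I) K * wt K / wt I * cf K x))" by (rule norm_sum)
      also have "\<dots> \<le> (\<Sum>K\<in>B I. 1 / wt I * norm x)"
      proof (rule sum_mono)
        fix K
        have "wt K * \<bar>cf K x\<bar> \<le> norm x" using cf_le[OF x, of K] by (simp add: pos_le_divide_eq mult.commute)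
        hence "wt K * \<bar>cf K x\<bar> / wt I \<le> norm x / wt I" by (intro divide_right_mono) auto
        thus "norm (sg (\<Theta> I) K * wt K / wt I * cf K x) \<le> 1 / wt I * norm x" by (simp add: abs_mult)
      qed
      finally show "norm (\<Sum>K\<in>B I. sg (\<Theta> I) K * wt K / wt I * cf K x) \<le> (\<Sum>K\<in>B I. 1 / wt I) * norm x" by (simp add: sum_distrib_right)
    qed (use bdl_add[OF cf] bdl_scale[OF cf] in \<open>auto simp: sum.distrib sum_distrib_left distrib_left add_divide_distrib mult_ac intro!: sum_nonneg\<close>)
    fix L :: nat assume L: "L \<ge> 1"
    have "cf I (u L) = c I L"
    proof (cases "I \<in> nodes (Suc (lev L))")
      case False
      hence "L \<notin> B I" using node_iff[of I "Suc (lev L)"] lev_le_of_mem[OF assms I, of L] I by auto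
      thus ?thesis using False by (simp add: u_def cf_lc c_def)
    qed (simp add: u_def cf_lc)
    moreover have "(\<Sum>K\<in>B I. sg (\<Theta> I) K * wt K / wt I * cf K (e L)) = (\<Sum>K\<in>B I. if K = L then sg (\<Theta> I) L * wt L / wt I else 0)"
      using cf_e[OF L] by (intro sum.cong) auto
    ultimately show "cf I (U (e L)) = (\<Sum>K\<in>B I. sg (\<Theta> I) K * wt K / wt I * cf K (e L))"
      using U(2)[OF L] B_finite[OF assms I] by (simp add: c_def)
  qed
  thus ?thesis using U by blast
qed

text \<open>Along the path from the root to \<open>K\<close> the entry \<open>d K\<close> is
  \<open>d 1\<close> plus increments. The multiplier is therefore \<open>d 1\<close> times the
  identity plus each increment times a restriction to one interval, and those have norm at most
  2.\<close>

lemma mult_exists: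
  assumes "\<And>n. (\<Sum>I\<in>nodes n - {1}. \<bar>d I - d (I div 2)\<bar>) \<le> D"
  shows "\<exists>U. bdl Y (\<bar>d 1\<bar> + 2 * D) U \<and> (\<forall>K\<ge>1. U (e K) = d K *\<^sub>R e K) \<and> (\<forall>y\<in>Y. U y \<in> Y)"
proof (rule ext_Y)
  have D0: "D \<ge> 0" using assms[of 0] by simp
  thus "\<bar>d 1\<bar> + 2 * D \<ge> 0" by simp
  fix n and a :: "nat \<Rightarrow> real"
  let ?N = "nodes n - {1}"
  have tel: "d K = d 1 + (\<Sum>I\<in>?N. if under K I then d I - d (I div 2) else 0)" if "K \<in> nodes n" for K
    using that
  proof (induction K rule: less_induct)
    case (less K)
    show ?case
    proof (cases "K = 1")
      case True
      have "\<not> under 1 I" if "I \<in> ?N" for I using under_le[of 1 I] that by auto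
      thus ?thesis using True by simp
    next
      case False
      hence K: "K \<ge> 2" "K \<in> ?N" using less by auto
      have Kd: "K div 2 \<in> nodes n" using less.prems K by auto
      have un: "under K I \<longleftrightarrow> I = K \<or> under (K div 2) I" if "I \<in> ?N" for I
      proof
        assume u: "under K I"
        show "I = K \<or> under (K div 2) I"
        proof (rule disjCI)
          assume "\<not> under (K div 2) I"
          obtain j where j: "K div 2 ^ j = I" using u by (auto simp: under_def)
          show "I = K"
          proof (cases j)
            case (Suc i)
            hence "under (K div 2) I" using j by (auto simp: under_def div_mult2_eq)
            thus ?thesis using \<open>\<not> under (K div 2) I\<close> by blast
          qed (use j in simp)
        qed
      next
        assume "I = K \<or> under (K div 2) I"
        moreover have "under K (K div 2)" unfolding under_def by (rule exI[of _ 1]) simp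
        ultimately show "under K I" using under_trans by auto
      qed
      have nk: "\<not> under (K div 2) K" using under_le[of "K div 2" K] K by auto
      have "(\<Sum>I\<in>?N. if under K I then d I - d (I div 2) else 0) = (\<Sum>I\<in>?N. (if I = K then d K - d (K div 2) else 0) + (if under (K div 2) I then d I - d (I div 2) else 0))"
        using un nk by (intro sum.cong) auto
      also have "\<dots> = (d K - d (K div 2)) + (\<Sum>I\<in>?N. if under (K div 2) I then d I - d (I div 2) else 0)"
        unfolding sum.distrib using K(2) by simp
      finally show ?thesis using less.IH[of "K div 2"] Kd K by simp
    qed
  qed
  have "(\<Sum>K\<in>nodes n. a K *\<^sub>R d K *\<^sub>R e K) = (\<Sum>K\<in>nodes n. d 1 *\<^sub>R (a K *\<^sub>R e K) + (\<Sum>I\<in>?N. (d I - d (I div 2)) *\<^sub>R ((if \<exists>L\<in>{I}. under K L then a K else 0) *\<^sub>R e K)))"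
  proof (intro sum.cong refl)
    fix K assume K: "K \<in> nodes n"
    have "a K *\<^sub>R d K *\<^sub>R e K = (d 1 * a K + (\<Sum>I\<in>?N. (if under K I then d I - d (I div 2) else 0) * a K)) *\<^sub>R e K"
      by (subst tel[OF K]) (simp add: algebra_simps sum_distrib_right sum_distrib_left)
    also have "\<dots> = d 1 *\<^sub>R (a K *\<^sub>R e K) + (\<Sum>I\<in>?N. ((if under K I then d I - d (I div 2) else 0) * a K) *\<^sub>R e K)"
      by (simp add: scaleR_add_left scaleR_sum_left)
    also have "(\<Sum>I\<in>?N. ((if under K I then d I - d (I div 2) else 0) * a K) *\<^sub>R e K) = (\<Sum>I\<in>?N. (d I - d (I div 2)) *\<^sub>R ((if \<exists>L\<in>{I}. under K L then a K else 0) *\<^sub>R e K))"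
      by (intro sum.cong) auto
    finally show "a K *\<^sub>R d K *\<^sub>R e K = d 1 *\<^sub>R (a K *\<^sub>R e K) + (\<Sum>I\<in>?N. (d I - d (I div 2)) *\<^sub>R ((if \<exists>L\<in>{I}. under K L then a K else 0) *\<^sub>R e K))" .
  qed
  also have "\<dots> = d 1 *\<^sub>R lc n a + (\<Sum>I\<in>?N. (d I - d (I div 2)) *\<^sub>R lc n (\<lambda>K. if \<exists>L\<in>{I}. under K L then a K else 0))"
    unfolding sum.distrib lc_def scaleR_sum_right by (rule arg_cong2[of _ _ _ _ plus, OF refl sum.swap])
  finally have eqn: "(\<Sum>K\<in>nodes n. a K *\<^sub>R d K *\<^sub>R e K) = d 1 *\<^sub>R lc n a + (\<Sum>I\<in>?N. (d I - d (I div 2)) *\<^sub>R lc n (\<lambda>K. if \<exists>L\<in>{I}. under K L then a K else 0))" .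
  have "norm (\<Sum>K\<in>nodes n. a K *\<^sub>R d K *\<^sub>R e K) \<le> norm (d 1 *\<^sub>R lc n a) + norm (\<Sum>I\<in>?N. (d I - d (I div 2)) *\<^sub>R lc n (\<lambda>K. if \<exists>L\<in>{I}. under K L then a K else 0))"
    unfolding eqn by (rule norm_triangle_ineq)
  also have "norm (\<Sum>I\<in>?N. (d I - d (I div 2)) *\<^sub>R lc n (\<lambda>K. if \<exists>L\<in>{I}. under K L then a K else 0)) \<le> (\<Sum>I\<in>?N. \<bar>d I - d (I div 2)\<bar> * (2 * norm (lc n a)))"
  proof (rule order_trans[OF norm_sum sum_mono])
    fix I assume "I \<in> ?N"
    hence "{I} \<subseteq> level (lev I)" by (auto simp: level_iff)
    from gauge_restrict[OF this, of n a]
    have "norm (lc n (\<lambda>K. if \<exists>L\<in>{I}. under K L then a K else 0)) \<le> 2 * norm (lc n a)" unfolding norm_lc .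
    thus "norm ((d I - d (I div 2)) *\<^sub>R lc n (\<lambda>K. if \<exists>L\<in>{I}. under K L then a K else 0)) \<le> \<bar>d I - d (I div 2)\<bar> * (2 * norm (lc n a))"
      by (simp add: mult_left_mono)
  qed
  also have "\<dots> = (\<Sum>I\<in>?N. \<bar>d I - d (I div 2)\<bar>) * (2 * norm (lc n a))" by (simp add: sum_distrib_right)
  also have "\<dots> \<le> D * (2 * norm (lc n a))" using assms[of n] by (intro mult_right_mono) auto
  finally show "norm (\<Sum>K\<in>nodes n. a K *\<^sub>R d K *\<^sub>R e K) \<le> (\<bar>d 1\<bar> + 2 * D) * norm (lc n a)" by (simp add: algebra_simps)
qed (use e_Y Y_scale in auto)

text \<open>A finite combination has no coefficients on late levels, and what remains of
  \<open>y\<close> is controlled by \<open>cf_level\<close>, uniformly in the level.\<close>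

lemma cf_tail: "y \<in> Y \<Longrightarrow> (\<lambda>m. \<Sum>K\<in>level m. wt K * \<bar>cf K y\<bar>) \<longlonglongrightarrow> 0"
proof (rule LIMSEQ_I)
  fix r :: real assume y: "y \<in> Y" and r: "r > 0"
  obtain n a where x: "norm (y - lc n a) < r" using Y_approx[OF y r] by blast
  show "\<exists>no. \<forall>m\<ge>no. norm ((\<Sum>K\<in>level m. wt K * \<bar>cf K y\<bar>) - 0) < r"
  proof (intro exI[of _ n] allI impI)
    fix m assume m: "m \<ge> n"
    have "cf K y = cf K (y - lc n a)" if "K \<in> level m" for K
    proof -
      have "K \<notin> nodes n" using that m node_iff[of K n] by (simp add: level_iff)
      hence "cf K (lc n a) = 0" by (simp only: cf_lc if_False)
      thus ?thesis using bdl_diff[OF cf subspace_Y y lc_Y, of K n a] by simp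
    qed
    hence "(\<Sum>K\<in>level m. wt K * \<bar>cf K y\<bar>) = (\<Sum>K\<in>level m. wt K * \<bar>cf K (y - lc n a)\<bar>)" by (intro sum.cong) auto
    also have "\<dots> \<le> norm (y - lc n a)" by (rule cf_level[OF Y_diff[OF y lc_Y]])
    finally have "(\<Sum>K\<in>level m. wt K * \<bar>cf K y\<bar>) < r" using x by simp
    moreover have "(\<Sum>K\<in>level m. wt K * \<bar>cf K y\<bar>) \<ge> 0" by (intro sum_nonneg) auto
    ultimately show "norm ((\<Sum>K\<in>level m. wt K * \<bar>cf K y\<bar>) - 0) < r" by simp
  qed
qed

end

section \<open>Rademacher functions with arbitrary signs\<close>

fun aut :: "(nat \<Rightarrow> bool) \<Rightarrow> nat \<Rightarrow> nat" where
  "aut p I = (if I \<le> 1 then 1 else pick (even I) (if p (aut p (I div 2)) then {aut p (I div 2)} else {}) (aut p (I div 2)))"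

declare aut.simps [simp del]

lemma aut_child:
  assumes "I \<ge> 1"
  shows "aut p (2 * I) = (if p (aut p I) then 2 * aut p I else 2 * aut p I + 1)"
    "aut p (2 * I + 1) = (if p (aut p I) then 2 * aut p I + 1 else 2 * aut p I)"
  using assms by (auto simp: aut.simps[of p "2 * I"] aut.simps[of p "2 * I + 1"] aut.simps[of p "Suc (2 * I)"] pick_def)

lemma aut_level: "aut p ` level n = level n"
proof (induction n)
  case 0
  show ?case by (simp add: aut.simps)
next
  case (Suc n)
  have "aut p ` level (Suc n) = (\<Union>I\<in>level n. {aut p (2 * I), aut p (2 * I + 1)})" unfolding level_Suc by auto
  also have "\<dots> = (\<Union>I\<in>level n. {2 * aut p I, 2 * aut p I + 1})" using aut_child level_pos by (intro SUP_cong) auto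
  also have "\<dots> = (\<Union>K\<in>aut p ` level n. {2 * K, 2 * K + 1})" by auto
  finally show ?case unfolding Suc level_Suc by auto
qed

text \<open>Replacing a Haar function by its negative exchanges the halves on which it is 1 and -1.
  The automorphism \<open>aut p\<close> exchanges the subtrees accordingly wherever \<open>p\<close>
  fails, so Haar vectors with signs prescribed by \<open>p\<close> still form a faithful
  system.\<close>

lemma aut_faithful: "faithful (\<lambda>I. {aut p I}) (\<lambda>I. if p (aut p I) then {aut p I} else {})"
  unfolding faithful_def
proof (intro allI impI)
  fix I :: nat assume "I \<ge> 1"
  have "source (\<lambda>I. {aut p I}) (\<lambda>I. if p (aut p I) then {aut p I} else {}) I = {aut p I}"
    by (simp add: source_def aut.simps[of p I])
  thus "refine (source (\<lambda>I. {aut p I}) (\<lambda>I. if p (aut p I) then {aut p I} else {}) I) {aut p I}"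
    unfolding refine_def by (auto intro!: exI[of _ "\<lambda>K. {K}"] Part_self)
qed

context haar_null
begin

text \<open>Weak nullity is assumed for the plain Rademacher functions only. Composing
  \<open>g\<close> with the embedding along \<open>aut p\<close>, where \<open>p\<close> records the
  sign of \<open>g\<close>, turns the value at a Rademacher function into the sum of moduli over its
  level.\<close>

lemma functional_level_null:
  fixes g :: "'b \<Rightarrow> real"
  assumes "bdl Y C g"
  shows "(\<lambda>m. \<Sum>K\<in>level m. \<bar>g (e K)\<bar>) \<longlonglongrightarrow> 0"
proof -
  define p where "p K \<longleftrightarrow> g (e K) \<ge> 0" for K
  obtain U where U: "bdl Y 1 U" "\<And>I. I \<ge> 1 \<Longrightarrow> U (e I) = (\<Sum>K\<in>{aut p I}. sg (if p (aut p I) then {aut p I} else {}) K *\<^sub>R e K)" "\<And>y. y \<in> Y \<Longrightarrow> U y \<in> Y"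
    using emb_exists[OF aut_faithful[of p]] by blast
  have lin: "linear_on Y (\<lambda>y. g (U y))"
    using bdl_add[OF U(1)] bdl_add[OF assms] bdl_scale[OF U(1)] bdl_scale[OF assms] U(3) by (simp add: linear_on_def)
  have "\<bar>g (U y)\<bar> \<le> C * norm y" if "y \<in> Y" for y
  proof -
    have "\<bar>g (U y)\<bar> \<le> C * norm (U y)" using bdl_norm[OF assms U(3)[OF that]] by simp
    also have "\<dots> \<le> C * norm y" using bdl_norm[OF U(1) that] bdl_nonneg[OF assms] by (intro mult_left_mono) auto
    finally show ?thesis .
  qed
  hence "bounded_functional Y norm (\<lambda>y. g (U y))" using lin by (auto simp: bounded_functional_def)
  hence lim: "(\<lambda>n. g (U (\<Sum>K\<in>level n. e K))) \<longlonglongrightarrow> 0"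
    using conjunct2[OF null[unfolded weakly_null_def], rule_format, of "\<lambda>y. g (U y)"] by blast
  have "g (U (\<Sum>K\<in>level n. e K)) = (\<Sum>K\<in>level n. \<bar>g (e K)\<bar>)" for n
  proof -
    have "g (U (\<Sum>I\<in>level n. 1 *\<^sub>R e I)) = (\<Sum>I\<in>level n. 1 *\<^sub>R g (U (e I)))"
      using lin subspace_Y by (rule linear_on_sum[of Y "\<lambda>y. g (U y)"]) (use e_Y level_pos in auto)
    also have "\<dots> = (\<Sum>I\<in>level n. \<bar>g (e (aut p I))\<bar>)"
    proof (intro sum.cong refl)
      fix I assume I: "I \<in> level n"
      hence "aut p I \<in> level n" using aut_level by blast
      hence "e (aut p I) \<in> Y" using e_Y level_pos by blast
      thus "1 *\<^sub>R g (U (e I)) = \<bar>g (e (aut p I))\<bar>"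
        using U(2)[OF level_pos[OF I]] bdl_scale[OF assms, of "e (aut p I)" "-1"] by (simp add: sg_def p_def)
    qed
    also have "\<dots> = (\<Sum>K\<in>aut p ` level n. \<bar>g (e K)\<bar>)"
      by (subst sum.reindex) (auto intro!: eq_card_imp_inj_on simp: aut_level)
    finally show ?thesis by (simp add: aut_level)
  qed
  thus ?thesis using lim by simp
qed

end

subsection \<open>Stabilising the diagonal\<close>

lemma sum_Pow_linear_sq:
  fixes y :: "nat \<Rightarrow> real"
  assumes "finite B"
  shows "(\<Sum>A\<in>Pow B. (\<Sum>j\<in>B. sg A j * y j)\<^sup>2) = 2 ^ card B * (\<Sum>j\<in>B. (y j)\<^sup>2)"
  using assms
proof (induction B rule: finite_induct)
  case (insert k B)
  have "(\<Sum>A\<in>Pow (insert k B). (\<Sum>j\<in>insert k B. sg A j * y j)\<^sup>2) = (\<Sum>A\<in>Pow B. 2 * (\<Sum>j\<in>B. sg A j * y j)\<^sup>2 + 2 * (y k)\<^sup>2)"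
    unfolding sum_Pow_insert[OF insert(1,2)]
  proof (intro sum.cong refl)
    fix A assume "A \<in> Pow B"
    hence "sg (insert k A) k = 1" "sg A k = -1" using insert(2) by (auto simp: sg_def)
    thus "(\<Sum>j\<in>insert k B. sg (insert k A) j * y j)\<^sup>2 + (\<Sum>j\<in>insert k B. sg A j * y j)\<^sup>2 = 2 * (\<Sum>j\<in>B. sg A j * y j)\<^sup>2 + 2 * (y k)\<^sup>2"
      using insert(1,2) sg_insert[OF insert(2), of A y] by (simp add: power2_eq_square algebra_simps)
  qed
  also have "\<dots> = 2 * (2 ^ card B * (\<Sum>j\<in>B. (y j)\<^sup>2)) + 2 ^ card B * (2 * (y k)\<^sup>2)"
    using insert(1) by (simp add: sum.distrib insert.IH card_Pow flip: sum_distrib_left)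
  finally show ?case using insert(1,2) by (simp add: algebra_simps)
qed simp

definition offdiag :: "nat set \<Rightarrow> (nat \<Rightarrow> nat \<Rightarrow> real) \<Rightarrow> nat set \<Rightarrow> real" where
  "offdiag B x A = (\<Sum>K\<in>B. \<Sum>L\<in>B - {K}. sg A K * sg A L * x K L)"

lemma offdiag_insert:
  assumes "finite B" "k \<notin> B"
  shows "offdiag (insert k B) x A = offdiag B x A + sg A k * (\<Sum>j\<in>B. sg A j * (x k j + x j k))"
proof -
  have 1: "(\<Sum>L\<in>insert k B - {K}. sg A K * sg A L * x K L) = sg A K * sg A k * x K k + (\<Sum>L\<in>B - {K}. sg A K * sg A L * x K L)"
    if "K \<in> B" for K
  proof -
    have "insert k B - {K} = insert k (B - {K})" using assms that by auto
    thus ?thesis using assms by simp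
  qed
  have "offdiag (insert k B) x A = (\<Sum>L\<in>B. sg A k * sg A L * x k L) + (\<Sum>K\<in>B. sg A K * sg A k * x K k + (\<Sum>L\<in>B - {K}. sg A K * sg A L * x K L))"
    unfolding offdiag_def using assms 1 by simp
  thus ?thesis by (simp add: offdiag_def sum.distrib sum_distrib_left distrib_left mult_ac)
qed

lemma offdiag_cong: "(\<And>K. K \<in> B \<Longrightarrow> sg A K = sg A' K) \<Longrightarrow> offdiag B x A = offdiag B x A'"
  unfolding offdiag_def by (intro sum.cong) auto

text \<open>The factor 2 accounts for the missing symmetry: the entries at \<open>(K, L)\<close> and
  \<open>(L, K)\<close> carry the same product of signs, and the square of their sum is at most
  twice the sum of their squares.\<close>

lemma sum_Pow_offdiag_sq:
  assumes "finite B"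
  shows "(\<Sum>A\<in>Pow B. (offdiag B x A)\<^sup>2) \<le> 2 ^ card B * (2 * (\<Sum>K\<in>B. \<Sum>L\<in>B. (x K L)\<^sup>2))"
  using assms
proof (induction B rule: finite_induct)
  case (insert k B)
  let ?l = "\<lambda>A. \<Sum>j\<in>B. sg A j * (x k j + x j k)"
  have "(\<Sum>A\<in>Pow (insert k B). (offdiag (insert k B) x A)\<^sup>2) = (\<Sum>A\<in>Pow B. 2 * (offdiag B x A)\<^sup>2 + 2 * (?l A)\<^sup>2)"
    unfolding sum_Pow_insert[OF insert(1,2)]
  proof (intro sum.cong refl)
    fix A assume "A \<in> Pow B"
    hence s: "sg (insert k A) k = 1" "sg A k = -1" using insert(2) by (auto simp: sg_def)
    have "offdiag B x (insert k A) = offdiag B x A" using insert(2) by (intro offdiag_cong) (auto simp: sg_def)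
    moreover have "?l (insert k A) = ?l A" by (rule sg_insert[OF insert(2)])
    ultimately show "(offdiag (insert k B) x (insert k A))\<^sup>2 + (offdiag (insert k B) x A)\<^sup>2 = 2 * (offdiag B x A)\<^sup>2 + 2 * (?l A)\<^sup>2"
      unfolding offdiag_insert[OF insert(1,2)] s by (simp add: power2_eq_square algebra_simps)
  qed
  also have "\<dots> = 2 * (\<Sum>A\<in>Pow B. (offdiag B x A)\<^sup>2) + 2 * (2 ^ card B * (\<Sum>j\<in>B. (x k j + x j k)\<^sup>2))"
    unfolding sum.distrib sum_Pow_linear_sq[OF insert(1), symmetric] by (simp add: sum_distrib_left)
  also have "\<dots> \<le> 2 * (2 ^ card B * (2 * (\<Sum>K\<in>B. \<Sum>L\<in>B. (x K L)\<^sup>2))) + 2 * (2 ^ card B * (\<Sum>j\<in>B. 2 * ((x k j)\<^sup>2 + (x j k)\<^sup>2)))"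
  proof (intro add_mono mult_left_mono insert.IH sum_mono)
    fix j
    have "0 \<le> (x k j - x j k)\<^sup>2" by simp
    thus "(x k j + x j k)\<^sup>2 \<le> 2 * ((x k j)\<^sup>2 + (x j k)\<^sup>2)" by (simp add: power2_eq_square algebra_simps)
  qed auto
  also have "\<dots> = 2 ^ card (insert k B) * (2 * ((\<Sum>K\<in>B. \<Sum>L\<in>B. (x K L)\<^sup>2) + (\<Sum>j\<in>B. (x k j)\<^sup>2) + (\<Sum>j\<in>B. (x j k)\<^sup>2)))"
    using insert(1,2) by (simp add: sum.distrib algebra_simps sum_distrib_left)
  also have "\<dots> \<le> 2 ^ card (insert k B) * (2 * (\<Sum>K\<in>insert k B. \<Sum>L\<in>insert k B. (x K L)\<^sup>2))"
    using insert(1,2) by (intro mult_left_mono) (auto simp: sum.distrib)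
  finally show ?case .
qed (simp add: offdiag_def)

text \<open>Some sign pattern does no worse than the mean. Adding the two squares before averaging
  makes one pattern serve both quantities.\<close>

lemma good_signs:
  fixes y :: "nat \<Rightarrow> real"
  assumes "finite B"
  shows "\<exists>A. (offdiag B x A)\<^sup>2 + (\<Sum>j\<in>B. sg A j * y j)\<^sup>2 \<le> 2 * (\<Sum>K\<in>B. \<Sum>L\<in>B. (x K L)\<^sup>2) + (\<Sum>j\<in>B. (y j)\<^sup>2)"
proof (rule ccontr)
  let ?R = "2 * (\<Sum>K\<in>B. \<Sum>L\<in>B. (x K L)\<^sup>2) + (\<Sum>j\<in>B. (y j)\<^sup>2)"
  assume "\<not> ?thesis"
  hence gt: "(offdiag B x A)\<^sup>2 + (\<Sum>j\<in>B. sg A j * y j)\<^sup>2 > ?R" for A by (simp add: not_le)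
  have "(\<Sum>A\<in>Pow B. ?R) < (\<Sum>A\<in>Pow B. (offdiag B x A)\<^sup>2 + (\<Sum>j\<in>B. sg A j * y j)\<^sup>2)"
    using assms gt by (intro sum_strict_mono) auto
  also have "\<dots> \<le> 2 ^ card B * (2 * (\<Sum>K\<in>B. \<Sum>L\<in>B. (x K L)\<^sup>2)) + 2 ^ card B * (\<Sum>j\<in>B. (y j)\<^sup>2)"
    unfolding sum.distrib using sum_Pow_offdiag_sq[OF assms, of x] sum_Pow_linear_sq[OF assms, of y] by simp
  also have "\<dots> = (\<Sum>A\<in>Pow B. ?R)" using assms by (simp add: card_Pow algebra_simps)
  finally show False by simp
qed

lemma summable_tail_small:
  fixes f :: "nat \<Rightarrow> real"
  assumes "summable f" "\<And>n. f n \<ge> 0" "\<epsilon> > 0"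
  shows "\<exists>m. \<forall>F. finite F \<longrightarrow> F \<subseteq> {m..} \<longrightarrow> sum f F \<le> \<epsilon>"
proof -
  obtain m where m: "\<And>n. norm (sum f {m..<n}) < \<epsilon>" using assms(1,3) unfolding summable_Cauchy by blast
  have "sum f F \<le> \<epsilon>" if F: "finite F" "F \<subseteq> {m..}" for F
  proof -
    obtain n where "F \<subseteq> {..<n}" using F(1) finite_nat_iff_bounded by blast
    hence "F \<subseteq> {m..<n}" using F by auto
    hence "sum f F \<le> sum f {m..<n}" using assms(2) by (intro sum_mono2) auto
    thus ?thesis using m[of n] by simp
  qed
  thus ?thesis by blast
qed

section \<open>Nearly optimal partitions and their limiting value\<close>

lemma Part_leaves: "K \<ge> 1 \<Longrightarrow> lev K \<le> l \<Longrightarrow> Part K (leaves l K)"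
proof (induction "l - lev K" arbitrary: K)
  case 0
  hence "K \<in> level l" by (simp add: level_iff)
  thus ?case using leaves_self Part_self by simp
next
  case (Suc n)
  have a: "lev K < l" "n = l - Suc (lev K)" using Suc.hyps(2) by auto
  have "Part (2 * K) (leaves l (2 * K))" "Part (2 * K + 1) (leaves l (2 * K + 1))"
    using Suc.hyps(1)[of "2 * K"] Suc.hyps(1)[of "2 * K + 1"] Suc.prems a by auto
  thus ?case unfolding leaves_split(1)[OF Suc.prems(1) a(1)] by (rule Part_split)
qed

definition val :: "(nat \<Rightarrow> real) \<Rightarrow> nat set \<Rightarrow> real" where "val d P = (\<Sum>L\<in>P. wt L * d L)"

text \<open>\<open>upval \<Lambda> d m K\<close> is the best weighted sum of \<open>d\<close> over a partition of \<open>K\<close> into intervals whose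
  levels belong to \<open>\<Lambda>\<close> and are at least \<open>m\<close>; the limit \<open>limval\<close> in \<open>m\<close> is additive.\<close>

definition parts :: "nat set \<Rightarrow> nat \<Rightarrow> nat \<Rightarrow> nat set set" where
  "parts \<Lambda> m K = {P. Part K P \<and> lev ` P \<subseteq> \<Lambda> \<inter> {m..}}"

definition upval :: "nat set \<Rightarrow> (nat \<Rightarrow> real) \<Rightarrow> nat \<Rightarrow> nat \<Rightarrow> real" where
  "upval \<Lambda> d m K = (SUP P\<in>parts \<Lambda> m K. val d P)"

definition limval :: "nat set \<Rightarrow> (nat \<Rightarrow> real) \<Rightarrow> nat \<Rightarrow> real" where
  "limval \<Lambda> d K = (INF m. upval \<Lambda> d m K)"

lemma parts_nonempty:
  assumes "infinite \<Lambda>" "K \<ge> 1" shows "parts \<Lambda> m K \<noteq> {}"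
proof -
  obtain l where l: "l \<in> \<Lambda>" "l > max m (lev K)" using assms(1) unfolding infinite_nat_iff_unbounded by blast
  have "Part K (leaves l K)" using Part_leaves assms(2) l by simp
  moreover have "lev ` leaves l K \<subseteq> \<Lambda> \<inter> {m..}" using l by (auto simp: leaves_def level_iff)
  ultimately show ?thesis by (auto simp: parts_def)
qed

lemma val_bound:
  assumes "\<And>L. \<bar>d L\<bar> \<le> D" "Part K P" "K \<ge> 1" shows "\<bar>val d P\<bar> \<le> D * wt K"
proof -
  have "\<bar>val d P\<bar> \<le> (\<Sum>L\<in>P. \<bar>wt L * d L\<bar>)" unfolding val_def by (rule sum_abs)
  also have "\<dots> \<le> (\<Sum>L\<in>P. D * wt L)" using assms(1) by (intro sum_mono) (simp add: abs_mult mult.commute mult_left_mono)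
  also have "\<dots> = D * wt K" using Part_props[OF assms(2,3)] by (simp flip: sum_distrib_left)
  finally show ?thesis .
qed

lemma val_split:
  assumes "K \<ge> 1" "Part (2 * K) P" "Part (2 * K + 1) Q"
  shows "val d (P \<union> Q) = val d P + val d Q"
proof -
  have P: "finite P" "\<forall>L\<in>P. under L (2 * K)" using Part_props[OF assms(2)] assms(1) by auto
  have Q: "finite Q" "\<forall>L\<in>Q. under L (Suc (2 * K))" using Part_props[OF assms(3)] assms(1) by auto
  have "P \<inter> Q = {}" using P(2) Q(2) not_under_sib[OF assms(1)] by blast
  thus ?thesis unfolding val_def using P Q by (simp add: sum.union_disjoint)
qed

context
  fixes \<Lambda> :: "nat set" and d :: "nat \<Rightarrow> real" and D :: real
  assumes inf: "infinite \<Lambda>" and bd: "\<And>L. \<bar>d L\<bar> \<le> D"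
begin

lemma bdd_val: "K \<ge> 1 \<Longrightarrow> bdd_above (val d ` parts \<Lambda> m K)"
  using val_bound[of d D, OF bd] by (intro bdd_aboveI[of _ "D * wt K"]) (auto simp: parts_def abs_le_iff)

lemma val_le_upval: "K \<ge> 1 \<Longrightarrow> P \<in> parts \<Lambda> m K \<Longrightarrow> val d P \<le> upval \<Lambda> d m K"
  unfolding upval_def by (rule cSUP_upper[OF _ bdd_val])

lemma upval_le: "K \<ge> 1 \<Longrightarrow> (\<And>P. P \<in> parts \<Lambda> m K \<Longrightarrow> val d P \<le> c) \<Longrightarrow> upval \<Lambda> d m K \<le> c"
  unfolding upval_def by (rule cSUP_least[OF parts_nonempty[OF inf]])

lemma upval_bound: "K \<ge> 1 \<Longrightarrow> \<bar>upval \<Lambda> d m K\<bar> \<le> D * wt K"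
proof -
  assume K: "K \<ge> 1"
  obtain P where P: "P \<in> parts \<Lambda> m K" using parts_nonempty[OF inf K] by blast
  have b: "\<bar>val d Q\<bar> \<le> D * wt K" if "Q \<in> parts \<Lambda> m K" for Q using val_bound[of d D, OF bd _ K] that by (auto simp: parts_def)
  have "upval \<Lambda> d m K \<le> D * wt K" using b by (intro upval_le[OF K]) (auto simp: abs_le_iff)
  moreover have "- (D * wt K) \<le> upval \<Lambda> d m K" using b[OF P] val_le_upval[OF K P] by (simp add: abs_le_iff)
  ultimately show ?thesis by (simp add: abs_le_iff)
qed

lemma upval_near: "K \<ge> 1 \<Longrightarrow> \<epsilon> > 0 \<Longrightarrow> \<exists>P\<in>parts \<Lambda> m K. upval \<Lambda> d m K - \<epsilon> < val d P"
  using upval_le[of K m "upval \<Lambda> d m K - \<epsilon>"] by (meson diff_less_eq less_add_same_cancel1 not_le order_refl le_less_trans linorder_not_less)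

lemma upval_mono: "K \<ge> 1 \<Longrightarrow> m \<le> n \<Longrightarrow> upval \<Lambda> d n K \<le> upval \<Lambda> d m K"
proof (rule upval_le)
  fix P assume "K \<ge> 1" "m \<le> n" "P \<in> parts \<Lambda> n K"
  moreover from this have "P \<in> parts \<Lambda> m K" by (force simp: parts_def image_subset_iff)
  ultimately show "val d P \<le> upval \<Lambda> d m K" using val_le_upval by blast
qed

lemma upval_lim: "K \<ge> 1 \<Longrightarrow> (\<lambda>m. upval \<Lambda> d m K) \<longlonglongrightarrow> limval \<Lambda> d K"
proof -
  assume K: "K \<ge> 1"
  have "- (D * wt K) \<le> upval \<Lambda> d m K" for m using upval_bound[OF K, of m] by linarith
  hence "bdd_below (range (\<lambda>m. upval \<Lambda> d m K))" by (intro bdd_belowI[of _ "- (D * wt K)"]) auto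
  moreover have "decseq (\<lambda>m. upval \<Lambda> d m K)" using upval_mono[OF K] by (simp add: decseq_def)
  ultimately show ?thesis unfolding limval_def by (intro LIMSEQ_decseq_INF)
qed

lemma limval_le: "K \<ge> 1 \<Longrightarrow> limval \<Lambda> d K \<le> upval \<Lambda> d m K"
  using decseq_ge[OF _ upval_lim] upval_mono by (simp add: decseq_def)

lemma limval_bound: "K \<ge> 1 \<Longrightarrow> \<bar>limval \<Lambda> d K\<bar> \<le> D * wt K"
  by (rule LIMSEQ_le_const2[OF tendsto_rabs[OF upval_lim]]) (auto simp: upval_bound)

text \<open>The condition \<open>lev K < m\<close> excludes the trivial partition
  \<open>{K}\<close>, so every admissible partition of \<open>K\<close> is a union of admissible
  partitions of its halves. For smaller \<open>m\<close> only one inequality would survive.\<close>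

lemma upval_add:
  assumes K: "K \<ge> 1" "lev K < m"
  shows "upval \<Lambda> d m K = upval \<Lambda> d m (2 * K) + upval \<Lambda> d m (2 * K + 1)"
proof (rule antisym)
  have K2: "2 * K \<ge> 1" "2 * K + 1 \<ge> 1" using K by auto
  show "upval \<Lambda> d m K \<le> upval \<Lambda> d m (2 * K) + upval \<Lambda> d m (2 * K + 1)"
  proof (rule upval_le[OF K(1)])
    fix P assume P: "P \<in> parts \<Lambda> m K"
    hence "Part K P" by (simp add: parts_def)
    thus "val d P \<le> upval \<Lambda> d m (2 * K) + upval \<Lambda> d m (2 * K + 1)"
    proof cases
      case Part_self
      thus ?thesis using P K by (auto simp: parts_def)
    next
      case (Part_split P1 P2)
      hence "P1 \<in> parts \<Lambda> m (2 * K)" "P2 \<in> parts \<Lambda> m (2 * K + 1)" using P by (auto simp: parts_def)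
      hence "val d P1 \<le> upval \<Lambda> d m (2 * K)" "val d P2 \<le> upval \<Lambda> d m (2 * K + 1)"
        using val_le_upval K2 by blast+
      moreover have "val d P = val d P1 + val d P2" using val_split[OF K(1)] Part_split by simp
      ultimately show ?thesis by linarith
    qed
  qed
  show "upval \<Lambda> d m (2 * K) + upval \<Lambda> d m (2 * K + 1) \<le> upval \<Lambda> d m K"
  proof -
    have "val d P1 + val d P2 \<le> upval \<Lambda> d m K" if "P1 \<in> parts \<Lambda> m (2 * K)" "P2 \<in> parts \<Lambda> m (2 * K + 1)" for P1 P2
    proof -
      have P: "Part (2 * K) P1" "Part (2 * K + 1) P2" using that by (auto simp: parts_def)
      have "P1 \<union> P2 \<in> parts \<Lambda> m K" using Part_split[OF P] that by (auto simp: parts_def)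
      thus ?thesis using val_le_upval[OF K(1)] val_split[OF K(1) P, of d] by metis
    qed
    hence "upval \<Lambda> d m (2 * K) \<le> upval \<Lambda> d m K - val d P2" if "P2 \<in> parts \<Lambda> m (2 * K + 1)" for P2
      using that by (intro upval_le[OF K2(1)]) (simp add: le_diff_eq)
    hence "upval \<Lambda> d m (2 * K + 1) \<le> upval \<Lambda> d m K - upval \<Lambda> d m (2 * K)"
      by (intro upval_le[OF K2(2)]) (simp add: le_diff_eq add.commute)
    thus ?thesis by simp
  qed
qed

lemma limval_add:
  assumes K: "K \<ge> 1"
  shows "limval \<Lambda> d K = limval \<Lambda> d (2 * K) + limval \<Lambda> d (2 * K + 1)"
proof (rule LIMSEQ_unique[OF upval_lim[OF K]])
  have "(\<lambda>m. upval \<Lambda> d m (2 * K) + upval \<Lambda> d m (2 * K + 1)) \<longlonglongrightarrow> limval \<Lambda> d (2 * K) + limval \<Lambda> d (2 * K + 1)"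
    using K by (intro tendsto_add upval_lim) auto
  moreover have "\<forall>\<^sub>F m in sequentially. upval \<Lambda> d m (2 * K) + upval \<Lambda> d m (2 * K + 1) = upval \<Lambda> d m K"
    using eventually_gt_at_top[of "lev K"] by eventually_elim (simp add: upval_add[OF K])
  ultimately show "(\<lambda>m. upval \<Lambda> d m K) \<longlonglongrightarrow> limval \<Lambda> d (2 * K) + limval \<Lambda> d (2 * K + 1)"
    by (rule Lim_transform_eventually)
qed

lemma upval_level: "l \<le> m \<Longrightarrow> upval \<Lambda> d m 1 = (\<Sum>K\<in>level l. upval \<Lambda> d m K)"
proof (induction l)
  case (Suc l)
  have "(\<Sum>K\<in>level l. upval \<Lambda> d m K) = (\<Sum>K\<in>level l. upval \<Lambda> d m (2 * K) + upval \<Lambda> d m (2 * K + 1))"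
    using Suc.prems by (intro sum.cong upval_add) (auto simp: level_iff)
  thus ?case using Suc by (simp add: sum_level_Suc)
qed simp

lemma limval_level: "limval \<Lambda> d 1 = (\<Sum>K\<in>level l. limval \<Lambda> d K)"
proof (induction l)
  case (Suc l)
  have "(\<Sum>K\<in>level l. limval \<Lambda> d K) = (\<Sum>K\<in>level l. limval \<Lambda> d (2 * K) + limval \<Lambda> d (2 * K + 1))"
    by (intro sum.cong limval_add) (auto simp: level_iff)
  thus ?case using Suc by (simp add: sum_level_Suc)
qed simp

lemma limval_Part: "Part K P \<Longrightarrow> K \<ge> 1 \<Longrightarrow> (\<Sum>L\<in>P. limval \<Lambda> d L) = limval \<Lambda> d K"
proof (induction rule: Part.induct)
  case (Part_split K P Q)
  have P: "finite P" "\<forall>L\<in>P. under L (2 * K)" using Part_props[OF Part_split(1)] Part_split.prems by auto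
  have Q: "finite Q" "\<forall>L\<in>Q. under L (Suc (2 * K))" using Part_props[OF Part_split(2)] Part_split.prems by auto
  have "P \<inter> Q = {}" using P(2) Q(2) not_under_sib[OF Part_split.prems] by blast
  thus ?case using P Q Part_split limval_add[OF Part_split.prems] by (simp add: sum.union_disjoint)
qed simp

end

lemma limval_cong:
  assumes "K \<ge> 1" "\<And>L. under L K \<Longrightarrow> d L = d' L"
  shows "limval \<Lambda> d K = limval \<Lambda> d' K"
proof -
  have "val d P = val d' P" if "P \<in> parts \<Lambda> m K" for P m
    unfolding val_def using that Part_props[OF _ assms(1)] assms(2) by (intro sum.cong) (auto simp: parts_def)
  hence "upval \<Lambda> d m K = upval \<Lambda> d' m K" for m unfolding upval_def by (intro SUP_cong) auto
  thus ?thesis by (simp add: limval_def)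
qed

lemma sum_refine:
  fixes f :: "nat \<Rightarrow> 'c::comm_monoid_add"
  assumes "antichain P" "\<And>K. K \<in> P \<Longrightarrow> Part K (p K)"
  shows "sum f (\<Union> (p ` P)) = (\<Sum>K\<in>P. sum f (p K))"
proof (rule sum.UNION_disjoint)
  have P: "finite P" "\<And>K. K \<in> P \<Longrightarrow> K \<ge> 1" using assms(1) by (auto simp: antichain_def)
  have pp: "finite (p K)" "\<And>L. L \<in> p K \<Longrightarrow> under L K" if "K \<in> P" for K using Part_props[OF assms(2) P(2)] that by auto
  show "finite P" by (rule P)
  show "\<forall>i\<in>P. finite (p i)" using pp by blast
  show "\<forall>i\<in>P. \<forall>j\<in>P. i \<noteq> j \<longrightarrow> p i \<inter> p j = {}" using pp(2) antichain_leaf_unique[OF assms(1)] by blast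
qed

text \<open>On one late level \<open>m\<close> in \<open>\<Lambda>\<close> the intervals are sorted
  by the sign of \<open>d\<close>. With the right sign, \<open>upval\<close> of an interval is at
  least its weight times \<open>\<delta>\<close>, and replacing \<open>upval\<close> by
  \<open>limval\<close> costs at most \<open>\<eta>\<close> in total, as the differences are
  nonnegative and add up over the level. One of the two signs carries at least half of the
  weight.\<close>

lemma signed_selection:
  assumes "infinite \<Lambda>" "\<And>L. \<bar>d L\<bar> \<le> D" "\<And>L. L \<ge> 1 \<Longrightarrow> \<bar>d L\<bar> \<ge> \<delta>" "\<eta> > 0"
  shows "\<exists>m S \<sigma>. S \<subseteq> level m \<and> (\<sigma> = 1 \<or> \<sigma> = -1) \<and> \<delta> / 2 - \<eta> \<le> limval \<Lambda> (\<lambda>K. if \<exists>L\<in>S. under K L then \<sigma> * d K else 0) 1"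
proof -
  let ?d = "\<lambda>\<sigma> L. \<sigma> * d L"
  have bd: "\<bar>?d \<sigma> L\<bar> \<le> D" if "\<bar>\<sigma>\<bar> = 1" for \<sigma> L using assms(2)[of L] that by (simp add: abs_mult)
  have ev: "\<forall>\<^sub>F m in sequentially. upval \<Lambda> (?d \<sigma>) m 1 < limval \<Lambda> (?d \<sigma>) 1 + \<eta>" if "\<bar>\<sigma>\<bar> = 1" for \<sigma> :: real
    using assms(4) by (intro order_tendstoD(2)[OF upval_lim[OF assms(1) bd[OF that]]]) auto
  obtain m0 where m0: "\<And>m. m \<ge> m0 \<Longrightarrow> upval \<Lambda> (?d 1) m 1 < limval \<Lambda> (?d 1) 1 + \<eta> \<and> upval \<Lambda> (?d (-1)) m 1 < limval \<Lambda> (?d (-1)) 1 + \<eta>"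
    using eventually_conj[OF ev[of 1] ev[of "-1"]] unfolding eventually_sequentially by auto
  obtain m where m: "m \<in> \<Lambda>" "m \<ge> m0" using assms(1) unfolding infinite_nat_iff_unbounded_le by blast
  define S where "S \<sigma> = {K \<in> level m. if \<sigma> = (1::real) then d K > 0 else \<not> d K > 0}" for \<sigma>
  have low: "(\<Sum>K\<in>S \<sigma>. limval \<Lambda> (?d \<sigma>) K) \<ge> (\<Sum>K\<in>S \<sigma>. wt K * \<delta>) - \<eta>" if s: "\<sigma> = 1 \<or> \<sigma> = -1" for \<sigma>
  proof -
    have s1: "\<bar>\<sigma>\<bar> = 1" using s by auto
    have sub: "S \<sigma> \<subseteq> level m" by (auto simp: S_def)
    have gap: "0 \<le> upval \<Lambda> (?d \<sigma>) m K - limval \<Lambda> (?d \<sigma>) K" if "K \<in> level m" for K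
      using limval_le[where d = "?d \<sigma>" and m = m, OF assms(1) bd[OF s1] level_pos[OF that]] by simp
    have "(\<Sum>K\<in>S \<sigma>. upval \<Lambda> (?d \<sigma>) m K - limval \<Lambda> (?d \<sigma>) K) \<le> (\<Sum>K\<in>level m. upval \<Lambda> (?d \<sigma>) m K - limval \<Lambda> (?d \<sigma>) K)"
      using gap sub by (intro sum_mono2) auto
    also have "\<dots> = upval \<Lambda> (?d \<sigma>) m 1 - limval \<Lambda> (?d \<sigma>) 1"
      using upval_level[where d = "?d \<sigma>" and l = m and m = m, OF assms(1) bd[OF s1]] limval_level[where d = "?d \<sigma>" and l = m, OF assms(1) bd[OF s1]] by (simp add: sum_subtractf)
    also have "\<dots> \<le> \<eta>" using m0[OF m(2)] s by auto
    finally have 1: "(\<Sum>K\<in>S \<sigma>. upval \<Lambda> (?d \<sigma>) m K) - \<eta> \<le> (\<Sum>K\<in>S \<sigma>. limval \<Lambda> (?d \<sigma>) K)" by (simp add: sum_subtractf)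
    have "(\<Sum>K\<in>S \<sigma>. wt K * \<delta>) \<le> (\<Sum>K\<in>S \<sigma>. upval \<Lambda> (?d \<sigma>) m K)"
    proof (rule sum_mono)
      fix K assume K: "K \<in> S \<sigma>"
      hence Kl: "K \<in> level m" "K \<ge> 1" using sub level_pos by auto
      \<comment> \<open>The one-element partition is admissible because \<open>m\<close> itself was
        taken from \<open>\<Lambda>\<close>.\<close>
      have "{K} \<in> parts \<Lambda> m K" using Part_self m Kl by (auto simp: parts_def level_iff)
      hence "val (?d \<sigma>) {K} \<le> upval \<Lambda> (?d \<sigma>) m K" by (rule val_le_upval[where d = "?d \<sigma>", OF assms(1) bd[OF s1] Kl(2)])
      moreover have "\<delta> \<le> \<sigma> * d K" using assms(3)[OF Kl(2)] K s by (auto simp: S_def split: if_splits)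
      ultimately show "wt K * \<delta> \<le> upval \<Lambda> (?d \<sigma>) m K"
        using order_trans[OF mult_left_mono[of \<delta> "\<sigma> * d K" "wt K", OF _ wt_nonneg]] unfolding val_def by simp
    qed
    thus ?thesis using 1 by simp
  qed
  have "(\<Sum>K\<in>S 1. wt K * \<delta>) + (\<Sum>K\<in>S (-1). wt K * \<delta>) = (\<Sum>K\<in>level m. wt K * \<delta>)"
  proof -
    have "level m = S 1 \<union> S (-1)" "S 1 \<inter> S (-1) = {}" "finite (S 1)" "finite (S (-1))" by (auto simp: S_def)
    thus ?thesis by (simp add: sum.union_disjoint)
  qed
  also have "\<dots> = \<delta>"
  proof -
    have "(\<Sum>K\<in>level m. wt K * \<delta>) = (\<Sum>K\<in>level m. \<delta> / 2 ^ m)" by (intro sum.cong) (auto simp: wt_def level_iff)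
    thus ?thesis by simp
  qed
  finally have tot: "(\<Sum>K\<in>S 1. wt K * \<delta>) + (\<Sum>K\<in>S (-1). wt K * \<delta>) = \<delta>" .
  obtain \<sigma> where s: "\<sigma> = 1 \<or> \<sigma> = -1" "(\<Sum>K\<in>S \<sigma>. wt K * \<delta>) \<ge> \<delta> / 2"
  proof (cases "(\<Sum>K\<in>S 1. wt K * \<delta>) \<ge> \<delta> / 2")
    case False
    hence "(\<Sum>K\<in>S (-1). wt K * \<delta>) \<ge> \<delta> / 2" using tot by linarith
    thus ?thesis using that by blast
  qed (use that in blast)
  have s1: "\<bar>\<sigma>\<bar> = 1" using s by auto
  have sub: "S \<sigma> \<subseteq> level m" by (auto simp: S_def)
  let ?dd = "\<lambda>K. if \<exists>L\<in>S \<sigma>. under K L then \<sigma> * d K else 0"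
  have bdd: "\<bar>?dd L\<bar> \<le> D" for L using bd[OF s1, of L] abs_ge_zero[of "\<sigma> * d L"] by (auto simp del: abs_ge_zero intro: order_trans)
  have "limval \<Lambda> ?dd 1 = (\<Sum>K\<in>level m. limval \<Lambda> ?dd K)" by (rule limval_level[OF assms(1) bdd])
  also have "\<dots> = (\<Sum>K\<in>level m. if K \<in> S \<sigma> then limval \<Lambda> (?d \<sigma>) K else 0)"
  proof (intro sum.cong refl)
    fix K assume K: "K \<in> level m"
    show "limval \<Lambda> ?dd K = (if K \<in> S \<sigma> then limval \<Lambda> (?d \<sigma>) K else 0)"
    proof (cases "K \<in> S \<sigma>")
      case True
      have "limval \<Lambda> ?dd K = limval \<Lambda> (?d \<sigma>) K" using True by (intro limval_cong level_pos[OF K]) auto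
      thus ?thesis using True by simp
    next
      case False
      have "limval \<Lambda> ?dd K = limval \<Lambda> (\<lambda>_. 0) K"
      proof (intro limval_cong level_pos[OF K])
        fix L assume L: "under L K"
        have "\<not> under L L'" if "L' \<in> S \<sigma>" for L'
        proof
          assume "under L L'"
          moreover have "L' \<in> level m" using sub that by blast
          ultimately have "K = L'" using under_same_lev[OF L] K by (auto simp: level_iff)
          thus False using False that by simp
        qed
        thus "?dd L = 0" by auto
      qed
      also have "\<dots> = 0" using limval_bound[OF assms(1), of "\<lambda>_. 0" 0, OF _ level_pos[OF K]] by simp
      finally show ?thesis using False by simp
    qed
  qed
  also have "\<dots> = (\<Sum>K\<in>S \<sigma>. limval \<Lambda> (?d \<sigma>) K)"
    using sub by (simp add: sum.inter_restrict[symmetric] Int_absorb1)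
  finally have "\<delta> / 2 - \<eta> \<le> limval \<Lambda> ?dd 1" using low[OF s(1)] s(2) by simp
  thus ?thesis using sub s(1) by blast
qed

section \<open>Construction of an almost constant diagonal\<close>

text \<open>\<open>t\<close> is the matrix of an operator in the Haar basis and \<open>\<Lambda>\<close> a set of levels between which it is almost zero.\<close>

locale almost_diagonal =
  fixes t :: "nat \<Rightarrow> nat \<Rightarrow> real" and \<Lambda> :: "nat set" and \<omega> \<nu> :: "nat \<Rightarrow> real" and D :: real
  assumes inf: "infinite \<Lambda>"
    and diag_le: "\<And>K. \<bar>t K K\<bar> \<le> D"
    and om_nonneg: "\<And>l. \<omega> l \<ge> 0" and om_sum: "summable \<omega>"
    and nu_nonneg: "\<And>l. \<nu> l \<ge> 0" and nu_sum: "summable \<nu>"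
    and same_level: "\<And>l. (\<Sum>K\<in>level l. \<Sum>L\<in>level l. (wt K * t K L)\<^sup>2) \<le> \<nu> l"
    and cross_level: "\<And>l l'. l \<in> \<Lambda> \<Longrightarrow> l' \<in> \<Lambda> \<Longrightarrow> l \<noteq> l' \<Longrightarrow>
      (\<Sum>K\<in>level l. \<Sum>L\<in>level l'. wt K * \<bar>t K L\<bar>) \<le> \<omega> l * \<omega> l'"
begin

definition cut :: "nat set \<Rightarrow> nat \<Rightarrow> real" where "cut S K = (if \<exists>L\<in>S. under K L then 1 else 0)"

lemma cut_bound: "\<bar>cut S K\<bar> \<le> 1" "0 \<le> cut S K" by (auto simp: cut_def)

lemma sum_by_level:
  fixes f :: "nat \<Rightarrow> real"
  assumes "finite P" "\<And>K. K \<in> P \<Longrightarrow> K \<ge> 1"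
  shows "sum f P = (\<Sum>l\<in>lev ` P. \<Sum>K\<in>P \<inter> level l. f K)"
proof -
  have "sum f P = (\<Sum>l\<in>lev ` P. \<Sum>K\<in>{K \<in> P. lev K = l}. f K)"
    by (rule sum.group[symmetric]) (use assms in auto)
  also have "\<dots> = (\<Sum>l\<in>lev ` P. \<Sum>K\<in>P \<inter> level l. f K)"
    using assms(2) by (intro sum.cong refl) (auto simp: level_iff)
  finally show ?thesis .
qed

text \<open>Everything becomes small on late levels of \<open>\<Lambda>\<close>: the tails of
  \<open>\<omega>\<close> and \<open>\<nu>\<close>, the distance from \<open>upval\<close> to
  \<open>limval\<close>, and the variance of the imbalance between halves, which is at most
  \<open>D\<^sup>2\<close> times the largest weight of a block.\<close>

lemma step:
  fixes S :: "nat set"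
  assumes "antichain P" "P \<noteq> {}" "sum wt P \<le> 1" "\<xi> > 0" "\<bar>\<sigma>\<bar> = 1"
  defines "d \<equiv> \<lambda>K. cut S K * (\<sigma> * t K K)"
  shows "\<exists>B A. refine P B \<and> antichain B \<and> sum wt B = sum wt P \<and> lev ` B \<subseteq> \<Lambda> \<inter> {m..} \<and> (\<Sum>l\<in>lev ` B. \<omega> l) \<le> \<xi> \<and>
     \<bar>val d B - (\<Sum>K\<in>P. limval \<Lambda> d K)\<bar> \<le> \<xi> \<and> \<bar>offdiag B (\<lambda>K L. cut S K * (wt K * t K L)) A\<bar> \<le> \<xi> \<and>
     \<bar>\<Sum>K\<in>B. sg A K * (limval \<Lambda> d (2 * K) - limval \<Lambda> d (2 * K + 1))\<bar> \<le> \<xi>"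
proof -
  have db: "\<bar>d K\<bar> \<le> D" for K
    using mult_mono[OF cut_bound(1)[of S K] diag_le[of K]] assms(5) by (simp add: d_def abs_mult)
  have P: "finite P" "\<And>K. K \<in> P \<Longrightarrow> K \<ge> 1" using assms(1) by (auto simp: antichain_def)
  have cP: "card P > 0" using P(1) assms(2) by (simp add: card_gt_0_iff)
  \<comment> \<open>The bound 1 makes the product of two tails of \<open>\<omega>\<close> at most
    \<open>\<eta>\<close>; the bound \<open>\<xi> / 2\<close> leaves room for two errors of size
    \<open>\<eta>\<close> in the off-diagonal sum.\<close>
  define \<eta> where "\<eta> = min 1 (\<xi> / 2)"
  have \<eta>: "\<eta> > 0" "\<eta> \<le> 1" "\<eta> \<le> \<xi> / 2" using assms(4) by (auto simp: \<eta>_def)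
  obtain m1 where m1: "\<And>F. finite F \<Longrightarrow> F \<subseteq> {m1..} \<Longrightarrow> sum \<omega> F \<le> \<eta>"
    using summable_tail_small[OF om_sum om_nonneg \<eta>(1)] by blast
  have \<eta>2: "\<eta>\<^sup>2 / 4 > 0" using \<eta>(1) by simp
  obtain m2 where m2: "\<And>F. finite F \<Longrightarrow> F \<subseteq> {m2..} \<Longrightarrow> sum \<nu> F \<le> \<eta>\<^sup>2 / 4"
    using summable_tail_small[OF nu_sum nu_nonneg \<eta>2] by blast
  have "(\<lambda>n. D\<^sup>2 * (1 / 2) ^ n) \<longlonglongrightarrow> D\<^sup>2 * 0" by (intro tendsto_mult tendsto_const LIMSEQ_power_zero) simp
  hence "\<forall>\<^sub>F n in sequentially. D\<^sup>2 * (1 / 2) ^ n < \<eta>\<^sup>2 / 2" using \<eta>2 by (intro order_tendstoD(2)[of _ "D\<^sup>2 * 0"]) auto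
  then obtain m3 where m3: "\<And>n. n \<ge> m3 \<Longrightarrow> D\<^sup>2 * (1 / 2) ^ n < \<eta>\<^sup>2 / 2" by (auto simp: eventually_sequentially)
  have "\<forall>\<^sub>F n in sequentially. upval \<Lambda> d n K < limval \<Lambda> d K + \<xi> / card P" if "K \<in> P" for K
    using assms(4) cP by (intro order_tendstoD(2)[OF upval_lim[OF inf db P(2)[OF that]]]) auto
  hence "\<forall>\<^sub>F n in sequentially. \<forall>K\<in>P. upval \<Lambda> d n K < limval \<Lambda> d K + \<xi> / card P"
    using P(1) by (simp add: eventually_ball_finite)
  then obtain m4 where m4: "\<And>n K. n \<ge> m4 \<Longrightarrow> K \<in> P \<Longrightarrow> upval \<Lambda> d n K < limval \<Lambda> d K + \<xi> / card P" by (auto simp: eventually_sequentially)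
  define M where "M = Max {m, m1, m2, m3, m4}"
  have M: "m \<le> M" "m1 \<le> M" "m2 \<le> M" "m3 \<le> M" "m4 \<le> M" by (auto simp: M_def)
  have "\<exists>Q\<in>parts \<Lambda> M K. upval \<Lambda> d M K - \<xi> / card P < val d Q" if "K \<in> P" for K
    using upval_near[where d = d and K = K and \<epsilon> = "\<xi> / card P" and m = M, OF inf db P(2)[OF that]] assms(4) cP by simp
  then obtain p where p: "\<And>K. K \<in> P \<Longrightarrow> p K \<in> parts \<Lambda> M K" "\<And>K. K \<in> P \<Longrightarrow> upval \<Lambda> d M K - \<xi> / card P < val d (p K)" by metis
  define B where "B = \<Union> (p ` P)"
  have pP: "Part K (p K)" if "K \<in> P" for K using p(1)[OF that] by (simp add: parts_def)
  have ref: "refine P B" unfolding refine_def B_def using pP by blast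
  have B: "antichain B" "sum wt B = sum wt P" using antichain_refine[OF assms(1) ref] by auto
  have B': "finite B" "\<And>K. K \<in> B \<Longrightarrow> K \<ge> 1" using B(1) by (auto simp: antichain_def)
  have lB: "lev ` B \<subseteq> \<Lambda> \<inter> {M..}" using p(1) by (auto simp: B_def parts_def)
  have lBM: "M \<le> lev K" if "K \<in> B" for K using lB that by auto
  have om: "(\<Sum>l\<in>lev ` B. \<omega> l) \<le> \<eta>" using B'(1) lB M by (intro m1) auto
  have nu: "(\<Sum>l\<in>lev ` B. \<nu> l) \<le> \<eta>\<^sup>2 / 4" using B'(1) lB M by (intro m2) auto
  have valB: "\<bar>val d B - (\<Sum>K\<in>P. limval \<Lambda> d K)\<bar> \<le> \<xi>"
  proof -
    have "val d B = (\<Sum>K\<in>P. val d (p K))" unfolding val_def B_def by (rule sum_refine[OF assms(1) pP])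
    hence "val d B - (\<Sum>K\<in>P. limval \<Lambda> d K) = (\<Sum>K\<in>P. val d (p K) - limval \<Lambda> d K)" by (simp add: sum_subtractf)
    also have "\<bar>\<dots>\<bar> \<le> (\<Sum>K\<in>P. \<bar>val d (p K) - limval \<Lambda> d K\<bar>)" by (rule sum_abs)
    also have "\<dots> \<le> (\<Sum>K\<in>P. \<xi> / card P)"
    proof (rule sum_mono)
      fix K assume K: "K \<in> P"
      have "val d (p K) \<le> upval \<Lambda> d M K" by (rule val_le_upval[OF inf db P(2)[OF K] p(1)[OF K]])
      moreover have "limval \<Lambda> d K \<le> upval \<Lambda> d M K" by (rule limval_le[OF inf db P(2)[OF K]])
      ultimately show "\<bar>val d (p K) - limval \<Lambda> d K\<bar> \<le> \<xi> / card P" using p(2)[OF K] m4[OF M(5) K] by linarith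
    qed
    also have "\<dots> = \<xi>" using cP by simp
    finally show ?thesis .
  qed
  \<comment> \<open>Only the entries within one level are entrusted to random signs. Those between
    different levels are absolutely small by \<open>cross_level\<close> and are added back in
    \<open>diff\<close>.\<close>
  define x where "x K L = (if lev K = lev L then cut S K * (wt K * t K L) else 0)" for K L
  define y where "y K = limval \<Lambda> d (2 * K) - limval \<Lambda> d (2 * K + 1)" for K
  have xs: "(\<Sum>K\<in>B. \<Sum>L\<in>B. (x K L)\<^sup>2) \<le> \<eta>\<^sup>2 / 4"
  proof -
    have "(\<Sum>K\<in>B. \<Sum>L\<in>B. (x K L)\<^sup>2) = (\<Sum>l\<in>lev ` B. \<Sum>K\<in>B \<inter> level l. \<Sum>L\<in>B. (x K L)\<^sup>2)"
      by (rule sum_by_level[OF B'])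
    also have "\<dots> \<le> (\<Sum>l\<in>lev ` B. \<nu> l)"
    proof (rule sum_mono)
      fix l
      have "(\<Sum>K\<in>B \<inter> level l. \<Sum>L\<in>B. (x K L)\<^sup>2) \<le> (\<Sum>K\<in>B \<inter> level l. \<Sum>L\<in>level l. (wt K * t K L)\<^sup>2)"
      proof (rule sum_mono)
        fix K assume K: "K \<in> B \<inter> level l"
        have "(\<Sum>L\<in>B. (x K L)\<^sup>2) = (\<Sum>L\<in>B \<inter> level l. (x K L)\<^sup>2)"
          using B' K by (intro sum.mono_neutral_right) (auto simp: x_def level_iff)
        also have "\<dots> \<le> (\<Sum>L\<in>B \<inter> level l. (wt K * t K L)\<^sup>2)"
          by (intro sum_mono) (auto simp: x_def cut_def)
        also have "\<dots> \<le> (\<Sum>L\<in>level l. (wt K * t K L)\<^sup>2)" by (intro sum_mono2) auto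
        finally show "(\<Sum>L\<in>B. (x K L)\<^sup>2) \<le> (\<Sum>L\<in>level l. (wt K * t K L)\<^sup>2)" .
      qed
      also have "\<dots> \<le> (\<Sum>K\<in>level l. \<Sum>L\<in>level l. (wt K * t K L)\<^sup>2)" by (intro sum_mono2 sum_nonneg) auto
      finally show "(\<Sum>K\<in>B \<inter> level l. \<Sum>L\<in>B. (x K L)\<^sup>2) \<le> \<nu> l" using same_level[of l] by simp
    qed
    finally show ?thesis using nu by simp
  qed
  have ys: "(\<Sum>K\<in>B. (y K)\<^sup>2) \<le> \<eta>\<^sup>2 / 2"
  proof -
    have "(\<Sum>K\<in>B. (y K)\<^sup>2) \<le> (\<Sum>K\<in>B. D\<^sup>2 * (1 / 2) ^ M * wt K)"
    proof (rule sum_mono)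
      fix K assume K: "K \<in> B"
      have K1: "K \<ge> 1" using B'(2)[OF K] .
      have "\<bar>y K\<bar> \<le> D * wt (2 * K) + D * wt (2 * K + 1)"
        using limval_bound[where d = d and K = "2 * K", OF inf db] limval_bound[where d = d and K = "2 * K + 1", OF inf db] K1 unfolding y_def by linarith
      hence yK: "\<bar>y K\<bar> \<le> D * wt K" using K1 by simp
      have "(2::real) ^ M \<le> 2 ^ lev K" using lBM[OF K] by (intro power_increasing) auto
      hence wM: "wt K \<le> (1 / 2) ^ M" by (simp add: wt_def power_one_over frac_le)
      have "(y K)\<^sup>2 \<le> (D * wt K)\<^sup>2" using power_mono[OF yK, of 2] by simp
      also have "\<dots> = D\<^sup>2 * wt K * wt K" by (simp add: power2_eq_square)
      also have "\<dots> \<le> D\<^sup>2 * (1 / 2) ^ M * wt K" using wM by (intro mult_right_mono mult_left_mono) auto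
      finally show "(y K)\<^sup>2 \<le> D\<^sup>2 * (1 / 2) ^ M * wt K" .
    qed
    also have "\<dots> = D\<^sup>2 * (1 / 2) ^ M * sum wt P" using B(2) by (simp flip: sum_distrib_left)
    also have "\<dots> \<le> D\<^sup>2 * (1 / 2) ^ M * 1" using assms(3) by (intro mult_left_mono) auto
    finally show ?thesis using m3[OF M(4)] by simp
  qed
  \<comment> \<open>The right-hand side is at most
    \<open>2 * (\<eta>\<^sup>2 / 4) + \<eta>\<^sup>2 / 2\<close>, that is
    \<open>\<eta>\<^sup>2\<close>, which explains the thresholds behind \<open>m2\<close> and
    \<open>m3\<close>.\<close>
  obtain A where A: "(offdiag B x A)\<^sup>2 + (\<Sum>K\<in>B. sg A K * y K)\<^sup>2 \<le> 2 * (\<Sum>K\<in>B. \<Sum>L\<in>B. (x K L)\<^sup>2) + (\<Sum>K\<in>B. (y K)\<^sup>2)"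
    using good_signs[OF B'(1)] by blast
  hence A2: "(offdiag B x A)\<^sup>2 + (\<Sum>K\<in>B. sg A K * y K)\<^sup>2 \<le> \<eta>\<^sup>2" using xs ys by linarith
  have "(offdiag B x A)\<^sup>2 \<le> \<eta>\<^sup>2" "(\<Sum>K\<in>B. sg A K * y K)\<^sup>2 \<le> \<eta>\<^sup>2"
    using A2 zero_le_power2[of "offdiag B x A"] zero_le_power2[of "\<Sum>K\<in>B. sg A K * y K"] by linarith+
  hence A3: "\<bar>offdiag B x A\<bar> \<le> \<eta>" "\<bar>\<Sum>K\<in>B. sg A K * y K\<bar> \<le> \<eta>" using \<eta>(1) by (auto simp: abs_le_square_iff[symmetric])
  have diff: "\<bar>offdiag B (\<lambda>K L. cut S K * (wt K * t K L)) A - offdiag B x A\<bar> \<le> \<eta>"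
  proof -
    have "offdiag B (\<lambda>K L. cut S K * (wt K * t K L)) A - offdiag B x A
        = (\<Sum>K\<in>B. \<Sum>L\<in>B - {K}. sg A K * sg A L * (cut S K * (wt K * t K L) - x K L))"
      unfolding offdiag_def by (simp add: sum_subtractf right_diff_distrib)
    also have "\<bar>\<dots>\<bar> \<le> (\<Sum>K\<in>B. \<Sum>L\<in>B - {K}. \<bar>sg A K * sg A L * (cut S K * (wt K * t K L) - x K L)\<bar>)"
      by (rule order_trans[OF sum_abs sum_mono[OF sum_abs]])
    also have "\<dots> \<le> (\<Sum>K\<in>B. \<Sum>L\<in>B. if lev K = lev L then 0 else wt K * \<bar>t K L\<bar>)"
    proof (rule sum_mono)
      fix K assume K: "K \<in> B"
      have "(\<Sum>L\<in>B - {K}. \<bar>sg A K * sg A L * (cut S K * (wt K * t K L) - x K L)\<bar>) \<le> (\<Sum>L\<in>B - {K}. if lev K = lev L then 0 else wt K * \<bar>t K L\<bar>)"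
        by (intro sum_mono) (auto simp: abs_mult x_def cut_def)
      also have "\<dots> \<le> (\<Sum>L\<in>B. if lev K = lev L then 0 else wt K * \<bar>t K L\<bar>)" using B'(1) by (intro sum_mono2) auto
      finally show "(\<Sum>L\<in>B - {K}. \<bar>sg A K * sg A L * (cut S K * (wt K * t K L) - x K L)\<bar>) \<le> (\<Sum>L\<in>B. if lev K = lev L then 0 else wt K * \<bar>t K L\<bar>)" .
    qed
    also have "\<dots> = (\<Sum>l\<in>lev ` B. \<Sum>K\<in>B \<inter> level l. \<Sum>l'\<in>lev ` B. \<Sum>L\<in>B \<inter> level l'. if lev K = lev L then 0 else wt K * \<bar>t K L\<bar>)"
    proof -
      have "(\<Sum>K\<in>B. \<Sum>L\<in>B. if lev K = lev L then 0 else wt K * \<bar>t K L\<bar>) = (\<Sum>l\<in>lev ` B. \<Sum>K\<in>B \<inter> level l. \<Sum>L\<in>B. if lev K = lev L then 0 else wt K * \<bar>t K L\<bar>)"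
        by (rule sum_by_level[OF B'])
      also have "\<dots> = (\<Sum>l\<in>lev ` B. \<Sum>K\<in>B \<inter> level l. \<Sum>l'\<in>lev ` B. \<Sum>L\<in>B \<inter> level l'. if lev K = lev L then 0 else wt K * \<bar>t K L\<bar>)"
        by (intro sum.cong refl sum_by_level[OF B'])
      finally show ?thesis .
    qed
    also have "\<dots> = (\<Sum>l\<in>lev ` B. \<Sum>l'\<in>lev ` B. \<Sum>K\<in>B \<inter> level l. \<Sum>L\<in>B \<inter> level l'. if lev K = lev L then 0 else wt K * \<bar>t K L\<bar>)"
      by (intro sum.cong refl sum.swap)
    also have "\<dots> \<le> (\<Sum>l\<in>lev ` B. \<Sum>l'\<in>lev ` B. \<omega> l * \<omega> l')"
    proof (intro sum_mono)
      fix l l' assume l: "l \<in> lev ` B" "l' \<in> lev ` B"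
      show "(\<Sum>K\<in>B \<inter> level l. \<Sum>L\<in>B \<inter> level l'. if lev K = lev L then 0 else wt K * \<bar>t K L\<bar>) \<le> \<omega> l * \<omega> l'"
      proof (cases "l = l'")
        case True
        have "(\<Sum>K\<in>B \<inter> level l. \<Sum>L\<in>B \<inter> level l'. if lev K = lev L then 0 else wt K * \<bar>t K L\<bar>) = 0"
          using True by (intro sum.neutral ballI) (auto simp: level_iff)
        thus ?thesis using om_nonneg by simp
      next
        case False
        have "(\<Sum>K\<in>B \<inter> level l. \<Sum>L\<in>B \<inter> level l'. if lev K = lev L then 0 else wt K * \<bar>t K L\<bar>) \<le> (\<Sum>K\<in>level l. \<Sum>L\<in>level l'. wt K * \<bar>t K L\<bar>)"
        proof -
          have "(\<Sum>K\<in>B \<inter> level l. \<Sum>L\<in>B \<inter> level l'. if lev K = lev L then 0 else wt K * \<bar>t K L\<bar>) \<le> (\<Sum>K\<in>B \<inter> level l. \<Sum>L\<in>level l'. wt K * \<bar>t K L\<bar>)"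
          proof (rule sum_mono)
            fix K
            have "(\<Sum>L\<in>B \<inter> level l'. if lev K = lev L then 0 else wt K * \<bar>t K L\<bar>) \<le> (\<Sum>L\<in>B \<inter> level l'. wt K * \<bar>t K L\<bar>)" by (intro sum_mono) auto
            also have "\<dots> \<le> (\<Sum>L\<in>level l'. wt K * \<bar>t K L\<bar>)" by (intro sum_mono2) auto
            finally show "(\<Sum>L\<in>B \<inter> level l'. if lev K = lev L then 0 else wt K * \<bar>t K L\<bar>) \<le> (\<Sum>L\<in>level l'. wt K * \<bar>t K L\<bar>)" .
          qed
          also have "\<dots> \<le> (\<Sum>K\<in>level l. \<Sum>L\<in>level l'. wt K * \<bar>t K L\<bar>)" by (intro sum_mono2 sum_nonneg) auto
          finally show ?thesis .
        qed
        also have "\<dots> \<le> \<omega> l * \<omega> l'" using l lB False by (intro cross_level) auto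
        finally show ?thesis .
      qed
    qed
    also have "\<dots> = (\<Sum>l\<in>lev ` B. \<omega> l) * (\<Sum>l\<in>lev ` B. \<omega> l)" by (simp add: sum_product)
    also have "\<dots> \<le> \<eta> * 1" using om \<eta> by (intro mult_mono) (auto intro: sum_nonneg om_nonneg)
    finally show ?thesis by simp
  qed
  have "refine P B \<and> antichain B \<and> sum wt B = sum wt P \<and> lev ` B \<subseteq> \<Lambda> \<inter> {m..}" using ref B lB M(1) by auto
  moreover have "(\<Sum>l\<in>lev ` B. \<omega> l) \<le> \<xi>" using om \<eta> assms(4) by linarith
  moreover have "\<bar>offdiag B (\<lambda>K L. cut S K * (wt K * t K L)) A\<bar> \<le> \<xi>" using diff A3(1) \<eta>(3) by linarith
  moreover have "\<bar>\<Sum>K\<in>B. sg A K * (limval \<Lambda> d (2 * K) - limval \<Lambda> d (2 * K + 1))\<bar> \<le> \<xi>"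
    using A3(2) \<eta>(3) assms(4) unfolding y_def by linarith
  ultimately show ?thesis using valB by blast
qed

text \<open>The diagonal entry at \<open>I\<close> of the operator compressed to the system
  \<open>B\<close>, \<open>\<Theta>\<close>: embed, apply \<open>t\<close>, restrict to
  \<open>S\<close> with sign \<open>\<sigma>\<close>, and take the adjoint of the embedding, whose
  coefficients are normalised by \<open>wt I\<close>.\<close>

definition entry :: "nat set \<Rightarrow> real \<Rightarrow> (nat \<Rightarrow> nat set) \<Rightarrow> (nat \<Rightarrow> nat set) \<Rightarrow> nat \<Rightarrow> real" where
  "entry S \<sigma> B \<Theta> I = \<sigma> / wt I * (\<Sum>K\<in>B I. \<Sum>L\<in>B I. cut S K * (sg (\<Theta> I) K * sg (\<Theta> I) L * (wt K * t K L)))"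

lemma entry_eq:
  assumes "finite (B I)"
  shows "entry S \<sigma> B \<Theta> I = (val (\<lambda>K. cut S K * (\<sigma> * t K K)) (B I) + \<sigma> * offdiag (B I) (\<lambda>K L. cut S K * (wt K * t K L)) (\<Theta> I)) / wt I"
proof -
  have "(\<Sum>L\<in>B I. cut S K * (sg (\<Theta> I) K * sg (\<Theta> I) L * (wt K * t K L)))
     = cut S K * (wt K * t K K) + (\<Sum>L\<in>B I - {K}. sg (\<Theta> I) K * sg (\<Theta> I) L * (cut S K * (wt K * t K L)))" if "K \<in> B I" for K
    using sum.remove[OF assms that, of "\<lambda>L. cut S K * (sg (\<Theta> I) K * sg (\<Theta> I) L * (wt K * t K L))"] by (simp add: mult_ac)
  hence "(\<Sum>K\<in>B I. \<Sum>L\<in>B I. cut S K * (sg (\<Theta> I) K * sg (\<Theta> I) L * (wt K * t K L)))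
     = (\<Sum>K\<in>B I. cut S K * (wt K * t K K)) + offdiag (B I) (\<lambda>K L. cut S K * (wt K * t K L)) (\<Theta> I)"
    by (simp add: sum.distrib offdiag_def)
  moreover have "val (\<lambda>K. cut S K * (\<sigma> * t K K)) (B I) = \<sigma> * (\<Sum>K\<in>B I. cut S K * (wt K * t K K))"
    unfolding val_def sum_distrib_left by (intro sum.cong) auto
  ultimately show ?thesis by (simp add: entry_def distrib_left add_divide_distrib)
qed

text \<open>The entry at \<open>I\<close> is close to \<open>V I / wt I\<close>, the mean of
  \<open>limval\<close> over the support. Additivity of \<open>limval\<close> preserves this mean
  under refinement, and balanced signs almost preserve it on passing to a child.\<close>

theorem stable_diagonal:
  assumes "\<And>K. K \<ge> 1 \<Longrightarrow> \<bar>t K K\<bar> \<ge> \<delta>" "\<eta> > 0"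
  shows "\<exists>m S \<sigma> c B \<Theta>. S \<subseteq> level m \<and> (\<sigma> = 1 \<or> \<sigma> = -1) \<and> \<delta> / 2 - \<eta> \<le> c \<and> faithful B \<Theta> \<and>
    (\<forall>I\<ge>1. lev ` B I \<subseteq> \<Lambda> \<and> (\<Sum>l\<in>lev ` B I. \<omega> l) \<le> \<eta> * wt I / 2 ^ I) \<and>
    (\<forall>I\<ge>1. \<forall>J\<ge>1. I \<noteq> J \<longrightarrow> lev ` B I \<inter> lev ` B J = {}) \<and>
    \<bar>entry S \<sigma> B \<Theta> 1 - c\<bar> \<le> \<eta> \<and> (\<forall>n. (\<Sum>I\<in>nodes n - {1}. \<bar>entry S \<sigma> B \<Theta> I - entry S \<sigma> B \<Theta> (I div 2)\<bar>) \<le> \<eta>)"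
proof -
  obtain m S \<sigma> where S: "S \<subseteq> level m" and sig: "\<sigma> = 1 \<or> \<sigma> = -1"
    and lim: "\<delta> / 2 - \<eta> \<le> limval \<Lambda> (\<lambda>K. if \<exists>L\<in>S. under K L then \<sigma> * t K K else 0) 1"
    using signed_selection[OF inf, of "\<lambda>K. t K K" D \<delta> \<eta>] diag_le assms by blast
  define d where "d K = cut S K * (\<sigma> * t K K)" for K
  have s1: "\<bar>\<sigma>\<bar> = 1" using sig by auto
  have db: "\<bar>d K\<bar> \<le> D" for K
    using mult_mono[OF cut_bound(1)[of S K] diag_le[of K]] s1 by (simp add: d_def abs_mult)
  define c where "c = limval \<Lambda> d 1"
  have "(\<lambda>K. if \<exists>L\<in>S. under K L then \<sigma> * t K K else 0) = d" by (auto simp: d_def cut_def)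
  hence c: "\<delta> / 2 - \<eta> \<le> c" using lim by (simp add: c_def)
  \<comment> \<open>After division by \<open>wt I\<close> this is
    \<open>\<eta> / (8 * 4 ^ I)\<close>. The base 4 is needed because the error of a parent
    \<open>I\<close> is compared with \<open>2 ^ J\<close> for a child \<open>J\<close> near
    \<open>2 * I\<close>; the 8 absorbs the constants in \<open>drift\<close>.\<close>
  define \<xi> where "\<xi> I = \<eta> * wt I / (8 * 4 ^ I)" for I
  have xi: "\<xi> I > 0" for I using assms(2) by (simp add: \<xi>_def)
  let ?src = "\<lambda>f. source (\<lambda>I. fst (f I)) (\<lambda>I. snd (f I))"
  \<comment> \<open>All levels used for \<open>I\<close> exceed those used for smaller indices,
    which later makes the level sets disjoint. The index 0 is exempt, as it is no interval.\<close>
  define Good where "Good f I r \<longleftrightarrow> (I \<ge> 1 \<longrightarrow> refine (?src f I) (fst r) \<and> antichain (fst r) \<and> sum wt (fst r) = wt I \<and>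
     lev ` fst r \<subseteq> \<Lambda> \<and> (\<forall>J. 1 \<le> J \<and> J < I \<longrightarrow> (\<forall>K\<in>fst r. \<forall>L\<in>fst (f J). lev L < lev K)) \<and>
     (\<Sum>l\<in>lev ` fst r. \<omega> l) \<le> \<xi> I \<and> \<bar>val d (fst r) - (\<Sum>K\<in>?src f I. limval \<Lambda> d K)\<bar> \<le> \<xi> I \<and>
     \<bar>offdiag (fst r) (\<lambda>K L. cut S K * (wt K * t K L)) (snd r)\<bar> \<le> \<xi> I \<and>
     \<bar>\<Sum>K\<in>fst r. sg (snd r) K * (limval \<Lambda> d (2 * K) - limval \<Lambda> d (2 * K + 1))\<bar> \<le> \<xi> I)"
    for f :: "nat \<Rightarrow> nat set \<times> nat set" and I and r :: "nat set \<times> nat set"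
  have "\<exists>f. \<forall>I. Good f I (f I)"
  proof (rule dependent_wellorder_choice)
    fix r :: "nat set \<times> nat set" and f g :: "nat \<Rightarrow> nat set \<times> nat set" and I :: nat assume fg: "\<And>y. y < I \<Longrightarrow> f y = g y"
    have src: "?src f I = ?src g I" using fg[of "I div 2"] by (cases "I \<le> 1") (auto simp: source_def)
    have "(\<forall>J. 1 \<le> J \<and> J < I \<longrightarrow> (\<forall>K\<in>fst r. \<forall>L\<in>fst (f J). lev L < lev K)) \<longleftrightarrow> (\<forall>J. 1 \<le> J \<and> J < I \<longrightarrow> (\<forall>K\<in>fst r. \<forall>L\<in>fst (g J). lev L < lev K))"
      using fg by auto
    thus "Good f I r = Good g I r" unfolding Good_def src by (simp only:)
  next
    fix I :: nat and f :: "nat \<Rightarrow> nat set \<times> nat set" assume IH: "\<And>y. y < I \<Longrightarrow> Good f y (f y)"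
    show "\<exists>r. Good f I r"
    proof (cases "I \<ge> 1")
      case True
      have src: "antichain (?src f I) \<and> ?src f I \<noteq> {} \<and> sum wt (?src f I) = wt I"
      proof (cases "I = 1")
        case True thus ?thesis by (simp add: source_def antichain_def)
      next
        case False
        define J where "J = I div 2"
        have J: "J \<ge> 1" "J < I" using True False by (auto simp: J_def)
        have lI: "wt I = wt J / 2"
        proof -
          have "I = 2 * J \<or> I = Suc (2 * J)" by (auto simp: J_def)
          thus ?thesis using J by auto
        qed
        have a: "antichain (fst (f J))" "sum wt (fst (f J)) = wt J" using IH[OF J(2)] J(1) by (auto simp: Good_def)
        have e: "?src f I = pick (even I) (snd (f J)) ` fst (f J)" using True False by (simp add: source_def J_def)
        have s: "sum wt (?src f I) = wt I" unfolding e antichain_pick(3)[OF a(1)] using a(2) lI by simp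
        moreover have "?src f I \<noteq> {}" using s wt_pos[of I] by auto
        ultimately show ?thesis unfolding e using antichain_pick(1)[OF a(1)] by simp
      qed
      have fin: "finite (\<Union>J\<in>{1..<I}. fst (f J))" using IH by (auto simp: Good_def antichain_def)
      obtain n where n: "\<And>K. K \<in> (\<Union>J\<in>{1..<I}. fst (f J)) \<Longrightarrow> lev K < n"
        using finite_imageI[OF fin, of lev] unfolding finite_nat_set_iff_bounded by blast
      obtain B A where BA: "refine (?src f I) B" "antichain B" "sum wt B = sum wt (?src f I)" "lev ` B \<subseteq> \<Lambda> \<inter> {n..}"
        "(\<Sum>l\<in>lev ` B. \<omega> l) \<le> \<xi> I" "\<bar>val d B - (\<Sum>K\<in>?src f I. limval \<Lambda> d K)\<bar> \<le> \<xi> I"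
        "\<bar>offdiag B (\<lambda>K L. cut S K * (wt K * t K L)) A\<bar> \<le> \<xi> I"
        "\<bar>\<Sum>K\<in>B. sg A K * (limval \<Lambda> d (2 * K) - limval \<Lambda> d (2 * K + 1))\<bar> \<le> \<xi> I"
        using step[of "?src f I" "\<xi> I" \<sigma> n S] src xi[of I] s1 wt_le_1[of I] unfolding d_def[abs_def] by auto
      have "lev L < lev K" if "1 \<le> J \<and> J < I" "K \<in> B" "L \<in> fst (f J)" for J K L
      proof -
        have "L \<in> (\<Union>J\<in>{1..<I}. fst (f J))" using that by auto
        hence "lev L < n" by (rule n)
        moreover have "n \<le> lev K" using BA(4) that by auto
        ultimately show ?thesis by simp
      qed
      hence "Good f I (B, A)" using BA src unfolding Good_def by auto
      thus ?thesis by blast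
    qed (auto simp: Good_def)
  qed
  then obtain f where f: "\<And>I. Good f I (f I)" by blast
  define B \<Theta> where "B = (\<lambda>I. fst (f I))" and "\<Theta> = (\<lambda>I. snd (f I))"
  have G: "refine (source B \<Theta> I) (B I)" "antichain (B I)" "lev ` B I \<subseteq> \<Lambda>"
    "\<And>J K L. 1 \<le> J \<Longrightarrow> J < I \<Longrightarrow> K \<in> B I \<Longrightarrow> L \<in> B J \<Longrightarrow> lev L < lev K"
    "(\<Sum>l\<in>lev ` B I. \<omega> l) \<le> \<xi> I" "\<bar>val d (B I) - (\<Sum>K\<in>source B \<Theta> I. limval \<Lambda> d K)\<bar> \<le> \<xi> I"
    "\<bar>offdiag (B I) (\<lambda>K L. cut S K * (wt K * t K L)) (\<Theta> I)\<bar> \<le> \<xi> I"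
    "\<bar>\<Sum>K\<in>B I. sg (\<Theta> I) K * (limval \<Lambda> d (2 * K) - limval \<Lambda> d (2 * K + 1))\<bar> \<le> \<xi> I" if "I \<ge> 1" for I
    using f[of I] that unfolding Good_def B_def \<Theta>_def by auto
  have faith: "faithful B \<Theta>" using G(1) by (simp add: faithful_def)
  define V where "V I = (\<Sum>K\<in>source B \<Theta> I. limval \<Lambda> d K)" for I
  have V1: "V 1 = c" by (simp add: V_def source_def c_def)
  have VB: "(\<Sum>K\<in>B I. limval \<Lambda> d K) = V I" if I: "I \<ge> 1" for I
  proof -
    obtain p where p: "\<And>K. K \<in> source B \<Theta> I \<Longrightarrow> Part K (p K)" "B I = \<Union> (p ` source B \<Theta> I)" using G(1)[OF I] by (auto simp: refine_def)
    have ac: "antichain (source B \<Theta> I)" by (rule source_antichain[OF faith I])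
    have "(\<Sum>K\<in>B I. limval \<Lambda> d K) = (\<Sum>K\<in>source B \<Theta> I. \<Sum>L\<in>p K. limval \<Lambda> d L)" unfolding p(2) by (rule sum_refine[OF ac p(1)])
    also have "\<dots> = V I" unfolding V_def using ac p(1) by (intro sum.cong refl limval_Part[OF inf db]) (auto simp: antichain_def)
    finally show ?thesis .
  qed
  \<comment> \<open>Each child receives half of \<open>V I\<close> plus or minus half of the signed
    imbalance, and the latter was made small by the choice of signs.\<close>
  have Vchild: "\<bar>V J / wt J - V I / wt I\<bar> \<le> \<xi> I / wt I" if I: "I \<ge> 1" "J = 2 * I \<or> J = Suc (2 * I)" for I J
  proof -
    define s where "s = (if even J then 1 else -1 :: real)"
    have e: "source B \<Theta> J = pick (even J) (\<Theta> I) ` B I" using I by (auto simp: source_def)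
    have ac: "antichain (B I)" by (rule G(2)[OF I(1)])
    have "V J = (\<Sum>K\<in>B I. limval \<Lambda> d (pick (even J) (\<Theta> I) K))" unfolding V_def e
      by (subst sum.reindex[OF antichain_pick(2)[OF ac]]) simp
    also have "\<dots> = (\<Sum>K\<in>B I. (limval \<Lambda> d K + s * (sg (\<Theta> I) K * (limval \<Lambda> d (2 * K) - limval \<Lambda> d (2 * K + 1)))) / 2)"
    proof (intro sum.cong refl)
      fix K assume "K \<in> B I"
      hence "K \<ge> 1" using ac by (auto simp: antichain_def)
      from limval_add[OF inf db this]
      show "limval \<Lambda> d (pick (even J) (\<Theta> I) K) = (limval \<Lambda> d K + s * (sg (\<Theta> I) K * (limval \<Lambda> d (2 * K) - limval \<Lambda> d (2 * K + 1)))) / 2"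
        by (auto simp: pick_def s_def sg_def)
    qed
    also have "\<dots> = (V I + s * (\<Sum>K\<in>B I. sg (\<Theta> I) K * (limval \<Lambda> d (2 * K) - limval \<Lambda> d (2 * K + 1)))) / 2"
      unfolding VB[OF I(1), symmetric] by (simp add: sum.distrib sum_distrib_left flip: sum_divide_distrib)
    finally have VJ: "V J = (V I + s * (\<Sum>K\<in>B I. sg (\<Theta> I) K * (limval \<Lambda> d (2 * K) - limval \<Lambda> d (2 * K + 1)))) / 2" .
    have wJ: "wt J = wt I / 2" using I by auto
    define W where "W = (\<Sum>K\<in>B I. sg (\<Theta> I) K * (limval \<Lambda> d (2 * K) - limval \<Lambda> d (2 * K + 1)))"
    have s1: "\<bar>s\<bar> = 1" by (simp add: s_def)
    have "V J / wt J - V I / wt I = s * W / wt I"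
      unfolding VJ[folded W_def] wJ by (simp add: add_divide_distrib)
    hence "\<bar>V J / wt J - V I / wt I\<bar> = \<bar>W\<bar> / wt I" by (simp add: abs_mult s1)
    also have "\<dots> \<le> \<xi> I / wt I" using G(8)[OF I(1)] unfolding W_def by (rule divide_right_mono) simp
    finally show ?thesis .
  qed
  have ent: "\<bar>entry S \<sigma> B \<Theta> I - V I / wt I\<bar> \<le> 2 * \<xi> I / wt I" if I: "I \<ge> 1" for I
  proof -
    have "entry S \<sigma> B \<Theta> I - V I / wt I = ((val d (B I) - V I) + \<sigma> * offdiag (B I) (\<lambda>K L. cut S K * (wt K * t K L)) (\<Theta> I)) / wt I"
      using entry_eq[of B I S \<sigma> \<Theta>] B_finite[OF faith I] unfolding d_def by (simp add: diff_divide_distrib add_divide_distrib)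
    also have "\<bar>\<dots>\<bar> \<le> (\<bar>val d (B I) - V I\<bar> + \<bar>\<sigma> * offdiag (B I) (\<lambda>K L. cut S K * (wt K * t K L)) (\<Theta> I)\<bar>) / wt I"
      unfolding abs_divide by (simp add: divide_right_mono)
    also have "\<dots> \<le> (\<xi> I + \<xi> I) / wt I"
      using G(6)[OF I] G(7)[OF I] s1 by (intro divide_right_mono add_mono) (auto simp: V_def abs_mult)
    finally show ?thesis by simp
  qed
  have xw: "\<xi> I / wt I = \<eta> / (8 * 4 ^ I)" for I by (simp add: \<xi>_def)
  have e1: "\<bar>entry S \<sigma> B \<Theta> 1 - c\<bar> \<le> \<eta>"
    using ent[of 1] xw[of 1] V1 assms(2) by simp
  \<comment> \<open>Two entry errors at \<open>J\<close>, two at its parent and one imbalance at the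
    parent give \<open>2 / 4 ^ J + 3 / 4 ^ I\<close>, hence at most \<open>8 / 2 ^ J\<close> before
    the factor \<open>\<eta> / 8\<close>.\<close>
  have drift: "\<bar>entry S \<sigma> B \<Theta> J - entry S \<sigma> B \<Theta> (J div 2)\<bar> \<le> \<eta> / 2 ^ J" if J: "J \<ge> 2" for J
  proof -
    define I where "I = J div 2"
    have I: "I \<ge> 1" "J = 2 * I \<or> J = Suc (2 * I)" using J by (auto simp: I_def)
    have "\<bar>entry S \<sigma> B \<Theta> J - entry S \<sigma> B \<Theta> I\<bar> \<le> 2 * \<xi> J / wt J + \<xi> I / wt I + 2 * \<xi> I / wt I"
      using ent[of J] ent[OF I(1)] Vchild[OF I] J by linarith
    also have "\<dots> = 2 * (\<xi> J / wt J) + 3 * (\<xi> I / wt I)" by simp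
    also have "\<dots> = \<eta> / 8 * (2 / 4 ^ J + 3 / 4 ^ I)" unfolding xw by (simp add: field_simps)
    also have "\<dots> \<le> \<eta> / 8 * (2 / 2 ^ J + 6 / 2 ^ J)"
    proof (intro mult_left_mono add_mono)
      show "2 / 4 ^ J \<le> 2 / (2::real) ^ J" by (intro divide_left_mono power_mono) auto
      have "(2::real) ^ J \<le> 2 ^ Suc (2 * I)" using I(2) by (intro power_increasing) auto
      also have "\<dots> = 2 * 4 ^ I" by (simp add: power_mult)
      finally have "(2::real) ^ J \<le> 2 * 4 ^ I" .
      thus "3 / 4 ^ I \<le> 6 / (2::real) ^ J" by (simp add: field_simps)
    qed (use assms(2) in auto)
    also have "\<dots> = \<eta> / 2 ^ J" by simp
    finally show ?thesis by (simp add: I_def)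
  qed
  have dsum: "(\<Sum>I\<in>nodes n - {1}. \<bar>entry S \<sigma> B \<Theta> I - entry S \<sigma> B \<Theta> (I div 2)\<bar>) \<le> \<eta>" for n
  proof -
    have "(\<Sum>I\<in>nodes n - {1}. \<bar>entry S \<sigma> B \<Theta> I - entry S \<sigma> B \<Theta> (I div 2)\<bar>) \<le> (\<Sum>I\<in>nodes n - {1}. \<eta> * (1 / 2) ^ I)"
    proof (rule sum_mono)
      fix I assume "I \<in> nodes n - {1}"
      hence "I \<ge> 2" by auto
      from drift[OF this] show "\<bar>entry S \<sigma> B \<Theta> I - entry S \<sigma> B \<Theta> (I div 2)\<bar> \<le> \<eta> * (1 / 2) ^ I"
        by (simp only: power_one_over times_divide_eq_right mult_1_right)
    qed
    also have "\<dots> \<le> (\<Sum>I\<in>{1..<2^n}. \<eta> * (1 / 2) ^ I)" using assms(2) by (intro sum_mono2) auto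
    also have "\<dots> \<le> (\<Sum>I. \<eta> * (1 / 2) ^ Suc I)"
    proof -
      have "(\<Sum>I\<in>{1..<2^n}. \<eta> * (1 / 2) ^ I) = (\<Sum>I<2 ^ n - 1. \<eta> * (1 / 2) ^ Suc I)"
        by (rule sum.reindex_bij_witness[of _ Suc "\<lambda>i. i - 1"]) auto
      also have "\<dots> \<le> (\<Sum>I. \<eta> * (1 / 2) ^ Suc I)"
      proof (rule sum_le_suminf)
        show "summable (\<lambda>I. \<eta> * (1 / 2) ^ Suc I)" by (rule summable_mult[OF sums_summable[OF power_half_series]])
      qed (use assms(2) in auto)
      finally show ?thesis .
    qed
    also have "\<dots> = \<eta>" using sums_unique[OF sums_mult[OF power_half_series, of \<eta>]] by simp
    finally show ?thesis .
  qed
  have disj: "lev ` B I \<inter> lev ` B J = {}" if "I \<ge> 1" "J \<ge> 1" "I \<noteq> J" for I J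
  proof -
    have "lev K \<noteq> lev L" if KL: "K \<in> B I" "L \<in> B J" for K L
    proof (cases "I < J")
      case True
      thus ?thesis using G(4)[OF \<open>J \<ge> 1\<close> \<open>I \<ge> 1\<close> True KL(2,1)] by simp
    next
      case False
      hence "J < I" using that \<open>I \<noteq> J\<close> by simp
      thus ?thesis using G(4)[OF \<open>I \<ge> 1\<close> \<open>J \<ge> 1\<close> _ KL] by simp
    qed
    thus ?thesis by blast
  qed
  have om: "(\<Sum>l\<in>lev ` B I. \<omega> l) \<le> \<eta> * wt I / 2 ^ I" if I: "I \<ge> 1" for I
  proof -
    have "(2::real) ^ I \<le> 4 ^ I" by (intro power_mono) auto
    moreover have "(4::real) ^ I > 0" by simp
    ultimately have "(2::real) ^ I \<le> 8 * 4 ^ I" by linarith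
    hence "\<xi> I \<le> \<eta> * wt I / 2 ^ I" unfolding \<xi>_def using assms(2) by (intro divide_left_mono) auto
    thus ?thesis using G(5)[OF I] by linarith
  qed
  show ?thesis
    by (rule exI[of _ m], rule exI[of _ S], rule exI[of _ \<sigma>], rule exI[of _ c], rule exI[of _ B], rule exI[of _ \<Theta>])
      (intro conjI allI impI S sig c faith G(3) om disj e1 dsum; assumption)
qed

end

section \<open>Matrices of operators and good systems\<close>

context haar_basis
begin

text \<open>Set to 0 unless both indices are positive, so that the bounds demanded by
  \<open>almost_diagonal\<close> hold for all numbers.\<close>

definition mat :: "('b \<Rightarrow> 'b) \<Rightarrow> nat \<Rightarrow> nat \<Rightarrow> real" where
  "mat T K L = (if K \<ge> 1 \<and> L \<ge> 1 then cf K (T (e L)) else 0)"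

text \<open>All Haar vectors of one level have equal norm, so the norm of \<open>e K\<close> in
  \<open>cf_norm_e\<close> cancels against that of \<open>e L\<close>.\<close>

lemma mat_same_level:
  assumes T: "bdl Y C T" "\<And>y. y \<in> Y \<Longrightarrow> T y \<in> Y" and KL: "K \<ge> 1" "L \<ge> 1" "lev K = lev L"
  shows "\<bar>mat T K L\<bar> \<le> 4 * C"
proof -
  have "\<bar>mat T K L\<bar> * norm (e K) \<le> 4 * norm (T (e L))"
    using cf_norm_e[OF KL(1) T(2)[OF e_Y[OF KL(2)]]] KL by (simp add: mat_def)
  also have "\<dots> \<le> 4 * (C * norm (e L))" using bdl_norm[OF T(1) e_Y[OF KL(2)]] by simp
  also have "norm (e L) = norm (e K)" using norm_e_level[OF KL(2,1)] KL by simp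
  finally have "\<bar>mat T K L\<bar> * norm (e K) \<le> (4 * C) * norm (e K)" by simp
  thus ?thesis using norm_e_pos[OF KL(1)] by simp
qed

lemma mat_diag:
  assumes "bdl Y C T" "\<And>y. y \<in> Y \<Longrightarrow> T y \<in> Y" shows "\<bar>mat T K K\<bar> \<le> 4 * C"
  using mat_same_level[OF assms, of K K] bdl_nonneg[OF assms(1)] by (cases "K \<ge> 1") (auto simp: mat_def)

text \<open>Column sums over one level are small when \<open>norm (e K)\<close> is small, row sums when it is large;
  combining both bounds covers spaces in which \<open>norm (e K)\<close> does not tend to zero.\<close>

lemma mat_level_sq:
  assumes T: "bdl Y C T" "\<And>y. y \<in> Y \<Longrightarrow> T y \<in> Y"
  shows "(\<Sum>K\<in>level l. \<Sum>L\<in>level l. (wt K * mat T K L)\<^sup>2) \<le> 8 * C\<^sup>2 * sqrt (1 / 2) ^ l"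
proof -
  have C: "C \<ge> 0" using bdl_nonneg[OF T(1)] .
  define \<rho> where "\<rho> = norm (e (2 ^ l))"
  have l1: "(2::nat) ^ l \<ge> 1" by simp
  have \<rho>: "\<rho> > 0" using norm_e_pos[OF l1] by (simp add: \<rho>_def)
  have ne: "norm (e K) = \<rho>" if "K \<in> level l" for K
    using norm_e_level[of K "2 ^ l"] that l1 by (simp add: \<rho>_def level_iff)
  have w: "wt K = 1 / 2 ^ l" if "K \<in> level l" for K using that by (simp add: wt_def level_iff)
  define V where "V = (\<Sum>K\<in>level l. \<Sum>L\<in>level l. (wt K * mat T K L)\<^sup>2)"
  define W where "W = (\<Sum>K\<in>level l. \<Sum>L\<in>level l. wt K * \<bar>mat T K L\<bar>)"
  have V0: "V \<ge> 0" unfolding V_def by (intro sum_nonneg) auto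
  have VW: "V \<le> 4 * C / 2 ^ l * W"
    unfolding V_def W_def sum_distrib_left
  proof (intro sum_mono)
    fix K L assume K: "K \<in> level l" and L: "L \<in> level l"
    have "wt K * \<bar>mat T K L\<bar> \<le> 1 / 2 ^ l * (4 * C)"
      using mat_same_level[OF T, of K L] K L w[OF K] by (intro mult_mono) (auto simp: level_iff)
    hence "wt K * \<bar>mat T K L\<bar> * (wt K * \<bar>mat T K L\<bar>) \<le> 1 / 2 ^ l * (4 * C) * (wt K * \<bar>mat T K L\<bar>)" by (intro mult_right_mono) auto
    moreover have "(wt K * mat T K L)\<^sup>2 = wt K * \<bar>mat T K L\<bar> * (wt K * \<bar>mat T K L\<bar>)"
      by (metis abs_mult abs_of_nonneg power2_abs power2_eq_square wt_nonneg)
    ultimately show "(wt K * mat T K L)\<^sup>2 \<le> 4 * C / 2 ^ l * (wt K * \<bar>mat T K L\<bar>)" by simp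
  qed
  have W1: "W \<le> 2 ^ l * (C * \<rho>)"
  proof -
    have "W = (\<Sum>L\<in>level l. \<Sum>K\<in>level l. wt K * \<bar>mat T K L\<bar>)" unfolding W_def by (rule sum.swap)
    also have "\<dots> \<le> (\<Sum>L\<in>level l. C * \<rho>)"
    proof (rule sum_mono)
      fix L assume L: "L \<in> level l"
      have LY: "e L \<in> Y" using e_Y level_pos[OF L] by blast
      have "(\<Sum>K\<in>level l. wt K * \<bar>mat T K L\<bar>) = (\<Sum>K\<in>level l. wt K * \<bar>cf K (T (e L))\<bar>)"
        using L by (intro sum.cong) (auto simp: mat_def level_iff)
      also have "\<dots> \<le> norm (T (e L))" by (rule cf_level[OF T(2)[OF LY]])
      also have "\<dots> \<le> C * \<rho>" using bdl_norm[OF T(1) LY] ne[OF L] by simp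
      finally show "(\<Sum>K\<in>level l. wt K * \<bar>mat T K L\<bar>) \<le> C * \<rho>" .
    qed
    finally show ?thesis by simp
  qed
  have W2: "W \<le> 4 * C / \<rho>"
  proof -
    have "W = (\<Sum>K\<in>level l. 1 / 2 ^ l * (\<Sum>L\<in>level l. \<bar>mat T K L\<bar>))" unfolding W_def sum_distrib_left using w by (intro sum.cong) auto
    also have "\<dots> \<le> (\<Sum>K\<in>level l. 1 / 2 ^ l * (4 * C / \<rho>))"
    proof (intro sum_mono mult_left_mono)
      fix K assume K: "K \<in> level l"
      define c where "c L = (if mat T K L \<ge> 0 then 1 else -1 :: real)" for L
      have c1: "\<bar>c L\<bar> \<le> 1" for L by (simp add: c_def)
      define z where "z = (\<Sum>L\<in>level l. c L *\<^sub>R e L)"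
      have zY: "z \<in> Y" unfolding z_def using e_Y level_pos subspace_Y by (intro subspace_sum subspace_scale) auto
      have "T z = (\<Sum>L\<in>level l. c L *\<^sub>R T (e L))" unfolding z_def
        using bdl_linear[OF T(1)] subspace_Y by (rule linear_on_sum) (use e_Y level_pos in auto)
      hence "cf K (T z) = (\<Sum>L\<in>level l. c L *\<^sub>R cf K (T (e L)))"
        using linear_on_sum[OF bdl_linear[OF cf] subspace_Y, of "level l" "\<lambda>L. T (e L)" K c] T(2) e_Y level_pos by auto
      also have "\<dots> = (\<Sum>L\<in>level l. \<bar>mat T K L\<bar>)"
        using K level_pos by (intro sum.cong) (auto simp: c_def mat_def level_iff)
      finally have s: "cf K (T z) = (\<Sum>L\<in>level l. \<bar>mat T K L\<bar>)" .
      have "\<bar>cf K (T z)\<bar> * \<rho> \<le> 4 * norm (T z)" using cf_norm_e[OF level_pos[OF K] T(2)[OF zY]] ne[OF K] by simp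
      also have "\<dots> \<le> 4 * (C * norm z)" using bdl_norm[OF T(1) zY] by simp
      also have "\<dots> \<le> 4 * (C * 1)" using norm_sum_level[of c l, OF c1] C unfolding z_def by (intro mult_left_mono) auto
      finally have "(\<Sum>L\<in>level l. \<bar>mat T K L\<bar>) * \<rho> \<le> 4 * C" using s by (simp add: sum_nonneg)
      thus "(\<Sum>L\<in>level l. \<bar>mat T K L\<bar>) \<le> 4 * C / \<rho>" using \<rho> by (simp add: pos_le_divide_eq)
    qed simp
    finally show ?thesis by simp
  qed
  have C2: "4 * C / 2 ^ l \<ge> 0" using C by simp
  have A: "V \<le> 4 * C\<^sup>2 * \<rho>" using order_trans[OF VW mult_left_mono[OF W1 C2]] by (simp add: power2_eq_square)
  have B: "V \<le> 16 * C\<^sup>2 / 2 ^ l / \<rho>" using order_trans[OF VW mult_left_mono[OF W2 C2]] by (simp add: power2_eq_square)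
  \<comment> \<open>The product of the two bounds no longer contains \<open>\<rho>\<close>; its
    square root decays like \<open>sqrt (1 / 2) ^ l\<close> in every case.\<close>
  have "V * V \<le> (4 * C\<^sup>2 * \<rho>) * (16 * C\<^sup>2 / 2 ^ l / \<rho>)" using A B V0 \<rho> by (intro mult_mono) auto
  also have "\<dots> = (8 * C\<^sup>2)\<^sup>2 * (1 / 2) ^ l" using \<rho> by (simp add: power2_eq_square power_one_over)
  also have "\<dots> = (8 * C\<^sup>2 * sqrt (1 / 2) ^ l)\<^sup>2"
  proof -
    have "(sqrt (1 / 2) ^ l)\<^sup>2 = ((sqrt (1 / 2))\<^sup>2) ^ l" by (simp only: power_mult[symmetric] mult.commute)
    thus ?thesis by (simp add: power_mult_distrib)
  qed
  finally have "V\<^sup>2 \<le> (8 * C\<^sup>2 * sqrt (1 / 2) ^ l)\<^sup>2" by (simp add: power2_eq_square)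
  hence "V \<le> 8 * C\<^sup>2 * sqrt (1 / 2) ^ l" by (rule power2_le_imp_le) simp
  thus ?thesis by (simp add: V_def)
qed

text \<open>\<open>good_system\<close> collects what one component contributes to the factorization: an embedding \<open>U\<close> along a
  faithful system, an operator \<open>A\<close> with coefficient rows \<open>\<rho>\<close>, and the multiplier \<open>M\<close> that compares the
  diagonal of \<open>A T U\<close> with the identity.\<close>

definition good_system ::
  "('b \<Rightarrow> 'b) \<Rightarrow> nat set \<Rightarrow> (nat \<Rightarrow> real) \<Rightarrow> real \<Rightarrow> real \<Rightarrow> (nat \<Rightarrow> nat set) \<Rightarrow> (nat \<Rightarrow> nat set) \<Rightarrow>
   ('b \<Rightarrow> 'b) \<Rightarrow> ('b \<Rightarrow> 'b) \<Rightarrow> ('b \<Rightarrow> 'b) \<Rightarrow> (nat \<Rightarrow> nat \<Rightarrow> real) \<Rightarrow> bool" where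
  "good_system T \<Lambda> \<omega> c0 \<eta> B \<Theta> U A M \<rho> \<longleftrightarrow>
    (\<forall>I\<ge>1. antichain (B I) \<and> lev ` B I \<subseteq> \<Lambda> \<and> sum wt (B I) = wt I \<and> (\<Sum>l\<in>lev ` B I. \<omega> l) \<le> \<eta> * wt I / 2 ^ I) \<and>
    (\<forall>I\<ge>1. \<forall>J\<ge>1. I \<noteq> J \<longrightarrow> lev ` B I \<inter> lev ` B J = {}) \<and>
    bdl Y 1 U \<and> (\<forall>I\<ge>1. U (e I) = (\<Sum>K\<in>B I. sg (\<Theta> I) K *\<^sub>R e K)) \<and>
    (\<forall>y\<in>Y. U y \<in> Y \<and> U y \<in> closure (span ((\<lambda>I. \<Sum>K\<in>B I. sg (\<Theta> I) K *\<^sub>R e K) ` {1..}))) \<and>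
    bdl Y (2 / c0) A \<and> (\<forall>y\<in>Y. A y \<in> Y) \<and> (\<forall>I\<ge>1. \<forall>K. \<bar>\<rho> I K\<bar> \<le> wt K / (c0 * wt I)) \<and>
    (\<forall>I\<ge>1. \<forall>y\<in>Y. cf I (A y) = (\<Sum>K\<in>B I. \<rho> I K * cf K y)) \<and>
    bdl Y (3 * \<eta> / c0) M \<and> (\<forall>y\<in>Y. M y \<in> Y) \<and>
    (\<forall>I\<ge>1. \<forall>y\<in>Y. cf I (M y) = ((\<Sum>K\<in>B I. \<rho> I K * (\<Sum>L\<in>B I. sg (\<Theta> I) L * mat T K L)) - 1) * cf I y)"

text \<open>\<open>A\<close> is the adjoint of the embedding after restriction to \<open>S\<close>,
  times \<open>\<sigma> / c\<close>; its bound \<open>2 / c0\<close> is the norm 2 of the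
  restriction over \<open>c0 \<le> c\<close>. \<open>M\<close> has the entries
  \<open>entry / c - 1\<close>: at most \<open>\<eta> / c\<close> at the root, plus twice a
  variation of at most \<open>\<eta> / c\<close>, gives \<open>3 * \<eta> / c0\<close>.\<close>

lemma good_system_exists:
  assumes T: "bdl Y C T" "\<And>y. y \<in> Y \<Longrightarrow> T y \<in> Y"
    and diag: "\<And>K. K \<ge> 1 \<Longrightarrow> \<bar>mat T K K\<bar> \<ge> \<delta>"
    and \<Lambda>: "infinite \<Lambda>" and om: "\<And>l. \<omega> l \<ge> 0" "summable \<omega>"
    and cross: "\<And>l l'. l \<in> \<Lambda> \<Longrightarrow> l' \<in> \<Lambda> \<Longrightarrow> l \<noteq> l' \<Longrightarrow> (\<Sum>K\<in>level l. \<Sum>L\<in>level l'. wt K * \<bar>mat T K L\<bar>) \<le> \<omega> l * \<omega> l'"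
    and c0: "0 < c0" "c0 \<le> \<delta> / 2 - \<eta>" and \<eta>: "\<eta> > 0"
  shows "\<exists>B \<Theta> U A M \<rho>. good_system T \<Lambda> \<omega> c0 \<eta> B \<Theta> U A M \<rho>"
proof -
  have sq: "0 \<le> sqrt (1 / 2)" "sqrt (1 / 2) < 1" by (auto simp: real_sqrt_lt_1_iff)
  interpret almost_diagonal "mat T" \<Lambda> \<omega> "\<lambda>l. 8 * C\<^sup>2 * sqrt (1 / 2) ^ l" "4 * C"
  proof
    show "summable (\<lambda>l. 8 * C\<^sup>2 * sqrt (1 / 2) ^ l)" using sq by (intro summable_mult summable_geometric) simp
    show "0 \<le> 8 * C\<^sup>2 * sqrt (1 / 2) ^ l" for l using sq by simp
    show "\<bar>mat T K K\<bar> \<le> 4 * C" for K by (rule mat_diag[OF T])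
    show "(\<Sum>K\<in>level l. \<Sum>L\<in>level l. (wt K * mat T K L)\<^sup>2) \<le> 8 * C\<^sup>2 * sqrt (1 / 2) ^ l" for l by (rule mat_level_sq[OF T])
  qed (fact \<Lambda> om cross)+
  obtain m S \<sigma> c B \<Theta> where st: "S \<subseteq> level m" "\<sigma> = 1 \<or> \<sigma> = -1" "\<delta> / 2 - \<eta> \<le> c" "faithful B \<Theta>"
    "\<forall>I\<ge>1. lev ` B I \<subseteq> \<Lambda> \<and> (\<Sum>l\<in>lev ` B I. \<omega> l) \<le> \<eta> * wt I / 2 ^ I"
    "\<forall>I\<ge>1. \<forall>J\<ge>1. I \<noteq> J \<longrightarrow> lev ` B I \<inter> lev ` B J = {}"
    "\<bar>entry S \<sigma> B \<Theta> 1 - c\<bar> \<le> \<eta>"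
    and st8: "\<forall>n. (\<Sum>I\<in>nodes n - {1}. \<bar>entry S \<sigma> B \<Theta> I - entry S \<sigma> B \<Theta> (I div 2)\<bar>) \<le> \<eta>"
    by (rule stable_diagonal[of \<delta> \<eta>, elim_format], erule diag, rule \<eta>, elim exE conjE) (rule that; assumption)
  have c: "c > 0" "c0 \<le> c" using st(3) c0 by linarith+
  obtain U where U: "bdl Y 1 U" "\<And>I. I \<ge> 1 \<Longrightarrow> U (e I) = (\<Sum>K\<in>B I. sg (\<Theta> I) K *\<^sub>R e K)" "\<And>y. y \<in> Y \<Longrightarrow> U y \<in> Y"
    "\<And>y. y \<in> Y \<Longrightarrow> U y \<in> closure (span ((\<lambda>I. \<Sum>K\<in>B I. sg (\<Theta> I) K *\<^sub>R e K) ` {1..}))"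
    using emb_exists[OF st(4)] by blast
  obtain A0 where A0: "bdl Y 1 A0" "\<And>I y. I \<ge> 1 \<Longrightarrow> y \<in> Y \<Longrightarrow> cf I (A0 y) = (\<Sum>K\<in>B I. sg (\<Theta> I) K * wt K / wt I * cf K y)"
    "\<And>y. y \<in> Y \<Longrightarrow> A0 y \<in> Y"
    using adj_exists[OF st(4)] by blast
  note R = res[OF st(1)]
  define A where "A y = (\<sigma> / c) *\<^sub>R A0 (res S y)" for y
  define \<rho> where "\<rho> I K = \<sigma> / c * (cut S K * (sg (\<Theta> I) K * wt K / wt I))" for I K
  have s1: "\<bar>\<sigma>\<bar> = 1" using st(2) by auto
  have "bdl Y (\<bar>\<sigma> / c\<bar> * (1 * 2)) A"
    unfolding A_def by (rule bdl_cmult[OF bdl_compose[OF R(1) A0(1) R(3)]])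
  moreover have "\<bar>\<sigma> / c\<bar> * (1 * 2) \<le> 2 / c0" using c c0 s1 by (simp add: divide_left_mono)
  ultimately have A1: "bdl Y (2 / c0) A" by (rule bdl_mono)
  have A2: "A y \<in> Y" if "y \<in> Y" for y unfolding A_def using that R(3) A0(3) Y_scale by blast
  have cfres: "cf K (res S y) = cut S K * cf K y" if K: "K \<ge> 1" and y: "y \<in> Y" for K y
  proof (rule bdl_eq[OF _ _ _ y])
    show "bdl Y (1 / wt K * 2) (\<lambda>y. cf K (res S y))" by (rule bdl_compose[OF R(1) cf R(3)])
    show "bdl Y (\<bar>cut S K\<bar> * (1 / wt K)) (\<lambda>y. cut S K * cf K y)" using bdl_cmult[OF cf] by simp
    fix L :: nat assume L: "L \<ge> 1"
    have c0: "cf K 0 = 0" using bdl_scale[OF cf Y_0, of K 0] by simp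
    show "cf K (res S (e L)) = cut S K * cf K (e L)" unfolding R(2)[OF L] using cf_e[OF L, of K] c0 by (auto simp: cut_def)
  qed
  have cfA: "cf I (A y) = (\<Sum>K\<in>B I. \<rho> I K * cf K y)" if I: "I \<ge> 1" and y: "y \<in> Y" for I y
  proof -
    have "cf I (A y) = \<sigma> / c * cf I (A0 (res S y))" using bdl_scale[OF cf A0(3)[OF R(3)[OF y]]] by (simp add: A_def)
    also have "\<dots> = \<sigma> / c * (\<Sum>K\<in>B I. sg (\<Theta> I) K * wt K / wt I * cf K (res S y))" using A0(2)[OF I R(3)[OF y]] by simp
    also have "\<dots> = (\<Sum>K\<in>B I. \<rho> I K * cf K y)" unfolding sum_distrib_left
      using cfres[OF B_pos[OF st(4) I] y] by (intro sum.cong refl) (simp add: \<rho>_def)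
    finally show ?thesis .
  qed
  have \<rho>_le: "\<bar>\<rho> I K\<bar> \<le> wt K / (c0 * wt I)" for I K
  proof -
    have "\<bar>\<rho> I K\<bar> = \<bar>cut S K\<bar> * (wt K / (c * wt I))" using c s1 by (simp add: \<rho>_def abs_mult)
    also have "\<dots> \<le> 1 * (wt K / (c0 * wt I))" using cut_bound c c0 by (intro mult_mono divide_left_mono mult_right_mono) auto
    finally show ?thesis by simp
  qed
  define d where "d I = entry S \<sigma> B \<Theta> I / c - 1" for I
  have dsum: "(\<Sum>I\<in>nodes n - {1}. \<bar>d I - d (I div 2)\<bar>) \<le> \<eta> / c" for n
  proof -
    have "(\<Sum>I\<in>nodes n - {1}. \<bar>d I - d (I div 2)\<bar>) = (\<Sum>I\<in>nodes n - {1}. \<bar>entry S \<sigma> B \<Theta> I - entry S \<sigma> B \<Theta> (I div 2)\<bar>) / c"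
      unfolding sum_divide_distrib d_def using c by (intro sum.cong refl) (simp flip: diff_divide_distrib)
    thus ?thesis using spec[OF st8, of n] c by (simp add: divide_right_mono)
  qed
  obtain M where M: "bdl Y (\<bar>d 1\<bar> + 2 * (\<eta> / c)) M" "\<And>K. K \<ge> 1 \<Longrightarrow> M (e K) = d K *\<^sub>R e K" "\<And>y. y \<in> Y \<Longrightarrow> M y \<in> Y"
    using mult_exists[of d "\<eta> / c", OF dsum] by blast
  have "\<bar>d 1\<bar> = \<bar>entry S \<sigma> B \<Theta> 1 - c\<bar> / c" using c abs_divide[of "entry S \<sigma> B \<Theta> 1 - c" c] by (simp add: d_def diff_divide_distrib)
  hence "\<bar>d 1\<bar> \<le> \<eta> / c" using st(7) c by (simp add: divide_right_mono)
  hence "\<bar>d 1\<bar> + 2 * (\<eta> / c) \<le> 3 * \<eta> / c" by simp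
  also have "\<dots> \<le> 3 * \<eta> / c0" using c c0 \<eta> by (intro divide_left_mono) auto
  finally have M1: "bdl Y (3 * \<eta> / c0) M" by (rule bdl_mono[OF M(1)])
  have dI: "(\<Sum>K\<in>B I. \<rho> I K * (\<Sum>L\<in>B I. sg (\<Theta> I) L * mat T K L)) - 1 = d I" if I: "I \<ge> 1" for I
  proof -
    have "(\<Sum>K\<in>B I. \<rho> I K * (\<Sum>L\<in>B I. sg (\<Theta> I) L * mat T K L)) = entry S \<sigma> B \<Theta> I / c"
      unfolding entry_def sum_distrib_left sum_divide_distrib by (intro sum.cong refl) (simp add: \<rho>_def mult_ac)
    thus ?thesis by (simp add: d_def)
  qed
  have cfM: "cf I (M y) = d I * cf I y" if I: "I \<ge> 1" and y: "y \<in> Y" for I y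
  proof (rule bdl_eq[OF _ _ _ y])
    show "bdl Y (1 / wt I * (3 * \<eta> / c0)) (\<lambda>y. cf I (M y))" by (rule bdl_compose[OF M1 cf M(3)])
    show "bdl Y (\<bar>d I\<bar> * (1 / wt I)) (\<lambda>y. d I * cf I y)" using bdl_cmult[OF cf] by simp
    fix L :: nat assume L: "L \<ge> 1"
    show "cf I (M (e L)) = d I * cf I (e L)" unfolding M(2)[OF L] using bdl_scale[OF cf e_Y[OF L]] cf_e[OF L, of I] by auto
  qed
  have "good_system T \<Lambda> \<omega> c0 \<eta> B \<Theta> U A M \<rho>"
    unfolding good_system_def
    by (intro conjI allI impI ballI) (use st(5,6) B_antichain[OF st(4)] B_wt[OF st(4)] U A1 A2 \<rho>_le cfA M1 M(3) cfM dI in auto)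
  thus ?thesis by blast
qed

text \<open>A coefficient at \<open>I\<close> is at most the norm divided by \<open>wt I\<close>, so
  weighted summability of the values on Haar vectors bounds the functional.\<close>

lemma functional_bound:
  fixes g :: "'b \<Rightarrow> real"
  assumes "bdl Y C g" "s \<ge> 0" "\<And>n. (\<Sum>I\<in>nodes n. \<bar>g (e I)\<bar> / wt I) \<le> s" "y \<in> Y"
  shows "\<bar>g y\<bar> \<le> s * norm y"
proof -
  have "bdl Y s g"
  proof (rule bdl_le[OF assms(1,2)])
    fix n and a :: "nat \<Rightarrow> real"
    have "norm (g (lc n a)) \<le> (\<Sum>I\<in>nodes n. norm (a I *\<^sub>R g (e I)))"
      unfolding bdl_lc[OF bdl_linear[OF assms(1)]] by (rule norm_sum)
    also have "\<dots> \<le> (\<Sum>I\<in>nodes n. norm (lc n a) * (\<bar>g (e I)\<bar> / wt I))"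
    proof (rule sum_mono)
      fix I assume "I \<in> nodes n"
      from coeff_le[OF this, of a] have "\<bar>a I\<bar> \<le> norm (lc n a) / wt I" by (simp add: pos_le_divide_eq mult.commute)
      from mult_right_mono[OF this, of "\<bar>g (e I)\<bar>"] show "norm (a I *\<^sub>R g (e I)) \<le> norm (lc n a) * (\<bar>g (e I)\<bar> / wt I)" by (simp add: abs_mult)
    qed
    also have "\<dots> = norm (lc n a) * (\<Sum>I\<in>nodes n. \<bar>g (e I)\<bar> / wt I)" by (rule sum_distrib_left[symmetric])
    also have "\<dots> \<le> norm (lc n a) * s" using assms(3) by (intro mult_left_mono) auto
    finally show "norm (g (lc n a)) \<le> s * norm (lc n a)" by (simp add: mult.commute)
  qed
  from bdl_norm[OF this assms(4)] show ?thesis by simp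
qed

end

subsection \<open>Sums of spaces\<close>

lemma component_vector_linear: "component_vector k (x + y) = component_vector k x + component_vector k y"
  "component_vector k (c *\<^sub>R x) = c *\<^sub>R component_vector k x" for x y :: "'b::real_vector"
  by (auto simp: component_vector_def scaleR_fun_def fun_eq_iff)

text \<open>The only place where the type of sum matters: a functional is determined, up to a small error,
  either by finitely many components or by finitely many Haar coefficients in every component.\<close>

definition vanishing_tails :: "(nat \<Rightarrow> 'b::real_normed_vector) set \<Rightarrow> ((nat \<Rightarrow> 'b) \<Rightarrow> real) \<Rightarrow> bool" where
  "vanishing_tails V N \<longleftrightarrow> (\<forall>x\<in>V. (\<lambda>L. N (\<lambda>l. if l < L then 0 else x l)) \<longlonglongrightarrow> 0)"

definition tail_continuous :: "(nat \<Rightarrow> nat \<Rightarrow> 'b::real_normed_vector) \<Rightarrow> (nat \<Rightarrow> 'b) set \<Rightarrow> ((nat \<Rightarrow> 'b) \<Rightarrow> real) \<Rightarrow> bool" where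
  "tail_continuous e V N \<longleftrightarrow>
    (\<forall>f C \<epsilon>. linear_on V f \<longrightarrow> (\<forall>x\<in>V. \<bar>f x\<bar> \<le> C * N x) \<longrightarrow> \<epsilon> > 0 \<longrightarrow>
      (\<exists>n :: nat \<Rightarrow> nat. \<forall>x\<in>V. (\<forall>l. x l \<in> closure (span (e l ` {n l..}))) \<longrightarrow> \<bar>f x\<bar> \<le> \<epsilon> * N x))"

text \<open>A common frame for the three cases: \<open>KK\<close> is the set of components in use,
  \<open>{0}\<close> for a single space and \<open>UNIV\<close> for sums. \<open>V_solid\<close>
  expresses that the norm depends monotonically on the norms of the components, and
  \<open>V_series\<close> is completeness, with sums taken in each component.\<close>

locale haar_sum =
  fixes e :: "nat \<Rightarrow> nat \<Rightarrow> 'b::banach" and nrm :: "nat \<Rightarrow> nat \<Rightarrow> (nat \<Rightarrow> real) \<Rightarrow> real"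
    and KK :: "nat set" and V :: "(nat \<Rightarrow> 'b) set" and N :: "(nat \<Rightarrow> 'b) \<Rightarrow> real"
  assumes comp: "\<And>k. haar_null (e k) (nrm k)"
    and KK: "KK \<noteq> {}"
    and V_Y: "\<And>x k. x \<in> V \<Longrightarrow> x k \<in> haar_basis.Y (e k)"
    and V_zero: "\<And>x k. x \<in> V \<Longrightarrow> k \<notin> KK \<Longrightarrow> x k = 0"
    and V_solid: "\<And>x z C. x \<in> V \<Longrightarrow> C \<ge> 0 \<Longrightarrow> (\<And>k. z k \<in> haar_basis.Y (e k)) \<Longrightarrow>
      (\<And>k. norm (z k) \<le> C * norm (x k)) \<Longrightarrow> z \<in> V \<and> N z \<le> C * N x"
    and V_comp: "\<And>k y. k \<in> KK \<Longrightarrow> y \<in> haar_basis.Y (e k) \<Longrightarrow> component_vector k y \<in> V \<and> N (component_vector k y) = norm y"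
    and V_le: "\<And>x k. x \<in> V \<Longrightarrow> norm (x k) \<le> N x"
    and V_add: "\<And>x y. x \<in> V \<Longrightarrow> y \<in> V \<Longrightarrow> x + y \<in> V \<and> N (x + y) \<le> N x + N y"
    and V_series: "\<And>x. (\<And>n. x n \<in> V) \<Longrightarrow> summable (\<lambda>n. N (x n)) \<Longrightarrow> (\<lambda>k. \<Sum>n. x n k) \<in> V \<and> N (\<lambda>k. \<Sum>n. x n k) \<le> (\<Sum>n. N (x n))"
    and V_tail: "vanishing_tails V N \<or> tail_continuous e V N"
begin

abbreviation "Yk k \<equiv> haar_basis.Y (e k)"
abbreviation "cfk k \<equiv> haar_basis.cf (e k)"

lemma hb: "haar_basis (e k) (nrm k)" using comp[of k] by (simp add: haar_null_def)

lemma comp_0: "component_vector k (0 :: 'b) = 0" by (simp add: fun_eq_iff component_vector_def)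

lemma zero_V: "0 \<in> V" "N 0 = 0"
proof -
  obtain k where "k \<in> KK" using KK by blast
  from V_comp[OF this haar_basis.Y_0[OF hb]] show "0 \<in> V" "N 0 = 0" by (auto simp: comp_0)
qed

lemma scale_V: "x \<in> V \<Longrightarrow> c *\<^sub>R x \<in> V \<and> N (c *\<^sub>R x) \<le> \<bar>c\<bar> * N x"
  by (rule V_solid) (auto simp: scaleR_fun_def intro: haar_basis.Y_scale[OF hb] V_Y)

lemma subspace_V: "subspace V" using zero_V scale_V V_add by (auto simp: subspace_def)

lemma N_nonneg: "x \<in> V \<Longrightarrow> N x \<ge> 0" using V_le[of x 0] norm_ge_zero order_trans by blast

lemma diff_V: "x \<in> V \<Longrightarrow> y \<in> V \<Longrightarrow> x - y \<in> V" using subspace_V subspace_diff by blast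

text \<open>Vectors with absolutely summable components lie in each of the spaces considered, so
  error estimates need only a summable bound per component.\<close>

lemma sum_V:
  assumes "\<And>k. k \<in> KK \<Longrightarrow> z k \<in> Yk k" "\<And>k. k \<notin> KK \<Longrightarrow> z k = 0" "\<And>k. k \<in> KK \<Longrightarrow> norm (z k) \<le> s k" "\<And>k. s k \<ge> 0" "summable s"
  shows "z \<in> V \<and> N z \<le> suminf s"
proof -
  have c: "component_vector n (z n) \<in> V \<and> N (component_vector n (z n)) \<le> s n" for n
  proof (cases "n \<in> KK")
    case True thus ?thesis using V_comp assms(1,3) by auto
  next
    case False thus ?thesis using assms(2)[of n] assms(4)[of n] zero_V comp_0[of n] by simp
  qed
  have sm: "summable (\<lambda>n. N (component_vector n (z n)))"
    by (rule summable_comparison_test'[OF assms(5), of 0]) (use c N_nonneg in auto)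
  have "(\<lambda>k. \<Sum>n. component_vector n (z n) k) = z"
  proof
    fix k
    have "(\<Sum>n. component_vector n (z n) k) = (\<Sum>n\<in>{k}. component_vector n (z n) k)"
      by (rule suminf_finite) (auto simp: component_vector_def)
    thus "(\<Sum>n. component_vector n (z n) k) = z k" by (simp add: component_vector_def)
  qed
  moreover have "(\<Sum>n. N (component_vector n (z n))) \<le> suminf s" using c sm assms(5) by (intro suminf_le) auto
  ultimately show ?thesis using V_series[of "\<lambda>n. component_vector n (z n)"] c sm by auto
qed

text \<open>\<open>G\<close> is the series of powers of \<open>K\<close>, the identity minus
  \<open>W\<close>, evaluated in each component. The series for \<open>G (W x)\<close> telescopes to
  \<open>x\<close>; a left inverse is all that the factorization asks for.\<close>

lemma neumann:
  assumes "linear_on V W" "\<And>x. x \<in> V \<Longrightarrow> W x \<in> V" "\<And>x. x \<in> V \<Longrightarrow> N (W x - x) \<le> q * N x" "0 \<le> q" "q < 1"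
  shows "\<exists>G. linear_on V G \<and> (\<forall>x\<in>V. G x \<in> V \<and> N (G x) \<le> N x / (1 - q) \<and> G (W x) = x)"
proof -
  define K where "K x = x - W x" for x
  have KV: "K x \<in> V" if "x \<in> V" for x using that assms(2) diff_V by (simp add: K_def)
  have KN: "N (K x) \<le> q * N x" if x: "x \<in> V" for x
  proof -
    have "K x = (-1) *\<^sub>R (W x - x)" by (simp add: K_def)
    hence "N (K x) \<le> N (W x - x)" using scale_V[of "W x - x" "-1"] assms(2) x diff_V by simp
    thus ?thesis using assms(3)[OF x] by simp
  qed
  have Kadd: "K (x + y) = K x + K y" and Kscale: "K (c *\<^sub>R x) = c *\<^sub>R K x" if "x \<in> V" "y \<in> V" for x y c
    using that assms(1) by (auto simp: K_def linear_on_def scaleR_diff_right)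
  have pV: "(K ^^ n) x \<in> V" if "x \<in> V" for n x using that KV by (induction n) auto
  have pN: "N ((K ^^ n) x) \<le> q ^ n * N x" if x: "x \<in> V" for n x
  proof (induction n)
    case (Suc n)
    have "N ((K ^^ Suc n) x) \<le> q * N ((K ^^ n) x)" using KN[OF pV[OF x, of n]] by simp
    also have "\<dots> \<le> q * (q ^ n * N x)" using Suc assms(4) by (intro mult_left_mono) auto
    finally show ?case by simp
  qed simp
  have padd: "(K ^^ n) (x + y) = (K ^^ n) x + (K ^^ n) y" if "x \<in> V" "y \<in> V" for n x y
    using that by (induction n) (auto simp: Kadd pV)
  have pscale: "(K ^^ n) (c *\<^sub>R x) = c *\<^sub>R (K ^^ n) x" if "x \<in> V" for n x c
    using that by (induction n) (auto simp: Kscale pV)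
  have gs: "summable (\<lambda>n. q ^ n * N x)" for x using assms(4,5) by (intro summable_mult2 summable_geometric) auto
  have sm: "summable (\<lambda>n. N ((K ^^ n) x))" if x: "x \<in> V" for x
    by (rule summable_comparison_test'[OF gs[of x], of 0]) (use pN[OF x] N_nonneg[OF pV[OF x]] in auto)
  have smk: "summable (\<lambda>n. (K ^^ n) x k)" if x: "x \<in> V" for x k
    by (rule summable_norm_cancel, rule summable_comparison_test'[OF sm[OF x], of 0]) (use V_le[OF pV[OF x]] in auto)
  define G where "G x = (\<lambda>k. \<Sum>n. (K ^^ n) x k)" for x
  have "linear_on V G" unfolding linear_on_def
  proof (intro conjI ballI allI)
    fix x y assume xy: "x \<in> V" "y \<in> V"
    show "G (x + y) = G x + G y" using suminf_add[OF smk smk, OF xy(1) xy(2)] padd[OF xy] by (auto simp: G_def fun_eq_iff)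
  next
    fix c x assume x: "x \<in> V"
    show "G (c *\<^sub>R x) = c *\<^sub>R G x"
      using suminf_scaleR_right[OF smk[OF x], of c] pscale[OF x] by (auto simp: G_def fun_eq_iff scaleR_fun_def)
  qed
  moreover have "G x \<in> V \<and> N (G x) \<le> N x / (1 - q) \<and> G (W x) = x" if x: "x \<in> V" for x
  proof -
    have 1: "G x \<in> V" "N (G x) \<le> (\<Sum>n. N ((K ^^ n) x))" using V_series[of "\<lambda>n. (K ^^ n) x"] pV[OF x] sm[OF x] by (auto simp: G_def)
    have "(\<Sum>n. N ((K ^^ n) x)) \<le> (\<Sum>n. q ^ n * N x)" using pN[OF x] sm[OF x] gs by (intro suminf_le) auto
    also have "\<dots> = N x / (1 - q)" using assms(4,5) suminf_mult2[OF summable_geometric[of q], of "N x"] suminf_geometric[of q] by simp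
    finally have 2: "N (G x) \<le> N x / (1 - q)" using 1(2) by linarith
    have "G (W x) = x"
    proof
      fix k
      have Wx: "W x = x - K x" by (simp add: K_def)
      have t: "(K ^^ n) (W x) k = (K ^^ n) x k - (K ^^ Suc n) x k" for n
      proof -
        have "(K ^^ n) (W x + K x) = (K ^^ n) (W x) + (K ^^ n) (K x)" by (rule padd) (use x assms(2) KV in auto)
        hence "(K ^^ n) x = (K ^^ n) (W x) + (K ^^ n) (K x)" by (simp add: Wx)
        moreover have "(K ^^ n) (K x) = (K ^^ Suc n) x" by (simp add: funpow_swap1)
        ultimately have "(K ^^ n) x = (K ^^ n) (W x) + (K ^^ Suc n) x" by simp
        from fun_cong[OF this, of k] show ?thesis by simp
      qed
      have "(\<lambda>n. (K ^^ n) x k) \<longlonglongrightarrow> 0" using smk[OF x] by (rule summable_LIMSEQ_zero)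
      hence "(\<lambda>n. (K ^^ n) (W x) k) sums ((K ^^ 0) x k - 0)" unfolding t by (rule telescope_sums'[unfolded])
      thus "G (W x) k = x k" by (simp add: G_def sums_iff)
    qed
    thus ?thesis using 1 2 by blast
  qed
  ultimately show ?thesis by blast
qed

end

section \<open>Simultaneous choice of levels for all components\<close>

locale diag_op = haar_sum e nrm KK V N
  for e :: "nat \<Rightarrow> nat \<Rightarrow> 'b::banach" and nrm KK and V :: "(nat \<Rightarrow> 'b) set" and N +
  fixes T :: "(nat \<Rightarrow> 'b) \<Rightarrow> nat \<Rightarrow> 'b" and C \<delta> :: real
  assumes T_lin: "linear_on V T" and T_V: "\<And>x. x \<in> V \<Longrightarrow> T x \<in> V" and T_le: "\<And>x. x \<in> V \<Longrightarrow> N (T x) \<le> C * N x"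
    and C: "C \<ge> 0" and \<delta>: "\<delta> > 0"
    and diag: "\<And>k K. k \<in> KK \<Longrightarrow> K \<ge> 1 \<Longrightarrow> \<bar>cfk k K (T (component_vector k (e k K)) k)\<bar> \<ge> \<delta>"
begin

definition \<psi> :: "nat \<Rightarrow> nat \<Rightarrow> (nat \<Rightarrow> 'b) \<Rightarrow> real" where "\<psi> k K x = cfk k K (T x k)"

definition Tk :: "nat \<Rightarrow> 'b \<Rightarrow> 'b" where "Tk k y = T (component_vector k y) k"

definition cross :: "nat \<Rightarrow> nat \<Rightarrow> nat \<Rightarrow> nat \<Rightarrow> real" where
  "cross k m l n = (\<Sum>K\<in>level m. \<Sum>L\<in>level n. wt K * \<bar>\<psi> k K (component_vector l (e l L))\<bar>)"

lemma \<psi>_add: "x \<in> V \<Longrightarrow> y \<in> V \<Longrightarrow> \<psi> k K (x + y) = \<psi> k K x + \<psi> k K y"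
  and \<psi>_scale: "x \<in> V \<Longrightarrow> \<psi> k K (c *\<^sub>R x) = c * \<psi> k K x"
  using T_lin V_Y[OF T_V] bdl_add[OF haar_basis.cf[OF hb]] bdl_scale[OF haar_basis.cf[OF hb]]
  by (auto simp: \<psi>_def linear_on_def scaleR_fun_def)

lemma \<psi>_linear: "linear_on V (\<psi> k K)"
  using \<psi>_add \<psi>_scale by (simp add: linear_on_def)

lemma \<psi>_le: "x \<in> V \<Longrightarrow> \<bar>\<psi> k K x\<bar> \<le> C / wt K * N x"
proof -
  assume x: "x \<in> V"
  have "\<bar>\<psi> k K x\<bar> \<le> norm (T x k) / wt K" unfolding \<psi>_def by (rule haar_basis.cf_le[OF hb V_Y[OF T_V[OF x]]])
  also have "norm (T x k) \<le> C * N x" using V_le[OF T_V[OF x], of k] T_le[OF x] by linarith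
  hence "norm (T x k) / wt K \<le> C / wt K * N x" by (simp add: divide_right_mono)
  finally show ?thesis .
qed

lemma \<psi>_comp:
  assumes l: "l \<in> KK" shows "bdl (Yk l) (C / wt K) (\<lambda>y. \<psi> k K (component_vector l y))"
proof (rule bdlI)
  fix x y assume "x \<in> Yk l" "y \<in> Yk l"
  thus "\<psi> k K (component_vector l (x + y)) = \<psi> k K (component_vector l x) + \<psi> k K (component_vector l y)"
    using V_comp[OF l] by (simp add: component_vector_linear \<psi>_add)
next
  fix c x assume "x \<in> Yk l"
  thus "\<psi> k K (component_vector l (c *\<^sub>R x)) = c *\<^sub>R \<psi> k K (component_vector l x)"
    using V_comp[OF l] by (simp add: component_vector_linear \<psi>_scale)
next
  fix x assume "x \<in> Yk l"
  thus "norm (\<psi> k K (component_vector l x)) \<le> C / wt K * norm x"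
    using V_comp[OF l] \<psi>_le[of "component_vector l x" k K] by simp
qed (use C in simp)

lemma Tk:
  assumes k: "k \<in> KK" shows "bdl (Yk k) C (Tk k)" "y \<in> Yk k \<Longrightarrow> Tk k y \<in> Yk k"
proof -
  show "bdl (Yk k) C (Tk k)"
  proof (rule bdlI)
    fix x y assume "x \<in> Yk k" "y \<in> Yk k"
    thus "Tk k (x + y) = Tk k x + Tk k y" using V_comp[OF k] T_lin by (simp add: Tk_def component_vector_linear linear_on_def)
  next
    fix c x assume "x \<in> Yk k"
    thus "Tk k (c *\<^sub>R x) = c *\<^sub>R Tk k x" using V_comp[OF k] T_lin by (simp add: Tk_def component_vector_linear linear_on_def scaleR_fun_def)
  next
    fix x assume "x \<in> Yk k"
    thus "norm (Tk k x) \<le> C * norm x"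
      using V_comp[OF k, of x] V_le[OF T_V, of "component_vector k x" k] T_le[of "component_vector k x"] by (simp add: Tk_def)
  qed (rule C)
  show "y \<in> Yk k \<Longrightarrow> Tk k y \<in> Yk k" using V_comp[OF k] V_Y[OF T_V] by (simp add: Tk_def)
qed

lemma mat_Tk: "haar_basis.mat (e k) (Tk k) K L = (if K \<ge> 1 \<and> L \<ge> 1 then \<psi> k K (component_vector k (e k L)) else 0)"
  unfolding haar_basis.mat_def[OF hb] \<psi>_def Tk_def by simp

text \<open>Finitely many coefficient functionals of \<open>T\<close>, each absolutely null on late
  levels of component \<open>l\<close> by \<open>functional_level_null\<close>.\<close>

lemma cross_row_null: "l \<in> KK \<Longrightarrow> (\<lambda>n. cross k m l n) \<longlonglongrightarrow> 0"
proof -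
  assume l: "l \<in> KK"
  have "(\<lambda>n. \<Sum>K\<in>level m. wt K * (\<Sum>L\<in>level n. \<bar>\<psi> k K (component_vector l (e l L))\<bar>)) \<longlonglongrightarrow> (\<Sum>K\<in>level m. wt K * 0)"
    by (intro tendsto_sum tendsto_mult tendsto_const haar_null.functional_level_null[OF comp \<psi>_comp[OF l]])
  thus ?thesis by (simp add: cross_def sum_distrib_left)
qed

text \<open>Finitely many fixed image vectors, each with vanishing weighted coefficients on late
  levels by \<open>cf_tail\<close>.\<close>

lemma cross_col_null: "l \<in> KK \<Longrightarrow> (\<lambda>n. cross k n l m) \<longlonglongrightarrow> 0"
proof -
  assume l: "l \<in> KK"
  have eq: "cross k n l m = (\<Sum>L\<in>level m. \<Sum>K\<in>level n. wt K * \<bar>cfk k K (T (component_vector l (e l L)) k)\<bar>)" for n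
    unfolding cross_def \<psi>_def by (rule sum.swap)
  have "(\<lambda>n. \<Sum>L\<in>level m. \<Sum>K\<in>level n. wt K * \<bar>cfk k K (T (component_vector l (e l L)) k)\<bar>) \<longlonglongrightarrow> (\<Sum>L\<in>level m. 0)"
  proof (intro tendsto_sum)
    fix L assume "L \<in> level m"
    hence "e l L \<in> Yk l" using haar_basis.e_Y[OF hb] level_pos by blast
    hence "T (component_vector l (e l L)) k \<in> Yk k" using V_Y[OF T_V] V_comp[OF l] by blast
    thus "(\<lambda>n. \<Sum>K\<in>level n. wt K * \<bar>cfk k K (T (component_vector l (e l L)) k)\<bar>) \<longlonglongrightarrow> 0" by (rule haar_basis.cf_tail[OF hb])
  qed
  thus ?thesis unfolding eq by simp
qed

text \<open>For each of the finitely many earlier \<open>j\<close> every requirement holds for all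
  sufficiently large levels, so a common level exists. The thresholds \<open>nn\<close> are
  arbitrary here; the case of l^infinity will supply them.\<close>

lemma levels_exist:
  assumes \<kappa>: "\<And>i. \<kappa> i \<in> KK"
  shows "\<exists>lam. \<forall>i. \<forall>j<i. lam j < lam i \<and> cross (\<kappa> j) (lam j) (\<kappa> i) (lam i) \<le> (1/2)^i * (1/2)^j \<and>
    cross (\<kappa> i) (lam i) (\<kappa> j) (lam j) \<le> (1/2)^i * (1/2)^j \<and> (\<forall>K\<in>level (lam j). nn (\<kappa> j) K j (\<kappa> i) \<le> lam i)"
proof (rule dependent_wellorder_choice)
  let ?P = "\<lambda>f i j r. f j < r \<and> cross (\<kappa> j) (f j) (\<kappa> i) r \<le> (1/2)^i * (1/2)^j \<and>
      cross (\<kappa> i) r (\<kappa> j) (f j) \<le> (1/2)^i * (1/2)^j \<and> (\<forall>K\<in>level (f j). nn (\<kappa> j) K j (\<kappa> i) \<le> r)"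
  fix r and f g :: "nat \<Rightarrow> nat" and i :: nat
  assume "\<And>j. j < i \<Longrightarrow> f j = g j"
  thus "(\<forall>j<i. ?P f i j r) =
    (\<forall>j<i. ?P g i j r)" by auto
next
  let ?P = "\<lambda>f i j r. f j < r \<and> cross (\<kappa> j) (f j) (\<kappa> i) r \<le> (1/2)^i * (1/2)^j \<and>
      cross (\<kappa> i) r (\<kappa> j) (f j) \<le> (1/2)^i * (1/2)^j \<and> (\<forall>K\<in>level (f j). nn (\<kappa> j) K j (\<kappa> i) \<le> r)"
  fix i :: nat and f :: "nat \<Rightarrow> nat"
  have "\<forall>\<^sub>F r in sequentially. ?P f i j r" for j
  proof (intro eventually_conj eventually_gt_at_top eventually_ball_finite finite_level ballI eventually_ge_at_top)
    have p: "0 < (1/2)^i * ((1/2)^j :: real)" by simp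
    show "\<forall>\<^sub>F r in sequentially. cross (\<kappa> j) (f j) (\<kappa> i) r \<le> (1/2)^i * (1/2)^j"
      by (rule eventually_mono[OF order_tendstoD(2)[OF cross_row_null[OF \<kappa>] p] less_imp_le])
    show "\<forall>\<^sub>F r in sequentially. cross (\<kappa> i) r (\<kappa> j) (f j) \<le> (1/2)^i * (1/2)^j"
      by (rule eventually_mono[OF order_tendstoD(2)[OF cross_col_null[OF \<kappa>] p] less_imp_le])
  qed
  hence "\<forall>\<^sub>F r in sequentially. \<forall>j\<in>{..<i}. ?P f i j r"
    by (intro eventually_ball_finite) auto
  from eventually_happens'[OF sequentially_bot this]
  show "\<exists>r. \<forall>j<i. ?P f i j r" by blast
qed

end

text \<open>The level \<open>lam i\<close> serves the component \<open>\<kappa> i\<close>, and the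
  system of component \<open>k\<close> uses only levels serving \<open>k\<close>. The budget
  \<open>\<eta> / 2 ^ k\<close> makes the errors summable over the components.\<close>

locale block_systems = diag_op e nrm KK V N T C \<delta>
  for e :: "nat \<Rightarrow> nat \<Rightarrow> 'b::banach" and nrm KK and V :: "(nat \<Rightarrow> 'b) set" and N T C \<delta> +
  fixes \<kappa> lam :: "nat \<Rightarrow> nat" and \<omega> :: "nat \<Rightarrow> real" and \<eta> c0 :: real
    and B \<Theta> :: "nat \<Rightarrow> nat \<Rightarrow> nat set" and U A M :: "nat \<Rightarrow> 'b \<Rightarrow> 'b" and \<rho> :: "nat \<Rightarrow> nat \<Rightarrow> nat \<Rightarrow> real"
  assumes \<kappa>: "\<And>i. \<kappa> i \<in> KK" and lam: "strict_mono lam"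
    and om: "\<And>i. \<omega> (lam i) = (1/2) ^ i" and om_nonneg: "\<And>l. \<omega> l \<ge> 0"
    and cross_le: "\<And>i j. i \<noteq> j \<Longrightarrow> cross (\<kappa> i) (lam i) (\<kappa> j) (lam j) \<le> \<omega> (lam i) * \<omega> (lam j)"
    and tail: "vanishing_tails V N \<or>
      (\<exists>nn. (\<forall>i. \<forall>j<i. \<forall>K\<in>level (lam j). nn (\<kappa> j) K j (\<kappa> i) \<le> lam i) \<and>
        (\<forall>k\<in>KK. \<forall>K j. \<forall>x\<in>V. (\<forall>l. x l \<in> closure (span (e l ` {nn k K j l :: nat..}))) \<longrightarrow> \<bar>\<psi> k K x\<bar> \<le> (1/2) ^ j * N x))"
    and \<eta>: "0 < \<eta>" "\<eta> \<le> 1" and c0: "c0 > 0"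
    and gs: "\<And>k. k \<in> KK \<Longrightarrow> haar_basis.good_system (e k) (Tk k) {lam i |i. \<kappa> i = k} \<omega> c0 (\<eta> / 2 ^ k) (B k) (\<Theta> k) (U k) (A k) (M k) (\<rho> k)"
begin

definition b :: "nat \<Rightarrow> nat \<Rightarrow> 'b" where "b k I = (\<Sum>K\<in>B k I. sg (\<Theta> k I) K *\<^sub>R e k K)"

definition Om :: "nat \<Rightarrow> nat \<Rightarrow> real" where "Om k I = (\<Sum>l\<in>lev ` B k I. \<omega> l)"

context
  fixes k assumes k: "k \<in> KK"
begin

lemmas gsk = gs[OF k, unfolded haar_basis.good_system_def[OF hb]]

lemma B_facts:
  assumes I: "I \<ge> 1"
  shows "finite (B k I)" "K \<in> B k I \<Longrightarrow> K \<ge> 1" "K \<in> B k I \<Longrightarrow> \<exists>i. \<kappa> i = k \<and> lev K = lam i" "sum wt (B k I) = wt I"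
    "Om k I \<le> \<eta> / 2 ^ k * wt I / 2 ^ I"
proof -
  have g: "antichain (B k I)" "lev ` B k I \<subseteq> {lam i |i. \<kappa> i = k}" "sum wt (B k I) = wt I" "Om k I \<le> \<eta> / 2 ^ k * wt I / 2 ^ I"
    using gsk I unfolding Om_def by simp_all
  show "finite (B k I)" "K \<in> B k I \<Longrightarrow> K \<ge> 1" using g(1) by (simp_all add: antichain_def)
  show "sum wt (B k I) = wt I" "Om k I \<le> \<eta> / 2 ^ k * wt I / 2 ^ I" by (fact g)+
  assume "K \<in> B k I"
  hence "lev K \<in> {lam i |i. \<kappa> i = k}" using g(2) by blast
  thus "\<exists>i. \<kappa> i = k \<and> lev K = lam i" by blast
qed

lemma B_disjoint: "I \<ge> 1 \<Longrightarrow> J \<ge> 1 \<Longrightarrow> I \<noteq> J \<Longrightarrow> lev ` B k I \<inter> lev ` B k J = {}"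
  using gsk by simp

lemma U: "bdl (Yk k) 1 (U k)" "I \<ge> 1 \<Longrightarrow> U k (e k I) = b k I" "y \<in> Yk k \<Longrightarrow> U k y \<in> Yk k" "y \<in> Yk k \<Longrightarrow> U k y \<in> closure (span (b k ` {1..}))"
  using gsk unfolding b_def by simp_all

lemma A: "bdl (Yk k) (2 / c0) (A k)" "y \<in> Yk k \<Longrightarrow> A k y \<in> Yk k"
    "I \<ge> 1 \<Longrightarrow> y \<in> Yk k \<Longrightarrow> cfk k I (A k y) = (\<Sum>K\<in>B k I. \<rho> k I K * cfk k K y)"
  using gsk by simp_all

lemma rho: "I \<ge> 1 \<Longrightarrow> \<bar>\<rho> k I K\<bar> \<le> wt K / (c0 * wt I)"
  using gsk by simp

lemma M: "bdl (Yk k) (3 * (\<eta> / 2 ^ k) / c0) (M k)" "y \<in> Yk k \<Longrightarrow> M k y \<in> Yk k"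
  using gsk by simp_all

lemma cf_M:
  assumes I: "I \<ge> 1" and y: "y \<in> Yk k"
  shows "cfk k I (M k y) = ((\<Sum>K\<in>B k I. \<rho> k I K * \<psi> k K (component_vector k (b k I))) - 1) * cfk k I y"
proof -
  have "\<psi> k K (component_vector k (b k I)) = (\<Sum>L\<in>B k I. sg (\<Theta> k I) L * haar_basis.mat (e k) (Tk k) K L)" if K: "K \<in> B k I" for K
  proof -
    have "\<psi> k K (component_vector k (b k I)) = (\<Sum>L\<in>B k I. sg (\<Theta> k I) L *\<^sub>R \<psi> k K (component_vector k (e k L)))"
      unfolding b_def by (rule linear_on_sum[OF bdl_linear[OF \<psi>_comp[OF k]] haar_basis.subspace_Y[OF hb]])
        (use B_facts(1,2)[OF I] haar_basis.e_Y[OF hb] in auto)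
    also have "\<dots> = (\<Sum>L\<in>B k I. sg (\<Theta> k I) L * haar_basis.mat (e k) (Tk k) K L)"
      using B_facts(2)[OF I] K by (intro sum.cong refl) (simp add: mat_Tk)
    finally show ?thesis .
  qed
  moreover have "cfk k I (M k y) = ((\<Sum>K\<in>B k I. \<rho> k I K * (\<Sum>L\<in>B k I. sg (\<Theta> k I) L * haar_basis.mat (e k) (Tk k) K L)) - 1) * cfk k I y"
    using gsk I y by simp
  ultimately show ?thesis by simp
qed

end

end

lemma linear_on_0: "linear_on V f \<Longrightarrow> x \<in> V \<Longrightarrow> f 0 = 0"
  unfolding linear_on_def by (metis scaleR_zero_left)

lemma sum_halves_le: "finite F \<Longrightarrow> F \<subseteq> {1..} \<Longrightarrow> (\<Sum>J\<in>F. (1/2::real) ^ J) \<le> 1"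
proof -
  assume F: "finite F" "F \<subseteq> {1..}"
  have s: "(\<Sum>J\<in>{1..<Suc m}. (1/2::real) ^ J) = 1 - (1/2) ^ m" for m by (induction m) auto
  obtain m where "F \<subseteq> {..<m}" using F(1) finite_nat_iff_bounded by blast
  hence "F \<subseteq> {1..<Suc m}" using F(2) by (force simp: subset_eq)
  hence "(\<Sum>J\<in>F. (1/2::real) ^ J) \<le> (\<Sum>J\<in>{1..<Suc m}. (1/2) ^ J)" by (intro sum_mono2) auto
  also have "\<dots> \<le> 1" unfolding s by simp
  finally show ?thesis .
qed

lemma sum_le_levels:
  fixes f :: "nat \<Rightarrow> real"
  assumes "finite P" "\<And>K. K \<in> P \<Longrightarrow> K \<ge> 1" "\<And>K. f K \<ge> 0"
  shows "sum f P \<le> (\<Sum>m\<in>lev ` P. sum f (level m))"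
proof -
  have "sum f P \<le> sum f (\<Union>m\<in>lev ` P. level m)"
    using assms by (intro sum_mono2) (auto simp: level_iff)
  also have "\<dots> = (\<Sum>m\<in>lev ` P. sum f (level m))"
    using assms(1) level_disjoint by (intro sum.UNION_disjoint) auto
  finally show ?thesis .
qed

context haar_sum
begin

lemma finite_support:
  assumes "finite F" "F \<subseteq> KK" "\<And>l. l \<in> F \<Longrightarrow> y l \<in> Yk l"
  shows "(\<lambda>l. if l \<in> F then y l else 0) \<in> V"
    and "linear_on V f \<Longrightarrow> f (\<lambda>l. if l \<in> F then y l else 0) = (\<Sum>l\<in>F. f (component_vector l (y l)) :: real)"
proof -
  have cV: "component_vector l (y l) \<in> V" if "l \<in> F" for l using that assms V_comp by blast
  have eq: "(\<lambda>l. if l \<in> F then y l else 0) = (\<Sum>l\<in>F. 1 *\<^sub>R component_vector l (y l))"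
  proof
    fix i
    have "(\<Sum>l\<in>F. component_vector l (y l)) i = (\<Sum>l\<in>F. component_vector l (y l) i)" by (induction F rule: infinite_finite_induct) auto
    also have "\<dots> = (if i \<in> F then y i else 0)" using assms(1) by (simp add: component_vector_def)
    finally show "(if i \<in> F then y i else 0) = (\<Sum>l\<in>F. 1 *\<^sub>R component_vector l (y l)) i" by simp
  qed
  show "(\<lambda>l. if l \<in> F then y l else 0) \<in> V" unfolding eq using cV subspace_V by (intro subspace_sum subspace_scale) auto
  assume f: "linear_on V f"
  show "f (\<lambda>l. if l \<in> F then y l else 0) = (\<Sum>l\<in>F. f (component_vector l (y l)))"
    unfolding eq using linear_on_sum[OF f subspace_V assms(1), of "\<lambda>l. component_vector l (y l)" "\<lambda>_. 1"] cV by simp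
qed

end

section \<open>Off-diagonal estimates for the compressed operator\<close>

context block_systems
begin

text \<open>As a functional of \<open>x\<close>, the coefficient at \<open>I\<close> in component
  \<open>k\<close> of \<open>coord (T x)\<close>.\<close>

definition G :: "nat \<Rightarrow> nat \<Rightarrow> (nat \<Rightarrow> 'b) \<Rightarrow> real" where "G k I x = (\<Sum>K\<in>B k I. \<rho> k I K * \<psi> k K x)"

definition emb :: "(nat \<Rightarrow> 'b) \<Rightarrow> nat \<Rightarrow> 'b" where "emb x l = (if l \<in> KK then U l (x l) else 0)"

definition coord :: "(nat \<Rightarrow> 'b) \<Rightarrow> nat \<Rightarrow> 'b" where "coord x l = (if l \<in> KK then A l (x l) else 0)"

lemma Y0 [simp]: "0 \<in> Yk l" by (rule haar_basis.Y_0[OF hb])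

lemma emb_V: "x \<in> V \<Longrightarrow> emb x \<in> V \<and> N (emb x) \<le> 1 * N x"
proof (rule V_solid)
  fix l assume x: "x \<in> V"
  show "emb x l \<in> Yk l" using U(3)[OF _ V_Y[OF x]] by (simp add: emb_def)
  show "norm (emb x l) \<le> 1 * norm (x l)" using bdl_norm[OF U(1) V_Y[OF x]] by (simp add: emb_def)
qed simp_all

lemma coord_V: "x \<in> V \<Longrightarrow> coord x \<in> V \<and> N (coord x) \<le> 2 / c0 * N x"
proof (rule V_solid)
  fix l assume x: "x \<in> V"
  show "coord x l \<in> Yk l" using A(2)[OF _ V_Y[OF x]] by (simp add: coord_def)
  show "norm (coord x l) \<le> 2 / c0 * norm (x l)" using bdl_norm[OF A(1) V_Y[OF x]] c0 by (simp add: coord_def)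
qed (use c0 in simp_all)

lemma emb_linear: "linear_on V emb" and coord_linear: "linear_on V coord"
  using bdl_add[OF U(1)] bdl_add[OF A(1)] bdl_scale[OF U(1)] bdl_scale[OF A(1)] V_Y
  by (simp_all add: linear_on_def emb_def coord_def scaleR_fun_def fun_eq_iff)

lemma Om_nonneg: "Om k I \<ge> 0" unfolding Om_def by (intro sum_nonneg om_nonneg)

lemma b_Y: "l \<in> KK \<Longrightarrow> J \<ge> 1 \<Longrightarrow> b l J \<in> Yk l"
  using U(2,3) haar_basis.e_Y[OF hb] by metis

lemma G_linear: "linear_on V (G k I)"
  using \<psi>_add \<psi>_scale by (simp add: linear_on_def G_def distrib_left sum.distrib sum_distrib_left mult_ac)

lemma G_le: "x \<in> V \<Longrightarrow> \<bar>G k I x\<bar> \<le> (\<Sum>K\<in>B k I. \<bar>\<rho> k I K\<bar> * (C / wt K)) * N x"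
proof -
  assume x: "x \<in> V"
  have "\<bar>G k I x\<bar> \<le> (\<Sum>K\<in>B k I. \<bar>\<rho> k I K * \<psi> k K x\<bar>)" unfolding G_def by (rule sum_abs)
  also have "\<dots> \<le> (\<Sum>K\<in>B k I. \<bar>\<rho> k I K\<bar> * (C / wt K * N x))"
    unfolding abs_mult by (intro sum_mono mult_left_mono \<psi>_le x) auto
  finally show ?thesis by (simp add: sum_distrib_right mult.assoc)
qed

lemma G_comp: "l \<in> KK \<Longrightarrow> bdl (Yk l) (\<Sum>K\<in>B k I. \<bar>\<rho> k I K\<bar> * (C / wt K)) (\<lambda>y. G k I (component_vector l y))"
proof (rule bdlI)
  assume l: "l \<in> KK"
  note lin = G_linear[of k I, unfolded linear_on_def]
  show "G k I (component_vector l (x + y)) = G k I (component_vector l x) + G k I (component_vector l y)" if "x \<in> Yk l" "y \<in> Yk l" for x y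
    using that lin V_comp[OF l] by (simp add: component_vector_linear)
  show "G k I (component_vector l (c *\<^sub>R x)) = c *\<^sub>R G k I (component_vector l x)" if "x \<in> Yk l" for x c
    using that lin V_comp[OF l] by (simp add: component_vector_linear)
  show "norm (G k I (component_vector l x)) \<le> (\<Sum>K\<in>B k I. \<bar>\<rho> k I K\<bar> * (C / wt K)) * norm x" if "x \<in> Yk l" for x
    using that V_comp[OF l, of x] G_le[of "component_vector l x" k I] by simp
qed (use C in \<open>auto intro!: sum_nonneg\<close>)

lemma cross_B:
  assumes k: "k \<in> KK" and l: "l \<in> KK" and I: "I \<ge> 1" and J: "J \<ge> 1" and ne: "k = l \<longrightarrow> I \<noteq> J"
  shows "(\<Sum>K\<in>B k I. \<Sum>L\<in>B l J. wt K * \<bar>\<psi> k K (component_vector l (e l L))\<bar>) \<le> Om k I * Om l J"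
proof -
  let ?t = "\<lambda>K L. wt K * \<bar>\<psi> k K (component_vector l (e l L))\<bar>"
  have "(\<Sum>K\<in>B k I. \<Sum>L\<in>B l J. ?t K L) \<le> (\<Sum>K\<in>B k I. \<Sum>n\<in>lev ` B l J. \<Sum>L\<in>level n. ?t K L)"
    by (intro sum_mono sum_le_levels B_facts(1)[OF l J] B_facts(2)[OF l J]) auto
  also have "\<dots> \<le> (\<Sum>m\<in>lev ` B k I. \<Sum>K\<in>level m. \<Sum>n\<in>lev ` B l J. \<Sum>L\<in>level n. ?t K L)"
    by (intro sum_le_levels B_facts(1)[OF k I] B_facts(2)[OF k I] sum_nonneg) auto
  also have "\<dots> = (\<Sum>m\<in>lev ` B k I. \<Sum>n\<in>lev ` B l J. cross k m l n)"
    unfolding cross_def by (intro sum.cong refl sum.swap)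
  also have "\<dots> \<le> (\<Sum>m\<in>lev ` B k I. \<Sum>n\<in>lev ` B l J. \<omega> m * \<omega> n)"
  proof (intro sum_mono)
    fix m n assume mn: "m \<in> lev ` B k I" "n \<in> lev ` B l J"
    obtain i where i: "\<kappa> i = k" "m = lam i" using mn(1) B_facts(3)[OF k I] by blast
    obtain j where j: "\<kappa> j = l" "n = lam j" using mn(2) B_facts(3)[OF l J] by blast
    \<comment> \<open>Equal positions would mean one component and one level, against the
      disjointness of the level sets of different indices.\<close>
    have "i \<noteq> j"
    proof
      assume "i = j"
      hence "k = l" "m = n" using i j by auto
      thus False using mn B_disjoint[OF k I J] ne by blast
    qed
    from cross_le[OF this] show "cross k m l n \<le> \<omega> m * \<omega> n" by (simp only: i j)
  qed
  also have "\<dots> = Om k I * Om l J" unfolding Om_def by (rule sum_product[symmetric])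
  finally show ?thesis .
qed

lemma G_b:
  assumes k: "k \<in> KK" and l: "l \<in> KK" and I: "I \<ge> 1" and J: "J \<ge> 1" and ne: "k = l \<longrightarrow> I \<noteq> J"
  shows "\<bar>G k I (component_vector l (b l J))\<bar> \<le> Om k I * Om l J / (c0 * wt I)"
proof -
  let ?t = "\<lambda>K L. \<bar>\<psi> k K (component_vector l (e l L))\<bar>"
  have "\<bar>\<psi> k K (component_vector l (b l J))\<bar> \<le> (\<Sum>L\<in>B l J. ?t K L)" for K
  proof -
    have eq: "\<psi> k K (component_vector l (b l J)) = (\<Sum>L\<in>B l J. sg (\<Theta> l J) L *\<^sub>R \<psi> k K (component_vector l (e l L)))"
      unfolding b_def by (rule linear_on_sum[OF bdl_linear[OF \<psi>_comp[OF l]] haar_basis.subspace_Y[OF hb]])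
        (use B_facts(1,2)[OF l J] haar_basis.e_Y[OF hb] in auto)
    show ?thesis unfolding eq by (rule order_trans[OF sum_abs]) (simp add: abs_mult)
  qed
  moreover have "0 \<le> wt K / (c0 * wt I)" for K using c0 by simp
  ultimately have "(\<Sum>K\<in>B k I. \<bar>\<rho> k I K * \<psi> k K (component_vector l (b l J))\<bar>) \<le> (\<Sum>K\<in>B k I. wt K / (c0 * wt I) * (\<Sum>L\<in>B l J. ?t K L))"
    unfolding abs_mult using rho[OF k I] by (intro sum_mono mult_mono) auto
  also have "\<dots> = (\<Sum>K\<in>B k I. \<Sum>L\<in>B l J. wt K * ?t K L) / (c0 * wt I)"
    by (simp add: sum_distrib_left sum_divide_distrib)
  also have "\<dots> \<le> Om k I * Om l J / (c0 * wt I)" using cross_B[OF assms] c0 by (intro divide_right_mono) auto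
  finally show ?thesis using sum_abs[of "\<lambda>K. \<rho> k I K * \<psi> k K (component_vector l (b l J))" "B k I"] unfolding G_def by linarith
qed

text \<open>Subtracting the direction of \<open>e k I\<close> removes exactly the diagonal entry. On
  every remaining Haar vector \<open>G_b\<close> applies, and the factors
  \<open>wt J / 2 ^ J\<close> in the bound for \<open>Om\<close> are what
  \<open>functional_bound\<close> needs.\<close>

lemma G_comp_le:
  assumes k: "k \<in> KK" and l: "l \<in> KK" and I: "I \<ge> 1" and y: "y \<in> Yk l"
  shows "\<bar>G k I (component_vector l (U l (y - (if l = k then cfk k I y *\<^sub>R e k I else 0))))\<bar>
    \<le> (\<eta> / 2 ^ k) / (c0 * 2 ^ I) * (\<eta> / 2 ^ l) * norm y"
proof -
  define Q where "Q y = y - (if l = k then cfk k I y *\<^sub>R e k I else 0)" for y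
  have QY: "Q y \<in> Yk l" if "y \<in> Yk l" for y
    using that haar_basis.Y_diff[OF hb] haar_basis.Y_scale[OF hb haar_basis.e_Y[OF hb I]] by (auto simp: Q_def)
  \<comment> \<open>The 5 is 1 plus the constant 4 of \<open>cf_norm_e\<close>. It only shows that
    \<open>g\<close> is bounded at all and does not enter the final estimate.\<close>
  have Q: "bdl (Yk l) 5 Q"
  proof (rule bdlI)
    fix y assume y: "y \<in> Yk l"
    have "norm (if l = k then cfk k I y *\<^sub>R e k I else 0) \<le> 4 * norm y"
      using haar_basis.cf_norm_e[OF hb I, of y k] y by auto
    thus "norm (Q y) \<le> 5 * norm y" unfolding Q_def using norm_triangle_ineq4[of y "if l = k then cfk k I y *\<^sub>R e k I else 0"] by linarith
  qed (use bdl_add[OF haar_basis.cf[OF hb]] bdl_scale[OF haar_basis.cf[OF hb]] in \<open>auto simp: Q_def scaleR_diff_right scaleR_add_left\<close>)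
  define g where "g y = G k I (component_vector l (U l (Q y)))" for y
  obtain D where g: "bdl (Yk l) D g"
    using bdl_compose[OF Q bdl_compose[OF U(1)[OF l] G_comp[OF l] U(3)[OF l]] QY] unfolding g_def by blast
  define s where "s = (\<eta> / 2 ^ k) / (c0 * 2 ^ I) * (\<eta> / 2 ^ l)"
  have s0: "s \<ge> 0" using \<eta> c0 by (simp add: s_def)
  have "\<bar>g (e l J)\<bar> / wt J \<le> s * (1/2) ^ J" if J: "J \<ge> 1" for J
  proof (cases "l = k \<and> J = I")
    case True
    hence "g (e l J) = G k I (component_vector l (U l 0))" using haar_basis.cf_e[OF hb I, of k I] by (simp add: g_def Q_def)
    also have "U l 0 = 0" using bdl_scale[OF U(1)[OF l] Y0, of 0] by simp
    also have "G k I (component_vector l 0) = 0" using linear_on_0[OF G_linear zero_V(1)] comp_0[of l] by simp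
    finally show ?thesis using s0 by simp
  next
    case False
    have "Q (e l J) = e l J" using False haar_basis.cf_e[OF hb J, of k I] by (auto simp: Q_def)
    hence "\<bar>g (e l J)\<bar> \<le> Om k I * Om l J / (c0 * wt I)" using G_b[OF k l I J] False U(2)[OF l J] unfolding g_def by metis
    also have "\<dots> \<le> (\<eta> / 2 ^ k * wt I / 2 ^ I) * (\<eta> / 2 ^ l * wt J / 2 ^ J) / (c0 * wt I)"
      using B_facts(5)[OF k I] B_facts(5)[OF l J] Om_nonneg c0 \<eta> by (intro divide_right_mono mult_mono) auto
    also have "\<dots> = s * (1/2) ^ J * wt J" by (simp add: s_def power_one_over mult_ac)
    finally show ?thesis by (simp add: pos_divide_le_eq)
  qed
  hence "(\<Sum>J\<in>nodes n. \<bar>g (e l J)\<bar> / wt J) \<le> s" for n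
  proof -
    assume a: "\<And>J. J \<ge> 1 \<Longrightarrow> \<bar>g (e l J)\<bar> / wt J \<le> s * (1/2) ^ J"
    have "(\<Sum>J\<in>nodes n. \<bar>g (e l J)\<bar> / wt J) \<le> (\<Sum>J\<in>nodes n. s * (1/2) ^ J)" by (intro sum_mono a) simp
    also have "\<dots> = s * (\<Sum>J\<in>nodes n. (1/2) ^ J)" by (rule sum_distrib_left[symmetric])
    also have "\<dots> \<le> s * 1" using s0 by (intro mult_left_mono sum_halves_le) auto
    finally show ?thesis by simp
  qed
  from haar_basis.functional_bound[OF hb g s0 this y] show ?thesis by (simp add: g_def Q_def s_def)
qed

lemma sum_halves_component: "finite F \<Longrightarrow> (\<Sum>l\<in>F. \<eta> / 2 ^ l) \<le> 2 * \<eta>"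
proof -
  assume F: "finite F"
  have "(\<Sum>J\<in>Suc ` F. (1/2::real) ^ J) \<le> 1" using F by (intro sum_halves_le) auto
  hence "(\<Sum>l\<in>F. (1/2::real) ^ Suc l) \<le> 1" by (simp add: sum.reindex)
  from mult_left_mono[OF this, of "2 * \<eta>"] show ?thesis using \<eta> by (simp add: sum_distrib_left power_one_over)
qed

end

section \<open>Distance from the identity and the factorization\<close>

context block_systems
begin

lemma restrict_V: "x \<in> V \<Longrightarrow> (\<lambda>l. if P l then 0 else x l) \<in> V"
proof -
  assume x: "x \<in> V"
  have "(\<lambda>l. if P l then 0 else x l) \<in> V \<and> N (\<lambda>l. if P l then 0 else x l) \<le> 1 * N x"
    by (rule V_solid[OF x]) (simp_all add: V_Y[OF x])
  thus ?thesis ..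
qed

lemma b_deep:
  assumes l: "l \<in> KK" and n: "\<And>J K. J \<ge> 1 \<Longrightarrow> K \<in> B l J \<Longrightarrow> n \<le> K" and y: "y \<in> Yk l"
  shows "U l y \<in> closure (span (e l ` {n..}))"
proof -
  have "b l J \<in> span (e l ` {n..})" if J: "J \<ge> 1" for J
    unfolding b_def using n[OF J] by (intro span_sum span_scale span_base) auto
  hence "span (b l ` {1..}) \<subseteq> span (e l ` {n..})" by (intro span_minimal subspace_span) auto
  thus ?thesis using closure_mono U(4)[OF l y] by blast
qed

text \<open>Reduction to finitely many components. If tails vanish in norm this is boundedness of
  \<open>G\<close>. Otherwise the components outside \<open>F\<close> are served only by levels
  beyond the thresholds \<open>nn\<close> of the finitely many functionals that make up
  \<open>G\<close>, which are therefore small there.\<close>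

lemma G_tail:
  assumes k: "k \<in> KK" and I: "I \<ge> 1" and x: "x \<in> V" and Nx: "N x > 0"
  shows "\<exists>F. finite F \<and> F \<subseteq> KK \<and> k \<in> F \<and>
    \<bar>G k I (\<lambda>l. if l \<in> F then 0 else emb x l)\<bar> \<le> (\<eta> / 2 ^ k) / (c0 * 2 ^ I) * N x"
  using tail
proof (elim disjE)
  assume dense: "vanishing_tails V N"
  define D where "D = (\<Sum>K\<in>B k I. \<bar>\<rho> k I K\<bar> * (C / wt K))"
  have "(\<lambda>L. D * N (\<lambda>l. if l < L then 0 else emb x l)) \<longlonglongrightarrow> D * 0"
    using dense[unfolded vanishing_tails_def] emb_V[OF x] by (intro tendsto_mult tendsto_const) auto
  moreover have p: "D * 0 < (\<eta> / 2 ^ k) / (c0 * 2 ^ I) * N x" using \<eta> c0 Nx by simp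
  ultimately have "\<forall>\<^sub>F L in sequentially. D * N (\<lambda>l. if l < L then 0 else emb x l) < (\<eta> / 2 ^ k) / (c0 * 2 ^ I) * N x"
    by (rule order_tendstoD(2))
  from eventually_happens'[OF sequentially_bot eventually_conj[OF this eventually_gt_at_top[of k]]]
  obtain L where L: "D * N (\<lambda>l. if l < L then 0 else emb x l) < (\<eta> / 2 ^ k) / (c0 * 2 ^ I) * N x" "k < L" by blast
  define F where "F = {l \<in> KK. l < L}"
  have eq: "(\<lambda>l. if l \<in> F then 0 else emb x l) = (\<lambda>l. if l < L then 0 else emb x l)" by (auto simp: F_def emb_def)
  have "(\<lambda>l. if l < L then 0 else emb x l) \<in> V"
    by (rule restrict_V[OF conjunct1[OF emb_V[OF x]]])
  hence "\<bar>G k I (\<lambda>l. if l \<in> F then 0 else emb x l)\<bar> \<le> (\<eta> / 2 ^ k) / (c0 * 2 ^ I) * N x"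
    unfolding eq using G_le[of "\<lambda>l. if l < L then 0 else emb x l" k I] L(1) unfolding D_def by linarith
  thus ?thesis using k L(2) by (intro exI[of _ F]) (auto simp: F_def)
next
  assume "\<exists>nn. (\<forall>i. \<forall>j<i. \<forall>K\<in>level (lam j). nn (\<kappa> j) K j (\<kappa> i) \<le> lam i) \<and>
        (\<forall>k\<in>KK. \<forall>K j. \<forall>x\<in>V. (\<forall>l. x l \<in> closure (span (e l ` {nn k K j l :: nat..}))) \<longrightarrow> \<bar>\<psi> k K x\<bar> \<le> (1/2) ^ j * N x)"
  then obtain nn :: "nat \<Rightarrow> nat \<Rightarrow> nat \<Rightarrow> nat \<Rightarrow> nat" where nn': "\<forall>i. \<forall>j<i. \<forall>K\<in>level (lam j). nn (\<kappa> j) K j (\<kappa> i) \<le> lam i"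
    and small': "\<forall>k\<in>KK. \<forall>K j. \<forall>x\<in>V. (\<forall>l. x l \<in> closure (span (e l ` {nn k K j l..}))) \<longrightarrow> \<bar>\<psi> k K x\<bar> \<le> (1/2) ^ j * N x"
    by (elim exE conjE)
  note nn = nn'[rule_format]
  note small = small'[rule_format, OF k]
  have "finite (lev ` B k I)" using B_facts(1)[OF k I] by simp
  then obtain i0 where i0: "lev ` B k I \<subseteq> {..<i0}" using finite_nat_iff_bounded by blast
  \<comment> \<open>Every level serving a component outside \<open>F\<close> has position at least
    \<open>i0\<close>, whereas the blocks of \<open>B k I\<close> come from positions
    \<open>j\<close> with \<open>j \<le> lam j < i0\<close>.\<close>
  define F where "F = insert k (\<kappa> ` {..<i0})"
  have F: "finite F" "F \<subseteq> KK" "k \<in> F" using \<kappa> k by (auto simp: F_def)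
  define z where "z l = (if l \<in> F then 0 else emb x l)" for l
  have z: "z \<in> V \<and> N z \<le> 1 * N x"
  proof (rule V_solid[OF x])
    fix l
    show "z l \<in> Yk l" using V_Y[of "emb x" l] emb_V[OF x] by (simp add: z_def)
    show "norm (z l) \<le> 1 * norm (x l)" using bdl_norm[OF U(1) V_Y[OF x]] by (simp add: z_def emb_def)
  qed simp
  have psi: "\<bar>\<psi> k K z\<bar> \<le> Om k I * N x" if K: "K \<in> B k I" for K
  proof -
    obtain j where j: "\<kappa> j = k" "lev K = lam j" using B_facts(3)[OF k I K] by blast
    have Kl: "K \<in> level (lam j)" using j B_facts(2)[OF k I K] by (simp add: level_iff)
    have "lam j < i0" using i0 K j by auto
    hence ji0: "j < i0" using strict_mono_imp_increasing[OF lam, of j] by simp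
    have "z l \<in> closure (span (e l ` {nn k K j l..}))" for l
    proof (cases "l \<in> KK - F")
      case False
      hence "z l = 0" by (auto simp: z_def emb_def)
      moreover have "0 \<in> closure (span (e l ` {nn k K j l..}))" by (rule subsetD[OF closure_subset span_zero])
      ultimately show ?thesis by simp
    next
      case True
      hence l: "l \<in> KK" "l \<notin> F" by auto
      have "U l (x l) \<in> closure (span (e l ` {nn k K j l..}))"
      proof (rule b_deep[OF l(1) _ V_Y[OF x]])
        fix J L assume J: "J \<ge> 1" and L: "L \<in> B l J"
        obtain i where i: "\<kappa> i = l" "lev L = lam i" using B_facts(3)[OF l(1) J L] by blast
        have "\<not> i < i0" using i l(2) by (auto simp: F_def)
        hence "nn (\<kappa> j) K j (\<kappa> i) \<le> lam i" using ji0 Kl by (intro nn) auto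
        \<comment> \<open>The threshold limits Haar indices but was compared with levels; an
          interval of level \<open>lam i\<close> has index at least
          \<open>2 ^ lam i\<close>.\<close>
        also have "\<dots> \<le> 2 ^ lam i" by (rule less_imp_le[OF less_exp])
        also have "\<dots> \<le> L" using i B_facts(2)[OF l(1) J L] level_iff[of L "lam i"] by (auto simp: level_def)
        finally show "nn k K j l \<le> L" by (simp add: i j)
      qed
      thus ?thesis using l by (simp add: z_def emb_def)
    qed
    hence "\<bar>\<psi> k K z\<bar> \<le> (1/2) ^ j * N z" using z by (intro small) auto
    also have "(1/2) ^ j = \<omega> (lev K)" using om[of j] j by simp
    also have "\<omega> (lev K) * N z \<le> Om k I * N x"
    proof (rule mult_mono)
      show "\<omega> (lev K) \<le> Om k I" unfolding Om_def
        using K B_facts(1)[OF k I] om_nonneg by (intro member_le_sum) auto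
    qed (use z Om_nonneg N_nonneg in auto)
    finally show ?thesis .
  qed
  have "\<bar>G k I z\<bar> \<le> (\<Sum>K\<in>B k I. \<bar>\<rho> k I K * \<psi> k K z\<bar>)" unfolding G_def by (rule sum_abs)
  also have "\<dots> \<le> (\<Sum>K\<in>B k I. wt K / (c0 * wt I) * (Om k I * N x))"
    unfolding abs_mult using rho[OF k I] psi c0 by (intro sum_mono mult_mono) auto
  also have "\<dots> = sum wt (B k I) / (c0 * wt I) * (Om k I * N x)"
    by (simp only: sum_divide_distrib sum_distrib_right)
  also have "\<dots> = Om k I / c0 * N x" using B_facts(4)[OF k I] by simp
  also have "\<dots> \<le> (\<eta> / 2 ^ k * wt I / 2 ^ I) / c0 * N x"
    using B_facts(5)[OF k I] c0 Nx by (intro mult_right_mono divide_right_mono) auto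
  also have "\<dots> \<le> (\<eta> / 2 ^ k * 1 / 2 ^ I) / c0 * N x"
    using wt_le_1[of I] c0 Nx \<eta> by (intro mult_right_mono divide_right_mono mult_left_mono) auto
  also have "\<dots> = (\<eta> / 2 ^ k) / (c0 * 2 ^ I) * N x" by (simp add: mult_ac)
  finally show ?thesis using F unfolding z_def by blast
qed

text \<open>The embedded vector is split into the components outside \<open>F\<close>, the
  components in \<open>F\<close> without the direction of \<open>I\<close> in component
  \<open>k\<close>, and that direction itself, whose contribution \<open>M\<close> accounts for. The
  constant 3 is 1 for the tail plus 2 for the geometric sum over the components.\<close>

lemma cf_error:
  assumes k: "k \<in> KK" and I: "I \<ge> 1" and x: "x \<in> V" and Nx: "N x > 0"
  shows "\<bar>cfk k I (coord (T (emb x)) k - x k - M k (x k))\<bar> \<le> 3 * (\<eta> / 2 ^ k) / c0 * N x * (1/2) ^ I"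
proof -
  obtain F where F: "finite F" "F \<subseteq> KK" "k \<in> F"
    and tl: "\<bar>G k I (\<lambda>l. if l \<in> F then 0 else emb x l)\<bar> \<le> (\<eta> / 2 ^ k) / (c0 * 2 ^ I) * N x"
    using G_tail[OF assms] by blast
  define \<epsilon> where "\<epsilon> = (\<eta> / 2 ^ k) / (c0 * 2 ^ I)"
  have \<epsilon>: "\<epsilon> \<ge> 0" using \<eta> c0 by (simp add: \<epsilon>_def)
  define y where "y l = U l (x l - (if l = k then cfk k I (x k) *\<^sub>R e k I else 0))" for l
  define z where "z l = (if l \<in> F then 0 else emb x l)" for l
  have eY: "e k I \<in> Yk k" by (rule haar_basis.e_Y[OF hb I])
  have QY: "x l - (if l = k then cfk k I (x k) *\<^sub>R e k I else 0) \<in> Yk l" for l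
    using haar_basis.Y_diff[OF hb V_Y[OF x] haar_basis.Y_scale[OF hb eY]] V_Y[OF x] by auto
  have yY: "y l \<in> Yk l" if "l \<in> F" for l unfolding y_def using that F(2) U(3)[OF _ QY] by blast
  have zV: "z \<in> V" unfolding z_def by (rule restrict_V[OF conjunct1[OF emb_V[OF x]]])
  have fs: "(\<lambda>l. if l \<in> F then y l else 0) \<in> V"
    "G k I (\<lambda>l. if l \<in> F then y l else 0) = (\<Sum>l\<in>F. G k I (component_vector l (y l)))"
    by (rule finite_support(1)[OF F(1,2) yY], assumption) (rule finite_support(2)[OF F(1,2) yY G_linear], assumption)
  have bV: "component_vector k (b k I) \<in> V" using V_comp[OF k b_Y[OF k I]] by simp
  have dec: "emb x = z + ((\<lambda>l. if l \<in> F then y l else 0) + cfk k I (x k) *\<^sub>R component_vector k (b k I))"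
  proof
    fix l
    have "U k (x k - cfk k I (x k) *\<^sub>R e k I) = U k (x k) - cfk k I (x k) *\<^sub>R b k I"
      using bdl_diff[OF U(1)[OF k] haar_basis.subspace_Y[OF hb] V_Y[OF x] haar_basis.Y_scale[OF hb eY]]
        bdl_scale[OF U(1)[OF k] eY] U(2)[OF k I] by simp
    thus "emb x l = (z + ((\<lambda>l. if l \<in> F then y l else 0) + cfk k I (x k) *\<^sub>R component_vector k (b k I))) l"
      using F k by (auto simp: z_def y_def emb_def component_vector_def scaleR_fun_def)
  qed
  have fV: "(\<lambda>l. if l \<in> F then y l else 0) \<in> V" by (rule fs(1))
  note Glin = G_linear[of k I, unfolded linear_on_def]
  have Gdec: "G k I (emb x) = G k I z + ((\<Sum>l\<in>F. G k I (component_vector l (y l))) + cfk k I (x k) * G k I (component_vector k (b k I)))"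
    unfolding dec fs(2)[symmetric] using Glin zV fV bV scale_V[OF bV] V_add by simp
  have TV: "T (emb x) \<in> V" using T_V emb_V[OF x] by blast
  have c1: "cfk k I (coord (T (emb x)) k) = G k I (emb x)"
    using A(3)[OF k I V_Y[OF TV]] k by (simp add: coord_def G_def \<psi>_def)
  have cY: "coord (T (emb x)) k \<in> Yk k" using V_Y[of "coord (T (emb x))"] coord_V[OF TV] by simp
  note cfd = bdl_diff[OF haar_basis.cf[OF hb] haar_basis.subspace_Y[OF hb]]
  have "cfk k I (coord (T (emb x)) k - x k - M k (x k)) = G k I (emb x) - cfk k I (x k) - cfk k I (M k (x k))"
    using cfd[OF haar_basis.Y_diff[OF hb cY V_Y[OF x]] M(2)[OF k V_Y[OF x]]] cfd[OF cY V_Y[OF x]] c1 by simp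
  also have "\<dots> = G k I (emb x) - cfk k I (x k) * G k I (component_vector k (b k I))"
    using cf_M[OF k I V_Y[OF x]] by (simp add: G_def algebra_simps)
  also have "\<dots> = G k I z + (\<Sum>l\<in>F. G k I (component_vector l (y l)))" using Gdec by simp
  finally have eq: "cfk k I (coord (T (emb x)) k - x k - M k (x k)) = G k I z + (\<Sum>l\<in>F. G k I (component_vector l (y l)))" .
  have "\<bar>\<Sum>l\<in>F. G k I (component_vector l (y l))\<bar> \<le> (\<Sum>l\<in>F. \<bar>G k I (component_vector l (y l))\<bar>)" by (rule sum_abs)
  also have "\<dots> \<le> (\<Sum>l\<in>F. \<epsilon> * (\<eta> / 2 ^ l) * N x)"
  proof (rule sum_mono)
    fix l assume "l \<in> F"
    hence l: "l \<in> KK" using F by blast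
    have "\<bar>G k I (component_vector l (y l))\<bar> \<le> \<epsilon> * (\<eta> / 2 ^ l) * norm (x l)"
      using G_comp_le[OF k l I V_Y[OF x]] by (cases "l = k") (simp_all add: y_def \<epsilon>_def)
    also have "\<dots> \<le> \<epsilon> * (\<eta> / 2 ^ l) * N x" using V_le[OF x] \<epsilon> \<eta> by (intro mult_left_mono) auto
    finally show "\<bar>G k I (component_vector l (y l))\<bar> \<le> \<epsilon> * (\<eta> / 2 ^ l) * N x" .
  qed
  also have "\<dots> = \<epsilon> * N x * (\<Sum>l\<in>F. \<eta> / 2 ^ l)" by (simp add: sum_distrib_left mult_ac)
  also have "\<dots> \<le> \<epsilon> * N x * 2"
    using sum_halves_component[OF F(1)] \<eta> \<epsilon> Nx by (intro mult_left_mono) auto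
  finally have "\<bar>G k I z + (\<Sum>l\<in>F. G k I (component_vector l (y l)))\<bar> \<le> 3 * (\<epsilon> * N x)"
    using tl unfolding \<epsilon>_def[symmetric] z_def[symmetric] by linarith
  also have "\<dots> = 3 * (\<eta> / 2 ^ k) / c0 * N x * (1/2) ^ I" by (simp add: \<epsilon>_def power_one_over mult_ac)
  finally show ?thesis unfolding eq .
qed

text \<open>In component \<open>k\<close> the coefficients sum to
  \<open>3 * (\<eta> / 2 ^ k) / c0\<close>, the multiplier \<open>M\<close> contributes the same
  amount, and summing over \<open>k\<close> doubles the total 6.\<close>

lemma close_to_identity:
  assumes x: "x \<in> V"
  shows "N (coord (T (emb x)) - x) \<le> 12 * \<eta> / c0 * N x"
proof (cases "N x > 0")
  case False
  hence "N x = 0" using N_nonneg[OF x] by simp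
  hence "x = 0" using V_le[OF x] by (simp add: fun_eq_iff)
  hence "coord (T (emb x)) = 0"
    using linear_on_0[OF emb_linear zero_V(1)] linear_on_0[OF T_lin zero_V(1)] linear_on_0[OF coord_linear zero_V(1)] by simp
  thus ?thesis using \<open>x = 0\<close> zero_V by simp
next
  case True
  have TV: "T (emb x) \<in> V" using T_V emb_V[OF x] by blast
  have WV: "coord (T (emb x)) \<in> V" using coord_V[OF TV] by simp
  define s where "s k = 6 * \<eta> / c0 * N x * (1/2) ^ k" for k :: nat
  have ss: "s sums (6 * \<eta> / c0 * N x * 2)" unfolding s_def
    using sums_mult[OF geometric_sums[of "1/2::real"], of "6 * \<eta> / c0 * N x"] by simp
  have "coord (T (emb x)) - x \<in> V \<and> N (coord (T (emb x)) - x) \<le> suminf s"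
  proof (rule sum_V)
    fix k assume k: "k \<in> KK"
    let ?d = "coord (T (emb x)) k - x k - M k (x k)"
    have WY: "coord (T (emb x)) k - x k \<in> Yk k" using haar_basis.Y_diff[OF hb V_Y[OF WV] V_Y[OF x]] .
    thus "(coord (T (emb x)) - x) k \<in> Yk k" by simp
    have "norm ?d \<le> 3 * (\<eta> / 2 ^ k) / c0 * N x"
    proof (rule haar_basis.norm_le_coeffs[OF hb])
      show "?d \<in> Yk k" by (rule haar_basis.Y_diff[OF hb WY M(2)[OF k V_Y[OF x]]])
      fix m
      have p: "3 * (\<eta> / 2 ^ k) / c0 * N x \<ge> 0" using \<eta> c0 True by simp
      have "(\<Sum>I\<in>nodes m. \<bar>cfk k I ?d\<bar>) \<le> (\<Sum>I\<in>nodes m. 3 * (\<eta> / 2 ^ k) / c0 * N x * (1/2) ^ I)"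
        by (intro sum_mono cf_error[OF k _ x True]) simp
      also have "\<dots> = 3 * (\<eta> / 2 ^ k) / c0 * N x * (\<Sum>I\<in>nodes m. (1/2) ^ I)" by (rule sum_distrib_left[symmetric])
      also have "\<dots> \<le> 3 * (\<eta> / 2 ^ k) / c0 * N x * 1" using p by (intro mult_left_mono sum_halves_le) auto
      finally show "(\<Sum>I\<in>nodes m. \<bar>cfk k I ?d\<bar>) \<le> 3 * (\<eta> / 2 ^ k) / c0 * N x" by simp
    qed
    moreover have "norm (M k (x k)) \<le> 3 * (\<eta> / 2 ^ k) / c0 * N x"
    proof -
      have "norm (M k (x k)) \<le> 3 * (\<eta> / 2 ^ k) / c0 * norm (x k)" by (rule bdl_norm[OF M(1)[OF k] V_Y[OF x]])
      also have "\<dots> \<le> 3 * (\<eta> / 2 ^ k) / c0 * N x" using V_le[OF x] \<eta> c0 by (intro mult_left_mono) auto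
      finally show ?thesis .
    qed
    moreover have "norm (coord (T (emb x)) k - x k) \<le> norm ?d + norm (M k (x k))"
      using norm_triangle_ineq[of ?d "M k (x k)"] by simp
    moreover have "s k = 3 * (\<eta> / 2 ^ k) / c0 * N x + 3 * (\<eta> / 2 ^ k) / c0 * N x"
      by (simp add: s_def power_one_over)
    ultimately have "norm (coord (T (emb x)) k - x k) \<le> s k" by linarith
    thus "norm ((coord (T (emb x)) - x) k) \<le> s k" by simp
  next
    fix k assume "k \<notin> KK"
    thus "(coord (T (emb x)) - x) k = 0" using V_zero[OF x] by (simp add: coord_def)
  next
    fix k show "s k \<ge> 0" using \<eta> c0 True by (simp add: s_def)
  qed (rule sums_summable[OF ss])
  thus ?thesis using sums_unique[OF ss] by simp
qed


text \<open>The product \<open>coord T emb\<close> has a left inverse \<open>H\<close> by the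
  Neumann series, so \<open>H\<close> composed with \<open>coord\<close> and the embedding are the
  two factors. The constant multiplies the bounds 1 of \<open>emb\<close>, \<open>2 / c0\<close> of
  \<open>coord\<close> and \<open>1 / (1 - 12 * \<eta> / c0)\<close> of \<open>H\<close>.\<close>

lemma factors:
  assumes q: "12 * \<eta> / c0 < 1"
  shows "factors_through V N (\<lambda>x. x) T (2 / c0 / (1 - 12 * \<eta> / c0))"
proof -
  define q where "q = 12 * \<eta> / c0"
  have q: "0 \<le> q" "q < 1" using assms \<eta> c0 by (simp_all add: q_def)
  define W where "W x = coord (T (emb x))" for x
  have TV: "T (emb x) \<in> V" if "x \<in> V" for x using that T_V emb_V by blast
  have lin: "linear_on V (\<lambda>x. g (f x))" if "linear_on V f" "linear_on V g" "\<And>x. x \<in> V \<Longrightarrow> f x \<in> V"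
    for f g :: "(nat \<Rightarrow> 'b) \<Rightarrow> nat \<Rightarrow> 'b"
    using that by (simp add: linear_on_def)
  have "linear_on V W" unfolding W_def
    by (rule lin[OF lin[OF emb_linear T_lin] coord_linear]) (use emb_V T_V in auto)
  moreover have "W x \<in> V" if "x \<in> V" for x unfolding W_def using coord_V[OF TV[OF that]] by simp
  moreover have "N (W x - x) \<le> q * N x" if "x \<in> V" for x unfolding W_def q_def by (rule close_to_identity[OF that])
  ultimately obtain H where H: "linear_on V H" "\<And>x. x \<in> V \<Longrightarrow> H x \<in> V \<and> N (H x) \<le> N x / (1 - q) \<and> H (W x) = x"
    using neumann[of W q] q by blast
  have HA: "H (coord x) \<in> V" "N (H (coord x)) \<le> 2 / c0 / (1 - q) * N x" if x: "x \<in> V" for x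
  proof -
    note c = coord_V[OF x]
    show "H (coord x) \<in> V" using H(2) c by blast
    have "N (H (coord x)) \<le> N (coord x) / (1 - q)" using H(2) c by blast
    also have "\<dots> \<le> 2 / c0 * N x / (1 - q)" using c q by (intro divide_right_mono) auto
    finally show "N (H (coord x)) \<le> 2 / c0 / (1 - q) * N x" by simp
  qed
  have on: "0 \<le> operator_norm V N f \<and> operator_norm V N f \<le> c"
    if f: "\<And>x. x \<in> V \<Longrightarrow> f x \<in> V" "\<And>x. x \<in> V \<Longrightarrow> N (f x) \<le> c * N x" "c \<ge> 0" for f c
  proof
    have le: "N (f x) \<le> c" if x: "x \<in> {x \<in> V. N x \<le> 1}" for x
    proof -
      have "N (f x) \<le> c * N x" using f(2) x by blast
      also have "\<dots> \<le> c * 1" using x f(3) by (intro mult_left_mono) auto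
      finally show ?thesis by simp
    qed
    have z: "0 \<in> {x \<in> V. N x \<le> 1}" using zero_V by simp
    show "operator_norm V N f \<le> c" unfolding operator_norm_def using z le by (intro cSUP_least) blast+
    have "0 \<le> N (f 0)" by (rule N_nonneg[OF f(1)[OF zero_V(1)]])
    also have "\<dots> \<le> operator_norm V N f" unfolding operator_norm_def
      using z le by (intro cSUP_upper bdd_aboveI2[of _ _ c])
    finally show "0 \<le> operator_norm V N f" .
  qed
  have "operator_norm V N (\<lambda>x. H (coord x)) * operator_norm V N emb \<le> 2 / c0 / (1 - q) * 1"
    using on[of "\<lambda>x. H (coord x)" "2 / c0 / (1 - q)"] HA on[of emb 1] emb_V c0 q by (intro mult_mono) auto
  moreover have "bounded_operator V N (\<lambda>x. H (coord x))"
    unfolding bounded_operator_def using lin[OF coord_linear H(1)] coord_V HA by blast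
  moreover have "bounded_operator V N emb" unfolding bounded_operator_def using emb_linear emb_V by blast
  moreover have "\<forall>x\<in>V. x = H (coord (T (emb x)))" using H(2) by (simp add: W_def)
  ultimately show ?thesis unfolding factors_through_def q_def by (intro exI[of _ "\<lambda>x. H (coord x)"] exI[of _ emb]) simp
qed

end

section \<open>Existence of the systems and the constant 4\<close>

lemma factors_through_mono: "factors_through V N S T C \<Longrightarrow> C \<le> D \<Longrightarrow> factors_through V N S T D"
  unfolding factors_through_def by (meson order_trans)

context diag_op
begin

lemma block_systems_exist:
  assumes \<eta>: "0 < \<eta>" "\<eta> \<le> 1" and c0: "0 < c0" "c0 \<le> \<delta> / 2 - \<eta>"
  shows "\<exists>\<kappa> lam \<omega> B \<Theta> U A M \<rho>. block_systems e nrm KK V N T C \<delta> \<kappa> lam \<omega> \<eta> c0 B \<Theta> U A M \<rho>"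
proof -
  obtain k0 where k0: "k0 \<in> KK" using KK by blast
  \<comment> \<open>Decoding pairs visits every component infinitely often, so each one is served by
    infinitely many levels; \<open>k0\<close> is the default for components outside
    \<open>KK\<close>.\<close>
  define \<kappa> where "\<kappa> i = (if fst (prod_decode i) \<in> KK then fst (prod_decode i) else k0)" for i
  have \<kappa>: "\<kappa> i \<in> KK" for i using k0 by (simp add: \<kappa>_def)
  have \<kappa>_inf: "infinite {i. \<kappa> i = k}" if k: "k \<in> KK" for k
  proof
    assume "finite {i. \<kappa> i = k}"
    moreover have "range (\<lambda>j. prod_encode (k, j)) \<subseteq> {i. \<kappa> i = k}" using k by (auto simp: \<kappa>_def)
    ultimately have "finite (range (\<lambda>j. prod_encode (k, j)))" by (rule rev_finite_subset)
    moreover have "inj (\<lambda>j. prod_encode (k, j))" by (auto simp: inj_on_def)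
    ultimately show False using finite_imageD infinite_UNIV_nat by blast
  qed
  \<comment> \<open>The thresholds are fixed before the levels, because each new level has to exceed
    those of all earlier functionals. When tails vanish any \<open>nn\<close> will do.\<close>
  have "\<exists>nn :: nat \<Rightarrow> nat \<Rightarrow> nat \<Rightarrow> nat \<Rightarrow> nat. vanishing_tails V N \<or>
     (\<forall>k\<in>KK. \<forall>K j. \<forall>x\<in>V. (\<forall>l. x l \<in> closure (span (e l ` {nn k K j l..}))) \<longrightarrow> \<bar>\<psi> k K x\<bar> \<le> (1/2) ^ j * N x)"
    using V_tail
  proof (elim disjE)
    assume t: "tail_continuous e V N"
    have "\<exists>n :: nat \<Rightarrow> nat. \<forall>x\<in>V. (\<forall>l. x l \<in> closure (span (e l ` {n l..}))) \<longrightarrow> \<bar>\<psi> k K x\<bar> \<le> (1/2) ^ j * N x" for k K j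
      using spec[OF spec[OF spec[OF t[unfolded tail_continuous_def], of "\<psi> k K"], of "C / wt K"], of "(1/2) ^ j"] \<psi>_linear \<psi>_le by simp
    then obtain nn :: "nat \<Rightarrow> nat \<Rightarrow> nat \<Rightarrow> nat \<Rightarrow> nat" where
      "\<And>k K j. \<forall>x\<in>V. (\<forall>l. x l \<in> closure (span (e l ` {nn k K j l..}))) \<longrightarrow> \<bar>\<psi> k K x\<bar> \<le> (1/2) ^ j * N x" by metis
    thus ?thesis by (intro exI[of _ nn]) blast
  qed blast
  then obtain nn :: "nat \<Rightarrow> nat \<Rightarrow> nat \<Rightarrow> nat \<Rightarrow> nat" where nn: "vanishing_tails V N \<or>
     (\<forall>k\<in>KK. \<forall>K j. \<forall>x\<in>V. (\<forall>l. x l \<in> closure (span (e l ` {nn k K j l..}))) \<longrightarrow> \<bar>\<psi> k K x\<bar> \<le> (1/2) ^ j * N x)" by (elim exE)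
  obtain lam where lam: "\<And>i j. j < i \<Longrightarrow> lam j < lam i \<and> cross (\<kappa> j) (lam j) (\<kappa> i) (lam i) \<le> (1/2)^i * (1/2)^j \<and>
    cross (\<kappa> i) (lam i) (\<kappa> j) (lam j) \<le> (1/2)^i * (1/2)^j \<and> (\<forall>K\<in>level (lam j). nn (\<kappa> j) K j (\<kappa> i) \<le> lam i)"
    using levels_exist[of \<kappa> nn, OF \<kappa>] by (elim exE) (rule that, elim allE impE)
  have sm: "strict_mono lam" by (rule strict_monoI) (use lam in blast)
  hence inj: "inj lam" by (rule strict_mono_imp_inj_on)
  \<comment> \<open>The value 0 off the range of \<open>lam\<close> makes \<open>\<omega>\<close>
    summable over all levels.\<close>
  define \<omega> where "\<omega> l = (if l \<in> range lam then (1/2) ^ inv lam l else 0 :: real)" for l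
  have om: "\<omega> (lam i) = (1/2) ^ i" for i using inj by (simp add: \<omega>_def)
  have om0: "\<omega> l \<ge> 0" for l by (simp add: \<omega>_def)
  have oms: "summable \<omega>"
    using summable_mono_reindex[OF sm, of \<omega>] by (simp add: om summable_geometric) (simp add: \<omega>_def)
  have cross_le: "cross (\<kappa> i) (lam i) (\<kappa> j) (lam j) \<le> \<omega> (lam i) * \<omega> (lam j)" if "i \<noteq> j" for i j
    using lam[of i j] lam[of j i] that unfolding om by (cases "i < j") (auto simp: mult.commute)
  have ex: "\<exists>B \<Theta> U A M \<rho>. haar_basis.good_system (e k) (Tk k) {lam i |i. \<kappa> i = k} \<omega> c0 (\<eta> / 2 ^ k) B \<Theta> U A M \<rho>" if k: "k \<in> KK" for k
  proof (rule haar_basis.good_system_exists[OF hb])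
    show "bdl (Yk k) C (Tk k)" "\<And>y. y \<in> Yk k \<Longrightarrow> Tk k y \<in> Yk k" using Tk[OF k] by auto
    show "\<bar>haar_basis.mat (e k) (Tk k) K K\<bar> \<ge> \<delta>" if "K \<ge> 1" for K using diag[OF k that] that by (simp add: mat_Tk \<psi>_def)
    have "{lam i |i. \<kappa> i = k} = lam ` {i. \<kappa> i = k}" by auto
    thus "infinite {lam i |i. \<kappa> i = k}" using \<kappa>_inf[OF k] finite_image_iff[OF inj_on_subset[OF inj subset_UNIV], of "{i. \<kappa> i = k}"] by simp
    show "(\<Sum>K\<in>level l. \<Sum>L\<in>level l'. wt K * \<bar>haar_basis.mat (e k) (Tk k) K L\<bar>) \<le> \<omega> l * \<omega> l'"
      if l: "l \<in> {lam i |i. \<kappa> i = k}" "l' \<in> {lam i |i. \<kappa> i = k}" "l \<noteq> l'" for l l'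
    proof -
      obtain i j where ij: "\<kappa> i = k" "l = lam i" "\<kappa> j = k" "l' = lam j" using l(1,2) by blast
      have "(\<Sum>K\<in>level l. \<Sum>L\<in>level l'. wt K * \<bar>haar_basis.mat (e k) (Tk k) K L\<bar>) = cross k l k l'"
        unfolding cross_def by (intro sum.cong refl) (simp add: mat_Tk level_iff)
      thus ?thesis using cross_le[of i j] ij l(3) by auto
    qed
    have "\<eta> / 2 ^ k \<le> \<eta> / 1" using \<eta> by (intro divide_left_mono) auto
    thus "c0 \<le> \<delta> / 2 - \<eta> / 2 ^ k" using c0 by simp
    show "\<eta> / 2 ^ k > 0" using \<eta> by simp
  qed (fact om0 oms c0(1))+
  define P where "P k p \<longleftrightarrow> haar_basis.good_system (e k) (Tk k) {lam i |i. \<kappa> i = k} \<omega> c0 (\<eta> / 2 ^ k)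
    (fst p) (fst (snd p)) (fst (snd (snd p))) (fst (snd (snd (snd p)))) (fst (snd (snd (snd (snd p))))) (snd (snd (snd (snd (snd p)))))" for k p
  have "\<forall>k\<in>KK. \<exists>p. P k p"
  proof
    fix k assume "k \<in> KK"
    from ex[OF this] show "\<exists>p. P k p" unfolding P_def split_paired_Ex fst_conv snd_conv .
  qed
  from bchoice[OF this] obtain p where p: "\<forall>k\<in>KK. P k (p k)" ..
  define B \<Theta> U A M \<rho> where "B k = fst (p k)" and "\<Theta> k = fst (snd (p k))" and "U k = fst (snd (snd (p k)))"
    and "A k = fst (snd (snd (snd (p k))))" and "M k = fst (snd (snd (snd (snd (p k)))))" and "\<rho> k = snd (snd (snd (snd (snd (p k)))))" for k
  have gs: "haar_basis.good_system (e k) (Tk k) {lam i |i. \<kappa> i = k} \<omega> c0 (\<eta> / 2 ^ k) (B k) (\<Theta> k) (U k) (A k) (M k) (\<rho> k)" if "k \<in> KK" for k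
    using bspec[OF p that] unfolding P_def B_def \<Theta>_def U_def A_def M_def \<rho>_def .
  have "block_systems e nrm KK V N T C \<delta> \<kappa> lam \<omega> \<eta> c0 B \<Theta> U A M \<rho>"
  proof
    show "vanishing_tails V N \<or>
      (\<exists>nn. (\<forall>i. \<forall>j<i. \<forall>K\<in>level (lam j). nn (\<kappa> j) K j (\<kappa> i) \<le> lam i) \<and>
        (\<forall>k\<in>KK. \<forall>K j. \<forall>x\<in>V. (\<forall>l. x l \<in> closure (span (e l ` {nn k K j l :: nat..}))) \<longrightarrow> \<bar>\<psi> k K x\<bar> \<le> (1/2) ^ j * N x))"
      using nn
    proof (elim disjE)
      assume t: "\<forall>k\<in>KK. \<forall>K j. \<forall>x\<in>V. (\<forall>l. x l \<in> closure (span (e l ` {nn k K j l..}))) \<longrightarrow> \<bar>\<psi> k K x\<bar> \<le> (1/2) ^ j * N x"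
      have "\<forall>i. \<forall>j<i. \<forall>K\<in>level (lam j). nn (\<kappa> j) K j (\<kappa> i) \<le> lam i" using lam by blast
      thus ?thesis using t by (intro disjI2 exI[of _ nn] conjI)
    qed (rule disjI1)
  qed (fact \<kappa> sm om om0 cross_le \<eta> c0(1) gs)+
  thus ?thesis by (intro exI)
qed

theorem factors_identity:
  assumes "\<gamma> > 0"
  shows "factors_through V N (\<lambda>x. x) T (4 / \<delta> + \<gamma>)"
proof -
  \<comment> \<open>The bound from \<open>factors\<close> equals
    \<open>2 / (c0 - 12 * \<eta>)\<close>, which is at most the desired constant as soon as the
    denominator is at least \<open>D\<close>.\<close>
  define D where "D = 2 / (4 / \<delta> + \<gamma>)"
  have p: "4 / \<delta> + \<gamma> > 4 / \<delta>" "4 / \<delta> > 0" using assms \<delta> by auto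
  have D: "D > 0" "2 / D = 4 / \<delta> + \<gamma>" using order.strict_trans[OF p(2,1)] by (simp_all add: D_def)
  have "D < 2 / (4 / \<delta>)" unfolding D_def
    by (rule divide_strict_left_mono[OF p(1)]) (simp, rule mult_pos_pos[OF order.strict_trans[OF p(2,1)] p(2)])
  hence D2: "D < \<delta> / 2" by simp
  \<comment> \<open>Of the 13 parts, 12 pay for the distance from the identity and one for
    \<open>c0\<close> being \<open>\<eta>\<close> below \<open>\<delta> / 2\<close>.\<close>
  define \<eta> where "\<eta> = min 1 ((\<delta> / 2 - D) / 13)"
  have \<eta>: "0 < \<eta>" "\<eta> \<le> 1" "13 * \<eta> \<le> \<delta> / 2 - D" using D2 by (auto simp: \<eta>_def min_def)
  define c0 where "c0 = \<delta> / 2 - \<eta>"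
  have cp: "0 < c0" "c0 - 12 * \<eta> \<ge> D" using \<eta> D(1) by (auto simp: c0_def)
  obtain \<kappa> lam \<omega> B \<Theta> U A M \<rho> where "block_systems e nrm KK V N T C \<delta> \<kappa> lam \<omega> \<eta> c0 B \<Theta> U A M \<rho>"
    using block_systems_exist[OF \<eta>(1,2) cp(1)] unfolding c0_def by auto
  then interpret block_systems e nrm KK V N T C \<delta> \<kappa> lam \<omega> \<eta> c0 B \<Theta> U A M \<rho> .
  have "factors_through V N (\<lambda>x. x) T (2 / c0 / (1 - 12 * \<eta> / c0))"
  proof (rule factors)
    have "12 * \<eta> < c0" using cp(2) D(1) by linarith
    thus "12 * \<eta> / c0 < 1" using cp(1) by simp
  qed
  moreover have "2 / c0 / (1 - 12 * \<eta> / c0) = 2 / (c0 - 12 * \<eta>)" using cp by (simp add: right_diff_distrib)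
  moreover have "2 / (c0 - 12 * \<eta>) \<le> 2 / D" using cp D by (intro divide_left_mono) auto
  ultimately show ?thesis using D(2) factors_through_mono by simp
qed

end

subsection \<open>Coordinatewise norms\<close>

text \<open>The norm is presented as the least common bound of functionals \<open>P m\<close> that
  are continuous for convergence in each component. This makes it lower semicontinuous, from which
  completeness of the sum follows without a separate argument for each norm.\<close>

locale coordinate_norm =
  fixes e :: "nat \<Rightarrow> nat \<Rightarrow> 'b::banach" and nrm :: "nat \<Rightarrow> nat \<Rightarrow> (nat \<Rightarrow> real) \<Rightarrow> real"
    and KK :: "nat set" and V :: "(nat \<Rightarrow> 'b) set" and N :: "(nat \<Rightarrow> 'b) \<Rightarrow> real"
    and P :: "nat \<Rightarrow> (nat \<Rightarrow> 'b) \<Rightarrow> real"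
  assumes comp: "\<And>k. haar_null (e k) (nrm k)"
    and KK: "KK \<noteq> {}"
    and char: "\<And>x c. 0 \<le> c \<Longrightarrow> x \<in> V \<and> N x \<le> c \<longleftrightarrow>
      (\<forall>k. x k \<in> haar_basis.Y (e k)) \<and> (\<forall>k. k \<notin> KK \<longrightarrow> x k = 0) \<and> (\<forall>m. P m x \<le> c)"
    and N_nonneg: "\<And>x. x \<in> V \<Longrightarrow> 0 \<le> N x"
    and P_add: "\<And>m x y. P m (x + y) \<le> P m x + P m y"
    and P_cont: "\<And>m s x. (\<And>k. (\<lambda>n. s n k) \<longlonglongrightarrow> x k) \<Longrightarrow> (\<lambda>n. P m (s n)) \<longlonglongrightarrow> P m x"
    and P_solid: "\<And>m x z C. 0 \<le> C \<Longrightarrow> (\<And>k. norm (z k) \<le> C * norm (x k)) \<Longrightarrow> P m z \<le> C * P m x"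
    and P_comp: "\<And>m k y. P m (component_vector k y) \<le> norm y"
    and P_le: "\<And>x k. \<exists>m. norm (x k) \<le> P m x"
begin

lemma hb: "haar_basis (e k) (nrm k)" using comp[of k] by (simp add: haar_null_def)

lemma V_D:
  assumes "x \<in> V" shows "x k \<in> haar_basis.Y (e k)" "k \<notin> KK \<Longrightarrow> x k = 0" "P m x \<le> N x" "norm (x k) \<le> N x"
proof -
  have *: "(\<forall>k. x k \<in> haar_basis.Y (e k)) \<and> (\<forall>k. k \<notin> KK \<longrightarrow> x k = 0) \<and> (\<forall>m. P m x \<le> N x)"
    using char[OF N_nonneg[OF assms], of x] assms by simp
  thus "x k \<in> haar_basis.Y (e k)" "k \<notin> KK \<Longrightarrow> x k = 0" "P m x \<le> N x" by auto
  obtain m where "norm (x k) \<le> P m x" using P_le by blast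
  thus "norm (x k) \<le> N x" using * order_trans by blast
qed

lemma V_I:
  assumes "\<And>k. x k \<in> haar_basis.Y (e k)" "\<And>k. k \<notin> KK \<Longrightarrow> x k = 0" "\<And>m. P m x \<le> c" "0 \<le> c"
  shows "x \<in> V \<and> N x \<le> c"
  using char[OF assms(4), of x] assms(1-3) by blast

lemma P_sum: "P m (\<lambda>k. \<Sum>n<L. x n k) \<le> (\<Sum>n<L. P m (x n))" for L :: nat
proof (induction L)
  case 0
  show ?case using P_solid[of 0 "\<lambda>_. 0" "\<lambda>_. 0" m] by simp
next
  case (Suc L)
  have "(\<lambda>k. \<Sum>n<Suc L. x n k) = (\<lambda>k. \<Sum>n<L. x n k) + x L" by auto
  thus ?case using P_add[of m "\<lambda>k. \<Sum>n<L. x n k" "x L"] Suc by simp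
qed

lemma haar_sumI:
  assumes tail: "vanishing_tails V N \<or> tail_continuous e V N"
  shows "haar_sum e nrm KK V N"
proof (rule haar_sum.intro)
  show "z \<in> V \<and> N z \<le> C * N x" if x: "x \<in> V" and C: "C \<ge> 0" and z: "\<And>k. z k \<in> haar_basis.Y (e k)" "\<And>k. norm (z k) \<le> C * norm (x k)" for x z C
  proof (rule V_I)
    show "z k = 0" if "k \<notin> KK" for k using z(2)[of k] V_D(2)[OF x that] by simp
    show "P m z \<le> C * N x" for m
      by (rule order_trans[OF P_solid[OF C z(2)] mult_left_mono[OF V_D(3)[OF x] C]])
    show "0 \<le> C * N x" using C N_nonneg[OF x] by simp
  qed (rule z)
  show "component_vector k y \<in> V \<and> N (component_vector k y) = norm y" if k: "k \<in> KK" and y: "y \<in> haar_basis.Y (e k)" for k y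
  proof -
    have 1: "component_vector k y \<in> V \<and> N (component_vector k y) \<le> norm y"
      by (rule V_I) (use k y P_comp haar_basis.Y_0[OF hb] in \<open>auto simp: component_vector_def\<close>)
    have "norm (component_vector k y k) \<le> N (component_vector k y)" using 1 V_D(4) by blast
    thus ?thesis using 1 by (simp add: component_vector_def)
  qed
  show "x + y \<in> V \<and> N (x + y) \<le> N x + N y" if xy: "x \<in> V" "y \<in> V" for x y
  proof (rule V_I)
    show "(x + y) k \<in> haar_basis.Y (e k)" for k using haar_basis.Y_add[OF hb V_D(1)[OF xy(1)] V_D(1)[OF xy(2)]] by simp
    show "(x + y) k = 0" if "k \<notin> KK" for k using V_D(2)[OF xy(1) that] V_D(2)[OF xy(2) that] by simp
    show "P m (x + y) \<le> N x + N y" for m using P_add[of m x y] V_D(3)[OF xy(1), of m] V_D(3)[OF xy(2), of m] by linarith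
    show "0 \<le> N x + N y" using N_nonneg xy by simp
  qed
  show "(\<lambda>k. \<Sum>n. x n k) \<in> V \<and> N (\<lambda>k. \<Sum>n. x n k) \<le> (\<Sum>n. N (x n))" if x: "\<And>n. x n \<in> V" and s: "summable (\<lambda>n. N (x n))" for x
  proof (rule V_I)
    have sk: "summable (\<lambda>n. x n k)" for k
      by (rule summable_norm_cancel, rule summable_comparison_test'[OF s, of 0]) (use V_D(4)[OF x] in simp)
    have lim: "(\<lambda>L. \<Sum>n<L. x n k) \<longlonglongrightarrow> (\<Sum>n. x n k)" for k by (rule summable_LIMSEQ[OF sk])
    show "(\<Sum>n. x n k) \<in> haar_basis.Y (e k)" for k
    proof (rule closed_sequentially[OF haar_basis.closed_Y[OF hb] _ lim])
      show "(\<Sum>n<L. x n k) \<in> haar_basis.Y (e k)" for L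
        using V_D(1)[OF x] by (intro subspace_sum haar_basis.subspace_Y[OF hb])
    qed
    show "(\<Sum>n. x n k) = 0" if "k \<notin> KK" for k using V_D(2)[OF x that] by simp
    show "P m (\<lambda>k. \<Sum>n. x n k) \<le> (\<Sum>n. N (x n))" for m
    \<comment> \<open>A Fatou argument: the partial sums are bounded for each fixed
      \<open>m\<close>, and \<open>P m\<close> passes to the limit in each component.\<close>
    proof (rule LIMSEQ_le_const2[OF P_cont[OF lim]], intro exI allI impI)
      fix L :: nat
      have "P m (\<lambda>k. \<Sum>n<L. x n k) \<le> (\<Sum>n<L. P m (x n))" by (rule P_sum)
      also have "\<dots> \<le> (\<Sum>n<L. N (x n))" by (intro sum_mono V_D(3) x)
      also have "\<dots> \<le> (\<Sum>n. N (x n))" by (rule sum_le_suminf[OF s]) (use N_nonneg x in auto)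
      finally show "P m (\<lambda>k. \<Sum>n<L. x n k) \<le> (\<Sum>n. N (x n))" .
    qed
    show "0 \<le> (\<Sum>n. N (x n))" by (rule suminf_nonneg[OF s]) (use N_nonneg x in auto)
  qed
qed (fact comp KK tail V_D)+

end

text \<open>The boundary cases \<open>u = 0\<close> and \<open>v = 0\<close> are separated; there
  the claim reduces to \<open>t powr p \<le> t\<close> on the unit interval.\<close>

lemma powr_convex_nonneg:
  fixes u v s t p :: real
  assumes p: "1 \<le> p" and uv: "0 \<le> u" "0 \<le> v" and st: "0 \<le> s" "0 \<le> t" "s + t = 1"
  shows "(s * u + t * v) powr p \<le> s * u powr p + t * v powr p"
proof -
  have le: "w powr p \<le> w" if "0 \<le> w" "w \<le> 1" for w using powr_mono'[of 1 p w] p that by simp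
  consider "u = 0" | "v = 0" | "u > 0" "v > 0" using uv by linarith
  thus ?thesis
  proof cases
    case 1
    thus ?thesis using mult_right_mono[OF le[of t], of "v powr p"] st by (simp add: powr_mult)
  next
    case 2
    thus ?thesis using mult_right_mono[OF le[of s], of "u powr p"] st by (simp add: powr_mult)
  next
    case 3
    have s: "1 - t = s" using st by simp
    show ?thesis using convex_onD[OF powr_convex[OF p], of t u v] 3 st by (simp add: s)
  qed
qed

text \<open>Each summand is \<open>A + B\<close> times a convex combination of the normalised terms
  \<open>a k / A\<close> and \<open>b k / B\<close>, with weights \<open>A / (A + B)\<close> and
  \<open>B / (A + B)\<close>; convexity of the power and summation give the claim.\<close>

lemma minkowski_finite:
  fixes a b :: "'i \<Rightarrow> real"
  assumes p: "1 \<le> p" and F: "finite F" and nn: "\<And>k. a k \<ge> 0" "\<And>k. b k \<ge> 0"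
  shows "(\<Sum>k\<in>F. (a k + b k) powr p) powr (1 / p) \<le> (\<Sum>k\<in>F. a k powr p) powr (1 / p) + (\<Sum>k\<in>F. b k powr p) powr (1 / p)"
proof -
  define A where "A = (\<Sum>k\<in>F. a k powr p) powr (1 / p)"
  define B where "B = (\<Sum>k\<in>F. b k powr p) powr (1 / p)"
  have zero: "u k = 0" if "(\<Sum>k\<in>F. u k powr p) powr (1 / p) = 0" "k \<in> F" for u :: "'i \<Rightarrow> real" and k
    using that F by (simp add: sum_nonneg_eq_0_iff)
  have A0: "A \<ge> 0" "B \<ge> 0" by (simp_all add: A_def B_def)
  show ?thesis
  proof (cases "A = 0 \<or> B = 0")
    case True
    thus ?thesis
    proof
      assume "A = 0"
      hence "(\<Sum>k\<in>F. (a k + b k) powr p) = (\<Sum>k\<in>F. b k powr p)" using zero[of a] by (intro sum.cong) (auto simp: A_def)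
      thus ?thesis by simp
    next
      assume "B = 0"
      hence "(\<Sum>k\<in>F. (a k + b k) powr p) = (\<Sum>k\<in>F. a k powr p)" using zero[of b] by (intro sum.cong) (auto simp: B_def)
      thus ?thesis by simp
    qed
  next
    case False
    hence pos: "A > 0" "B > 0" using A0 by auto
    have Ap: "(\<Sum>k\<in>F. a k powr p) = A powr p" "(\<Sum>k\<in>F. b k powr p) = B powr p"
      using p by (simp_all add: A_def B_def powr_powr sum_nonneg)
    have term_le: "(a k + b k) powr p \<le> (A + B) powr p * (A / (A + B) * (a k powr p / A powr p) + B / (A + B) * (b k powr p / B powr p))" for k
    proof -
      have "(a k + b k) powr p = ((A + B) * (A / (A + B) * (a k / A) + B / (A + B) * (b k / B))) powr p"
      proof -
        have "A + B \<noteq> 0" using pos by simp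
        thus ?thesis using pos by (simp add: distrib_left)
      qed
      also have "\<dots> = (A + B) powr p * (A / (A + B) * (a k / A) + B / (A + B) * (b k / B)) powr p"
        by (rule powr_mult)
      also have "(A / (A + B) * (a k / A) + B / (A + B) * (b k / B)) powr p \<le> A / (A + B) * (a k / A) powr p + B / (A + B) * (b k / B) powr p"
      proof -
        have w: "A / (A + B) \<ge> 0" "B / (A + B) \<ge> 0" "A / (A + B) + B / (A + B) = 1" using pos by (auto simp flip: add_divide_distrib)
        show ?thesis using pos nn w by (intro powr_convex_nonneg p) auto
      qed
      finally show ?thesis using pos nn by (simp add: powr_divide mult_left_mono)
    qed
    have "(\<Sum>k\<in>F. (a k + b k) powr p) \<le> (\<Sum>k\<in>F. (A + B) powr p * (A / (A + B) * (a k powr p / A powr p) + B / (A + B) * (b k powr p / B powr p)))"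
      by (rule sum_mono[OF term_le])
    also have "\<dots> = (A + B) powr p * (A / (A + B) * ((\<Sum>k\<in>F. a k powr p) / A powr p) + B / (A + B) * ((\<Sum>k\<in>F. b k powr p) / B powr p))"
      by (simp only: sum_distrib_left[symmetric] sum.distrib sum_divide_distrib[symmetric])
    also have "\<dots> = (A + B) powr p * (A / (A + B) + B / (A + B))" using pos by (simp add: Ap)
    also have "A / (A + B) + B / (A + B) = 1" using pos by (simp flip: add_divide_distrib)
    finally have "(\<Sum>k\<in>F. (a k + b k) powr p) powr (1 / p) \<le> ((A + B) powr p) powr (1 / p)"
      using p by (intro powr_mono2) (auto intro: sum_nonneg)
    also have "\<dots> = A + B" using p pos by (simp add: powr_powr)
    finally show ?thesis by (simp add: A_def B_def)
  qed
qed

lemma lp_coordinate_norm: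
  assumes p: "1 \<le> p" and comp: "\<And>k. haar_null (e k) (nrm k)"
  shows "coordinate_norm e nrm UNIV (lp_sum p (\<lambda>k. haar_basis.Y (e k))) (lp_norm p) (\<lambda>m x. (\<Sum>k<m. norm (x k) powr p) powr (1 / p))"
proof (rule coordinate_norm.intro)
  have inv: "(c powr p) powr (1 / p) = c" if "c \<ge> 0" for c :: real using that p by (simp add: powr_powr)
  have le_iff: "s powr (1 / p) \<le> c \<longleftrightarrow> s \<le> c powr p" if "c \<ge> 0" "s \<ge> 0" for s c :: real
  proof
    assume "s powr (1 / p) \<le> c"
    hence "(s powr (1 / p)) powr p \<le> c powr p" using p by (intro powr_mono2) auto
    thus "s \<le> c powr p" using p that by (simp add: powr_powr)
  next
    assume "s \<le> c powr p"
    hence "s powr (1 / p) \<le> (c powr p) powr (1 / p)" using p that by (intro powr_mono2) auto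
    thus "s powr (1 / p) \<le> c" using inv that by simp
  qed
  show "x \<in> lp_sum p (\<lambda>k. haar_basis.Y (e k)) \<and> lp_norm p x \<le> c \<longleftrightarrow>
      (\<forall>k. x k \<in> haar_basis.Y (e k)) \<and> (\<forall>k. k \<notin> UNIV \<longrightarrow> x k = 0) \<and> (\<forall>m. (\<Sum>k<m. norm (x k) powr p) powr (1 / p) \<le> c)"
    if c: "0 \<le> c" for x :: "nat \<Rightarrow> 'a" and c
  proof -
    have "summable (\<lambda>k. norm (x k) powr p) \<and> lp_norm p x \<le> c \<longleftrightarrow> (\<forall>m. (\<Sum>k<m. norm (x k) powr p) \<le> c powr p)"
    proof
      assume s: "summable (\<lambda>k. norm (x k) powr p) \<and> lp_norm p x \<le> c"
      hence "(\<Sum>k. norm (x k) powr p) \<le> c powr p" using le_iff[OF c] suminf_nonneg[of "\<lambda>k. norm (x k) powr p"] by (simp add: lp_norm_def)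
      moreover have "(\<Sum>k<m. norm (x k) powr p) \<le> (\<Sum>k. norm (x k) powr p)" for m using s by (intro sum_le_suminf) auto
      ultimately show "\<forall>m. (\<Sum>k<m. norm (x k) powr p) \<le> c powr p" using order_trans by blast
    next
      assume b: "\<forall>m. (\<Sum>k<m. norm (x k) powr p) \<le> c powr p"
      hence s: "summable (\<lambda>k. norm (x k) powr p)" by (intro summableI_nonneg_bounded[of _ "c powr p"]) auto
      have "(\<Sum>k. norm (x k) powr p) \<le> c powr p" by (rule suminf_le_const[OF s]) (use b in blast)
      thus "summable (\<lambda>k. norm (x k) powr p) \<and> lp_norm p x \<le> c"
        using s le_iff[OF c] suminf_nonneg[OF s] by (simp add: lp_norm_def)
    qed
    thus ?thesis using le_iff[OF c] by (auto simp: lp_sum_def sum_nonneg)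
  qed
  show "0 \<le> lp_norm p x" for x :: "nat \<Rightarrow> 'a" by (simp add: lp_norm_def)
  show "(\<Sum>k<m. norm ((x + y) k) powr p) powr (1 / p) \<le> (\<Sum>k<m. norm (x k) powr p) powr (1 / p) + (\<Sum>k<m. norm (y k) powr p) powr (1 / p)"
    for m and x y :: "nat \<Rightarrow> 'a"
  proof -
    have "(\<Sum>k<m. norm ((x + y) k) powr p) powr (1 / p) \<le> (\<Sum>k<m. (norm (x k) + norm (y k)) powr p) powr (1 / p)"
      using p by (intro powr_mono2 sum_mono sum_nonneg) (auto intro: norm_triangle_ineq)
    also have "\<dots> \<le> (\<Sum>k<m. norm (x k) powr p) powr (1 / p) + (\<Sum>k<m. norm (y k) powr p) powr (1 / p)"
      by (rule minkowski_finite[OF p]) auto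
    finally show ?thesis .
  qed
  show "(\<lambda>n. (\<Sum>k<m. norm (s n k) powr p) powr (1 / p)) \<longlonglongrightarrow> (\<Sum>k<m. norm (x k) powr p) powr (1 / p)"
    if "\<And>k. (\<lambda>n. s n k) \<longlonglongrightarrow> x k" for m s and x :: "nat \<Rightarrow> 'a"
    using p by (intro tendsto_powr' tendsto_sum tendsto_norm that tendsto_const disjI2 conjI always_eventually allI sum_nonneg) auto
  show "(\<Sum>k<m. norm (z k) powr p) powr (1 / p) \<le> C * (\<Sum>k<m. norm (x k) powr p) powr (1 / p)"
    if C: "0 \<le> C" and zx: "\<And>k. norm (z k) \<le> C * norm (x k)" for m C and x z :: "nat \<Rightarrow> 'a"
  proof -
    have "(\<Sum>k<m. norm (z k) powr p) \<le> (\<Sum>k<m. (C * norm (x k)) powr p)" using p zx by (intro sum_mono powr_mono2) auto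
    also have "\<dots> = C powr p * (\<Sum>k<m. norm (x k) powr p)" using C by (simp add: powr_mult sum_distrib_left)
    finally have "(\<Sum>k<m. norm (z k) powr p) powr (1 / p) \<le> (C powr p * (\<Sum>k<m. norm (x k) powr p)) powr (1 / p)"
      using p by (intro powr_mono2) (auto intro: sum_nonneg)
    also have "\<dots> = C * (\<Sum>k<m. norm (x k) powr p) powr (1 / p)" using C inv by (simp add: powr_mult sum_nonneg)
    finally show ?thesis .
  qed
  show "(\<Sum>l<m. norm (component_vector k y l) powr p) powr (1 / p) \<le> norm y" for m k and y :: 'a
  proof -
    have "(\<Sum>l<m. norm (component_vector k y l) powr p) = (\<Sum>l<m. if l = k then norm y powr p else 0)"
      by (intro sum.cong) (auto simp: component_vector_def)
    also have "\<dots> \<le> norm y powr p" by simp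
    finally show ?thesis using le_iff[of "norm y" "\<Sum>l<m. norm (component_vector k y l) powr p"] by (simp add: sum_nonneg)
  qed
  show "\<exists>m. norm (x k) \<le> (\<Sum>l<m. norm (x l) powr p) powr (1 / p)" for x :: "nat \<Rightarrow> 'a" and k
  proof -
    have "norm (x k) powr p \<le> (\<Sum>l<Suc k. norm (x l) powr p)" by (rule member_le_sum) auto
    hence "(norm (x k) powr p) powr (1 / p) \<le> (\<Sum>l<Suc k. norm (x l) powr p) powr (1 / p)" using p by (intro powr_mono2) auto
    thus ?thesis unfolding inv[OF norm_ge_zero] by blast
  qed
qed (use comp in simp_all)

lemma lp_tail:
  assumes p: "1 \<le> p" and x: "x \<in> lp_sum p Y"
  shows "(\<lambda>L. lp_norm p (\<lambda>l. if l < L then 0 else x l)) \<longlonglongrightarrow> 0"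
proof -
  let ?f = "\<lambda>k. norm (x k) powr p"
  have s: "summable ?f" using x by (simp add: lp_sum_def)
  have eq: "(\<Sum>k. norm (if k < L then 0 else x k) powr p) = suminf ?f - sum ?f {..<L}" for L
  proof -
    have "(\<lambda>k. norm (if k < L then 0 else x k) powr p) = (\<lambda>k. ?f k - (if k \<in> {..<L} then ?f k else 0))" using p by auto
    moreover have "(\<lambda>k. if k \<in> {..<L} then ?f k else 0) sums sum ?f {..<L}" by (rule sums_If_finite_set) simp
    ultimately show ?thesis using sums_unique[OF sums_diff[OF summable_sums[OF s], of "\<lambda>k. if k \<in> {..<L} then ?f k else 0"]] by simp
  qed
  have "(\<lambda>L. suminf ?f - sum ?f {..<L}) \<longlonglongrightarrow> suminf ?f - suminf ?f" by (intro tendsto_diff tendsto_const summable_LIMSEQ s)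
  hence "(\<lambda>L. suminf ?f - sum ?f {..<L}) \<longlonglongrightarrow> 0" by simp
  hence "(\<lambda>L. (suminf ?f - sum ?f {..<L}) powr (1 / p)) \<longlonglongrightarrow> 0"
    using p sum_le_suminf[OF s] by (intro tendsto_zero_powrI[OF _ tendsto_const]) (auto intro!: always_eventually)
  thus ?thesis unfolding lp_norm_def eq .
qed

lemma linf_coordinate_norm:
  assumes comp: "\<And>k. haar_null (e k) (nrm k)"
  shows "coordinate_norm e nrm UNIV (linf_sum (\<lambda>k. haar_basis.Y (e k))) linf_norm (\<lambda>m x. norm (x m))"
proof (rule coordinate_norm.intro)
  show "x \<in> linf_sum (\<lambda>k. haar_basis.Y (e k)) \<and> linf_norm x \<le> c \<longleftrightarrow>
      (\<forall>k. x k \<in> haar_basis.Y (e k)) \<and> (\<forall>k. k \<notin> UNIV \<longrightarrow> x k = 0) \<and> (\<forall>m. norm (x m) \<le> c)"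
    if c: "0 \<le> c" for x :: "nat \<Rightarrow> 'a" and c
  proof -
    have "bounded (range x) \<and> linf_norm x \<le> c \<longleftrightarrow> (\<forall>m. norm (x m) \<le> c)"
    proof
      assume a: "bounded (range x) \<and> linf_norm x \<le> c"
      hence "bdd_above (range (\<lambda>k. norm (x k)))" by (auto simp: bounded_iff bdd_above_def)
      hence "norm (x m) \<le> linf_norm x" for m unfolding linf_norm_def by (intro cSUP_upper) auto
      thus "\<forall>m. norm (x m) \<le> c" using a order_trans by blast
    next
      assume a: "\<forall>m. norm (x m) \<le> c"
      thus "bounded (range x) \<and> linf_norm x \<le> c" unfolding linf_norm_def bounded_iff by (auto intro: cSUP_least)
    qed
    thus ?thesis by (auto simp: linf_sum_def)
  qed
  show "0 \<le> linf_norm x" if "x \<in> linf_sum (\<lambda>k. haar_basis.Y (e k))" for x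
  proof -
    have "bdd_above (range (\<lambda>k. norm (x k)))" using that by (auto simp: linf_sum_def bounded_iff bdd_above_def)
    hence "norm (x 0) \<le> linf_norm x" unfolding linf_norm_def by (intro cSUP_upper) auto
    thus ?thesis using norm_ge_zero order_trans by blast
  qed
qed (use comp in \<open>auto simp: component_vector_def intro: norm_triangle_ineq tendsto_norm\<close>)

section \<open>Block sequences and asymptotic curvature\<close>

context haar_basis
begin

lemma span_segment:
  assumes y: "y \<in> span (e ` {n..<q})" and n: "1 \<le> n"
  shows "y = (\<Sum>K\<in>{n..<q}. cf K y *\<^sub>R e K)" and "K \<notin> {n..<q} \<Longrightarrow> cf K y = 0"
proof -
  have eY: "e K \<in> Y" if "K \<in> {n..<q}" for K using that n by (intro e_Y) simp
  have *: "y \<in> Y \<and> y = (\<Sum>K\<in>{n..<q}. cf K y *\<^sub>R e K) \<and> (\<forall>K. K \<notin> {n..<q} \<longrightarrow> cf K y = 0)"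
    using y
  proof (induction rule: span_induct_alt)
    case base
    have "cf K 0 = 0" for K using bdl_scale[OF cf Y_0, of K 0] by simp
    thus ?case using Y_0 by simp
  next
    case (step c x y)
    then obtain L where L: "L \<in> {n..<q}" "x = e L" by blast
    have L1: "L \<ge> 1" using L n by simp
    have cfs: "cf K (c *\<^sub>R x + y) = c * (if L = K then 1 else 0) + cf K y" for K
      using bdl_add[OF cf Y_scale[OF eY[OF L(1)]]] bdl_scale[OF cf eY[OF L(1)]] step.IH cf_e[OF L1] unfolding L(2) by simp
    have "(\<Sum>K\<in>{n..<q}. cf K (c *\<^sub>R x + y) *\<^sub>R e K) = (\<Sum>K\<in>{n..<q}. (if L = K then c *\<^sub>R e L else 0)) + (\<Sum>K\<in>{n..<q}. cf K y *\<^sub>R e K)"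
      unfolding cfs scaleR_add_left sum.distrib by (intro arg_cong2[of _ _ _ _ plus] sum.cong) auto
    also have "\<dots> = c *\<^sub>R x + y" using L step.IH by simp
    finally show ?case using Y_add[OF Y_scale[OF eY[OF L(1)]]] step.IH L cfs by auto
  qed
  show "y = (\<Sum>K\<in>{n..<q}. cf K y *\<^sub>R e K)" using * by blast
  show "K \<notin> {n..<q} \<Longrightarrow> cf K y = 0" using * by blast
qed

lemma approx_segment:
  assumes y: "y \<in> closure (span (e ` {n..}))" and n: "1 \<le> n" and \<theta>: "\<theta> > 0"
  shows "\<exists>q z. n < q \<and> z \<in> span (e ` {n..<q}) \<and> z \<noteq> 0 \<and> norm (z - y) < \<theta>"
proof -
  obtain u where u: "u \<in> span (e ` {n..})" "norm (u - y) < \<theta> / 2"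
    using y \<theta> unfolding closure_approachable dist_norm by (metis half_gt_zero)
  have "\<exists>q. n < q \<and> u \<in> span (e ` {n..<q})" using u(1)
  proof (induction rule: span_induct_alt)
    case base
    show ?case by (intro exI[of _ "Suc n"]) (simp add: span_zero)
  next
    case (step c x y)
    then obtain L q where L: "L \<ge> n" "x = e L" "n < q" "y \<in> span (e ` {n..<q})" by auto
    define m where "m = max q (Suc L)"
    have "y \<in> span (e ` {n..<m})" by (rule subsetD[OF span_mono L(4)]) (auto simp: m_def)
    moreover have "x \<in> span (e ` {n..<m})" unfolding L(2) by (rule span_base) (use L(1) in \<open>auto simp: m_def\<close>)
    ultimately show ?case using L(3) by (intro exI[of _ m]) (auto simp: m_def intro: span_add span_scale)
  qed
  then obtain q where q: "n < q" "u \<in> span (e ` {n..<q})" by blast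
  show ?thesis
  proof (cases "u = 0")
    case False
    thus ?thesis using q u(2) \<theta> by (intro exI[of _ q] exI[of _ u]) simp
  next
    \<comment> \<open>A block basis must consist of non-zero vectors, so a zero approximation is
      replaced by a small multiple of \<open>e n\<close>.\<close>
    case True
    have "norm ((\<theta> / 2) *\<^sub>R e n - y) \<le> norm ((\<theta> / 2) *\<^sub>R e n) + norm y" by (rule norm_triangle_ineq4)
    also have "norm ((\<theta> / 2) *\<^sub>R e n) \<le> \<theta> / 2 * 1" using norm_e_le[OF n] \<theta> by (simp add: mult_left_mono)
    finally have "norm ((\<theta> / 2) *\<^sub>R e n - y) < \<theta>" using u(2) True by simp
    moreover have "(\<theta> / 2) *\<^sub>R e n \<noteq> 0" using norm_e_pos[OF n] \<theta> by auto
    moreover have "(\<theta> / 2) *\<^sub>R e n \<in> span (e ` {n..<q})" using q(1) by (intro span_scale span_base) auto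
    ultimately show ?thesis using q(1) by (intro exI[of _ q] exI[of _ "(\<theta> / 2) *\<^sub>R e n"]) simp
  qed
qed

lemma block_basis_segments:
  assumes q: "strict_mono q" "q 0 \<ge> 1" and x: "\<And>j. x j \<in> span (e ` {q j..<q (Suc j)})" "\<And>j. x j \<noteq> 0"
  shows "block_basis (\<lambda>j. e (Suc j)) x"
proof -
  have q1: "1 \<le> q j" for j using q strict_mono_less_eq[OF q(1), of 0 j] by linarith
  define q' where "q' j = q j - 1" for j
  have Sq: "q j = Suc (q' j)" for j using q1[of j] by (simp add: q'_def)
  have qm: "strict_mono q'" using strict_mono_less[OF q(1)] by (intro strict_monoI) (simp add: Sq)
  \<comment> \<open>The blocks are disjoint, so at most one summand is non-zero, and the block
    containing \<open>i\<close> has number at most \<open>i\<close> because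
    \<open>j \<le> q' j\<close>. One coefficient sequence thus serves all blocks; the shift by one
    is due to Haar indices starting at 1.\<close>
  define a where "a i = (\<Sum>j\<le>i. cf (Suc i) (x j))" for i
  have a: "a i = cf (Suc i) (x j)" if i: "i \<in> {q' j..<q' (Suc j)}" for i j
  proof -
    have "j \<le> q' j" by (rule strict_mono_imp_increasing[OF qm])
    hence ji: "j \<le> i" using i by simp
    have "cf (Suc i) (x l) = 0" if l: "l \<noteq> j" for l
    proof (rule span_segment(2)[OF x(1) q1])
      have "q' (Suc l) \<le> q' j \<or> q' (Suc j) \<le> q' l" using l strict_mono_less_eq[OF qm] by (cases "l < j") auto
      thus "Suc i \<notin> {q l..<q (Suc l)}" using i by (auto simp: Sq)
    qed
    hence "(\<Sum>l\<in>{..i} - {j}. cf (Suc i) (x l)) = 0" by (intro sum.neutral) auto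
    thus ?thesis unfolding a_def using ji by (subst sum.remove[of _ j]) auto
  qed
  have "x j = (\<Sum>i\<in>{q' j..<q' (Suc j)}. a i *\<^sub>R e (Suc i))" for j
  proof -
    have "x j = (\<Sum>K\<in>{Suc (q' j)..<Suc (q' (Suc j))}. cf K (x j) *\<^sub>R e K)" using span_segment(1)[OF x(1) q1, of j] unfolding Sq .
    also have "\<dots> = (\<Sum>i\<in>{q' j..<q' (Suc j)}. cf (Suc i) (x j) *\<^sub>R e (Suc i))" by (rule sum.shift_bounds_Suc_ivl)
    also have "\<dots> = (\<Sum>i\<in>{q' j..<q' (Suc j)}. a i *\<^sub>R e (Suc i))" using a by (intro sum.cong) auto
    finally show ?thesis .
  qed
  thus ?thesis unfolding block_basis_def using qm x(2) by blast
qed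

end

text \<open>If no thresholds work, every choice of thresholds admits a normalised vector beyond
  them, in all components at once, on which \<open>f\<close> exceeds \<open>\<epsilon>\<close>.
  Iterating gives block sequences in every component. The sum of the first \<open>n\<close> vectors
  has value at least \<open>n * \<epsilon> / 2\<close> under \<open>f\<close>, while curvature makes
  its norm small compared with \<open>n\<close>.\<close>

lemma curved_tail:
  assumes comp: "\<And>k. haar_null (e k) (nrm k)"
    and curved: "uniformly_asymptotically_curved (\<lambda>k j. e k (Suc j))"
    and f: "linear_on (linf_sum (\<lambda>k. haar_basis.Y (e k))) f"
      "\<And>x. x \<in> linf_sum (\<lambda>k. haar_basis.Y (e k)) \<Longrightarrow> \<bar>f x\<bar> \<le> C * linf_norm x" and \<epsilon>: "\<epsilon> > 0"
  shows "\<exists>n :: nat \<Rightarrow> nat. \<forall>x\<in>linf_sum (\<lambda>k. haar_basis.Y (e k)).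
    (\<forall>l. x l \<in> closure (span (e l ` {n l..}))) \<longrightarrow> \<bar>f x\<bar> \<le> \<epsilon> * linf_norm x"
proof (rule ccontr)
  let ?V = "linf_sum (\<lambda>k. haar_basis.Y (e k))"
  interpret coordinate_norm e nrm UNIV ?V linf_norm "\<lambda>m x. norm (x m)" by (rule linf_coordinate_norm[OF comp])
  assume neg: "\<not> ?thesis"
  have lin: "f (x + y) = f x + f y" "f (c *\<^sub>R x) = c * f x" if "x \<in> ?V" "y \<in> ?V" for x y c
    using f(1) that by (simp_all add: linear_on_def)
  have scale: "c *\<^sub>R x \<in> ?V \<and> linf_norm (c *\<^sub>R x) \<le> \<bar>c\<bar> * linf_norm x" if "x \<in> ?V" for c x
    by (rule V_I) (use V_D(1,4)[OF that] N_nonneg[OF that] haar_basis.Y_scale[OF hb] in \<open>auto simp: scaleR_fun_def mult_left_mono\<close>)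
  have add: "x + y \<in> ?V \<and> linf_norm (x + y) \<le> linf_norm x + linf_norm y" if "x \<in> ?V" "y \<in> ?V" for x y
    by (rule V_I) (use V_D(1)[OF that(1)] V_D(1)[OF that(2)] N_nonneg that haar_basis.Y_add[OF hb]
        order_trans[OF norm_triangle_ineq add_mono[OF V_D(4)[OF that(1)] V_D(4)[OF that(2)]]] in auto)
  have cancel: "(\<bar>C\<bar> + 1) * (\<epsilon> / (a * (\<bar>C\<bar> + 1))) = \<epsilon> / a" for a
  proof -
    have "D * (\<epsilon> / (a * D)) = \<epsilon> / a" if "D > 0" for D using that by simp
    thus ?thesis by simp
  qed
  \<comment> \<open>A counterexample is normalised, its sign adjusted and each component replaced by
    a non-zero finite segment; half of \<open>\<epsilon>\<close> and one unit of norm are given away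
    for this.\<close>
  have step: "\<exists>x q. x \<in> ?V \<and> linf_norm x \<le> 2 \<and> f x \<ge> \<epsilon> / 2 \<and> (\<forall>l. n l < q l \<and> x l \<noteq> 0 \<and> x l \<in> span (e l ` {n l..<q l}))"
    if n: "\<And>l. 1 \<le> n l" for n :: "nat \<Rightarrow> nat"
  proof -
    obtain x0 where x0: "x0 \<in> ?V" "\<And>l. x0 l \<in> closure (span (e l ` {n l..}))" "\<bar>f x0\<bar> > \<epsilon> * linf_norm x0"
      using neg by (metis linorder_not_le)
    have p: "linf_norm x0 > 0"
    proof (rule ccontr)
      assume "\<not> linf_norm x0 > 0"
      hence "linf_norm x0 = 0" using N_nonneg[OF x0(1)] by simp
      thus False using f(2)[OF x0(1)] x0(3) by simp
    qed
    define c where "c = (if f x0 \<ge> 0 then 1 else -1) / linf_norm x0"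
    define x1 where "x1 = c *\<^sub>R x0"
    have c: "\<bar>c\<bar> = 1 / linf_norm x0" using p by (simp add: c_def)
    have x1: "x1 \<in> ?V" "linf_norm x1 \<le> 1" using scale[OF x0(1), of c] c p by (simp_all add: x1_def)
    have "f x1 = \<bar>f x0\<bar> / linf_norm x0" unfolding x1_def lin(2)[OF x0(1) x0(1)] by (simp add: c_def)
    hence f1: "f x1 > \<epsilon>" using x0(3) p by (simp add: pos_less_divide_eq)
    have x1c: "x1 l \<in> closure (span (e l ` {n l..}))" for l
    proof -
      have "c *\<^sub>R x0 l \<in> (*\<^sub>R) c ` closure (span (e l ` {n l..}))" using x0(2) by blast
      also have "\<dots> = closure ((*\<^sub>R) c ` span (e l ` {n l..}))" by (rule closure_scaleR)
      also have "\<dots> \<subseteq> closure (span (e l ` {n l..}))" by (intro closure_mono) (auto intro: span_scale)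
      finally show ?thesis by (simp add: x1_def scaleR_fun_def)
    qed
    \<comment> \<open>The error changes \<open>f\<close> by at most \<open>\<epsilon> / 2\<close>
      and, being at most 1, keeps the norm below 2. Using \<open>\<bar>C\<bar> + 1\<close> keeps the
      denominator positive whatever \<open>C\<close> is.\<close>
    define \<theta> where "\<theta> = min 1 (\<epsilon> / (2 * (\<bar>C\<bar> + 1)))"
    have t1: "\<epsilon> / (2 * (\<bar>C\<bar> + 1)) > 0" using \<epsilon> by simp
    have \<theta>: "\<theta> > 0" "\<theta> \<le> 1" using t1 by (auto simp: \<theta>_def)
    have "(\<bar>C\<bar> + 1) * \<theta> \<le> (\<bar>C\<bar> + 1) * (\<epsilon> / (2 * (\<bar>C\<bar> + 1)))" by (intro mult_left_mono) (auto simp: \<theta>_def)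
    also have "\<dots> = \<epsilon> / 2" by (rule cancel)
    finally have \<theta>3: "(\<bar>C\<bar> + 1) * \<theta> \<le> \<epsilon> / 2" .
    have "\<forall>l. \<exists>qz. n l < fst qz \<and> snd qz \<in> span (e l ` {n l..<fst qz}) \<and> snd qz \<noteq> 0 \<and> norm (snd qz - x1 l) < \<theta>"
      using haar_basis.approx_segment[OF hb x1c n \<theta>(1)] by simp
    from choice[OF this] obtain qz where qz: "\<forall>l. n l < fst (qz l) \<and> snd (qz l) \<in> span (e l ` {n l..<fst (qz l)}) \<and> snd (qz l) \<noteq> 0 \<and> norm (snd (qz l) - x1 l) < \<theta>" ..
    define x where "x l = snd (qz l)" for l
    have "x l \<in> haar_basis.Y (e l)" for l
    proof -
      have "span (e l ` {n l..<fst (qz l)}) \<subseteq> haar_basis.Y (e l)"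
        using haar_basis.e_Y[OF hb] n[of l] by (intro span_minimal haar_basis.subspace_Y[OF hb]) auto
      thus ?thesis using qz by (auto simp: x_def)
    qed
    hence d: "x - x1 \<in> ?V \<and> linf_norm (x - x1) \<le> \<theta>"
      using qz V_D(1)[OF x1(1)] \<theta> by (intro V_I) (auto simp: x_def less_imp_le intro: haar_basis.Y_diff[OF hb])
    have xe: "x = x1 + (x - x1)" by simp
    have xV: "x \<in> ?V \<and> linf_norm x \<le> linf_norm x1 + linf_norm (x - x1)" using add[OF x1(1) conjunct1[OF d]] by simp
    have "\<bar>f (x - x1)\<bar> \<le> C * linf_norm (x - x1)" using f(2) d by blast
    also have "\<dots> \<le> (\<bar>C\<bar> + 1) * \<theta>" using d N_nonneg[of "x - x1"] by (intro mult_mono) auto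
    finally have "f x \<ge> f x1 - \<epsilon> / 2" using \<theta>3 lin(1)[OF x1(1) conjunct1[OF d]] by simp
    hence "f x \<ge> \<epsilon> / 2" using f1 by simp
    moreover have "linf_norm x \<le> 2" using xV x1(2) d \<theta>(2) by linarith
    moreover have "\<forall>l. n l < fst (qz l) \<and> x l \<noteq> 0 \<and> x l \<in> span (e l ` {n l..<fst (qz l)})" using qz by (simp add: x_def)
    ultimately show ?thesis using xV by (intro exI[of _ x] exI[of _ "\<lambda>l. fst (qz l)"]) simp
  qed
  have "\<forall>n. \<exists>p. (\<forall>l. 1 \<le> n l) \<longrightarrow> fst p \<in> ?V \<and> linf_norm (fst p) \<le> 2 \<and> f (fst p) \<ge> \<epsilon> / 2 \<and>
      (\<forall>l. n l < snd p l \<and> fst p l \<noteq> 0 \<and> fst p l \<in> span (e l ` {n l..<snd p l}))"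
    using step by simp
  from choice[OF this] obtain p where p: "\<forall>n. (\<forall>l. 1 \<le> n l) \<longrightarrow> fst (p n) \<in> ?V \<and> linf_norm (fst (p n)) \<le> 2 \<and> f (fst (p n)) \<ge> \<epsilon> / 2 \<and>
      (\<forall>l. n l < snd (p n) l \<and> fst (p n) l \<noteq> 0 \<and> fst (p n) l \<in> span (e l ` {n l..<snd (p n) l}))" ..
  \<comment> \<open>The thresholds are iterated from the constant 1: in each component
    \<open>l\<close> the vector \<open>x j\<close> occupies the segment from \<open>s j l\<close> to
    \<open>s (Suc j) l\<close>.\<close>
  define s where "s j = ((\<lambda>n. snd (p n)) ^^ j) (\<lambda>_. 1 :: nat)" for j :: nat
  have s0: "s 0 = (\<lambda>_. 1)" and sS: "s (Suc j) = snd (p (s j))" for j by (simp_all add: s_def)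
  have s1: "\<forall>l. 1 \<le> s j l" for j
  proof (induction j)
    case (Suc j)
    show ?case using p[rule_format, of "s j"] Suc unfolding sS by (meson less_imp_le order_trans)
  qed (simp add: s0)
  define x where "x j = fst (p (s j))" for j
  have x: "x j \<in> ?V" "linf_norm (x j) \<le> 2" "f (x j) \<ge> \<epsilon> / 2" for j using p[rule_format, of "s j"] s1 by (simp_all add: x_def)
  have xl: "s j l < s (Suc j) l" "x j l \<noteq> 0" "x j l \<in> span (e l ` {s j l..<s (Suc j) l})" for j l
    using p[rule_format, of "s j"] s1 by (simp_all add: x_def sS)
  have xb: "norm (x j l) \<le> 2" for j l using V_D(4)[OF x(1), of j l] x(2)[of j] by linarith
  have "block_basis (\<lambda>j. e l (Suc j)) (\<lambda>j. x j l)" for l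
    by (rule haar_basis.block_basis_segments[OF hb, of "\<lambda>j. s j l"]) (use xl s0 in \<open>auto simp: strict_mono_Suc_iff\<close>)
  hence "(\<lambda>n. SUP l. 1 / real n * norm (\<Sum>j<n. x j l)) \<longlonglongrightarrow> 0"
    using curved[unfolded uniformly_asymptotically_curved_def, rule_format, of "\<lambda>l j. x j l"] xb by blast
  \<comment> \<open>With this accuracy the upper bound for \<open>f\<close> of the sum is below
    \<open>n * \<epsilon> / 4\<close>, against the lower bound
    \<open>n * \<epsilon> / 2\<close>.\<close>
  from LIMSEQ_D[OF this, of "\<epsilon> / (4 * (\<bar>C\<bar> + 1))"] \<epsilon>
  obtain n0 where n0: "\<And>n. n \<ge> n0 \<Longrightarrow> \<bar>SUP l. 1 / real n * norm (\<Sum>j<n. x j l)\<bar> < \<epsilon> / (4 * (\<bar>C\<bar> + 1))" by auto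
  define n where "n = Suc n0"
  define S where "S = (SUP l. 1 / real n * norm (\<Sum>j<n. x j l))"
  have npos: "real n > 0" by (simp add: n_def)
  have nb: "norm (\<Sum>j<n. x j l) \<le> 2 * real n" for l
    using order_trans[OF norm_sum sum_bounded_above[of "{..<n}" "\<lambda>j. norm (x j l)" 2]] xb by simp
  have Sl: "norm (\<Sum>j<n. x j l) \<le> real n * S" for l
  proof -
    have "1 / real n * norm (\<Sum>j<n. x j l) \<le> S" unfolding S_def
      using nb npos by (intro cSUP_upper bdd_aboveI2[of _ _ 2]) (auto simp: pos_divide_le_eq)
    thus ?thesis using npos by (simp add: pos_divide_le_eq mult.commute)
  qed
  define X where "X = (\<Sum>j<n. 1 *\<^sub>R x j)"
  have subV: "subspace ?V" unfolding subspace_def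
  proof (intro conjI ballI allI)
    show "0 \<in> ?V" using scale[OF x(1)[of 0], of 0] by simp
  qed (use add scale in auto)
  have Xl: "X l = (\<Sum>j<n. x j l)" for l unfolding X_def by (induction n) (auto simp: scaleR_fun_def)
  have S0: "S \<ge> 0" using order_trans[OF norm_ge_zero Sl[of 0]] npos by (simp add: zero_le_mult_iff)
  have XV: "X \<in> ?V" unfolding X_def using x(1) subV by (intro subspace_sum subspace_scale) auto
  have X: "X \<in> ?V \<and> linf_norm X \<le> real n * S"
    by (rule V_I) (use V_D(1)[OF XV] Sl S0 npos in \<open>auto simp: Xl\<close>)
  have "f X = (\<Sum>j<n. 1 *\<^sub>R f (x j))" unfolding X_def using f(1) subV by (rule linear_on_sum) (use x(1) in auto)
  hence "f X = (\<Sum>j<n. f (x j))" by simp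
  also have "\<dots> \<ge> (\<Sum>j<n. \<epsilon> / 2)" by (intro sum_mono x(3))
  finally have lower: "real n * (\<epsilon> / 2) \<le> f X" by simp
  have "f X \<le> C * linf_norm X" using f(2)[OF XV] by linarith
  also have "\<dots> \<le> (\<bar>C\<bar> + 1) * (real n * S)" using X N_nonneg[OF XV] by (intro mult_mono) auto
  also have "\<dots> = real n * ((\<bar>C\<bar> + 1) * S)" by simp
  finally have "real n * (\<epsilon> / 2) \<le> real n * ((\<bar>C\<bar> + 1) * S)" using lower by linarith
  hence "\<epsilon> / 2 \<le> (\<bar>C\<bar> + 1) * S" using npos by simp
  moreover have "S < \<epsilon> / (4 * (\<bar>C\<bar> + 1))" using n0[of n] unfolding S_def[symmetric] by (simp add: n_def)
  hence "(\<bar>C\<bar> + 1) * S < (\<bar>C\<bar> + 1) * (\<epsilon> / (4 * (\<bar>C\<bar> + 1)))" by (intro mult_strict_left_mono) auto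
  moreover have "(\<bar>C\<bar> + 1) * (\<epsilon> / (4 * (\<bar>C\<bar> + 1))) = \<epsilon> / 4" by (rule cancel)
  ultimately show False using \<epsilon> by linarith
qed

section \<open>Transfer to the functionals and spaces of the theorem\<close>

lemma haar_functional_eq_cf:
  assumes hb: "haar_basis (\<lambda>K. J (haar (ivl K))) nrm" and Y: "hardy0 J = haar_basis.Y (\<lambda>K. J (haar (ivl K)))"
    and K: "K \<ge> 1" and y: "y \<in> hardy0 J"
  shows "haar_functional J (ivl K) y = haar_basis.cf (\<lambda>K. J (haar (ivl K))) K y"
proof -
  let ?e = "\<lambda>K. J (haar (ivl K))"
  interpret haar_basis ?e nrm by (rule hb)
  define F where "F f \<longleftrightarrow> bounded_functional Y norm f \<and> (\<forall>I\<in>dyadic. f (J (haar I)) = (if I = ivl K then 1 else 0))" for f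
  have "bounded_functional Y norm (cf K)"
    unfolding bounded_functional_def using bdl_linear[OF cf] bdl_norm[OF cf, of _ K]
    by (intro conjI exI[of _ "1 / wt K"] ballI) auto
  moreover have "cf K (J (haar I)) = (if I = ivl K then 1 else 0)" if "I \<in> dyadic" for I
  proof -
    obtain L where L: "L \<ge> 1" "I = ivl L" using \<open>I \<in> dyadic\<close> unfolding dyadic_eq by auto
    thus ?thesis using cf_e[OF L(1), of K] ivl_inj[OF L(1) K] by auto
  qed
  \<comment> \<open>\<open>cf K\<close> shows that the description defining
    \<open>haar_functional\<close> is satisfiable, so the chosen functional is bounded and
    biorthogonal; two such functionals agree on the closed span.\<close>
  ultimately have "F (cf K)" unfolding F_def by blast
  hence F: "F (haar_functional J (ivl K))"
    unfolding haar_functional_def biorthogonal_functional_def Y F_def[symmetric] by (rule someI[of F])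
  then obtain C where C: "\<And>x. x \<in> Y \<Longrightarrow> \<bar>haar_functional J (ivl K) x\<bar> \<le> C * norm x"
    and lin: "linear_on Y (haar_functional J (ivl K))" unfolding F_def bounded_functional_def by blast
  have "bdl Y \<bar>C\<bar> (haar_functional J (ivl K))"
    unfolding bdl_def
  proof (intro conjI ballI)
    fix x assume "x \<in> Y"
    hence "\<bar>haar_functional J (ivl K) x\<bar> \<le> C * norm x" by (rule C)
    also have "\<dots> \<le> \<bar>C\<bar> * norm x" by (intro mult_right_mono) auto
    finally show "norm (haar_functional J (ivl K) x) \<le> \<bar>C\<bar> * norm x" by simp
  qed (simp_all add: lin)
  thus ?thesis
  proof (rule bdl_eq[OF _ cf])
    fix L :: nat assume L: "L \<ge> 1"
    have "ivl L \<in> dyadic" using L unfolding dyadic_eq by blast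
    thus "haar_functional J (ivl K) (J (haar (ivl L))) = cf K (J (haar (ivl L)))"
      using F cf_e[OF L, of K] ivl_inj[OF L K] unfolding F_def by auto
  qed (use y Y in simp)
qed

lemma (in haar_sum) factorization_propertyI:
  assumes "\<And>k K. k \<in> KK \<Longrightarrow> K \<ge> 1 \<Longrightarrow> \<exists>m. eb m = component_vector k (e k K) \<and> (\<forall>x\<in>V. eb' m x = cfk k K (x k))"
  shows "factorization_property V N eb eb' (\<lambda>\<delta>. 4 / \<delta>)"
  unfolding factorization_property_def factors_through_plus_def
proof (intro allI impI, elim conjE)
  fix \<delta> :: real and T and \<gamma> :: real
  assume \<delta>: "\<delta> > 0" and T: "bounded_operator V N T" and ld: "large_diagonal eb eb' \<delta> T" and \<gamma>: "\<gamma> > 0"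
  obtain C where T': "linear_on V T" "\<And>x. x \<in> V \<Longrightarrow> T x \<in> V" "\<And>x. x \<in> V \<Longrightarrow> N (T x) \<le> C * N x"
    using T unfolding bounded_operator_def by blast
  interpret diag_op e nrm KK V N T "\<bar>C\<bar>" \<delta>
  proof
    fix x assume x: "x \<in> V"
    have "N (T x) \<le> C * N x" by (rule T'(3)[OF x])
    also have "\<dots> \<le> \<bar>C\<bar> * N x" by (intro mult_right_mono N_nonneg[OF x]) auto
    finally show "N (T x) \<le> \<bar>C\<bar> * N x" .
  next
    fix k K assume k: "k \<in> KK" and K: "K \<ge> (1 :: nat)"
    obtain m where m: "eb m = component_vector k (e k K)" "\<forall>x\<in>V. eb' m x = cfk k K (x k)" using assms[OF k K] by blast
    have "component_vector k (e k K) \<in> V" using V_comp[OF k haar_basis.e_Y[OF hb K]] by blast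
    hence "eb' m (T (eb m)) = cfk k K (T (component_vector k (e k K)) k)" using m T'(2) by simp
    thus "\<delta> \<le> \<bar>cfk k K (T (component_vector k (e k K)) k)\<bar>" using ld unfolding large_diagonal_def by metis
  qed (use T' \<delta> in simp_all)
  show "factors_through V N (\<lambda>x. x) T (4 / \<delta> + \<gamma>)" by (rule factors_identity[OF \<gamma>])
qed

lemma array_factorization_property:
  assumes sum: "haar_sum (\<lambda>k K. Js k (haar (ivl K))) nrm UNIV V N"
    and Y: "\<And>k. hardy0 (Js k) = haar_basis.Y (\<lambda>K. Js k (haar (ivl K)))" and \<phi>: "array_enumeration \<phi>"
  shows "factorization_property V N (array_basis Js \<phi>) (array_functional Js \<phi>) (\<lambda>\<delta>. 4 / \<delta>)"
proof (rule haar_sum.factorization_propertyI[OF sum])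
  fix k K assume K: "K \<ge> (1 :: nat)"
  have "(k, ivl K) \<in> range \<phi>" using \<phi> K unfolding array_enumeration_def bij_betw_def dyadic_eq by auto
  then obtain m where m: "\<phi> m = (k, ivl K)" by (metis imageE)
  have "array_functional Js \<phi> m x = haar_basis.cf (\<lambda>K. Js k (haar (ivl K))) K (x k)" if x: "x \<in> V" for x
    unfolding array_functional_def m using haar_functional_eq_cf[OF haar_sum.hb[OF sum] Y K] haar_sum.V_Y[OF sum x, of k] Y by simp
  thus "\<exists>m. array_basis Js \<phi> m = component_vector k (Js k (haar (ivl K))) \<and>
      (\<forall>x\<in>V. array_functional Js \<phi> m x = haar_basis.cf (\<lambda>K. Js k (haar (ivl K))) K (x k))"
    using m by (intro exI[of _ m]) (simp add: array_basis_def)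
qed

text \<open>A single space is treated as a sum supported in component 0, so that the argument for
  sums covers it as well.\<close>

lemma single_coordinate_norm:
  assumes hn: "haar_null e nrm"
  shows "coordinate_norm (\<lambda>_. e) (\<lambda>_. nrm) {0} (component_vector 0 ` haar_basis.Y e) (\<lambda>x. norm (x 0)) (\<lambda>m x. norm (x m))"
proof (rule coordinate_norm.intro)
  have Y0: "0 \<in> haar_basis.Y e" using hn haar_basis.Y_0 by (auto simp: haar_null_def)
  show "x \<in> component_vector 0 ` haar_basis.Y e \<and> norm (x 0) \<le> c \<longleftrightarrow>
      (\<forall>k. x k \<in> haar_basis.Y e) \<and> (\<forall>k. k \<notin> {0} \<longrightarrow> x k = 0) \<and> (\<forall>m. norm (x m) \<le> c)"
    if c: "0 \<le> c" for x :: "nat \<Rightarrow> 'a" and c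
  proof
    assume "x \<in> component_vector 0 ` haar_basis.Y e \<and> norm (x 0) \<le> c"
    thus "(\<forall>k. x k \<in> haar_basis.Y e) \<and> (\<forall>k. k \<notin> {0} \<longrightarrow> x k = 0) \<and> (\<forall>m. norm (x m) \<le> c)"
      using c Y0 by (auto simp: component_vector_def)
  next
    assume a: "(\<forall>k. x k \<in> haar_basis.Y e) \<and> (\<forall>k. k \<notin> {0} \<longrightarrow> x k = 0) \<and> (\<forall>m. norm (x m) \<le> c)"
    have "x = component_vector 0 (x 0)"
    proof
      fix k show "x k = component_vector 0 (x 0) k" using a by (cases "k = 0") (simp_all add: component_vector_def)
    qed
    moreover have "x 0 \<in> haar_basis.Y e" "norm (x 0) \<le> c" using a by auto
    ultimately show "x \<in> component_vector 0 ` haar_basis.Y e \<and> norm (x 0) \<le> c" by (intro conjI image_eqI)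
  qed
qed (use hn in \<open>auto simp: component_vector_def intro: norm_triangle_ineq tendsto_norm\<close>)

lemma component_vector_same [simp]: "component_vector k y k = y"
  by (simp add: component_vector_def)

lemma factorization_property_single:
  fixes e :: "nat \<Rightarrow> 'b::banach"
  assumes fp: "factorization_property (component_vector 0 ` Y) (\<lambda>x. norm (x 0)) (\<lambda>m. component_vector 0 (e m)) (\<lambda>m x. e' m (x 0)) K"
    and eY: "\<And>m. e m \<in> Y"
  shows "factorization_property Y norm e e' K"
  unfolding factorization_property_def factors_through_plus_def
proof (intro allI impI, elim conjE)
  let ?V = "component_vector (0::nat) ` Y" and ?N = "\<lambda>x :: nat \<Rightarrow> 'b. norm (x 0)"
  fix \<delta> :: real and T and \<gamma> :: real
  assume \<delta>: "\<delta> > 0" and T: "bounded_operator Y norm T" and ld: "large_diagonal e e' \<delta> T" and \<gamma>: "\<gamma> > 0"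
  define S where "S x = component_vector (0::nat) (T (x 0))" for x :: "nat \<Rightarrow> 'b"
  have "bounded_operator ?V ?N S"
    using T by (auto simp: bounded_operator_def linear_on_def S_def component_vector_linear scaleR_fun_def)
  moreover have "large_diagonal (\<lambda>m. component_vector 0 (e m)) (\<lambda>m x. e' m (x 0)) \<delta> S"
    using ld by (simp add: large_diagonal_def S_def)
  ultimately have "factors_through ?V ?N (\<lambda>x. x) S (K \<delta> + \<gamma>)"
    using fp \<delta> \<gamma> unfolding factorization_property_def factors_through_plus_def by blast
  then obtain A B where AB: "bounded_operator ?V ?N A" "bounded_operator ?V ?N B" "\<And>x. x \<in> ?V \<Longrightarrow> x = A (S (B x))"
    "operator_norm ?V ?N A * operator_norm ?V ?N B \<le> K \<delta> + \<gamma>" unfolding factors_through_def by blast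
  \<comment> \<open>Operators are carried back along the isometry \<open>component_vector 0\<close>,
    which preserves bounds and operator norms.\<close>
  define r where "r F y = F (component_vector (0::nat) y) 0" for F :: "(nat \<Rightarrow> 'b) \<Rightarrow> nat \<Rightarrow> 'b" and y
  have comp: "component_vector 0 (r F y) = F (component_vector 0 y)" if "bounded_operator ?V ?N F" "y \<in> Y" for F y
  proof -
    have "F (component_vector 0 y) \<in> ?V" using that by (simp add: bounded_operator_def)
    thus ?thesis by (auto simp: r_def)
  qed
  have bo: "bounded_operator Y norm (r F)" if F: "bounded_operator ?V ?N F" for F
  proof -
    have F1: "linear_on ?V F" "\<forall>x\<in>?V. F x \<in> ?V" using F by (simp_all add: bounded_operator_def)
    obtain C where C: "\<forall>x\<in>?V. ?N (F x) \<le> C * ?N x" using F by (auto simp: bounded_operator_def)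
    have "linear_on Y (r F)" using F1(1) by (simp add: linear_on_def r_def component_vector_linear scaleR_fun_def)
    moreover have "r F y \<in> Y" if "y \<in> Y" for y using F1(2) that by (force simp: r_def)
    moreover have "norm (r F y) \<le> C * norm y" if "y \<in> Y" for y using C that by (force simp: r_def)
    ultimately show ?thesis unfolding bounded_operator_def by blast
  qed
  have on: "operator_norm Y norm (r F) = operator_norm ?V ?N F" for F
  proof -
    have "{x \<in> ?V. ?N x \<le> 1} = component_vector 0 ` {y \<in> Y. norm y \<le> 1}" by auto
    thus ?thesis unfolding operator_norm_def by (simp add: image_image r_def)
  qed
  have "y = r A (T (r B y))" if y: "y \<in> Y" for y
  proof -
    have "component_vector 0 y = A (S (B (component_vector 0 y)))" using AB(3) y by blast
    also have "\<dots> = A (component_vector 0 (T (r B y)))" by (simp add: S_def r_def)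
    finally show ?thesis unfolding r_def[of A] by (metis component_vector_same)
  qed
  thus "factors_through Y norm (\<lambda>x. x) T (K \<delta> + \<gamma>)"
    unfolding factors_through_def using bo[OF AB(1)] bo[OF AB(2)] AB(4)
    by (intro exI[of _ "r A"] exI[of _ "r B"]) (simp add: on)
qed

theorem theorem3p2:
  fixes N :: "(real \<Rightarrow> real) \<Rightarrow> real"
    and r :: "real set \<Rightarrow> real \<Rightarrow> real"
    and J :: "(real \<Rightarrow> real) \<Rightarrow> 'a::banach"
    and Ns :: "nat \<Rightarrow> (real \<Rightarrow> real) \<Rightarrow> real"
    and rs :: "nat \<Rightarrow> real set \<Rightarrow> real \<Rightarrow> real"
    and Js :: "nat \<Rightarrow> (real \<Rightarrow> real) \<Rightarrow> 'b::banach"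
  assumes "haar_system_norm N" and "r \<in> rademacher_choices" and "hardy_completion N r J"
    and "\<And>k. haar_system_norm (Ns k)" and "\<And>k. rs k \<in> rademacher_choices"
    and "\<And>k. hardy_completion (Ns k) (rs k) (Js k)"
    and "weakly_null (hardy0 J) norm (\<lambda>n. J (rademacher n))"
    and "\<And>k. weakly_null (hardy0 (Js k)) norm (\<lambda>n. Js k (rademacher n))"
  shows
    "factorization_property (hardy0 J) norm
       (\<lambda>m. J (haar (dyadic_seq m))) (\<lambda>m. haar_functional J (dyadic_seq m)) (\<lambda>\<delta>. 4 / \<delta>) \<and>
     (\<forall>p \<phi>. 1 \<le> p \<and> array_enumeration \<phi> \<longrightarrow>
       factorization_property (lp_sum p (\<lambda>k. hardy0 (Js k))) (lp_norm p)
         (array_basis Js \<phi>) (array_functional Js \<phi>) (\<lambda>\<delta>. 4 / \<delta>)) \<and>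
     (\<forall>\<phi>. uniformly_asymptotically_curved (\<lambda>k j. Js k (haar (dyadic_seq j))) \<and>
          array_enumeration \<phi> \<longrightarrow>
       factorization_property (linf_sum (\<lambda>k. hardy0 (Js k))) linf_norm
         (array_basis Js \<phi>) (array_functional Js \<phi>) (\<lambda>\<delta>. 4 / \<delta>))"
proof (intro conjI allI impI, goal_cases)
  case 1
  let ?e = "\<lambda>K. J (haar (ivl K))"
  obtain nrm where hn: "haar_null ?e nrm" using hardy_haar_null(1)[OF assms(1-3,7)] by blast
  note Y = hardy_haar_null(2)[OF assms(1-3,7)]
  let ?V = "component_vector 0 ` haar_basis.Y ?e"
  have sum: "haar_sum (\<lambda>_. ?e) (\<lambda>_. nrm) {0} ?V (\<lambda>x. norm (x 0))"
  proof (rule coordinate_norm.haar_sumI[OF single_coordinate_norm[OF hn]], unfold vanishing_tails_def, intro disjI1 ballI)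
    fix x :: "nat \<Rightarrow> 'a"
    \<comment> \<open>The only component is cut off as soon as \<open>L \<ge> 1\<close>.\<close>
    have "\<forall>\<^sub>F L in sequentially. 0 = norm (if 0 < (L::nat) then 0 else x 0)"
      using eventually_gt_at_top[of 0] by (rule eventually_mono) simp
    thus "(\<lambda>L. norm (if 0 < (L::nat) then 0 else x 0)) \<longlonglongrightarrow> 0" by (rule Lim_transform_eventually[OF tendsto_const])
  qed
  show ?case unfolding Y
  proof (rule factorization_property_single)
    have hb: "haar_basis ?e nrm" using hn by (simp add: haar_null_def)
    show "J (haar (dyadic_seq m)) \<in> haar_basis.Y ?e" for m unfolding dyadic_seq_ivl by (rule haar_basis.e_Y[OF hb]) simp
    show "factorization_property ?V (\<lambda>x. norm (x 0)) (\<lambda>m. component_vector 0 (J (haar (dyadic_seq m))))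
        (\<lambda>m x. haar_functional J (dyadic_seq m) (x 0)) (\<lambda>\<delta>. 4 / \<delta>)"
    proof (rule haar_sum.factorization_propertyI[OF sum])
      fix k K assume k: "k \<in> {0 :: nat}" and K: "K \<ge> (1 :: nat)"
      \<comment> \<open>The enumeration of the basis starts at 0 while intervals are numbered from
        1.\<close>
      have "haar_functional J (dyadic_seq (K - 1)) (x 0) = haar_basis.cf ?e K (x 0)" if "x \<in> ?V" for x
        using haar_functional_eq_cf[OF hb Y K, of "x 0"] that K Y by (auto simp: dyadic_seq_ivl)
      thus "\<exists>m. component_vector 0 (J (haar (dyadic_seq m))) = component_vector k (J (haar (ivl K))) \<and>
          (\<forall>x\<in>?V. haar_functional J (dyadic_seq m) (x 0) = haar_basis.cf ?e K (x k))"
        using k K by (intro exI[of _ "K - 1"]) (simp add: dyadic_seq_ivl)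
    qed
  qed
next
  case (2 p \<phi>)
  let ?e = "\<lambda>k K. Js k (haar (ivl K))"
  have "\<forall>k. \<exists>nrm. haar_null (?e k) nrm" using hardy_haar_null(1)[OF assms(4,5,6,8)] by blast
  from choice[OF this] obtain nrm where hn: "\<And>k. haar_null (?e k) (nrm k)" by blast
  have Y: "hardy0 (Js k) = haar_basis.Y (?e k)" for k by (rule hardy_haar_null(2)[OF assms(4,5,6,8)])
  have p: "1 \<le> p" using 2 by simp
  have "haar_sum ?e nrm UNIV (lp_sum p (\<lambda>k. hardy0 (Js k))) (lp_norm p)"
    unfolding Y by (rule coordinate_norm.haar_sumI[OF lp_coordinate_norm[OF p hn]]) (unfold vanishing_tails_def, use lp_tail[OF p] in blast)
  from array_factorization_property[OF this Y] 2 show ?case by blast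
next
  case (3 \<phi>)
  let ?e = "\<lambda>k K. Js k (haar (ivl K))"
  have "\<forall>k. \<exists>nrm. haar_null (?e k) nrm" using hardy_haar_null(1)[OF assms(4,5,6,8)] by blast
  from choice[OF this] obtain nrm where hn: "\<And>k. haar_null (?e k) (nrm k)" by blast
  have Y: "hardy0 (Js k) = haar_basis.Y (?e k)" for k by (rule hardy_haar_null(2)[OF assms(4,5,6,8)])
  have c: "uniformly_asymptotically_curved (\<lambda>k j. ?e k (Suc j))" using 3 by (simp add: dyadic_seq_ivl)
  have "haar_sum ?e nrm UNIV (linf_sum (\<lambda>k. hardy0 (Js k))) linf_norm"
    unfolding Y
  proof (rule coordinate_norm.haar_sumI[OF linf_coordinate_norm[OF hn]], unfold tail_continuous_def, intro disjI2 allI impI)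
    fix f and C \<epsilon> :: real
    assume "linear_on (linf_sum (\<lambda>k. haar_basis.Y (?e k))) f" "\<forall>x\<in>linf_sum (\<lambda>k. haar_basis.Y (?e k)). \<bar>f x\<bar> \<le> C * linf_norm x" "0 < \<epsilon>"
    thus "\<exists>n. \<forall>x\<in>linf_sum (\<lambda>k. haar_basis.Y (?e k)). (\<forall>l. x l \<in> closure (span (?e l ` {n l..}))) \<longrightarrow> \<bar>f x\<bar> \<le> \<epsilon> * linf_norm x"
      by (intro curved_tail[OF hn c]) auto
  qed
  from array_factorization_property[OF this Y] 3 show ?case by blast
qed

end
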